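(* Let $m>0$ and let $\mathcal L$ be the set of lattices $\Lambda\subset\mathbb R^2$ such that $j_\Lambda\in\mathcal A_m$ (i.e. lattices whose periodicity cell has area $2\pi/m$). Then the minimum of $\Lambda\mapsto W(\Lambda)$ over $\mathcal L$ is achieved uniquely, modulo rotation, by the triangular lattice $$\Lambda_m=\sqrt{\frac{4\pi}{m\sqrt3}}\left((1,0)\mathbb Z\oplus\Big(\frac12,\frac{\sqrt3}2\Big)\mathbb Z\right).$$
   Context: $B_R$ is the ball of center $0$ and radius $R$ in $\mathbb R^2$. For $m>0$, $\mathcal A_m$ is the set of vector fields $j$ on $\mathbb R^2$ such that $\operatorname{curl} j=\nu-m$ and $\operatorname{div} j=0$ in the sense of distributions, where $\nu=2\pi\sum_{p\in\Lambda}\delta_p$ for some discrete set $\Lambda\subset\mathbb R^2$ and $\nu(B_R)/|B_R|$ is bounded independently of $R>1$. For a function $\chi$, $W(j,\chi)=\lim_{\eta\to0}\big(\frac12\int_{\mathbb R^2\setminus\cup_{p\in\Lambda}B(p,\eta)}\chi|j|^2+\pi\log\eta\sum_{p\in\Lambda}\chi(p)\big)$, and for $j\in\mathcal A_m$, $W(j)=\limsup_{R\to\infty}W(j,\chi_{B_R})/|B_R|$, where $\chi_{B_R}$ are nonnegative cutoff functions with $|\nabla\chi_{B_R}|\le C$ ($C$ independent of $R$), $\operatorname{Supp}\chi_{B_R}\subset B_R$, $\chi_{B_R}=1$ at points at distance $\ge1$ from $B_R^c$ (the value does not depend on their choice). A lattice is a set $\Lambda=\mathbb Z\vec u\oplus\mathbb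 Z\vec v$ with $(\vec u,\vec v)$ a basis of $\mathbb R^2$. For a lattice $\Lambda$, $j_\Lambda$ denotes the unique $\Lambda$-periodic vector field with mean zero over a period cell satisfying $\operatorname{curl}j_\Lambda=2\pi\sum_{p\in\Lambda}\delta_p-m$, $\operatorname{div}j_\Lambda=0$, where necessarily $m=2\pi/(\text{area of the cell})$; and $W(\Lambda):=W(j_\Lambda)$. *)

theory Defs
  imports "HOL-Analysis.Analysis"
begin

text \<open>Test functions \<open>C\<^sub>c\<^sup>\<infinity>(\<real>\<^sup>2)\<close>.\<close>

definition partial :: "2 \<Rightarrow> (real^2 \<Rightarrow> real) \<Rightarrow> real^2 \<Rightarrow> real" where
  "partial i f x = frechet_derivative f (at x) (axis i 1)"

definition grad :: "(real^2 \<Rightarrow> real) \<Rightarrow> real^2 \<Rightarrow> real^2" where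
  "grad f x = (\<chi> i. partial i f x)"

primrec C_diff :: "nat \<Rightarrow> (real^2 \<Rightarrow> real) \<Rightarrow> bool" where
  "C_diff 0 f \<longleftrightarrow> continuous_on UNIV f"
| "C_diff (Suc k) f \<longleftrightarrow> (\<forall>x. f differentiable (at x)) \<and> (\<forall>i. C_diff k (partial i f))"

definition supp :: "(real^2 \<Rightarrow> real) \<Rightarrow> (real^2) set" where
  "supp f = closure {x. f x \<noteq> 0}"

definition test_function :: "(real^2 \<Rightarrow> real) \<Rightarrow> bool" where
  "test_function \<phi> \<longleftrightarrow> (\<forall>k. C_diff k \<phi>) \<and> compact (supp \<phi>)"

text \<open>Vector fields are represented by locally integrable functions. The distributions
  \<open>curl j = \<partial>\<^sub>1 j\<^sub>2 - \<partial>\<^sub>2 j\<^sub>1\<close> and \<open>div j = \<partial>\<^sub>1 j\<^sub>1 + \<partial>\<^sub>2 j\<^sub>2\<close> are given by their action on a test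
  function, where each derivative has been moved onto the test function with a minus sign.\<close>

definition locally_integrable :: "(real^2 \<Rightarrow> real^2) \<Rightarrow> bool" where
  "locally_integrable j \<longleftrightarrow> (\<forall>K. compact K \<longrightarrow> j absolutely_integrable_on K)"

definition curl_dist :: "(real^2 \<Rightarrow> real^2) \<Rightarrow> (real^2 \<Rightarrow> real) \<Rightarrow> real" where
  "curl_dist j \<phi> = - (\<integral>x. j x $ 2 * partial 1 \<phi> x - j x $ 1 * partial 2 \<phi> x \<partial>lebesgue)"

definition div_dist :: "(real^2 \<Rightarrow> real^2) \<Rightarrow> (real^2 \<Rightarrow> real) \<Rightarrow> real" where
  "div_dist j \<phi> = - (\<integral>x. j x $ 1 * partial 1 \<phi> x + j x $ 2 * partial 2 \<phi> x \<partial>lebesgue)"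

text \<open>The system \<open>curl j = 2\<pi> (\<Sum>p\<in>\<Lambda>. \<delta>\<^sub>p) - m\<close>, \<open>div j = 0\<close>. The set \<open>\<Lambda>\<close> is meant to be locally
  finite; the sum over it then has finitely many nonzero terms.\<close>

definition curl_div_system :: "real \<Rightarrow> (real^2) set \<Rightarrow> (real^2 \<Rightarrow> real^2) \<Rightarrow> bool" where
  "curl_div_system m \<Lambda> j \<longleftrightarrow> locally_integrable j \<and>
     (\<forall>\<phi>. test_function \<phi> \<longrightarrow>
        curl_dist j \<phi> = 2 * pi * (\<Sum>\<^sub>\<infinity>p\<in>\<Lambda>. \<phi> p) - m * (\<integral>x. \<phi> x \<partial>lebesgue) \<and>
        div_dist j \<phi> = 0)"

definition bounded_density :: "(real^2) set \<Rightarrow> bool" where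
  "bounded_density \<Lambda> \<longleftrightarrow> (\<exists>K. \<forall>R>1. finite (\<Lambda> \<inter> ball 0 R) \<and>
      2 * pi * real (card (\<Lambda> \<inter> ball 0 R)) / measure lebesgue (ball (0 :: real^2) R) \<le> K)"

definition A_set :: "real \<Rightarrow> (real^2 \<Rightarrow> real^2) set" where
  "A_set m = {j. \<exists>\<Lambda>. discrete \<Lambda> \<and> bounded_density \<Lambda> \<and> curl_div_system m \<Lambda> j}"

text \<open>The renormalized energy \<open>W(j, \<chi>)\<close> for a nonnegative \<open>\<chi>\<close>, where \<open>\<Lambda>\<close> is the set of
  singularities of \<open>j\<close>. The integral takes values in \<open>[0, \<infinity>]\<close>, so that
  \<open>W(j, \<chi>) = \<infinity>\<close> if \<open>\<chi> |j|\<^sup>2\<close> is not integrable away from \<open>\<Lambda>\<close>.\<close>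

definition W_cut :: "(real^2) set \<Rightarrow> (real^2 \<Rightarrow> real^2) \<Rightarrow> (real^2 \<Rightarrow> real) \<Rightarrow> ereal" where
  "W_cut \<Lambda> j \<chi>' = Lim (at_right 0) (\<lambda>\<eta>.
     enn2ereal (\<integral>\<^sup>+x\<in>UNIV - (\<Union>p\<in>\<Lambda>. ball p \<eta>). ennreal (\<chi>' x * (norm (j x))\<^sup>2) \<partial>lebesgue) / 2
     + ereal (pi * ln \<eta> * (\<Sum>\<^sub>\<infinity>p\<in>\<Lambda>. \<chi>' p)))"

definition cutoff_family :: "(real \<Rightarrow> real^2 \<Rightarrow> real) \<Rightarrow> bool" where
  "cutoff_family X \<longleftrightarrow> (\<exists>C. \<forall>R>0.
     (\<forall>x. X R x \<ge> 0) \<and>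
     (\<forall>x. X R differentiable (at x) \<and> norm (grad (X R) x) \<le> C) \<and>
     supp (X R) \<subseteq> ball 0 R \<and>
     (\<forall>x \<in> ball 0 R. infdist x (- ball 0 R) \<ge> 1 \<longrightarrow> X R x = 1))"

text \<open>The value of \<open>W(j)\<close> is the common value obtained from all families of cutoff functions.\<close>

definition W_field :: "(real^2) set \<Rightarrow> (real^2 \<Rightarrow> real^2) \<Rightarrow> ereal" where
  "W_field \<Lambda> j = (THE w. \<forall>X. cutoff_family X \<longrightarrow>
     w = Limsup at_top (\<lambda>R. W_cut \<Lambda> j (X R) / ereal (measure lebesgue (ball (0 :: real^2) R))))"

definition lattice_of :: "real^2 \<Rightarrow> real^2 \<Rightarrow> (real^2) set" where
  "lattice_of u v = {of_int a *\<^sub>R u + of_int b *\<^sub>R v | a b :: int. True}"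

definition plane_basis :: "real^2 \<Rightarrow> real^2 \<Rightarrow> bool" where
  "plane_basis u v \<longleftrightarrow> u \<noteq> v \<and> independent {u, v} \<and> span {u, v} = UNIV"

definition is_lattice :: "(real^2) set \<Rightarrow> bool" where
  "is_lattice \<Lambda> \<longleftrightarrow> (\<exists>u v. plane_basis u v \<and> \<Lambda> = lattice_of u v)"

definition period_cell :: "real^2 \<Rightarrow> real^2 \<Rightarrow> (real^2) set" where
  "period_cell u v = {s *\<^sub>R u + t *\<^sub>R v | s t. 0 \<le> s \<and> s < 1 \<and> 0 \<le> t \<and> t < 1}"

text \<open>The conditions below determine \<open>m\<close> (it is \<open>2\<pi>\<close> divided by the area of a period cell), and
  determine \<open>j\<close> up to changes on a null set, which affect neither membership in \<open>A_set m\<close> nor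
  the energy.\<close>

definition is_lattice_field :: "(real^2) set \<Rightarrow> (real^2 \<Rightarrow> real^2) \<Rightarrow> bool" where
  "is_lattice_field \<Lambda> j \<longleftrightarrow>
     (\<exists>m. curl_div_system m \<Lambda> j) \<and>
     (\<forall>p\<in>\<Lambda>. \<forall>x. j (x + p) = j x) \<and>
     (\<forall>u v. plane_basis u v \<and> \<Lambda> = lattice_of u v \<longrightarrow>
        (\<integral>x\<in>period_cell u v. j x \<partial>lebesgue) = 0)"

definition lattice_field :: "(real^2) set \<Rightarrow> real^2 \<Rightarrow> real^2" where
  "lattice_field \<Lambda> = (SOME j. is_lattice_field \<Lambda> j)"

definition W_lattice :: "(real^2) set \<Rightarrow> ereal" where
  "W_lattice \<Lambda> = W_field \<Lambda> (lattice_field \<Lambda>)"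

definition L_set :: "real \<Rightarrow> (real^2) set set" where
  "L_set m = {\<Lambda>. is_lattice \<Lambda> \<and> lattice_field \<Lambda> \<in> A_set m}"

definition triangular_lattice :: "real \<Rightarrow> (real^2) set" where
  "triangular_lattice m = (\<lambda>x. sqrt (4 * pi / (m * sqrt 3)) *\<^sub>R x) `
     lattice_of (vector [1, 0]) (vector [1/2, sqrt 3 / 2])"

end

theory Submission
  imports Defs "HOL-Complex_Analysis.Complex_Analysis"
begin

text \<open>Identify \<open>\<real>\<^sup>2\<close> with \<open>\<complex>\<close> and write a lattice as \<open>w\<^sub>1(\<int> \<oplus> \<tau>\<int>)\<close> with \<open>\<tau> = a + \<i>b\<close>, \<open>b > 0\<close>. Its field is an
  explicit doubly periodic function with simple poles of residue 1, given by a series in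
  \<open>q = exp(2\<pi>\<i>\<tau>)\<close>; it is the only one because a periodic field with constant curl and zero divergence
  is a.e. constant (mollify). As \<open>|j|\<^sup>2\<close> is periodic, \<open>W\<close> is the finite part of its integral over one
  cell divided by the area \<open>A\<close> of the cell, since cells meeting the boundary of the ball do not count in
  the limit. Parseval's identity on horizontal lines of the cell evaluates this finite part:
  \<open>W = (C + (\<pi>/2) ln A + \<pi> \<Phi>(a, b)) / A\<close> with \<open>\<Phi>(a, b) = - (ln b)/2 + \<pi>b/6 + 2 \<Sum>\<^sub>k Re(q\<^sup>k / (1 - q\<^sup>k)) / k\<close>,
  which is \<open>- ln(\<surd>b |\<eta>(\<tau>)|\<^sup>2)\<close> for Dedekind's \<open>\<eta>\<close>.

  It remains to minimize \<open>\<Phi>\<close> on the fundamental domain \<open>|a| \<le> 1/2\<close>, \<open>|\<tau>| \<ge> 1\<close>. The dominant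
  term of the series shows \<open>\<Phi>(a, b) \<ge> \<Phi>(1/2, b)\<close>. As \<open>W\<close> does not depend on the basis, \<open>\<Phi>\<close> is invariant
  under \<open>\<tau> \<mapsto> - 1/\<tau>\<close>, and moving the image of \<open>1/2 + \<i>b\<close> back to the line \<open>a = 1/2\<close> only decreases \<open>\<Phi>\<close>:
  \<open>\<Phi>(1/2, b) \<ge> \<Phi>(1/2, b / (1/4 + b\<^sup>2))\<close>. For \<open>b \<le> 1\<close> this excludes every minimizer on that line
  except the fixed point \<open>b = \<surd>3/2\<close>, the triangular lattice; for \<open>b > 1\<close> one has \<open>\<Phi>(1/2, b) > \<Phi>(1/2, 1)\<close>.\<close>

unbundle no fps_syntax

section \<open>The plane as the complex line\<close>

text \<open>\<open>W_field\<close> is a definite description ranging over all cutoff families and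
  \<open>lattice_field\<close> is an arbitrary choice. So an energy can be computed only once the
  field is known almost everywhere, one limit is shown to serve every family, and some family
  exists. The energy formula is derived only for \<open>Im tau > 1/2\<close>: there |q| is at most
  1/10 and crude geometric bounds control every series. Reduced bases, and all points visited in the
  minimization, stay in that range. The minimum on the line \<open>a = 1/2\<close> is found without
  differentiating \<open>Phi\<close>. The map b -> b / (1/4 + b^2) exchanges the two sides of its
  fixed point sqrt 3 / 2. A minimizer in (sqrt 3 / 2, 1] would be carried below the fixed point and
  then back into that interval, with \<open>Phi\<close> strictly smaller after each move.
  Compactness of [sqrt 3 / 2, 1] therefore leaves the fixed point as the only minimizer.\<close>

definition toC :: "real^2 \<Rightarrow> complex" where "toC x = Complex (x $ 1) (x $ 2)"

definition ofC :: "complex \<Rightarrow> real^2" where "ofC z = vector [Re z, Im z]"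

lemma toC_ofC [simp]: "toC (ofC z) = z"
  by (simp add: toC_def ofC_def)

lemma ofC_toC [simp]: "ofC (toC x) = x"
  by (simp add: toC_def ofC_def vec_eq_iff forall_2)

lemma toC_add: "toC (x + y) = toC x + toC y"
  and toC_diff: "toC (x - y) = toC x - toC y"
  and toC_scaleR: "toC (r *\<^sub>R x) = r *\<^sub>R toC x"
  and toC_uminus: "toC (- x) = - toC x"
  and toC_0 [simp]: "toC 0 = 0"
  by (auto simp: toC_def complex_eq_iff)

lemma ofC_add: "ofC (x + y) = ofC x + ofC y"
  and ofC_diff: "ofC (x - y) = ofC x - ofC y"
  and ofC_scaleR: "ofC (r *\<^sub>R x) = r *\<^sub>R ofC x"
  and ofC_0 [simp]: "ofC 0 = 0"
  by (auto simp: ofC_def vec_eq_iff forall_2)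

lemma norm_toC [simp]: "cmod (toC x) = norm x"
  by (simp add: toC_def cmod_def norm_vec_def L2_set_def sum_2)

lemma norm_ofC [simp]: "norm (ofC z) = cmod z"
  by (metis norm_toC toC_ofC)

lemma dist_toC [simp]: "dist (toC x) (toC y) = dist x y"
  by (simp add: dist_norm flip: toC_diff)

lemma bounded_linear_toC: "bounded_linear toC"
  by (intro bounded_linear_intro[where K=1]) (auto simp: toC_add toC_scaleR)

lemma bounded_linear_ofC: "bounded_linear ofC"
  by (intro bounded_linear_intro[where K=1]) (auto simp: ofC_add ofC_scaleR)

lemma inj_toC: "inj toC"
  by (metis injI ofC_toC)

lemma continuous_on_toC [continuous_intros]:
  "continuous_on S f \<Longrightarrow> continuous_on S (\<lambda>x. toC (f x))"
  by (rule bounded_linear.continuous_on[OF bounded_linear_toC])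

lemma continuous_on_ofC [continuous_intros]:
  "continuous_on S f \<Longrightarrow> continuous_on S (\<lambda>x. ofC (f x))"
  by (rule bounded_linear.continuous_on[OF bounded_linear_ofC])

lemma borel_measurable_toC [measurable]: "toC \<in> borel_measurable borel"
  by (intro borel_measurable_continuous_onI continuous_intros)

lemma borel_measurable_ofC [measurable]: "ofC \<in> borel_measurable borel"
  by (intro borel_measurable_continuous_onI continuous_intros)

section \<open>Lebesgue measure on the plane, on the complex line and on the product of two
  lines\<close>

lemma box_complex_iff: "z \<in> box l u \<longleftrightarrow> Re l < Re z \<and> Re z < Re u \<and> Im l < Im z \<and> Im z < Im u"
  for z l u :: complex
  by (auto simp: box_def Basis_complex_def)

lemma emeasure_box_complex:
  assumes "Re l \<le> Re u" "Im l \<le> Im u"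
  shows "emeasure lborel (box l u) = ennreal ((Re u - Re l) * (Im u - Im l))"
  using assms by (subst emeasure_lborel_box) (auto simp: Basis_complex_def algebra_simps)

lemma lborel_toC: "distr lborel borel toC = lborel"
proof (rule lborel_eqI[symmetric])
  fix l u :: complex
  assume lu: "\<And>b. b \<in> Basis \<Longrightarrow> l \<bullet> b \<le> u \<bullet> b"
  have le: "Re l \<le> Re u" "Im l \<le> Im u"
    using lu[of 1] lu[of \<i>] by (auto simp: Basis_complex_def)
  have "toC -` box l u = box (ofC l) (ofC u)"
    by (auto simp: box_complex_iff mem_box_cart forall_2 toC_def ofC_def)
  moreover have "emeasure lborel (box (ofC l) (ofC u)) = ennreal ((Re u - Re l) * (Im u - Im l))"
    using le by (subst emeasure_lborel_box)
      (auto simp: Basis_vec_def ofC_def UNIV_2 inner_axis axis_eq_axis prod.insert_if algebra_simps)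
  ultimately show "emeasure (distr lborel borel toC) (box l u) = (\<Prod>b\<in>Basis. (u - l) \<bullet> b)"
    by (simp add: emeasure_distr Basis_complex_def)
qed simp

lemma measurable_Complex [measurable]:
  "(\<lambda>(x, y). Complex x y) \<in> borel_measurable (lborel \<Otimes>\<^sub>M lborel)"
  unfolding Complex_eq case_prod_unfold by measurable

lemma lborel_Complex:
  "distr (lborel \<Otimes>\<^sub>M lborel) borel (\<lambda>(x, y). Complex x y) = (lborel :: complex measure)"
proof (rule lborel_eqI[symmetric])
  fix l u :: complex
  assume lu: "\<And>b. b \<in> Basis \<Longrightarrow> l \<bullet> b \<le> u \<bullet> b"
  have le: "Re l \<le> Re u" "Im l \<le> Im u"
    using lu[of 1] lu[of \<i>] by (auto simp: Basis_complex_def)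
  have "(\<lambda>(x, y). Complex x y) -` box l u \<inter> space (lborel \<Otimes>\<^sub>M lborel)
        = {Re l<..<Re u} \<times> {Im l<..<Im u}"
    by (auto simp: box_complex_iff space_pair_measure)
  then show "emeasure (distr (lborel \<Otimes>\<^sub>M lborel) borel (\<lambda>(x, y). Complex x y)) (box l u)
        = (\<Prod>b\<in>Basis. (u - l) \<bullet> b)"
    using le by (simp add: emeasure_distr lborel.emeasure_pair_measure_Times Basis_complex_def ennreal_mult)
qed simp

lemma integrable_toC_iff:
  fixes g :: "complex \<Rightarrow> 'a::{banach, second_countable_topology}"
  assumes [measurable]: "g \<in> borel_measurable borel"
  shows "integrable lborel (\<lambda>x. g (toC x)) \<longleftrightarrow> integrable lborel g"
  using integrable_distr_eq[of toC lborel borel g] by (simp add: lborel_toC)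

lemma integral_toC:
  fixes g :: "complex \<Rightarrow> 'a::{banach, second_countable_topology}"
  assumes [measurable]: "g \<in> borel_measurable borel"
  shows "integral\<^sup>L lborel (\<lambda>x. g (toC x)) = integral\<^sup>L lborel g"
  using integral_distr[of toC lborel borel g] by (simp add: lborel_toC)

lemma nn_integral_toC:
  assumes [measurable]: "g \<in> borel_measurable borel"
  shows "(\<integral>\<^sup>+x. g (toC x) \<partial>lborel) = (\<integral>\<^sup>+z. g z \<partial>lborel)"
  using nn_integral_distr[of toC lborel borel g] by (simp add: lborel_toC)

lemma nn_integral_translate:
  fixes c :: "'a::euclidean_space"
  assumes [measurable]: "g \<in> borel_measurable borel"
  shows "(\<integral>\<^sup>+z. g (c + z) \<partial>lborel) = (\<integral>\<^sup>+z. g z \<partial>lborel)"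
  by (subst (2) lborel_distr_plus[of c, symmetric], subst nn_integral_distr) auto

lemma integrable_translate:
  fixes c :: "'a::euclidean_space" and g :: "'a \<Rightarrow> 'b::{banach, second_countable_topology}"
  assumes "integrable lborel g"
  shows "integrable lborel (\<lambda>z. g (c + z))"
proof -
  have [measurable]: "g \<in> borel_measurable borel" using assms by auto
  show ?thesis
    using assms by (subst (asm) lborel_distr_plus[of c, symmetric], subst (asm) integrable_distr_eq) auto
qed

lemma integral_translate:
  fixes c :: "'a::euclidean_space" and g :: "'a \<Rightarrow> 'b::{banach, second_countable_topology}"
  assumes [measurable]: "g \<in> borel_measurable borel"
  shows "integral\<^sup>L lborel (\<lambda>z. g (c + z)) = integral\<^sup>L lborel g"
  by (subst (2) lborel_distr_plus[of c, symmetric], subst integral_distr) auto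

text \<open>Boxes determine \<open>lborel\<close>. The preimage of a box under multiplication by
  \<open>w\<close> is its image under multiplication by 1/w, a linear map of the real plane with
  determinant 1/|w|^2; the density restores the factor.\<close>

lemma lborel_mult_complex:
  fixes w :: complex
  assumes w: "w \<noteq> 0"
  shows "density (distr lborel borel ((*) w)) (\<lambda>_. ennreal ((cmod w)\<^sup>2)) = lborel"
proof (rule lborel_eqI[symmetric])
  fix l u :: complex
  assume lu: "\<And>b. b \<in> Basis \<Longrightarrow> l \<bullet> b \<le> u \<bullet> b"
  have le: "Re l \<le> Re u" "Im l \<le> Im u"
    using lu[of 1] lu[of \<i>] by (auto simp: Basis_complex_def)
  define v where "v = inverse w"
  define f where "f x = ofC (v * toC x)" for x
  have lin: "linear f"
    unfolding f_def by (intro linearI) (auto simp: toC_add toC_scaleR ofC_add ofC_scaleR algebra_simps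
        simp flip: ofC_scaleR)
  have det: "det (matrix f) = (cmod v)\<^sup>2"
    by (simp add: det_2 matrix_def f_def ofC_def toC_def axis_def cmod_power2 flip: power2_eq_square)
  have im: "toC -` ((*) w -` box l u) = f ` box (ofC l) (ofC u)"
  proof (intro set_eqI iffI)
    fix x assume "x \<in> toC -` ((*) w -` box l u)"
    then have "ofC (w * toC x) \<in> box (ofC l) (ofC u)"
      by (auto simp: box_complex_iff mem_box_cart forall_2 ofC_def)
    moreover have "x = f (ofC (w * toC x))"
      using w by (simp add: f_def v_def field_simps)
    ultimately show "x \<in> f ` box (ofC l) (ofC u)" by blast
  next
    fix x assume "x \<in> f ` box (ofC l) (ofC u)"
    then obtain y where y: "y \<in> box (ofC l) (ofC u)" "x = f y" by auto
    then have "w * toC x = toC y"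
      using w by (simp add: f_def v_def)
    then show "x \<in> toC -` ((*) w -` box l u)"
      using y(1) by (auto simp: box_complex_iff mem_box_cart forall_2 ofC_def toC_def)
  qed
  have m0: "measure lebesgue (box (ofC l) (ofC u)) = (Re u - Re l) * (Im u - Im l)"
    using le by (auto simp: measure_lborel_box_eq Basis_vec_def ofC_def UNIV_2 inner_axis axis_eq_axis
        prod.insert_if algebra_simps)
  have fin: "f ` box (ofC l) (ofC u) \<in> lmeasurable"
    by (intro measurable_linear_image lin) auto
  have m1: "measure lebesgue (f ` box (ofC l) (ofC u)) = (cmod v)\<^sup>2 * ((Re u - Re l) * (Im u - Im l))"
    by (subst measure_linear_image[OF lin]) (auto simp: det m0)
  have [measurable]: "(*) w \<in> borel_measurable borel" by measurable
  have B: "toC -` ((*) w -` box l u) \<in> sets borel"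
    using measurable_sets[OF measurable_comp[OF borel_measurable_toC \<open>(*) w \<in> borel_measurable borel\<close>], of "box l u"]
    by (simp add: vimage_comp o_def)
  have "emeasure (distr lborel borel ((*) w)) (box l u) = emeasure (distr lborel borel toC) ((*) w -` box l u)"
    by (simp add: emeasure_distr lborel_toC)
  also have "\<dots> = emeasure lborel (toC -` ((*) w -` box l u))"
    using measurable_sets[OF \<open>(*) w \<in> borel_measurable borel\<close>, of "box l u"] by (subst emeasure_distr) auto
  also have "\<dots> = emeasure lebesgue (toC -` ((*) w -` box l u))"
    using B by simp
  also have "\<dots> = ennreal ((cmod v)\<^sup>2 * ((Re u - Re l) * (Im u - Im l)))"
    unfolding im using fin m1 by (simp add: emeasure_eq_measure2)
  finally have "emeasure (distr lborel borel ((*) w)) (box l u)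
      = ennreal ((cmod v)\<^sup>2 * ((Re u - Re l) * (Im u - Im l)))" .
  then have "emeasure (density (distr lborel borel ((*) w)) (\<lambda>_. ennreal ((cmod w)\<^sup>2))) (box l u)
      = ennreal ((cmod w)\<^sup>2) * ennreal ((cmod v)\<^sup>2 * ((Re u - Re l) * (Im u - Im l)))"
    by (simp add: emeasure_density_const)
  also have "\<dots> = ennreal ((Re u - Re l) * (Im u - Im l))"
    using w le by (simp add: v_def norm_inverse power_inverse flip: ennreal_mult)
  finally show "emeasure (density (distr lborel borel ((*) w)) (\<lambda>_. ennreal ((cmod w)\<^sup>2))) (box l u)
      = (\<Prod>b\<in>Basis. (u - l) \<bullet> b)"
    by (simp add: Basis_complex_def)
qed simp

lemma nn_integral_mult_complex:
  assumes "w \<noteq> 0" and [measurable]: "g \<in> borel_measurable borel"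
  shows "(\<integral>\<^sup>+z. g z \<partial>lborel) = ennreal ((cmod w)\<^sup>2) * (\<integral>\<^sup>+z. g (w * z) \<partial>lborel)"
  by (subst lborel_mult_complex[OF assms(1), symmetric])
     (simp add: nn_integral_density nn_integral_cmult nn_integral_distr)

lemma integral_mult_complex:
  fixes g :: "complex \<Rightarrow> 'a::{banach, second_countable_topology}"
  assumes "w \<noteq> 0" and [measurable]: "g \<in> borel_measurable borel"
  shows "integral\<^sup>L lborel g = (cmod w)\<^sup>2 *\<^sub>R integral\<^sup>L lborel (\<lambda>z. g (w * z))"
  by (subst lborel_mult_complex[OF assms(1), symmetric])
     (simp add: integral_density integral_distr)

section \<open>Integration of radial functions\<close>

lemma lborel_cmod: "distr lborel borel cmod = density lborel (\<lambda>t. ennreal (2 * pi * t) * indicator {0..} t)"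
proof (rule measure_eqI_generator_eq[where E = "range (\<lambda>a::real. {..a})" and \<Omega> = UNIV
        and A = "\<lambda>i. {..real i}"])
  show "Int_stable (range (\<lambda>a::real. {..a}))"
  proof (rule Int_stableI)
    fix a b :: "real set" assume "a \<in> range (\<lambda>a. {..a})" "b \<in> range (\<lambda>a. {..a})"
    then obtain x y where "a = {..x}" "b = {..y}" by auto
    then have "a \<inter> b = {..min x y}" by auto
    then show "a \<inter> b \<in> range (\<lambda>a. {..a})" by blast
  qed
  have s: "sets (borel::real measure) = sigma_sets UNIV (range (\<lambda>a::real. {..a}))"
    by (simp add: borel_eq_atMost)
  show "sets (distr lborel borel cmod) = sigma_sets UNIV (range (\<lambda>a::real. {..a}))"
    and "sets (density lborel (\<lambda>t. ennreal (2 * pi * t) * indicator {0..} t))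
      = sigma_sets UNIV (range (\<lambda>a::real. {..a}))"
    by (simp_all add: s[symmetric])
  \<comment> \<open>Half lines form an intersection-stable generator, and on \<open>{..a}\<close>
    both measures give the area of the disc of radius a, which is empty for negative a.\<close>
  have e1: "emeasure (distr lborel borel cmod) {..a} = (if a < 0 then 0 else ennreal (pi * a\<^sup>2))" for a
  proof -
    have "cmod -` {..a} = cball 0 a" by auto
    moreover have "emeasure lborel (cball (0::complex) a) = (if a < 0 then 0 else ennreal (pi * a\<^sup>2))"
      by (auto simp: emeasure_cball unit_ball_vol_2)
    ultimately show ?thesis by (simp add: emeasure_distr)
  qed
  have e2: "emeasure (density lborel (\<lambda>t. ennreal (2 * pi * t) * indicator {0..} t)) {..a}
      = (if a < 0 then 0 else ennreal (pi * a\<^sup>2))" for a :: real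
  proof (cases "a < 0")
    case True
    then have *: "(\<lambda>t. (ennreal (2 * pi * t) * indicator {0..} t) * indicator {..a} t) = (\<lambda>_. 0)"
      by (auto simp: indicator_def fun_eq_iff)
    show ?thesis using True by (subst emeasure_density) (simp_all only: *, auto)
  next
    case False
    have "emeasure (density lborel (\<lambda>t. ennreal (2 * pi * t) * indicator {0..} t)) {..a}
       = (\<integral>\<^sup>+t. ennreal (2 * pi * t) * indicator {0..a} t \<partial>lborel)"
      by (subst emeasure_density) (auto intro!: nn_integral_cong simp: indicator_def)
    also have "\<dots> = ennreal (pi * a\<^sup>2 - pi * 0\<^sup>2)"
      using False by (intro nn_integral_FTC_Icc) (auto intro!: derivative_eq_intros)
    finally show ?thesis using False by simp
  qed
  show "emeasure (distr lborel borel cmod) X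
      = emeasure (density lborel (\<lambda>t. ennreal (2 * pi * t) * indicator {0..} t)) X"
    if "X \<in> range (\<lambda>a::real. {..a})" for X
    using that e1 e2 by auto
  show "emeasure (distr lborel borel cmod) {..real i} \<noteq> \<infinity>" for i
    by (subst e1) auto
  show "(\<Union>i. {..real i}) = UNIV"
    by (auto intro: real_arch_simple)
qed auto

lemma nn_integral_cmod:
  assumes [measurable]: "g \<in> borel_measurable borel"
  shows "(\<integral>\<^sup>+z. g (cmod z) \<partial>lborel) = (\<integral>\<^sup>+t. ennreal (2 * pi * t) * indicator {0..} t * g t \<partial>lborel)"
proof -
  have "(\<integral>\<^sup>+z. g (cmod z) \<partial>lborel) = (\<integral>\<^sup>+t. g t \<partial>distr lborel borel cmod)"
    by (subst nn_integral_distr) auto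
  then show ?thesis
    unfolding lborel_cmod by (subst (asm) nn_integral_density) auto
qed

lemma nn_integral_inverse_cmod:
  assumes "R \<ge> 0"
  shows "(\<integral>\<^sup>+z. ennreal (1 / cmod z) * indicator (cball 0 R) z \<partial>lborel) = ennreal (2 * pi * R)"
proof -
  have "(\<integral>\<^sup>+z. ennreal (1 / cmod z) * indicator (cball 0 R) z \<partial>lborel)
      = (\<integral>\<^sup>+z. ennreal (1 / cmod z) * indicator {..R} (cmod z) \<partial>lborel)"
    by (intro nn_integral_cong) (auto simp: indicator_def)
  also have "\<dots> = (\<integral>\<^sup>+t. ennreal (2 * pi * t) * indicator {0..} t * (ennreal (1 / t) * indicator {..R} t) \<partial>lborel)"
    by (subst nn_integral_cmod[where g="\<lambda>t. ennreal (1 / t) * indicator {..R} t", symmetric]) auto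
  also have "\<dots> = (\<integral>\<^sup>+t. ennreal (2 * pi) * indicator {0..R} t \<partial>lborel)"
  proof (rule nn_integral_cong_AE, use AE_lborel_singleton[of "0::real"] in eventually_elim)
    fix t :: real assume "t \<noteq> 0"
    then show "ennreal (2 * pi * t) * indicator {0..} t * (ennreal (1 / t) * indicator {..R} t)
        = ennreal (2 * pi) * indicator {0..R} t"
      by (cases "t > 0") (auto simp: indicator_def simp flip: ennreal_mult)
  qed
  also have "\<dots> = ennreal (2 * pi * R)"
    using assms by (simp add: nn_integral_cmult ennreal_mult)
  finally show ?thesis .
qed

lemma integrable_inverse_cmod: "set_integrable lborel (cball 0 R) (\<lambda>z::complex. 1 / cmod z)"
proof (cases "R \<ge> 0")
  case True
  show ?thesis
    unfolding set_integrable_def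
  proof (rule integrableI_nonneg)
    show "(\<integral>\<^sup>+ x. ennreal (indicator (cball 0 R) x *\<^sub>R (1 / cmod x)) \<partial>lborel) < \<infinity>"
    proof -
      have "ennreal (indicator (cball 0 R) x *\<^sub>R (1 / cmod x)) = ennreal (1 / cmod x) * indicator (cball 0 R) x" for x
        by (simp add: indicator_def)
      then show ?thesis
        using nn_integral_inverse_cmod[OF True] by simp
    qed
    show "(\<lambda>x::complex. indicator (cball 0 R) x *\<^sub>R (1 / cmod x)) \<in> borel_measurable lborel"
      by (intro borel_measurable_scaleR borel_measurable_indicator borel_measurable_divide borel_measurable_norm) auto
  qed auto
qed (auto simp: set_integrable_def indicator_def)

text \<open>This is the mass of the approximate identity in \<open>dbar_cauchy_kernel_0\<close>,
  hence the source of the factor 2 pi attached to every pole.\<close>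

lemma nn_integral_bubble: "(\<integral>\<^sup>+z. ennreal (2 / (1 + (cmod z)\<^sup>2)\<^sup>2) \<partial>lborel) = ennreal (2 * pi)"
proof -
  have "(\<integral>\<^sup>+z. ennreal (2 / (1 + (cmod z)\<^sup>2)\<^sup>2) \<partial>lborel)
    = (\<integral>\<^sup>+t. ennreal (2 * pi * t) * indicator {0..} t * ennreal (2 / (1 + t\<^sup>2)\<^sup>2) \<partial>lborel)"
    by (subst nn_integral_cmod[where g="\<lambda>t. ennreal (2 / (1 + t\<^sup>2)\<^sup>2)", symmetric]) auto
  also have "\<dots> = (\<integral>\<^sup>+t. ennreal (4 * pi * t / (1 + t\<^sup>2)\<^sup>2) * indicator {0..} t \<partial>lborel)"
    by (intro nn_integral_cong) (auto simp: indicator_def simp flip: ennreal_mult)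
  also have "\<dots> = ennreal (0 - (- 2 * pi / (1 + 0\<^sup>2)))"
  proof (rule nn_integral_FTC_atLeast)
    show "DERIV (\<lambda>t. - 2 * pi / (1 + t\<^sup>2)) t :> 4 * pi * t / (1 + t\<^sup>2)\<^sup>2" if "0 \<le> t" for t :: real
    proof -
      have "1 + t\<^sup>2 \<noteq> 0" by (simp add: add_nonneg_eq_0_iff)
      then show ?thesis
        by (auto intro!: derivative_eq_intros simp: field_simps power2_eq_square)
    qed
    show "((\<lambda>t::real. - 2 * pi / (1 + t\<^sup>2)) \<longlongrightarrow> 0) at_top"
      by real_asymp
  qed auto
  finally show ?thesis by simp
qed

text \<open>Half of this integral is the energy that piles up around a singularity as the inner
  radius shrinks; the term \<open>pi * ln \<eta>\<close> in \<open>W_cut\<close> compensates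
  it.\<close>

lemma nn_integral_annulus:
  assumes "0 < r" "r \<le> R"
  shows "(\<integral>\<^sup>+z. ennreal (1 / (cmod z)\<^sup>2) * indicator {z. r \<le> cmod z \<and> cmod z \<le> R} z \<partial>lborel)
    = ennreal (2 * pi * ln R - 2 * pi * ln r)"
proof -
  have "(\<integral>\<^sup>+z. ennreal (1 / (cmod z)\<^sup>2) * indicator {z. r \<le> cmod z \<and> cmod z \<le> R} z \<partial>lborel)
      = (\<integral>\<^sup>+z. ennreal (1 / (cmod z)\<^sup>2) * indicator {r..R} (cmod z) \<partial>lborel)"
    by (intro nn_integral_cong) (auto simp: indicator_def)
  also have "\<dots> = (\<integral>\<^sup>+t. ennreal (2 * pi * t) * indicator {0..} t * (ennreal (1 / t\<^sup>2) * indicator {r..R} t) \<partial>lborel)"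
    by (subst nn_integral_cmod[where g="\<lambda>t. ennreal (1 / t\<^sup>2) * indicator {r..R} t", symmetric]) auto
  also have "\<dots> = (\<integral>\<^sup>+t. ennreal (2 * pi / t) * indicator {r..R} t \<partial>lborel)"
    using assms
    by (intro nn_integral_cong) (auto simp: indicator_def power2_eq_square simp flip: ennreal_mult)
  also have "\<dots> = ennreal (2 * pi * ln R - 2 * pi * ln r)"
    using assms by (intro nn_integral_FTC_Icc) (auto intro!: derivative_eq_intros simp: field_simps)
  finally show ?thesis .
qed

section \<open>The Cauchy kernel\<close>

lemma has_derivative_eq_0:
  assumes "open A" "z \<in> A" "\<And>x. x \<in> A \<Longrightarrow> f x = 0"
  shows "(f has_derivative (\<lambda>_. 0)) (at z)"
proof -
  have "((\<lambda>_. 0) has_derivative (\<lambda>_. 0)) (at z)" by simp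
  then show ?thesis
    by (rule has_derivative_transform_within_open[OF _ assms(1,2)]) (simp add: assms(3))
qed

lemma continuous_norm_bound_cball:
  fixes f :: "'a::euclidean_space \<Rightarrow> 'b::real_normed_vector"
  assumes "continuous_on UNIV f"
  obtains M where "\<And>z. norm z \<le> R \<Longrightarrow> norm (f z) \<le> M"
proof -
  have "compact (f ` cball 0 R)"
    by (intro compact_continuous_image continuous_on_subset[OF assms]) auto
  then have "bounded (f ` cball 0 R)" by (rule compact_imp_bounded)
  then obtain M where "\<forall>x\<in>f ` cball 0 R. norm x \<le> M" unfolding bounded_iff by blast
  then show ?thesis using that[of M] by auto
qed

text \<open>Translation invariance makes the integral of every difference quotient in the direction
  \<open>v\<close> vanish. The mean value theorem bounds the quotients by the maximum of the
  derivative, so dominated convergence applies.\<close>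

lemma integral_directional_derivative_eq_0:
  fixes \<psi> :: "'a::euclidean_space \<Rightarrow> 'b::euclidean_space"
  assumes d: "\<And>z. (\<psi> has_derivative \<psi>' z) (at z)"
    and cont: "continuous_on UNIV (\<lambda>z. \<psi>' z v)"
    and supp: "\<And>z. norm z > R \<Longrightarrow> \<psi> z = 0"
  shows "integrable lborel (\<lambda>z. \<psi>' z v)" "integral\<^sup>L lborel (\<lambda>z. \<psi>' z v) = 0"
proof -
  define g where "g z = \<psi>' z v" for z
  have g0: "g z = 0" if "norm z > R" for z
  proof -
    have "open {z. norm z > R}"
      by (intro open_Collect_less continuous_intros)
    then have "(\<psi> has_derivative (\<lambda>_. 0)) (at z)"
      using that supp by (intro has_derivative_eq_0[of "{z. norm z > R}"]) auto
    then show ?thesis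
      using has_derivative_unique[OF d[of z]] by (auto simp: g_def)
  qed
  obtain M0 where M0: "\<And>z. norm z \<le> R \<Longrightarrow> norm (g z) \<le> M0"
    using continuous_norm_bound_cball[OF cont] unfolding g_def by metis
  define M where "M = max M0 0"
  have M: "norm (g z) \<le> M" for z
    using M0[of z] g0[of z] by (cases "norm z \<le> R") (auto simp: M_def)
  have Mge: "M \<ge> 0" by (simp add: M_def)
  define dd where "dd n z = real (Suc n) *\<^sub>R (\<psi> (inverse (real (Suc n)) *\<^sub>R v + z) - \<psi> z)" for n z
  have contp: "continuous_on UNIV \<psi>"
    by (meson d continuous_at_imp_continuous_on has_derivative_continuous)
  have mp[measurable]: "\<psi> \<in> borel_measurable borel"
    by (intro borel_measurable_continuous_onI contp)
  have mg[measurable]: "g \<in> borel_measurable borel"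
    using cont unfolding g_def by (intro borel_measurable_continuous_onI)
  have line: "((\<lambda>t. \<psi> (t *\<^sub>R v + z)) has_vector_derivative g (t *\<^sub>R v + z)) (at t within T)" for t z T
  proof -
    have "((\<lambda>t. \<psi> (t *\<^sub>R v + z)) has_derivative (\<lambda>s. \<psi>' (t *\<^sub>R v + z) (s *\<^sub>R v))) (at t within T)"
      by (rule has_derivative_compose[OF _ d]) (auto intro!: derivative_eq_intros)
    moreover have "\<psi>' (t *\<^sub>R v + z) (s *\<^sub>R v) = s *\<^sub>R g (t *\<^sub>R v + z)" for s
      using linear_cmul[OF has_derivative_linear[OF d]] by (auto simp: g_def)
    ultimately show ?thesis
      by (simp add: has_vector_derivative_def)
  qed
  have bnd: "norm (dd n z) \<le> M" for n z
  proof -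
    have "norm (\<psi> (inverse (real (Suc n)) *\<^sub>R v + z) - \<psi> (0 *\<^sub>R v + z)) \<le> M * norm (inverse (real (Suc n)) - 0)"
    proof (rule differentiable_bound[where S=UNIV and f="\<lambda>t. \<psi> (t *\<^sub>R v + z)" and f'="\<lambda>t s. s *\<^sub>R g (t *\<^sub>R v + z)"])
      show "((\<lambda>t. \<psi> (t *\<^sub>R v + z)) has_derivative (\<lambda>s. s *\<^sub>R g (t *\<^sub>R v + z))) (at t within UNIV)" for t
        using line[of z t UNIV] by (simp add: has_vector_derivative_def)
      show "onorm (\<lambda>s. s *\<^sub>R g (t *\<^sub>R v + z)) \<le> M" for t
        by (intro onorm_bound) (auto simp: mult.commute[of _ "norm (g _)"] Mge intro!: mult_right_mono M)
    qed auto
    moreover have "norm (dd n z) = real (Suc n) * norm (\<psi> (inverse (real (Suc n)) *\<^sub>R v + z) - \<psi> (0 *\<^sub>R v + z))"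
      by (simp add: dd_def del: of_nat_Suc)
    ultimately show ?thesis
      by (simp add: divide_inverse[symmetric] pos_le_divide_eq mult.commute del: of_nat_Suc)
  qed
  have lim: "(\<lambda>n. dd n z) \<longlonglongrightarrow> g z" for z
  proof -
    have "((\<lambda>h. norm (\<psi> (h *\<^sub>R v + z) - \<psi> z - h *\<^sub>R g z) / norm h) \<longlongrightarrow> 0) (at 0)"
      using line[of z 0 UNIV] by (simp add: has_vector_derivative_def has_derivative_at)
    moreover have "filterlim (\<lambda>n. inverse (real (Suc n))) (at 0) sequentially"
      using LIMSEQ_inverse_real_of_nat by (auto simp: filterlim_at)
    ultimately have "(\<lambda>n. norm (\<psi> (inverse (real (Suc n)) *\<^sub>R v + z) - \<psi> z - inverse (real (Suc n)) *\<^sub>R g z) / norm (inverse (real (Suc n)))) \<longlonglongrightarrow> 0"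
      by (rule filterlim_compose)
    moreover have "norm (\<psi> (inverse (real (Suc n)) *\<^sub>R v + z) - \<psi> z - inverse (real (Suc n)) *\<^sub>R g z) / norm (inverse (real (Suc n)))
       = norm (dd n z - g z)" for n
    proof -
      have "dd n z - g z = real (Suc n) *\<^sub>R (\<psi> (inverse (real (Suc n)) *\<^sub>R v + z) - \<psi> z - inverse (real (Suc n)) *\<^sub>R g z)"
        unfolding dd_def scaleR_diff_right scaleR_scaleR by (simp del: of_nat_Suc)
      then show ?thesis by (simp only: norm_scaleR norm_inverse divide_inverse abs_inverse inverse_inverse_eq real_norm_def mult.commute)
    qed
    ultimately show ?thesis
      by (simp add: tendsto_norm_zero_iff LIM_zero_iff)
  qed
  \<comment> \<open>The quotients move the support by at most \<open>norm v\<close>, so they vanish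
    outside this ball.\<close>
  define w where "w z = indicator (cball 0 (R + norm v)) z * M" for z :: 'a
  have iw: "integrable lborel w"
    unfolding w_def by (intro integrable_mult_left integrable_real_indicator) (auto intro: emeasure_bounded_finite[unfolded infinity_ennreal_def])
  have dw: "norm (dd n z) \<le> w z" for n z
  proof (cases "norm z \<le> R + norm v")
    case True
    then show ?thesis using bnd[of n z] by (auto simp: w_def)
  next
    case False
    have "norm z \<le> norm (inverse (real (Suc n)) *\<^sub>R v + z) + norm (inverse (real (Suc n)) *\<^sub>R v)"
      by (metis add_diff_cancel_left' norm_triangle_ineq4 add.commute)
    moreover have "norm (inverse (real (Suc n)) *\<^sub>R v) \<le> norm v"
      by (auto simp: mult_left_le_one_le inverse_le_1_iff)
    ultimately have "norm (inverse (real (Suc n)) *\<^sub>R v + z) > R"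
      using False by linarith
    moreover have "norm z > R" using False norm_ge_zero[of v] by linarith
    ultimately show ?thesis
      using False by (simp add: dd_def supp w_def)
  qed
  have mdd[measurable]: "dd n \<in> borel_measurable borel" for n
    unfolding dd_def by measurable
  note DC = integral_dominated_convergence[of g lborel dd w, OF _ _ iw]
  show ig: "integrable lborel (\<lambda>z. \<psi>' z v)"
    using integrable_dominated_convergence[of g lborel dd w, OF _ _ iw] lim dw mg mdd
    unfolding g_def[abs_def] by auto
  have ip: "integrable lborel \<psi>"
  proof -
    have "set_integrable lborel (cball 0 R) \<psi>"
      unfolding set_integrable_def
      by (intro borel_integrable_compact continuous_on_subset[OF contp]) auto
    moreover have "indicator (cball 0 R) z *\<^sub>R \<psi> z = \<psi> z" for z
      using supp[of z] by (auto simp: indicator_def)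
    ultimately show ?thesis by (simp add: set_integrable_def)
  qed
  have "integral\<^sup>L lborel (dd n) = 0" for n
    unfolding dd_def using ip integrable_translate[OF ip] integral_translate[OF mp]
    by (subst integral_scaleR_right, subst Bochner_Integration.integral_diff) auto
  moreover have "(\<lambda>n. integral\<^sup>L lborel (dd n)) \<longlonglongrightarrow> integral\<^sup>L lborel g"
    using lim dw mg mdd by (intro DC) auto
  ultimately show "integral\<^sup>L lborel (\<lambda>z. \<psi>' z v) = 0"
    using LIMSEQ_unique[of "\<lambda>n. 0" 0 "integral\<^sup>L lborel g"] unfolding g_def[abs_def] by auto
qed

definition C1c :: "(complex \<Rightarrow> real) \<Rightarrow> (complex \<Rightarrow> complex \<Rightarrow> real) \<Rightarrow> bool" where
  "C1c \<phi> \<phi>' \<longleftrightarrow> (\<forall>z. (\<phi> has_derivative \<phi>' z) (at z)) \<and> (\<forall>v. continuous_on UNIV (\<lambda>z. \<phi>' z v))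
     \<and> (\<exists>R. \<forall>z. cmod z > R \<longrightarrow> \<phi> z = 0)"

text \<open>The operator d/dx + i d/dy, twice the Wirtinger derivative in the conjugate variable.
  Without the factor 1/2 it matches curl + i div, and the kernel 1/z yields 2 pi instead of
  pi.\<close>

definition dbar :: "(complex \<Rightarrow> complex \<Rightarrow> real) \<Rightarrow> complex \<Rightarrow> complex" where
  "dbar \<phi>' z = of_real (\<phi>' z 1) + \<i> * of_real (\<phi>' z \<i>)"

lemma C1c_translate:
  assumes "C1c \<phi> \<phi>'"
  shows "C1c (\<lambda>z. \<phi> (p + z)) (\<lambda>z. \<phi>' (p + z))"
proof -
  obtain R where R: "\<And>z. cmod z > R \<Longrightarrow> \<phi> z = 0" and d: "\<And>z. (\<phi> has_derivative \<phi>' z) (at z)"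
    and c: "\<And>v. continuous_on UNIV (\<lambda>z. \<phi>' z v)"
    using assms by (auto simp: C1c_def)
  have "((\<lambda>z. \<phi> (p + z)) has_derivative \<phi>' (p + z)) (at z)" for z
    by (rule has_derivative_compose[OF _ d, of "\<lambda>z. p + z" "\<lambda>h. h", simplified]) (auto intro!: derivative_eq_intros)
  moreover have "continuous_on UNIV (\<lambda>z. \<phi>' (p + z) v)" for v
    by (rule continuous_on_compose2[OF c]) (auto intro!: continuous_intros)
  moreover have "\<phi> (p + z) = 0" if "cmod z > R + cmod p" for z
  proof -
    have "cmod z \<le> cmod (p + z) + cmod p"
      by (metis add_diff_cancel_left' norm_triangle_ineq4)
    then show ?thesis using that by (intro R) auto
  qed
  ultimately show ?thesis unfolding C1c_def by blast
qed

lemma C1c_bounds: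
  assumes "C1c \<phi> \<phi>'"
  obtains R M where "R > 0" "M \<ge> 0" "\<And>z. cmod z > R \<Longrightarrow> \<phi> z = 0" "\<And>z. cmod z > R \<Longrightarrow> dbar \<phi>' z = 0"
    "\<And>z. \<bar>\<phi> z\<bar> \<le> M" "\<And>z. cmod (dbar \<phi>' z) \<le> M"
    "continuous_on UNIV \<phi>" "continuous_on UNIV (dbar \<phi>')"
proof -
  obtain R0 where R0: "\<And>z. cmod z > R0 \<Longrightarrow> \<phi> z = 0" and d: "\<And>z. (\<phi> has_derivative \<phi>' z) (at z)"
    and c: "\<And>v. continuous_on UNIV (\<lambda>z. \<phi>' z v)"
    using assms by (auto simp: C1c_def)
  define R where "R = max R0 1"
  have R: "cmod z > R \<Longrightarrow> \<phi> z = 0" for z using R0[of z] by (auto simp: R_def)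
  have DR: "dbar \<phi>' z = 0" if "cmod z > R" for z
  proof -
    have "open {z. cmod z > R}"
      by (intro open_Collect_less continuous_intros)
    then have "(\<phi> has_derivative (\<lambda>_. 0)) (at z)"
      using that R by (intro has_derivative_eq_0[of "{z. cmod z > R}"]) auto
    then show ?thesis
      using has_derivative_unique[OF d[of z]] by (auto simp: dbar_def)
  qed
  have cp: "continuous_on UNIV \<phi>"
    by (meson d continuous_at_imp_continuous_on has_derivative_continuous)
  have cd: "continuous_on UNIV (dbar \<phi>')"
    unfolding dbar_def using c by (intro continuous_intros)
  obtain M1 where M1: "\<And>z. cmod z \<le> R \<Longrightarrow> norm (\<phi> z) \<le> M1"
    by (rule continuous_norm_bound_cball[OF cp, where R=R], rule that)
  obtain M2 where M2: "\<And>z. cmod z \<le> R \<Longrightarrow> norm (dbar \<phi>' z) \<le> M2"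
    by (rule continuous_norm_bound_cball[OF cd, where R=R], rule that)
  define M where "M = max 0 (max M1 M2)"
  have m1: "\<bar>\<phi> z\<bar> \<le> M" for z
    using M1[of z] R[of z] by (cases "cmod z \<le> R") (auto simp: M_def)
  have m2: "cmod (dbar \<phi>' z) \<le> M" for z
    using M2[of z] DR[of z] by (cases "cmod z \<le> R") (auto simp: M_def)
  have "R > 0" "M \<ge> 0" by (auto simp: R_def M_def)
  then show ?thesis
    by (rule that[OF _ _ R DR m1 m2 cp cd])
qed

text \<open>The kernel 1/z is regularised to cnj z / (|z|^2 + eps^2), which is differentiable
  everywhere and still bounded by 1/|z|. Integration by parts moves the derivative onto it, where it
  becomes 2 eps^2 / (|z|^2 + eps^2)^2, an approximate identity of mass 2 pi.\<close>

lemma dbar_cauchy_kernel_0: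
  assumes C: "C1c \<phi> \<phi>'"
  shows "integrable lborel (\<lambda>z. dbar \<phi>' z / z)" "integral\<^sup>L lborel (\<lambda>z. dbar \<phi>' z / z) = - 2 * pi * \<phi> 0"
proof -
  obtain R M where RM: "R > 0" "M \<ge> 0" "\<And>z. cmod z > R \<Longrightarrow> \<phi> z = 0" "\<And>z. cmod z > R \<Longrightarrow> dbar \<phi>' z = 0"
    "\<And>z. \<bar>\<phi> z\<bar> \<le> M" "\<And>z. cmod (dbar \<phi>' z) \<le> M"
    and cp: "continuous_on UNIV \<phi>" and cd: "continuous_on UNIV (dbar \<phi>')"
    by (rule C1c_bounds[OF C], rule that)
  have d: "\<And>z. (\<phi> has_derivative \<phi>' z) (at z)" and c: "\<And>v. continuous_on UNIV (\<lambda>z. \<phi>' z v)"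
    using C by (auto simp: C1c_def)
  have [measurable]: "\<phi> \<in> borel_measurable borel" "dbar \<phi>' \<in> borel_measurable borel"
    by (intro borel_measurable_continuous_onI cp cd)+
  define \<epsilon> where "\<epsilon> n = inverse (real (Suc n))" for n
  have e0: "\<epsilon> n > 0" for n by (simp add: \<epsilon>_def)
  have elim: "\<epsilon> \<longlonglongrightarrow> 0" unfolding \<epsilon>_def by (rule LIMSEQ_inverse_real_of_nat)
  define den where "den n z = z * cnj z + of_real ((\<epsilon> n)\<^sup>2)" for n and z :: complex
  have den: "den n z = of_real ((cmod z)\<^sup>2 + (\<epsilon> n)\<^sup>2)" for n z
    by (simp only: den_def of_real_add complex_norm_square)
  have den0: "den n z \<noteq> 0" for n z
  proof -
    have "(cmod z)\<^sup>2 + (\<epsilon> n)\<^sup>2 > 0" using e0[of n] by (intro add_nonneg_pos) auto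
    then show ?thesis unfolding den by (metis of_real_eq_0_iff less_irrefl)
  qed
  define k where "k n z = cnj z / den n z" for n z
  define k' where "k' n z h = ((\<epsilon> n)\<^sup>2 * cnj h - (cnj z)\<^sup>2 * h) / (den n z)\<^sup>2" for n z h
  have kd: "(k n has_derivative k' n z) (at z)" for n z
  proof -
    have "(k n has_derivative (\<lambda>h. (cnj h * den n z - cnj z * (z * cnj h + h * cnj z)) / (den n z * den n z))) (at z)"
      unfolding k_def using den0[of n z]
      by (auto intro!: derivative_eq_intros simp: den_def)
    moreover have "(\<lambda>h. (cnj h * den n z - cnj z * (z * cnj h + h * cnj z)) / (den n z * den n z)) = k' n z"
      by (auto simp: fun_eq_iff k'_def den_def power2_eq_square algebra_simps)
    ultimately show ?thesis by simp
  qed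
  have contk: "continuous_on UNIV (k n)" for n
    by (meson kd continuous_at_imp_continuous_on has_derivative_continuous)
  define \<psi>' where "\<psi>' n z h = of_real (\<phi> z) * k' n z h + of_real (\<phi>' z h) * k n z" for n z h
  have psi: "((\<lambda>z. of_real (\<phi> z) * k n z) has_derivative \<psi>' n z) (at z)" for n z
    unfolding \<psi>'_def by (intro has_derivative_mult kd has_derivative_of_real d)
  have contpsi: "continuous_on UNIV (\<lambda>z. \<psi>' n z h)" for n h
    unfolding \<psi>'_def k'_def using den0
    by (intro continuous_intros cp c contk) (auto simp: den_def intro!: continuous_intros)
  have supp: "of_real (\<phi> z) * k n z = 0" if "cmod z > R" for n z
    using RM(3)[OF that] by simp
  note I = integral_directional_derivative_eq_0[OF psi contpsi supp]
  have Dpsi: "\<psi>' n z 1 + \<i> * \<psi>' n z \<i> = dbar \<phi>' z * k n z + of_real (\<phi> z * (2 * (\<epsilon> n)\<^sup>2 / ((cmod z)\<^sup>2 + (\<epsilon> n)\<^sup>2)\<^sup>2))" for n z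
  proof -
    have "k' n z 1 + \<i> * k' n z \<i> = 2 * (\<epsilon> n)\<^sup>2 / (den n z)\<^sup>2"
      by (simp add: k'_def add_divide_distrib[symmetric] diff_divide_distrib[symmetric] algebra_simps)
    moreover have "\<psi>' n z 1 + \<i> * \<psi>' n z \<i> = dbar \<phi>' z * k n z + of_real (\<phi> z) * (k' n z 1 + \<i> * k' n z \<i>)"
      by (simp add: \<psi>'_def dbar_def algebra_simps)
    ultimately show ?thesis by (simp add: den)
  qed
  have mk[measurable]: "k n \<in> borel_measurable borel" for n
    by (intro borel_measurable_continuous_onI contk)
  have normk: "cmod (k n z) \<le> 1 / cmod z" for n z
  proof (cases "z = 0")
    case False
    have "cmod (k n z) = cmod z / ((cmod z)\<^sup>2 + (\<epsilon> n)\<^sup>2)"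
      unfolding k_def den norm_divide norm_of_real by simp
    also have "\<dots> \<le> cmod z / (cmod z)\<^sup>2"
      using False by (intro divide_left_mono) (auto intro!: mult_pos_pos add_pos_nonneg)
    finally show ?thesis using False by (simp add: power2_eq_square)
  qed (simp add: k_def)
  define w where "w z = M * (indicator (cball 0 R) z *\<^sub>R (1 / cmod z))" for z
  have iw: "integrable lborel w"
    unfolding w_def using integrable_inverse_cmod[of R] by (intro integrable_mult_right) (auto simp: set_integrable_def)
  have dom: "norm (dbar \<phi>' z * k n z) \<le> w z" for n z
    using RM(4)[of z] mult_mono[OF RM(6)[of z] normk[of n z] RM(2)]
    by (cases "cmod z \<le> R") (auto simp: w_def norm_mult)
  have limk: "(\<lambda>n. dbar \<phi>' z * k n z) \<longlonglongrightarrow> dbar \<phi>' z / z" for z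
  proof (cases "z = 0")
    case False
    have "(\<lambda>n. dbar \<phi>' z * (cnj z / (z * cnj z + of_real ((\<epsilon> n)\<^sup>2)))) \<longlonglongrightarrow> dbar \<phi>' z * (cnj z / (z * cnj z + of_real (0\<^sup>2)))"
      using False by (intro tendsto_intros elim) auto
    then show ?thesis using False by (simp add: k_def den_def)
  qed (simp add: k_def)
  have mm[measurable]: "(\<lambda>z. dbar \<phi>' z / z) \<in> borel_measurable lborel"
    by measurable
  have mm2[measurable]: "(\<lambda>z. dbar \<phi>' z * k n z) \<in> borel_measurable lborel" for n
    by measurable
  show "integrable lborel (\<lambda>z. dbar \<phi>' z / z)"
    by (rule integrable_dominated_convergence[of _ _ "\<lambda>n z. dbar \<phi>' z * k n z" w]) (use iw dom limk in auto)
  have L1: "(\<lambda>n. integral\<^sup>L lborel (\<lambda>z. dbar \<phi>' z * k n z)) \<longlonglongrightarrow> integral\<^sup>L lborel (\<lambda>z. dbar \<phi>' z / z)"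
    by (rule integral_dominated_convergence[of _ _ _ w]) (use iw dom limk in auto)
  have ik: "integrable lborel (\<lambda>z. dbar \<phi>' z * k n z)" for n
    by (rule Bochner_Integration.integrable_bound[OF iw mm2]) (use dom in \<open>auto intro!: AE_I2 order_trans[OF dom]\<close>)
  define b where "b w = 2 / (1 + (cmod w)\<^sup>2)\<^sup>2" for w
  have b0: "b w \<ge> 0" for w by (simp add: b_def)
  have bm[measurable]: "b \<in> borel_measurable borel" unfolding b_def by measurable
  have ib: "integrable lborel b" and vb: "integral\<^sup>L lborel b = 2 * pi"
    using nn_integral_bubble b0 nn_integral_eq_integrable[of b lborel "2 * pi"]
    by (auto simp: b_def)
  define B where "B n z = \<phi> z * (2 * (\<epsilon> n)\<^sup>2 / ((cmod z)\<^sup>2 + (\<epsilon> n)\<^sup>2)\<^sup>2)" for n z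
  have Bm[measurable]: "B n \<in> borel_measurable borel" for n unfolding B_def by measurable
  have "\<epsilon> n \<noteq> 0" for n using e0[of n] by auto
  \<comment> \<open>Substituting z = eps w turns the approximate identity into the fixed profile
    \<open>b\<close>, so that only the argument of \<open>\<phi>\<close> still depends on
    eps.\<close>
  have BI: "integral\<^sup>L lborel (B n) = integral\<^sup>L lborel (\<lambda>w. \<phi> (of_real (\<epsilon> n) * w) * b w)" for n
  proof -
    have "integral\<^sup>L lborel (B n) = (\<epsilon> n)\<^sup>2 *\<^sub>R integral\<^sup>L lborel (\<lambda>w. B n (of_real (\<epsilon> n) * w))"
      using \<open>\<epsilon> n \<noteq> 0\<close> by (subst integral_mult_complex[of "of_real (\<epsilon> n)"]) auto
    also have "\<dots> = integral\<^sup>L lborel (\<lambda>w. (\<epsilon> n)\<^sup>2 *\<^sub>R B n (of_real (\<epsilon> n) * w))"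
      by simp
    also have "(\<lambda>w. (\<epsilon> n)\<^sup>2 *\<^sub>R B n (of_real (\<epsilon> n) * w)) = (\<lambda>w. \<phi> (of_real (\<epsilon> n) * w) * b w)"
    proof
      fix w :: complex
      define X where "X = 1 + (cmod w)\<^sup>2"
      have X: "X > 0" by (simp add: X_def add_pos_nonneg)
      have "(cmod (of_real (\<epsilon> n) * w))\<^sup>2 + (\<epsilon> n)\<^sup>2 = (\<epsilon> n)\<^sup>2 * X"
        by (simp add: X_def norm_mult power_mult_distrib algebra_simps)
      then have "B n (of_real (\<epsilon> n) * w) = \<phi> (of_real (\<epsilon> n) * w) * (2 * (\<epsilon> n)\<^sup>2 / ((\<epsilon> n)\<^sup>2 * X)\<^sup>2)"
        by (simp only: B_def)
      then show "(\<epsilon> n)\<^sup>2 *\<^sub>R B n (of_real (\<epsilon> n) * w) = \<phi> (of_real (\<epsilon> n) * w) * b w"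
        using \<open>\<epsilon> n \<noteq> 0\<close> X unfolding b_def X_def[symmetric] by (simp add: field_simps power2_eq_square)
    qed
    finally show ?thesis .
  qed
  have L2: "(\<lambda>n. integral\<^sup>L lborel (\<lambda>w. \<phi> (of_real (\<epsilon> n) * w) * b w)) \<longlonglongrightarrow> integral\<^sup>L lborel (\<lambda>w. \<phi> 0 * b w)"
  proof (rule integral_dominated_convergence[of _ _ _ "\<lambda>w. M * b w"])
    show "integrable lborel (\<lambda>w. M * b w)" using ib by simp
    show "AE w in lborel. (\<lambda>n. \<phi> (of_real (\<epsilon> n) * w) * b w) \<longlonglongrightarrow> \<phi> 0 * b w"
    proof (intro AE_I2 tendsto_intros)
      fix w :: complex
      have "isCont \<phi> 0" using cp by (simp add: continuous_on_eq_continuous_at)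
      moreover have "(\<lambda>n. of_real (\<epsilon> n) * w) \<longlonglongrightarrow> 0"
        using tendsto_mult_right[OF tendsto_of_real[OF elim], of w] by simp
      ultimately show "(\<lambda>n. \<phi> (of_real (\<epsilon> n) * w)) \<longlonglongrightarrow> \<phi> 0"
        by (rule isCont_tendsto_compose)
    qed
    show "AE w in lborel. norm (\<phi> (of_real (\<epsilon> n) * w) * b w) \<le> M * b w" for n
      using RM(5) b0 by (auto simp: abs_mult intro!: mult_right_mono)
  qed measurable
  have iB: "integrable lborel (\<lambda>z. of_real (B n z) :: complex)" for n
  proof -
    have "integrable lborel (\<lambda>z. (\<psi>' n z 1 + \<i> * \<psi>' n z \<i>) - dbar \<phi>' z * k n z)"
      using I(1) ik by (intro Bochner_Integration.integrable_diff Bochner_Integration.integrable_add integrable_mult_right) auto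
    then show ?thesis by (simp add: Dpsi B_def)
  qed
  have E: "integral\<^sup>L lborel (\<lambda>z. dbar \<phi>' z * k n z) = - of_real (integral\<^sup>L lborel (B n))" for n
  proof -
    have "0 = integral\<^sup>L lborel (\<lambda>z. \<psi>' n z 1 + \<i> * \<psi>' n z \<i>)"
      using I by (subst Bochner_Integration.integral_add) auto
    also have "\<dots> = integral\<^sup>L lborel (\<lambda>z. dbar \<phi>' z * k n z) + integral\<^sup>L lborel (\<lambda>z. of_real (B n z))"
      unfolding Dpsi B_def[symmetric] using ik iB by (intro Bochner_Integration.integral_add) auto
    finally show ?thesis by (simp add: eq_neg_iff_add_eq_0 add.commute)
  qed
  have "(\<lambda>n. - complex_of_real (integral\<^sup>L lborel (B n))) \<longlonglongrightarrow> - of_real (integral\<^sup>L lborel (\<lambda>w. \<phi> 0 * b w))"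
    unfolding BI by (intro tendsto_intros L2)
  then have "integral\<^sup>L lborel (\<lambda>z. dbar \<phi>' z / z) = - of_real (integral\<^sup>L lborel (\<lambda>w. \<phi> 0 * b w))"
    using L1 unfolding E by (rule LIMSEQ_unique[rotated])
  then show "integral\<^sup>L lborel (\<lambda>z. dbar \<phi>' z / z) = - 2 * pi * \<phi> 0"
    by (simp add: vb mult_ac)
qed

lemma dbar_cauchy_kernel:
  assumes C: "C1c \<phi> \<phi>'"
  shows "integrable lborel (\<lambda>z. dbar \<phi>' z / (z - p))"
    "integral\<^sup>L lborel (\<lambda>z. dbar \<phi>' z / (z - p)) = - 2 * pi * \<phi> p"
proof -
  note T = dbar_cauchy_kernel_0[OF C1c_translate[OF C, of p]]
  have eq: "dbar (\<lambda>z. \<phi>' (p + z)) z = dbar \<phi>' (p + z)" for z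
    by (simp add: dbar_def)
  have "continuous_on UNIV (dbar \<phi>')" by (rule C1c_bounds[OF C])
  then have [measurable]: "dbar \<phi>' \<in> borel_measurable borel"
    by (intro borel_measurable_continuous_onI)
  show "integrable lborel (\<lambda>z. dbar \<phi>' z / (z - p))"
    using integrable_translate[OF T(1), of "-p"] by (simp add: eq)
  have "integral\<^sup>L lborel (\<lambda>z. dbar \<phi>' z / (z - p)) = integral\<^sup>L lborel (\<lambda>z. dbar \<phi>' (p + z) / (p + z - p))"
    by (rule integral_translate[symmetric, of "\<lambda>z. dbar \<phi>' z / (z - p)"]) measurable
  then show "integral\<^sup>L lborel (\<lambda>z. dbar \<phi>' z / (z - p)) = - 2 * pi * \<phi> p"
    using T(2) by (simp add: eq)
qed

text \<open>The integrand is the d-bar derivative of the product of \<open>\<phi>\<close> and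
  \<open>g\<close>, which continues by zero outside \<open>U\<close> because \<open>\<phi>\<close>
  vanishes off the closed set \<open>S\<close> inside \<open>U\<close>. This treats the part of a
  lattice field that is regular on the support of a test function.\<close>

lemma integral_dbar_mult:
  assumes C: "C1c \<phi> \<phi>'" and U: "open U" and S: "closed S" "S \<subseteq> U" "\<And>z. z \<notin> S \<Longrightarrow> \<phi> z = 0"
    and g: "\<And>z. z \<in> U \<Longrightarrow> (g has_derivative g' z) (at z)" "\<And>h. continuous_on U (\<lambda>z. g' z h)"
  shows "integrable lborel (\<lambda>z. dbar \<phi>' z * g z + of_real (\<phi> z) * (g' z 1 + \<i> * g' z \<i>))"
    "integral\<^sup>L lborel (\<lambda>z. dbar \<phi>' z * g z + of_real (\<phi> z) * (g' z 1 + \<i> * g' z \<i>)) = 0"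
proof -
  obtain R where R: "\<And>z. cmod z > R \<Longrightarrow> \<phi> z = 0" and d: "\<And>z. (\<phi> has_derivative \<phi>' z) (at z)"
    and c: "\<And>v. continuous_on UNIV (\<lambda>z. \<phi>' z v)"
    using C by (auto simp: C1c_def)
  define \<psi>' where "\<psi>' z h = of_real (\<phi> z) * g' z h + of_real (\<phi>' z h) * g z" for z h
  have cp: "continuous_on UNIV \<phi>"
    by (meson d continuous_at_imp_continuous_on has_derivative_continuous)
  have d0: "\<phi>' z h = 0" if "z \<notin> S" for z h
  proof -
    have "open (- S)" using S by auto
    then have "(\<phi> has_derivative (\<lambda>_. 0)) (at z)"
      using that S by (intro has_derivative_eq_0[of "- S"]) auto
    then show ?thesis
      using has_derivative_unique[OF d[of z]] by auto
  qed
  have psi: "((\<lambda>z. of_real (\<phi> z) * g z) has_derivative \<psi>' z) (at z)" for z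
  proof (cases "z \<in> U")
    case True
    show ?thesis
      unfolding \<psi>'_def by (intro has_derivative_mult has_derivative_of_real d g True)
  next
    case False
    then have "z \<in> - S" "open (- S)" using S by auto
    then have "((\<lambda>z. of_real (\<phi> z) * g z) has_derivative (\<lambda>_. 0)) (at z)"
      using S by (intro has_derivative_eq_0[of "- S"]) auto
    moreover have "\<psi>' z = (\<lambda>_. 0)"
      using \<open>z \<in> - S\<close> S(3)[of z] d0[of z] by (auto simp: \<psi>'_def fun_eq_iff)
    ultimately show ?thesis by simp
  qed
  have contpsi: "continuous_on UNIV (\<lambda>z. \<psi>' z h)" for h
  proof -
    have "continuous_on U (\<lambda>z. \<psi>' z h)"
      unfolding \<psi>'_def
      by (intro continuous_intros g continuous_on_subset[OF cp] continuous_on_subset[OF c] subset_UNIV)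
         (meson g(1) continuous_at_imp_continuous_on has_derivative_continuous)
    moreover have "continuous_on (- S) (\<lambda>z. \<psi>' z h)"
      by (rule continuous_on_eq[OF continuous_on_const[of _ 0]]) (use S d0 in \<open>auto simp: \<psi>'_def\<close>)
    ultimately have "continuous_on (U \<union> - S) (\<lambda>z. \<psi>' z h)"
      using U S by (intro continuous_on_open_Un) auto
    moreover have "U \<union> - S = UNIV" using S by auto
    ultimately show ?thesis by simp
  qed
  have supp: "of_real (\<phi> z) * g z = 0" if "cmod z > R" for z
    using R[OF that] by simp
  note I = integral_directional_derivative_eq_0[OF psi contpsi supp]
  have E: "dbar \<phi>' z * g z + of_real (\<phi> z) * (g' z 1 + \<i> * g' z \<i>) = \<psi>' z 1 + \<i> * \<psi>' z \<i>" for z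
    by (simp add: \<psi>'_def dbar_def algebra_simps)
  show "integrable lborel (\<lambda>z. dbar \<phi>' z * g z + of_real (\<phi> z) * (g' z 1 + \<i> * g' z \<i>))"
    unfolding E using I(1) by (intro Bochner_Integration.integrable_add integrable_mult_right) auto
  show "integral\<^sup>L lborel (\<lambda>z. dbar \<phi>' z * g z + of_real (\<phi> z) * (g' z 1 + \<i> * g' z \<i>)) = 0"
    unfolding E using I by (subst Bochner_Integration.integral_add) auto
qed

section \<open>A doubly periodic function with simple poles\<close>

definition e2 :: "complex \<Rightarrow> complex" where "e2 z = exp (2 * of_real pi * \<i> * z)"

lemma e2_add: "e2 (z + w) = e2 z * e2 w"
  by (simp add: e2_def exp_add algebra_simps)

lemma e2_minus: "e2 (- z) = inverse (e2 z)"
  by (simp add: e2_def exp_minus)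

lemma e2_nonzero [simp]: "e2 z \<noteq> 0"
  by (simp add: e2_def)

lemma norm_e2: "cmod (e2 z) = exp (- 2 * pi * Im z)"
  by (simp add: e2_def)

lemma e2_0 [simp]: "e2 0 = 1"
  by (simp add: e2_def)

lemma e2_eq_1_iff: "e2 z = 1 \<longleftrightarrow> z \<in> \<int>"
proof -
  have "e2 z = 1 \<longleftrightarrow> (\<exists>n. Re (2 * of_real pi * \<i> * z) = 0 \<and> Im (2 * of_real pi * \<i> * z) = of_int (2 * n) * pi)"
    unfolding e2_def exp_eq_1 by blast
  also have "\<dots> \<longleftrightarrow> (\<exists>n. z = of_int n)"
    by (auto simp: complex_eq_iff)
  finally show ?thesis by (auto elim!: Ints_cases)
qed

lemma e2_of_int [simp]: "e2 (of_int n) = 1"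
  by (simp add: e2_eq_1_iff)

lemma e2_diff_of_int [simp]: "e2 (z - of_int n) = e2 z" "e2 (z + of_int n) = e2 z"
  "e2 (z + 1) = e2 z"
proof -
  show "e2 (z - of_int n) = e2 z"
    using e2_add[of z "- of_int n"] e2_minus[of "of_int n"] by simp
  show "e2 (z + of_int n) = e2 z"
    using e2_add[of z "of_int n"] by simp
  show "e2 (z + 1) = e2 z"
    using e2_add[of z "of_int 1"] e2_of_int[of 1] by simp
qed

lemma has_field_derivative_e2 [derivative_intros]:
  "(e2 has_field_derivative 2 * of_real pi * \<i> * e2 z) (at z within S)"
  unfolding e2_def[abs_def] by (auto intro!: derivative_eq_intros)

lemma holomorphic_e2 [holomorphic_intros]:
  "f holomorphic_on S \<Longrightarrow> (\<lambda>z. e2 (f z)) holomorphic_on S"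
  unfolding e2_def by (intro holomorphic_intros)

lemma continuous_on_e2 [continuous_intros]:
  "continuous_on S f \<Longrightarrow> continuous_on S (\<lambda>z. e2 (f z))"
  unfolding e2_def by (intro continuous_intros)

lemma measurable_e2 [measurable]: "e2 \<in> borel_measurable borel"
  by (intro borel_measurable_continuous_onI continuous_intros)

text \<open>This is pi cot(pi z), written in \<open>e2 z\<close>. At the integers the denominator is
  0, so the value there is 0.\<close>

definition cotp :: "complex \<Rightarrow> complex" where
  "cotp z = of_real pi * \<i> * (e2 z + 1) / (e2 z - 1)"

lemma cotp_shift [simp]: "cotp (z - of_int n) = cotp z"
  by (simp add: cotp_def)

lemma cotp_minus: "cotp (- z) = - cotp z"
proof (cases "e2 z = 1")
  case False
  then have "inverse (e2 z) - 1 \<noteq> 0" "e2 z - 1 \<noteq> 0" by (auto simp: field_simps)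
  then show ?thesis
    by (simp add: cotp_def e2_minus divide_simps) (simp add: algebra_simps)
qed (simp add: cotp_def e2_minus)

text \<open>\<open>cotp z - 1 / z\<close> equals \<open>N z / (z * (e2 z - 1))\<close>, and
  \<open>N\<close> vanishes at 0 together with its derivative. Dividing numerator and denominator by
  z^2 leaves the holomorphic \<open>N2\<close> over the nonvanishing \<open>s\<close>.\<close>

lemma cotp_pole:
  obtains h where "h holomorphic_on ball 0 1" "h 0 = 0"
    "\<And>z. z \<in> ball 0 1 \<Longrightarrow> cotp z = 1 / z + h z"
proof -
  define B where "B = ball (0::complex) 1"
  have oB: "open B" and B0: "0 \<in> B" by (auto simp: B_def)
  have ne: "e2 z \<noteq> 1" if "z \<in> B" "z \<noteq> 0" for z
  proof
    assume "e2 z = 1"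
    then obtain n where "z = of_int n" by (auto simp: e2_eq_1_iff elim: Ints_cases)
    with that show False by (auto simp: B_def)
  qed
  define s where "s z = (if z = 0 then deriv e2 0 else (e2 z - e2 0) / (z - 0))" for z
  have hs: "s holomorphic_on B"
    unfolding s_def by (rule pole_lemma_open[OF _ oB]) (intro holomorphic_intros)
  have s0: "s 0 = 2 * of_real pi * \<i>"
    unfolding s_def using DERIV_imp_deriv[OF has_field_derivative_e2[of 0 UNIV]] by simp
  have sne: "s z \<noteq> 0" if "z \<in> B" for z
    using that ne[of z] s0 by (cases "z = 0") (auto simp: s_def)
  define N where "N z = of_real pi * \<i> * z * (e2 z + 1) - (e2 z - 1)" for z
  have hN: "N holomorphic_on B" unfolding N_def by (intro holomorphic_intros)
  have "(N has_field_derivative 0) (at 0)"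
    unfolding N_def by (auto intro!: derivative_eq_intros)
  then have dN: "deriv N 0 = 0" by (rule DERIV_imp_deriv)
  have N0: "N 0 = 0" by (simp add: N_def)
  define N1 where "N1 z = (if z = 0 then deriv N 0 else (N z - N 0) / (z - 0))" for z
  have hN1: "N1 holomorphic_on B"
    unfolding N1_def by (rule pole_lemma_open[OF hN oB])
  have N10: "N1 0 = 0" by (simp add: N1_def dN)
  define N2 where "N2 z = (if z = 0 then deriv N1 0 else (N1 z - N1 0) / (z - 0))" for z
  have hN2: "N2 holomorphic_on B"
    unfolding N2_def by (rule pole_lemma_open[OF hN1 oB])
  define h where "h z = N2 z / s z" for z
  have hh: "h holomorphic_on B"
    unfolding h_def using sne by (intro holomorphic_intros hN2 hs)
  have eq: "cotp z = 1 / z + h z" if "z \<in> B" "z \<noteq> 0" for z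
  proof -
    have "N2 z = N z / z\<^sup>2" "s z = (e2 z - 1) / z"
      using that by (auto simp: N2_def N1_def N10 N0 s_def power2_eq_square dN)
    moreover have "e2 z - 1 \<noteq> 0" using ne[OF that] by simp
    ultimately have "h z = N z / (z * (e2 z - 1))" "e2 z - 1 \<noteq> 0"
      using that by (simp_all add: h_def power2_eq_square)
    moreover obtain u where u: "e2 z = u + 1" by (metis diff_add_cancel)
    ultimately show ?thesis
      using that unfolding cotp_def N_def u by (simp add: field_simps)
  qed
  \<comment> \<open>Oddness forces \<open>h 0 = 0\<close>. The decomposition then also holds at 0,
    where \<open>cotp 0\<close> and \<open>1 / 0\<close> are both 0, so that no exception has to be
    made at lattice points later on.\<close>
  have odd: "h (- z) = - h z" if "z \<in> B" "z \<noteq> 0" for z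
  proof -
    have "- z \<in> B" "- z \<noteq> 0" using that by (auto simp: B_def)
    then have "h (- z) = cotp (- z) - 1 / (- z)" using eq[of "- z"] by simp
    moreover have "h z = cotp z - 1 / z" using eq[OF that] by simp
    ultimately show ?thesis by (simp add: cotp_minus)
  qed
  have "isCont h 0"
    using hh oB B0 by (meson holomorphic_on_imp_continuous_on continuous_on_eq_continuous_at)
  then have "h \<midarrow>0\<rightarrow> h 0" by (simp add: isCont_def)
  moreover have "(\<lambda>z. h (- z)) \<midarrow>0\<rightarrow> h 0"
  proof -
    have "(\<lambda>z::complex. - z) \<midarrow>0\<rightarrow> 0" by (auto intro!: tendsto_eq_intros)
    then show ?thesis by (rule isCont_tendsto_compose[OF \<open>isCont h 0\<close>])
  qed
  ultimately have "(\<lambda>z. h z + h (- z)) \<midarrow>0\<rightarrow> h 0 + h 0" by (intro tendsto_intros)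
  moreover have "(\<lambda>z. h z + h (- z)) \<midarrow>0\<rightarrow> 0"
  proof (rule tendsto_eventually)
    have "\<forall>\<^sub>F z in at 0. z \<in> B" using oB B0 by (rule eventually_at_in_open')
    moreover have "\<forall>\<^sub>F z in at 0. z \<noteq> (0::complex)" by (simp add: eventually_at_filter)
    ultimately show "\<forall>\<^sub>F z in at 0. h z + h (- z) = 0"
      by eventually_elim (simp add: odd)
  qed
  ultimately have "h 0 + h 0 = 0" by (rule LIM_unique)
  then have h0: "h 0 = 0" by simp
  have "cotp z = 1 / z + h z" if "z \<in> B" for z
    using eq[of z] that h0 by (cases "z = 0") (auto simp: cotp_def)
  then show ?thesis using that hh h0 unfolding B_def by blast
qed

text \<open>With these terms, \<open>base\<close> is the derivative of ln theta_1(pi z) for Jacobi's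
  theta function of nome exp(pi i tau): the cotangent plus a sine series with coefficients q^n / (1
  - q^n), where q is \<open>e2 \<tau>\<close> and n is shifted by one.\<close>

definition strm :: "complex \<Rightarrow> complex \<Rightarrow> nat \<Rightarrow> complex" where
  "strm \<tau> z n = e2 \<tau> ^ Suc n * (e2 z ^ Suc n - inverse (e2 z) ^ Suc n) / (1 - e2 \<tau> ^ Suc n)"

definition base :: "complex \<Rightarrow> complex \<Rightarrow> complex" where
  "base \<tau> z = cotp z - 2 * of_real pi * \<i> * (\<Sum>n. strm \<tau> z n)"

text \<open>\<open>base\<close> has additive period 1 and changes by \<open>- 2\<pi>\<i>\<close> under \<open>z \<mapsto> z + \<tau>\<close>; the non-holomorphic linear term
  restores periodicity and produces the uniform background in the curl. The series only converges in a
  strip, hence the reduction to \<open>0 \<le> Im w < Im \<tau>\<close>.\<close>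

definition fld :: "complex \<Rightarrow> complex \<Rightarrow> complex" where
  "fld \<tau> z = (let w = z - of_int \<lfloor>Im z / Im \<tau>\<rfloor> * \<tau> in base \<tau> w + 2 * of_real pi * \<i> * of_real (Im w / Im \<tau>))"

lemma strm_minus: "strm \<tau> (- z) n = - strm \<tau> z n"
  by (simp add: strm_def e2_minus algebra_simps minus_divide_left del: power_Suc)

lemma base_plus_1 [simp]: "base \<tau> (z + 1) = base \<tau> z"
  by (simp add: base_def cotp_def strm_def)

context
  fixes \<tau> :: complex
  assumes tau: "Im \<tau> > 0"
begin

lemma norm_q: "cmod (e2 \<tau>) < 1"
  using tau by (simp add: norm_e2 mult_pos_pos)

lemma q_power_ne_1 [simp]: "1 - e2 \<tau> ^ Suc n \<noteq> 0" "e2 \<tau> ^ Suc n \<noteq> 1"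
proof -
  have "cmod (e2 \<tau> ^ Suc n) < 1"
    using power_strict_mono[OF norm_q, of "Suc n"] by (simp add: norm_power del: power_Suc)
  then show "e2 \<tau> ^ Suc n \<noteq> 1" by (metis norm_one less_irrefl)
  then show "1 - e2 \<tau> ^ Suc n \<noteq> 0" by simp
qed

lemma norm_one_minus_q: "cmod (1 - e2 \<tau> ^ Suc n) \<ge> 1 - cmod (e2 \<tau>)"
proof -
  have "cmod (e2 \<tau> ^ Suc n) \<le> cmod (e2 \<tau>) ^ 1"
    unfolding norm_power using norm_q by (intro power_decreasing) auto
  then show ?thesis
    using norm_triangle_ineq2[of 1 "e2 \<tau> ^ Suc n"] by simp
qed

lemma norm_geom_over_q:
  assumes "cmod x \<le> r"
  shows "cmod (x ^ Suc n / (1 - e2 \<tau> ^ Suc n)) \<le> r ^ Suc n / (1 - cmod (e2 \<tau>))"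
proof -
  have "cmod (x ^ Suc n) \<le> r ^ Suc n"
    unfolding norm_power using assms by (intro power_mono) auto
  then show ?thesis
    unfolding norm_divide using norm_one_minus_q[of n] norm_q
    by (intro frac_le) (auto intro: order_trans[OF norm_ge_zero])
qed

lemma summable_geom_over_q:
  assumes "cmod x < 1"
  shows "summable (\<lambda>n. x ^ Suc n / (1 - e2 \<tau> ^ Suc n))"
proof (rule summable_comparison_test')
  show "summable (\<lambda>n. cmod x ^ Suc n / (1 - cmod (e2 \<tau>)))"
    using assms by (intro summable_divide summable_mult) (simp_all add: summable_geometric)
qed (use norm_geom_over_q[of x "cmod x"] in auto)

text \<open>Two series of geometric type appear, with ratios \<open>e2 (\<tau> + z)\<close> and
  \<open>e2 (\<tau> - z)\<close>. Both have modulus below 1 exactly when |Im z| < Im tau, which is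
  the strip of convergence.\<close>

lemma strm_alt: "strm \<tau> z n = (e2 (\<tau> + z)) ^ Suc n / (1 - e2 \<tau> ^ Suc n) - (e2 (\<tau> - z)) ^ Suc n / (1 - e2 \<tau> ^ Suc n)"
  using e2_add[of \<tau> z] e2_add[of \<tau> "- z"]
  by (simp add: strm_def e2_minus power_mult_distrib right_diff_distrib diff_divide_distrib del: power_Suc)

lemma norm_e2_strip:
  assumes "\<bar>Im z\<bar> < Im \<tau>"
  shows "cmod (e2 (\<tau> + z)) < 1" "cmod (e2 (\<tau> - z)) < 1"
  using assms by (auto simp: norm_e2 intro!: mult_pos_pos)

lemma summable_strm: "\<bar>Im z\<bar> < Im \<tau> \<Longrightarrow> summable (strm \<tau> z)"
  unfolding strm_alt[abs_def]
  by (intro summable_diff summable_geom_over_q norm_e2_strip)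

lemma base_minus: "\<bar>Im z\<bar> < Im \<tau> \<Longrightarrow> base \<tau> (- z) = - base \<tau> z"
  by (simp add: base_def cotp_minus strm_minus suminf_minus summable_strm)

lemma holomorphic_strm_sum: "(\<lambda>z. \<Sum>n. strm \<tau> z n) holomorphic_on {z. \<bar>Im z\<bar> < Im \<tau>}"
proof -
  define S where "S = {z. \<bar>Im z\<bar> < Im \<tau>}"
  have S: "open S" unfolding S_def
    by (intro open_Collect_less continuous_intros)
  have cmp: "\<exists>d h. 0 < d \<and> summable h \<and> range h \<subseteq> \<real>\<^sub>\<ge>\<^sub>0 \<and> (\<forall>\<^sub>F n in sequentially. \<forall>y\<in>ball x d \<inter> S. cmod (strm \<tau> y n) \<le> cmod (h n))"
    if "x \<in> S" for x
  proof -
    \<comment> \<open>Half the distance from \<open>x\<close> to the boundary of the strip. On the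
      ball of this radius both ratios stay below exp(- 2 pi d) in modulus, which gives a locally
      uniform majorant.\<close>
    define d where "d = (Im \<tau> - \<bar>Im x\<bar>) / 2"
    have d: "d > 0" using that by (auto simp: d_def S_def)
    define r where "r = exp (- 2 * pi * d)"
    have r: "0 < r" "r < 1" using d by (auto simp: r_def)
    define h :: "nat \<Rightarrow> complex" where "h n = of_real (2 * (r ^ Suc n / (1 - cmod (e2 \<tau>))))" for n :: nat
    have "summable (\<lambda>n. 2 * (r ^ Suc n / (1 - cmod (e2 \<tau>))))"
      using r by (intro summable_mult summable_divide) (simp_all add: summable_geometric)
    then have "summable h" unfolding h_def by (rule summable_of_real)
    moreover have h0: "2 * (r ^ Suc n / (1 - cmod (e2 \<tau>))) \<ge> 0" for n
      using r norm_q by simp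
    then have "range h \<subseteq> \<real>\<^sub>\<ge>\<^sub>0" unfolding h_def image_subset_iff by (intro ballI, subst nonneg_Reals_of_real_iff)
    moreover have "cmod (strm \<tau> y n) \<le> cmod (h n)" if "y \<in> ball x d" for y n
    proof -
      have "\<bar>Im y - Im x\<bar> < d"
        using that abs_Im_le_cmod[of "y - x"] by (auto simp: dist_norm norm_minus_commute)
      then have "d \<le> Im \<tau> + Im y" "d \<le> Im \<tau> - Im y"
        unfolding d_def by (auto simp: field_simps abs_if split: if_splits)
      then have "cmod (e2 (\<tau> + y)) \<le> r" "cmod (e2 (\<tau> - y)) \<le> r"
        by (auto simp: norm_e2 r_def)
      then have "cmod (strm \<tau> y n) \<le> r ^ Suc n / (1 - cmod (e2 \<tau>)) + r ^ Suc n / (1 - cmod (e2 \<tau>))"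
        unfolding strm_alt by (intro order_trans[OF norm_triangle_ineq4] add_mono norm_geom_over_q)
      also have "\<dots> = cmod (h n)" unfolding h_def norm_of_real abs_of_nonneg[OF h0[of n]] by simp
      finally show ?thesis .
    qed
    ultimately show ?thesis using d
      by (intro exI[of _ d] exI[of _ h]) auto
  qed
  have fd: "(\<lambda>z. strm \<tau> z n) field_differentiable at x" for n x
  proof -
    have "(\<lambda>z. strm \<tau> z n) holomorphic_on UNIV"
      unfolding strm_def by (intro holomorphic_intros) (auto simp del: power_Suc)
    then show ?thesis by (simp add: holomorphic_on_def)
  qed
  obtain g where g: "\<forall>x\<in>S. strm \<tau> x sums g x \<and> g field_differentiable (at x)"
    by (rule series_differentiable_comparison_complex[OF S fd cmp], assumption, rule that)
  then have "g holomorphic_on S"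
    by (auto simp: holomorphic_on_def intro: field_differentiable_at_within)
  then show ?thesis
    unfolding S_def[symmetric] by (rule holomorphic_transform) (use g in \<open>auto simp: sums_iff\<close>)
qed

text \<open>In the difference of the terms at \<open>z + \<tau>\<close> and at \<open>z\<close> the
  denominator 1 - q^n cancels, and two geometric series remain, in \<open>e2 (z + \<tau>)\<close>
  and in \<open>inverse (e2 z)\<close>. They are precisely the series by which the two cotangents
  deviate from - pi i and pi i, so only these constants survive.\<close>

lemma base_shift:
  assumes "- Im \<tau> < Im z" "Im z < 0"
  shows "base \<tau> (z + \<tau>) = base \<tau> z - 2 * of_real pi * \<i>"
proof -
  define q where "q = e2 \<tau>"
  define x where "x = e2 (z + \<tau>)"
  define y where "y = inverse (e2 z)"
  have x1: "cmod x < 1" using assms by (simp add: x_def norm_e2 mult_neg_pos)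
  have y1: "cmod y < 1" using assms by (simp add: y_def norm_e2 norm_inverse mult_pos_neg flip: exp_minus)
  have x0: "x \<noteq> 0" "y \<noteq> 0" "q \<noteq> 0" by (auto simp: x_def y_def q_def)
  have sx: "(\<lambda>n. x ^ Suc n) sums (x / (1 - x))"
    using sums_mult[OF geometric_sums[OF x1], of x] by (simp add: field_simps)
  have sy: "(\<lambda>n. y ^ Suc n) sums (y / (1 - y))"
    using sums_mult[OF geometric_sums[OF y1], of y] by (simp add: field_simps)
  have s1: "summable (strm \<tau> z)" and s2: "summable (strm \<tau> (z + \<tau>))"
    using assms by (auto intro!: summable_strm)
  have "strm \<tau> (z + \<tau>) n - strm \<tau> z n = - (x ^ Suc n) - y ^ Suc n" for n
  proof -
    define Q where "Q = q ^ Suc n"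
    define X where "X = e2 z ^ Suc n"
    have XY: "x ^ Suc n = Q * X" "y ^ Suc n = inverse X" "e2 (z + \<tau>) ^ Suc n = Q * X"
      "Q \<noteq> 0" "X \<noteq> 0" "1 - Q \<noteq> 0"
      using q_power_ne_1(1)[of n] x0
      by (simp_all add: x_def y_def X_def Q_def q_def e2_add power_mult_distrib power_inverse mult.commute del: power_Suc)
    have a: "strm \<tau> (z + \<tau>) n = Q * (Q * X - inverse (Q * X)) / (1 - Q)"
      unfolding strm_def power_inverse XY(3) by (simp add: Q_def q_def)
    have b: "strm \<tau> z n = Q * (X - inverse X) / (1 - Q)"
      unfolding strm_def power_inverse by (simp add: Q_def q_def X_def)
    have "Q * (Q * X - inverse (Q * X)) - Q * (X - inverse X) = (1 - Q) * (- (Q * X) - inverse X)"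
      using XY(4,5) by (simp add: field_simps)
    then show ?thesis
      unfolding XY(1,2) a b diff_divide_distrib[symmetric] using XY(6) by simp
  qed
  then have "(\<lambda>n. - (x ^ Suc n) - y ^ Suc n) sums ((\<Sum>n. strm \<tau> (z + \<tau>) n) - (\<Sum>n. strm \<tau> z n))"
    using sums_diff[OF summable_sums[OF s2] summable_sums[OF s1]] by simp
  moreover have "(\<lambda>n. - (x ^ Suc n) - y ^ Suc n) sums (- (x / (1 - x)) - y / (1 - y))"
    by (intro sums_diff sums_minus sx sy)
  ultimately have D: "(\<Sum>n. strm \<tau> (z + \<tau>) n) - (\<Sum>n. strm \<tau> z n) = - (x / (1 - x)) - y / (1 - y)"
    by (rule sums_unique2)
  have ne: "1 - x \<noteq> 0" "1 - y \<noteq> 0" "e2 z - 1 \<noteq> 0" using x1 y1 by (auto simp: y_def)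
  have ez: "e2 z = inverse y" by (simp add: y_def)
  have c1: "cotp (z + \<tau>) = - of_real pi * \<i> - 2 * of_real pi * \<i> * (x / (1 - x))"
    using ne unfolding cotp_def x_def[symmetric] by (simp add: divide_simps) (simp add: algebra_simps)
  have c2: "cotp z = of_real pi * \<i> + 2 * of_real pi * \<i> * (y / (1 - y))"
    using ne x0 unfolding cotp_def ez by (simp add: divide_simps) (simp add: algebra_simps)
  have "base \<tau> (z + \<tau>) - base \<tau> z = cotp (z + \<tau>) - cotp z - 2 * of_real pi * \<i> * ((\<Sum>n. strm \<tau> (z + \<tau>) n) - (\<Sum>n. strm \<tau> z n))"
    by (simp add: base_def algebra_simps)
  also have "\<dots> = - 2 * of_real pi * \<i>"
    unfolding D c1 c2 by (simp add: algebra_simps)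
  finally show ?thesis by (simp add: algebra_simps)
qed

text \<open>The meromorphic part of \<open>fld\<close>. It gives up the period tau, but its only
  singularities are poles, which is what local expansions need.\<close>

definition "fldh z = fld \<tau> z - 2 * of_real pi * \<i> * of_real (Im z / Im \<tau>)"

text \<open>The floor in \<open>fld\<close> hides that \<open>fldh\<close> is meromorphic across the
  lines where the floor jumps. Here \<open>z\<close> may be reduced to the larger strip |Im| < Im
  tau, whose translates overlap; on an overlap \<open>base_shift\<close> reconciles the two
  reductions.\<close>

lemma fldh_eq_base:
  assumes "\<bar>Im (z - of_int n * \<tau>)\<bar> < Im \<tau>"
  shows "fldh z = base \<tau> (z - of_int n * \<tau>) - 2 * of_real pi * \<i> * of_int n"
proof -
  define b where "b = Im \<tau>"
  have b: "b > 0" using tau by (simp add: b_def)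
  have I: "Im (z - of_int k * \<tau>) = Im z - of_int k * b" for k by (simp add: b_def)
  have A: "fldh z = base \<tau> (z - of_int \<lfloor>Im z / b\<rfloor> * \<tau>) - 2 * of_real pi * \<i> * of_int \<lfloor>Im z / b\<rfloor>"
    unfolding fldh_def fld_def Let_def I b_def[symmetric] using b
    by (simp add: diff_divide_distrib algebra_simps)
  have "of_int n - 1 < Im z / b" "Im z / b < of_int n + 1"
    using assms b unfolding I b_def[symmetric] by (auto simp: field_simps abs_less_iff)
  then have "\<lfloor>Im z / b\<rfloor> = n \<or> \<lfloor>Im z / b\<rfloor> = n - 1 \<and> Im z / b < of_int n"
    by linarith
  then show ?thesis
  proof
    assume "\<lfloor>Im z / b\<rfloor> = n - 1 \<and> Im z / b < of_int n"
    then have *: "\<lfloor>Im z / b\<rfloor> = n - 1" "Im z < of_int n * b" using b by (auto simp: field_simps)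
    have "base \<tau> (z - of_int n * \<tau> + \<tau>) = base \<tau> (z - of_int n * \<tau>) - 2 * of_real pi * \<i>"
      using * assms by (intro base_shift) (auto simp: b_def)
    then show ?thesis using A * by (simp add: algebra_simps)
  qed (use A in simp)
qed

lemma fld_plus_1: "fld \<tau> (z + 1) = fld \<tau> z"
  by (simp add: fld_def Let_def) (metis add_diff_eq base_plus_1 add.commute diff_add_eq)

lemma fld_plus_tau: "fld \<tau> (z + \<tau>) = fld \<tau> z"
proof -
  have "\<lfloor>Im (z + \<tau>) / Im \<tau>\<rfloor> = \<lfloor>Im z / Im \<tau>\<rfloor> + 1"
    using tau by (simp add: add_divide_distrib)
  then show ?thesis
    by (simp add: fld_def Let_def algebra_simps)
qed

lemma Im_reduced: "0 \<le> Im (z - of_int \<lfloor>Im z / Im \<tau>\<rfloor> * \<tau>)" "Im (z - of_int \<lfloor>Im z / Im \<tau>\<rfloor> * \<tau>) < Im \<tau>"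
proof -
  have "of_int \<lfloor>Im z / Im \<tau>\<rfloor> \<le> Im z / Im \<tau>" "Im z / Im \<tau> < of_int \<lfloor>Im z / Im \<tau>\<rfloor> + 1"
    by linarith+
  then show "0 \<le> Im (z - of_int \<lfloor>Im z / Im \<tau>\<rfloor> * \<tau>)" "Im (z - of_int \<lfloor>Im z / Im \<tau>\<rfloor> * \<tau>) < Im \<tau>"
    using tau mult_right_mono[OF of_int_floor_le[of "Im z / Im \<tau>"], of "Im \<tau>"]
    by (auto simp: pos_divide_less_eq algebra_simps)
qed

lemma fldh_minus: "fldh (- z) = - fldh z"
proof -
  define n where "n = \<lfloor>Im z / Im \<tau>\<rfloor>"
  have "0 \<le> Im (z - of_int n * \<tau>)" "Im (z - of_int n * \<tau>) < Im \<tau>"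
    unfolding n_def by (rule Im_reduced)+
  then have *: "\<bar>Im (z - of_int n * \<tau>)\<bar> < Im \<tau>" "\<bar>Im (- z - of_int (- n) * \<tau>)\<bar> < Im \<tau>"
    by auto
  have "base \<tau> (- z - of_int (- n) * \<tau>) = - base \<tau> (z - of_int n * \<tau>)"
    using base_minus[OF *(1)] by (simp add: algebra_simps)
  then show ?thesis
    unfolding fldh_eq_base[OF *(1)] fldh_eq_base[OF *(2)] by simp
qed

text \<open>Oddness is what gives the field mean zero over every period cell, and what reduces the
  energy integral to the upper half of a cell.\<close>

lemma fld_minus: "fld \<tau> (- z) = - fld \<tau> z"
proof -
  have "fld \<tau> z + fld \<tau> (- z) = 0"
    using fldh_minus[of z] by (simp add: fldh_def algebra_simps)
  then show ?thesis by (simp add: eq_neg_iff_add_eq_0 add.commute)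
qed

lemma fld_strip: "\<bar>Im z\<bar> < Im \<tau> \<Longrightarrow> fld \<tau> z = base \<tau> z + 2 * of_real pi * \<i> * of_real (Im z / Im \<tau>)"
  using fldh_eq_base[of z 0] by (simp add: fldh_def diff_eq_eq)

end

section \<open>Poles and Fourier series of the doubly periodic function\<close>

definition latt :: "complex \<Rightarrow> complex \<Rightarrow> complex set" where
  "latt w1 w2 = {of_int m * w1 + of_int n * w2 | m n. True}"

text \<open>After a multiple of tau is subtracted, the point lies in the strip, where the series is
  holomorphic and only the cotangent can be singular, namely at integers. The equation includes
  \<open>z = p\<close>, with \<open>1 / 0 = 0\<close>.\<close>

lemma fldh_local:
  assumes tau: "Im \<tau> > 0"
  obtains e g where "e > 0" "g holomorphic_on ball p e"
    "\<And>z. z \<in> ball p e \<Longrightarrow> fldh \<tau> z = (if p \<in> latt 1 \<tau> then 1 / (z - p) else 0) + g z"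
proof -
  define n where "n = \<lfloor>Im p / Im \<tau>\<rfloor>"
  define p0 where "p0 = p - of_int n * \<tau>"
  have p0: "0 \<le> Im p0" "Im p0 < Im \<tau>"
    unfolding p0_def n_def using Im_reduced[OF tau] by auto
  have lat: "p \<in> latt 1 \<tau> \<longleftrightarrow> p0 \<in> \<int>"
  proof
    assume "p \<in> latt 1 \<tau>"
    then obtain k l where kl: "p = of_int k + of_int l * \<tau>" by (auto simp: latt_def)
    then have "n = l" using tau by (simp add: n_def)
    then show "p0 \<in> \<int>" using kl by (simp add: p0_def)
  next
    assume "p0 \<in> \<int>"
    then obtain k where "p0 = of_int k" by (auto elim: Ints_cases)
    then have "p = of_int k * 1 + of_int n * \<tau>" by (simp add: p0_def algebra_simps)
    then show "p \<in> latt 1 \<tau>" unfolding latt_def by blast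
  qed
  define e0 where "e0 = Im \<tau> - Im p0"
  have e0: "e0 > 0" using p0 by (simp add: e0_def)
  have strip: "\<bar>Im (z - of_int n * \<tau>)\<bar> < Im \<tau>" if "z \<in> ball p (min e0 (Im \<tau>))" for z
  proof -
    have "\<bar>Im z - Im p\<bar> < min e0 (Im \<tau>)"
      using that abs_Im_le_cmod[of "z - p"] by (auto simp: dist_norm norm_minus_commute)
    then show ?thesis using p0 unfolding e0_def p0_def by auto
  qed
  have hs: "(\<lambda>z. \<Sum>k. strm \<tau> (z - of_int n * \<tau>) k) holomorphic_on ball p (min e0 (Im \<tau>))"
    by (rule holomorphic_on_compose_gen[OF _ holomorphic_strm_sum[OF tau], unfolded o_def])
       (use strip in \<open>auto intro!: holomorphic_intros\<close>)
  have eq: "fldh \<tau> z = cotp (z - of_int n * \<tau>) - 2 * of_real pi * \<i> * (\<Sum>k. strm \<tau> (z - of_int n * \<tau>) k)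
       - 2 * of_real pi * \<i> * of_int n" if "z \<in> ball p (min e0 (Im \<tau>))" for z
    using fldh_eq_base[OF tau strip[OF that]] by (simp add: base_def)
  show ?thesis
  proof (cases "p0 \<in> \<int>")
    case True
    then obtain k where k: "p0 = of_int k" by (auto elim: Ints_cases)
    obtain h where h: "h holomorphic_on ball 0 1" "\<And>z. z \<in> ball 0 1 \<Longrightarrow> cotp z = 1 / z + h z"
      using cotp_pole by metis
    define e where "e = min 1 (min e0 (Im \<tau>))"
    have e: "e > 0" "ball p e \<subseteq> ball p (min e0 (Im \<tau>))" using e0 tau by (auto simp: e_def)
    define g where "g z = h (z - p) - 2 * of_real pi * \<i> * (\<Sum>k. strm \<tau> (z - of_int n * \<tau>) k)
       - 2 * of_real pi * \<i> * of_int n" for z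
    have "(\<lambda>z. h (z - p)) holomorphic_on ball p e"
      by (rule holomorphic_on_compose_gen[OF _ h(1), unfolded o_def])
         (auto intro!: holomorphic_intros simp: e_def dist_norm norm_minus_commute)
    then have "g holomorphic_on ball p e"
      unfolding g_def by (intro holomorphic_intros holomorphic_on_subset[OF hs e(2)])
    moreover have "fldh \<tau> z = 1 / (z - p) + g z" if "z \<in> ball p e" for z
    proof -
      have "cotp (z - of_int n * \<tau>) = cotp (z - of_int n * \<tau> - of_int k)"
        by (simp only: cotp_shift)
      also have "z - of_int n * \<tau> - of_int k = z - p"
        using k by (simp add: p0_def algebra_simps)
      also have "cotp (z - p) = 1 / (z - p) + h (z - p)"
        using that by (intro h) (auto simp: e_def dist_norm norm_minus_commute)
      finally show ?thesis using eq[of z] that e(2) by (auto simp: g_def)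
    qed
    ultimately show ?thesis using that[of e g] e lat True by auto
  next
    case False
    then have "e2 (p - of_int n * \<tau>) \<noteq> 1" by (simp add: e2_eq_1_iff p0_def)
    moreover have "isCont (\<lambda>z. e2 (z - of_int n * \<tau>)) p"
      by (auto intro!: continuous_on_interior[of UNIV] continuous_intros)
    ultimately have "\<forall>\<^sub>F z in at p. e2 (z - of_int n * \<tau>) \<noteq> 1"
      unfolding isCont_def by (rule tendsto_imp_eventually_ne[rotated])
    then obtain d where d: "d > 0" "\<And>z. z \<noteq> p \<Longrightarrow> dist z p < d \<Longrightarrow> e2 (z - of_int n * \<tau>) \<noteq> 1"
      by (auto simp: eventually_at)
    define e where "e = min d (min e0 (Im \<tau>))"
    have e: "e > 0" "ball p e \<subseteq> ball p (min e0 (Im \<tau>))" using e0 tau d by (auto simp: e_def)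
    have ne: "e2 (z - of_int n * \<tau>) - 1 \<noteq> 0" if "z \<in> ball p e" for z
      using that d(2)[of z] \<open>e2 (p - of_int n * \<tau>) \<noteq> 1\<close>
      by (cases "z = p") (auto simp: e_def dist_commute)
    define g where "g z = cotp (z - of_int n * \<tau>) - 2 * of_real pi * \<i> * (\<Sum>k. strm \<tau> (z - of_int n * \<tau>) k)
       - 2 * of_real pi * \<i> * of_int n" for z
    have "g holomorphic_on ball p e"
      unfolding g_def cotp_def
      by (intro holomorphic_intros holomorphic_on_subset[OF hs e(2)] ne)
    then show ?thesis using that[of e g] e lat False eq unfolding g_def by (auto simp: subset_iff)
  qed
qed

text \<open>For Im z > 0 the cotangent also expands in powers of \<open>e2 z\<close> and merges with
  the series into a single Fourier series in Re z, whose zero mode is linear in Im z. Parseval's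
  identity is applied to this form.\<close>

lemma fldh_Fourier:
  assumes tau: "Im \<tau> > 0" and z: "0 < Im z" "Im z < Im \<tau>"
  shows "(\<lambda>n. (e2 z ^ Suc n - e2 (\<tau> - z) ^ Suc n) / (1 - e2 \<tau> ^ Suc n)) sums
     ((fld \<tau> z + of_real pi * \<i> * of_real (1 - 2 * Im z / Im \<tau>)) / (- 2 * of_real pi * \<i>))"
proof -
  define x where "x = e2 z"
  have x1: "cmod x < 1" using z by (simp add: x_def norm_e2)
  have sx: "(\<lambda>n. x ^ Suc n) sums (x / (1 - x))"
    using sums_mult[OF geometric_sums[OF x1], of x] by (simp add: field_simps)
  have ne: "1 - x \<noteq> 0" "x - 1 \<noteq> 0" using x1 by auto
  have st: "strm \<tau> z sums (\<Sum>n. strm \<tau> z n)"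
    using z by (intro summable_sums summable_strm tau) auto
  have "(\<lambda>n. x ^ Suc n + strm \<tau> z n) sums (x / (1 - x) + (\<Sum>n. strm \<tau> z n))"
    by (intro sums_add sx st)
  moreover have "x ^ Suc n + strm \<tau> z n = (e2 z ^ Suc n - e2 (\<tau> - z) ^ Suc n) / (1 - e2 \<tau> ^ Suc n)" for n
  proof -
    define P Q R where "P = e2 z ^ Suc n" and "Q = e2 \<tau> ^ Suc n" and "R = e2 (\<tau> - z) ^ Suc n"
    have "R = Q * inverse P" "1 - Q \<noteq> 0"
      using e2_add[of \<tau> "- z"] q_power_ne_1[OF tau, of n]
      by (simp_all add: P_def Q_def R_def e2_minus power_mult_distrib power_inverse del: power_Suc)
    moreover have "strm \<tau> z n = Q * (P - inverse P) / (1 - Q)"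
      unfolding strm_def power_inverse by (simp add: P_def Q_def)
    moreover have "x ^ Suc n = P" by (simp add: x_def P_def)
    ultimately show ?thesis
      unfolding P_def[symmetric] Q_def[symmetric] R_def[symmetric] by (simp add: field_simps)
  qed
  moreover have "x / (1 - x) + (\<Sum>n. strm \<tau> z n) = (fld \<tau> z + of_real pi * \<i> * of_real (1 - 2 * Im z / Im \<tau>)) / (- 2 * of_real pi * \<i>)"
  proof -
    have c: "cotp z = - of_real pi * \<i> - 2 * of_real pi * \<i> * (x / (1 - x))"
      using ne unfolding cotp_def x_def[symmetric] by (simp add: divide_simps) (simp add: algebra_simps)
    have "fld \<tau> z = base \<tau> z + 2 * of_real pi * \<i> * of_real (Im z / Im \<tau>)"
      using z by (intro fld_strip[OF tau]) auto
    then have "fld \<tau> z + of_real pi * \<i> * of_real (1 - 2 * Im z / Im \<tau>)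
        = (- 2 * of_real pi * \<i>) * (x / (1 - x) + (\<Sum>n. strm \<tau> z n))"
      unfolding base_def c by (simp add: algebra_simps)
    then show ?thesis by simp
  qed
  ultimately show ?thesis by simp
qed

lemma measurable_fld [measurable]: "fld \<tau> \<in> borel_measurable borel"
proof -
  have [measurable]: "base \<tau> \<in> borel_measurable borel"
    unfolding base_def[abs_def] cotp_def strm_def by measurable
  show ?thesis unfolding fld_def[abs_def] Let_def by measurable
qed

section \<open>The field of a lattice\<close>

locale lat =
  fixes w1 w2 :: complex
  assumes orient: "Im (w2 / w1) > 0"
begin

definition "tau = w2 / w1"
definition "area = (cmod w1)\<^sup>2 * Im tau"
definition "L = latt w1 w2"
text \<open>Composition with z / w1 alone would multiply the residues by \<open>w1\<close>; the
  outer division keeps them equal to 1.\<close>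

definition "jC z = fld tau (z / w1) / w1"

lemma w1_nz [simp]: "w1 \<noteq> 0"
  using orient by auto

lemma Im_tau: "Im tau > 0"
  using orient by (simp add: tau_def)

lemma area_pos: "area > 0"
  using Im_tau by (simp add: area_def)

lemma tau_w1: "tau * w1 = w2"
  by (simp add: tau_def)

lemma L_D: "p \<in> L \<Longrightarrow> \<exists>m n. p = of_int m * w1 + of_int n * w2"
  unfolding L_def latt_def by blast

lemma L_I: "of_int m * w1 + of_int n * w2 \<in> L"
  unfolding L_def latt_def by blast

lemma L_iff: "p \<in> L \<longleftrightarrow> p / w1 \<in> latt 1 tau"
proof
  assume "p \<in> L"
  then obtain m n where "p = of_int m * w1 + of_int n * w2"
    using L_D by meson
  then have "p = (of_int m * 1 + of_int n * tau) * w1"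
    by (simp add: distrib_right mult.assoc tau_w1)
  then have "p / w1 = of_int m * 1 + of_int n * tau" by simp
  then show "p / w1 \<in> latt 1 tau" unfolding latt_def by blast
next
  assume "p / w1 \<in> latt 1 tau"
  then obtain m n where "p / w1 = of_int m * 1 + of_int n * tau" by (auto simp: latt_def)
  then have "p / w1 * w1 = (of_int m * 1 + of_int n * tau) * w1" by simp
  then have "p = of_int m * w1 + of_int n * w2" by (simp add: distrib_right mult.assoc tau_w1)
  then show "p \<in> L" unfolding L_def latt_def by blast
qed

lemma L_0 [simp]: "0 \<in> L"
proof -
  have "0 = of_int 0 * w1 + of_int 0 * w2" by simp
  then show ?thesis unfolding L_def latt_def by blast
qed

lemma L_minus: "p \<in> L \<Longrightarrow> - p \<in> L"
proof -
  assume "p \<in> L"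
  then obtain m n where "p = of_int m * w1 + of_int n * w2"
    using L_D by meson
  then have "- p = of_int (- m) * w1 + of_int (- n) * w2" by simp
  then show ?thesis unfolding L_def latt_def by blast
qed

lemma L_add: "p \<in> L \<Longrightarrow> q \<in> L \<Longrightarrow> p + q \<in> L"
proof -
  assume "p \<in> L" "q \<in> L"
  then obtain m n m' n' where "p = of_int m * w1 + of_int n * w2" "q = of_int m' * w1 + of_int n' * w2"
    using L_D by meson
  then have "p + q = of_int (m + m') * w1 + of_int (n + n') * w2" by (simp add: algebra_simps)
  then show ?thesis unfolding L_def latt_def by blast
qed

lemma L_diff: "p \<in> L \<Longrightarrow> q \<in> L \<Longrightarrow> p - q \<in> L"
  using L_add[of p "- q"] L_minus[of q] by simp

lemma finite_L_cball: "finite (L \<inter> cball 0 R)"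
proof -
  define b where "b = Im tau"
  have b: "b > 0" using Im_tau by (simp add: b_def)
  define R' where "R' = R / cmod w1"
  define N where "N = \<lceil>R' / b\<rceil>"
  define M where "M = \<lceil>R' + of_int N * cmod tau\<rceil>"
  have "L \<inter> cball 0 R \<subseteq> (\<lambda>(m, n). of_int m * w1 + of_int n * w2) ` ({-M..M} \<times> {-N..N})"
  proof
    fix p assume p: "p \<in> L \<inter> cball 0 R"
    then obtain m n where mn: "p = of_int m * w1 + of_int n * w2"
      using L_D[of p] by auto
    define z where "z = of_int m + of_int n * tau"
    have "p = z * w1" using mn by (simp add: z_def distrib_right mult.assoc tau_w1)
    then have z: "cmod z \<le> R'" using p by (simp add: R'_def norm_mult field_simps)
    have "\<bar>of_int n\<bar> * b \<le> R'"
      using abs_Im_le_cmod[of z] z b by (simp add: z_def b_def abs_mult)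
    then have "\<bar>of_int n\<bar> \<le> R' / b" using b by (simp add: field_simps)
    then have n: "\<bar>n\<bar> \<le> N" unfolding N_def by linarith
    have "cmod (of_int m) \<le> cmod z + cmod (of_int n * tau)"
      using norm_triangle_ineq4[of z "of_int n * tau"] by (simp add: z_def)
    also have "\<dots> \<le> R' + of_int N * cmod tau"
      using z n by (auto simp: norm_mult intro!: add_mono mult_right_mono)
    finally have "\<bar>m\<bar> \<le> M" unfolding M_def by simp linarith
    with n show "p \<in> (\<lambda>(m, n). of_int m * w1 + of_int n * w2) ` ({-M..M} \<times> {-N..N})"
      by (intro image_eqI[of _ _ "(m, n)"]) (auto simp: mn)
  qed
  then show ?thesis by (rule finite_subset) auto
qed

lemma finite_L_ball: "finite (L \<inter> ball 0 R)"
  by (rule finite_subset[OF _ finite_L_cball[of R]]) auto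

lemma fld_int_shift: "fld tau (z + of_int m) = fld tau z"
proof -
  have N: "fld tau (z + of_nat k) = fld tau z" for k z
    by (induction k arbitrary: z) (auto simp: fld_plus_1[OF Im_tau] simp flip: add.assoc)
  show ?thesis
  proof (cases "m \<ge> 0")
    case True then show ?thesis using N[of z "nat m"] by simp
  next
    case False then show ?thesis using N[of "z + of_int m" "nat (- m)"] by simp
  qed
qed

lemma fld_tau_shift: "fld tau (z + of_int m * tau) = fld tau z"
proof -
  have N: "fld tau (z + of_nat k * tau) = fld tau z" for k z
    by (induction k arbitrary: z)
       (auto simp: fld_plus_tau[OF Im_tau] algebra_simps simp flip: add.assoc)
  show ?thesis
  proof (cases "m \<ge> 0")
    case True then show ?thesis using N[of z "nat m"] by simp
  next
    case False then show ?thesis using N[of "z + of_int m * tau" "nat (- m)"] by simp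
  qed
qed

lemma jC_periodic: "p \<in> L \<Longrightarrow> jC (z + p) = jC z"
proof -
  assume "p \<in> L"
  then obtain m n where "p = of_int m * w1 + of_int n * w2"
    using L_D by meson
  then have "z + p = (z / w1 + of_int m + of_int n * tau) * w1"
    by (simp add: distrib_right mult.assoc tau_w1)
  then have "(z + p) / w1 = (z / w1 + of_int m) + of_int n * tau" by simp
  then show ?thesis by (simp add: jC_def fld_tau_shift fld_int_shift)
qed

lemma jC_minus: "jC (- z) = - jC z"
  using fld_minus[OF Im_tau, of "z / w1"] by (simp add: jC_def)

lemma measurable_jC [measurable]: "jC \<in> borel_measurable borel"
  unfolding jC_def[abs_def] by measurable

text \<open>The real-linear summand of \<open>jC\<close>. The rest is meromorphic, so the uniform
  background of the curl stems from this term alone (\<open>lin_dbar\<close>).\<close>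

definition "lin z = 2 * of_real pi * \<i> * of_real (Im (z / w1) / Im tau) / w1"

lemma jC_local:
  obtains e g where "e > 0" "g holomorphic_on ball p e"
    "\<And>z. z \<in> ball p e \<Longrightarrow> jC z = (if p \<in> L then 1 / (z - p) else 0) + g z + lin z"
proof -
  obtain e g where eg: "e > 0" "g holomorphic_on ball (p / w1) e"
    "\<And>z. z \<in> ball (p / w1) e \<Longrightarrow> fldh tau z = (if p / w1 \<in> latt 1 tau then 1 / (z - p / w1) else 0) + g z"
    using fldh_local[OF Im_tau, of "p / w1"] by metis
  define e' where "e' = e * cmod w1"
  have sub: "z / w1 \<in> ball (p / w1) e" if "z \<in> ball p e'" for z
  proof -
    have "dist (p / w1) (z / w1) = dist p z / cmod w1"
      by (simp add: dist_norm norm_divide flip: diff_divide_distrib)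
    then show ?thesis using that unfolding mem_ball e'_def by (simp add: pos_divide_less_eq)
  qed
  have "(\<lambda>z. g (z / w1)) holomorphic_on ball p e'"
    by (rule holomorphic_on_compose_gen[OF _ eg(2), unfolded o_def])
       (use sub in \<open>auto intro!: holomorphic_intros\<close>)
  then have h: "(\<lambda>z. g (z / w1) / w1) holomorphic_on ball p e'"
    by (intro holomorphic_intros) auto
  have e': "e' > 0" using eg(1) by (simp add: e'_def)
  have "jC z = (if p \<in> L then 1 / (z - p) else 0) + g (z / w1) / w1 + lin z" if "z \<in> ball p e'" for z
  proof -
    have "fld tau (z / w1) = fldh tau (z / w1) + 2 * of_real pi * \<i> * of_real (Im (z / w1) / Im tau)"
      by (simp add: fldh_def[OF Im_tau])
    moreover have "1 / (z / w1 - p / w1) / w1 = 1 / (z - p)"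
      by (simp flip: diff_divide_distrib)
    ultimately show ?thesis
      using eg(3)[OF sub[OF that]] by (simp add: jC_def lin_def L_iff add_divide_distrib)
  qed
  then show ?thesis by (rule that[OF e' h])
qed

text \<open>\<open>G\<close> is defined by subtraction, so the equation holds everywhere. It is
  holomorphic across the poles because the local expansions of \<open>jC_local\<close> hold at the
  poles themselves, with \<open>1 / 0 = 0\<close> on both sides.\<close>

lemma jC_decomp:
  obtains G where "G holomorphic_on ball 0 R"
    "\<And>z. jC z = G z + (\<Sum>p\<in>L \<inter> cball 0 R. 1 / (z - p)) + lin z"
proof -
  define F where "F = L \<inter> cball 0 R"
  have fin: "finite F" unfolding F_def by (rule finite_L_cball)
  define G where "G z = jC z - (\<Sum>p\<in>F. 1 / (z - p)) - lin z" for z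
  have "G field_differentiable (at p)" if p: "p \<in> ball 0 R" for p
  proof -
    obtain e g where eg: "e > 0" "g holomorphic_on ball p e"
      "\<And>z. z \<in> ball p e \<Longrightarrow> jC z = (if p \<in> L then 1 / (z - p) else 0) + g z + lin z"
      using jC_local[of p] by metis
    have "(\<lambda>z. g z - (\<Sum>q\<in>F - {p}. 1 / (z - q))) field_differentiable (at p)"
      using eg(1,2) by (intro field_differentiable_diff field_differentiable_sum field_differentiable_divide)
        (auto intro!: derivative_intros simp: holomorphic_on_imp_differentiable_at)
    moreover have "G z = g z - (\<Sum>q\<in>F - {p}. 1 / (z - q))" if "z \<in> ball p e" for z
    proof (cases "p \<in> F")
      case True
      then have "(\<Sum>q\<in>F. 1 / (z - q)) = 1 / (z - p) + (\<Sum>q\<in>F - {p}. 1 / (z - q))"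
        using fin by (simp add: sum.remove)
      then show ?thesis using eg(3)[OF that] True by (simp add: G_def F_def)
    next
      case False
      then have "p \<notin> L" using p by (auto simp: F_def)
      then show ?thesis using eg(3)[OF that] False by (simp add: G_def)
    qed
    moreover obtain D where "((\<lambda>z. g z - (\<Sum>q\<in>F - {p}. 1 / (z - q))) has_field_derivative D) (at p)"
      using calculation(1) by (auto simp: field_differentiable_def)
    ultimately have "(G has_field_derivative D) (at p)"
      using eg(1) by (intro has_field_derivative_transform_within_open[of _ D p "ball p e" G]) auto
    then show ?thesis by (auto simp: field_differentiable_def)
  qed
  then have "G holomorphic_on ball 0 R"
    unfolding holomorphic_on_def by (blast intro: field_differentiable_at_within)
  then show ?thesis
    by (rule that) (simp add: G_def F_def)
qed

lemma lin_deriv: "(lin has_derivative (\<lambda>h. lin h)) (at z)"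
  and lin_dbar: "lin 1 + \<i> * lin \<i> = - of_real (2 * pi / area)"
  and continuous_on_lin [continuous_intros]: "continuous_on S f \<Longrightarrow> continuous_on S (\<lambda>z. lin (f z))"
proof -
  have "bounded_linear lin"
    unfolding lin_def[abs_def]
    by (intro bounded_linear_const_mult bounded_linear_divide bounded_linear_compose[OF bounded_linear_divide]
          bounded_linear_compose[OF bounded_linear_of_real]
          bounded_linear_compose[OF bounded_linear_divide] bounded_linear_compose[OF bounded_linear_Im] bounded_linear_ident
          bounded_linear_compose[OF bounded_linear_mult_right])
  then show "(lin has_derivative (\<lambda>h. lin h)) (at z)"
    by (rule bounded_linear_imp_has_derivative)
  from \<open>bounded_linear lin\<close> show "continuous_on S f \<Longrightarrow> continuous_on S (\<lambda>z. lin (f z))"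
    by (rule bounded_linear.continuous_on)
  have "complex_of_real (Im v) + \<i> * of_real (Im (\<i> * v)) = \<i> * cnj v" for v
    by (simp add: complex_eq_iff)
  from this[of "1 / w1"]
  have "complex_of_real (Im (1 / w1)) + \<i> * of_real (Im (\<i> / w1)) = \<i> * cnj (1 / w1)"
    by simp
  moreover have "lin 1 + \<i> * lin \<i> = 2 * of_real pi * \<i> / (of_real (Im tau) * w1) * (complex_of_real (Im (1 / w1)) + \<i> * of_real (Im (\<i> / w1)))"
    using Im_tau by (simp add: lin_def field_simps)
  moreover have "2 * of_real pi * \<i> / (of_real (Im tau) * w1) * (\<i> * cnj (1 / w1)) = - of_real (2 * pi) / (of_real (Im tau) * (w1 * cnj w1))"
    by (simp add: field_simps)
  ultimately show "lin 1 + \<i> * lin \<i> = - of_real (2 * pi / area)"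
    by (simp add: area_def mult.commute flip: complex_norm_square)
qed

lemma integrable_inverse_dist: "set_integrable lborel (cball 0 R) (\<lambda>z::complex. 1 / cmod (z - p))"
proof -
  have "integrable lborel (\<lambda>z. indicator (cball 0 (R + cmod p)) (- p + z) *\<^sub>R (1 / cmod (- p + z)))"
    using integrable_translate[OF integrable_inverse_cmod[of "R + cmod p", unfolded set_integrable_def], of "- p"] by simp
  then show ?thesis
    unfolding set_integrable_def
  proof (rule Bochner_Integration.integrable_bound)
    show "AE z in lborel. norm (indicator (cball 0 R) z *\<^sub>R (1 / cmod (z - p)))
       \<le> norm (indicator (cball 0 (R + cmod p)) (- p + z) *\<^sub>R (1 / cmod (- p + z)))"
    proof (rule AE_I2)
      fix z
      have "cmod z \<le> R \<Longrightarrow> cmod (z - p) \<le> R + cmod p"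
        using norm_triangle_ineq4[of z p] by linarith
      then show "norm (indicator (cball 0 R) z *\<^sub>R (1 / cmod (z - p)))
       \<le> norm (indicator (cball 0 (R + cmod p)) (- p + z) *\<^sub>R (1 / cmod (- p + z)))"
        by (auto simp: indicator_def)
    qed
  qed (intro borel_measurable_scaleR borel_measurable_indicator borel_measurable_divide borel_measurable_norm, auto)
qed

lemma set_integrable_jC: "set_integrable lborel (cball 0 R) jC"
proof -
  define F where "F = L \<inter> cball 0 (R + 1)"
  obtain G where G: "G holomorphic_on ball 0 (R + 1)"
    "\<And>z. jC z = G z + (\<Sum>p\<in>F. 1 / (z - p)) + lin z"
    using jC_decomp[of "R + 1"] unfolding F_def by metis
  have "set_integrable lborel (cball 0 R) (\<lambda>z. G z + lin z)"
    unfolding set_integrable_def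
    by (intro borel_integrable_compact continuous_intros holomorphic_on_imp_continuous_on
        holomorphic_on_subset[OF G(1)]) auto
  moreover have "set_integrable lborel (cball 0 R) (\<lambda>z. \<Sum>p\<in>F. 1 / (z - p))"
  proof (unfold set_integrable_def scaleR_sum_right, intro Bochner_Integration.integrable_sum)
    fix p :: complex
    show "integrable lborel (\<lambda>z. indicator (cball 0 R) z *\<^sub>R (1 / (z - p)))"
      by (rule Bochner_Integration.integrable_bound[OF integrable_inverse_dist[of R p, unfolded set_integrable_def]])
         (auto simp: norm_divide indicator_def intro!: borel_measurable_scaleR borel_measurable_indicator borel_measurable_divide)
  qed
  ultimately have "set_integrable lborel (cball 0 R) (\<lambda>z. (G z + lin z) + (\<Sum>p\<in>F. 1 / (z - p)))"
    by (rule set_integral_add)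
  moreover have "(\<lambda>z. (G z + lin z) + (\<Sum>p\<in>F. 1 / (z - p))) = jC"
    using G(2) by (auto simp: fun_eq_iff)
  ultimately show ?thesis by simp
qed

text \<open>Near the support of \<open>\<phi>\<close>, \<open>jC\<close> is a finite sum of Cauchy
  kernels plus a regular function. Each kernel contributes a point mass by
  \<open>dbar_cauchy_kernel\<close>; the regular function contributes, through its linear part, the
  uniform background by \<open>integral_dbar_mult\<close>.\<close>

lemma dbar_jC:
  assumes C: "C1c \<phi> \<phi>'" and F: "finite F" "F \<subseteq> L" "\<And>p. p \<in> L - F \<Longrightarrow> \<phi> p = 0"
  shows "integral\<^sup>L lborel (\<lambda>z. dbar \<phi>' z * jC z)
     = - of_real (2 * pi * (\<Sum>p\<in>F. \<phi> p) - 2 * pi / area * integral\<^sup>L lborel \<phi>)"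
proof -
  obtain R M where RM: "R > 0" "M \<ge> 0" "\<And>z. cmod z > R \<Longrightarrow> \<phi> z = 0" "\<And>z. cmod z > R \<Longrightarrow> dbar \<phi>' z = 0"
    "\<And>z. \<bar>\<phi> z\<bar> \<le> M" "\<And>z. cmod (dbar \<phi>' z) \<le> M"
    and cp: "continuous_on UNIV \<phi>" and cd: "continuous_on UNIV (dbar \<phi>')"
    by (rule C1c_bounds[OF C], rule that)
  define U where "U = ball (0::complex) (R + 1)"
  define E where "E = L \<inter> cball 0 (R + 1)"
  have fE: "finite E" unfolding E_def by (rule finite_L_cball)
  obtain G where G: "G holomorphic_on U" "\<And>z. jC z = G z + (\<Sum>p\<in>E. 1 / (z - p)) + lin z"
    using jC_decomp[of "R + 1"] unfolding E_def U_def by metis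
  have oU: "open U" by (simp add: U_def)
  define g where "g z = G z + lin z" for z
  define g' where "g' z h = deriv G z * h + lin h" for z h
  have gd: "(g has_derivative g' z) (at z)" if "z \<in> U" for z
    unfolding g_def g'_def
    using holomorphic_derivI[OF G(1) oU that] lin_deriv
    by (intro has_derivative_add) (auto simp: has_field_derivative_def)
  have gc: "continuous_on U (\<lambda>z. g' z h)" for h
    unfolding g'_def
    by (intro continuous_intros holomorphic_on_imp_continuous_on holomorphic_deriv G oU)
  have gs: "g' z 1 + \<i> * g' z \<i> = - of_real (2 * pi / area)" for z
    using lin_dbar by (simp add: g'_def algebra_simps)
  have sub: "cball 0 R \<subseteq> U" by (auto simp: U_def)
  define c where "c = complex_of_real (2 * pi / area)"
  have IB: "integrable lborel (\<lambda>z. dbar \<phi>' z * g z + of_real (\<phi> z) * - c)"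
    "integral\<^sup>L lborel (\<lambda>z. dbar \<phi>' z * g z + of_real (\<phi> z) * - c) = 0"
    using integral_dbar_mult[OF C oU closed_cball sub _ gd gc] RM(3) unfolding gs c_def by auto
  have ip: "integrable lborel \<phi>"
  proof -
    have "integrable lborel (\<lambda>x. indicator (cball 0 R) x *\<^sub>R \<phi> x)"
      by (intro borel_integrable_compact continuous_on_subset[OF cp]) auto
    moreover have "indicator (cball 0 R) z *\<^sub>R \<phi> z = \<phi> z" for z
      using RM(3)[of z] by (auto simp: indicator_def)
    ultimately show ?thesis by (simp only:)
  qed
  have ic: "integrable lborel (\<lambda>z. of_real (\<phi> z) * c)"
    using ip by (intro integrable_mult_left) auto
  have ik: "integrable lborel (\<lambda>z. dbar \<phi>' z / (z - p))" for p
    by (rule dbar_cauchy_kernel[OF C])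
  have eq: "dbar \<phi>' z * jC z = (dbar \<phi>' z * g z + of_real (\<phi> z) * - c) + of_real (\<phi> z) * c + (\<Sum>p\<in>E. dbar \<phi>' z / (z - p))" for z
    by (simp add: G(2) g_def algebra_simps sum_distrib_left divide_inverse)
  have iS: "integrable lborel (\<lambda>z. \<Sum>p\<in>E. dbar \<phi>' z / (z - p))"
    by (intro Bochner_Integration.integrable_sum ik)
  have "integral\<^sup>L lborel (\<lambda>z. dbar \<phi>' z * jC z) = 0 + integral\<^sup>L lborel (\<lambda>z. of_real (\<phi> z) * c)
     + (\<Sum>p\<in>E. integral\<^sup>L lborel (\<lambda>z. dbar \<phi>' z / (z - p)))"
    unfolding eq Bochner_Integration.integral_add[OF Bochner_Integration.integrable_add[OF IB(1) ic] iS]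
      Bochner_Integration.integral_add[OF IB(1) ic] IB(2) Bochner_Integration.integral_sum[OF ik] ..
  also have "(\<Sum>p\<in>E. integral\<^sup>L lborel (\<lambda>z. dbar \<phi>' z / (z - p))) = - of_real (2 * pi * (\<Sum>p\<in>E. \<phi> p))"
    by (simp add: dbar_cauchy_kernel[OF C] sum_negf sum_distrib_left)
  also have "(\<Sum>p\<in>E. \<phi> p) = (\<Sum>p\<in>F. \<phi> p)"
  proof (rule sum.mono_neutral_cong[OF F(1) fE])
    show "\<And>p. p \<in> E - F \<Longrightarrow> \<phi> p = 0" using F by (auto simp: E_def)
    show "\<And>p. p \<in> F - E \<Longrightarrow> \<phi> p = 0" using F RM(3) by (auto simp: E_def not_le)
  qed auto
  also have "integral\<^sup>L lborel (\<lambda>z. of_real (\<phi> z) * c) = of_real (2 * pi / area * integral\<^sup>L lborel \<phi>)"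
    by (simp add: c_def mult.commute)
  finally show ?thesis by simp
qed

end

text \<open>A planar field \<open>j\<close> is encoded by the complex function \<open>j\<^sub>2 + \<i> j\<^sub>1\<close>, for which
  \<open>(\<partial>\<^sub>1 + \<i> \<partial>\<^sub>2) (j\<^sub>2 + \<i> j\<^sub>1) = curl j + \<i> div j\<close>.\<close>

definition cfield :: "(real^2 \<Rightarrow> real^2) \<Rightarrow> real^2 \<Rightarrow> complex" where
  "cfield j x = Complex (j x $ 2) (j x $ 1)"

definition dtest :: "(real^2 \<Rightarrow> real) \<Rightarrow> real^2 \<Rightarrow> complex" where
  "dtest \<phi> x = Complex (partial 1 \<phi> x) (partial 2 \<phi> x)"

lemma norm_cfield [simp]: "cmod (cfield j x) = norm (j x)"
  by (simp add: cfield_def cmod_def norm_vec_def L2_set_def sum_2 add.commute)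

section \<open>The distributional system in complex notation\<close>

lemma test_function_props:
  assumes "test_function \<phi>"
  shows "(\<phi> has_derivative frechet_derivative \<phi> (at x)) (at x)"
    "continuous_on UNIV (partial i \<phi>)" "continuous_on UNIV \<phi>"
    "frechet_derivative \<phi> (at x) h = h $ 1 * partial 1 \<phi> x + h $ 2 * partial 2 \<phi> x"
    "continuous_on UNIV (dtest \<phi>)"
proof -
  have C: "C_diff (Suc 0) \<phi>" using assms by (auto simp: test_function_def)
  then show d: "(\<phi> has_derivative frechet_derivative \<phi> (at x)) (at x)" for x
    by (auto simp: frechet_derivative_works)
  then show "continuous_on UNIV \<phi>"
    by (meson continuous_at_imp_continuous_on has_derivative_continuous)
  show c: "continuous_on UNIV (partial i \<phi>)" for i using C by simp
  show "continuous_on UNIV (dtest \<phi>)"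
    unfolding dtest_def[abs_def] Complex_eq by (intro continuous_intros c)
  have "h = h $ 1 *\<^sub>R axis 1 1 + h $ 2 *\<^sub>R axis 2 1"
    by (simp add: vec_eq_iff forall_2 axis_def)
  then have "frechet_derivative \<phi> (at x) h = frechet_derivative \<phi> (at x) (h $ 1 *\<^sub>R axis 1 1 + h $ 2 *\<^sub>R axis 2 1)"
    by simp
  also have "\<dots> = h $ 1 *\<^sub>R frechet_derivative \<phi> (at x) (axis 1 1) + h $ 2 *\<^sub>R frechet_derivative \<phi> (at x) (axis 2 1)"
    using has_derivative_linear[OF d[of x]] by (simp add: linear_add linear_cmul)
  finally show "frechet_derivative \<phi> (at x) h = h $ 1 * partial 1 \<phi> x + h $ 2 * partial 2 \<phi> x"
    by (simp add: partial_def)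
qed

lemma test_function_bounded_support:
  assumes "test_function \<phi>"
  obtains R where "R > 0" "\<And>x. norm x > R \<Longrightarrow> \<phi> x = 0" "\<And>x. norm x > R \<Longrightarrow> dtest \<phi> x = 0"
proof -
  have "bounded (supp \<phi>)" using assms by (auto simp: test_function_def intro: compact_imp_bounded)
  then obtain R0 where R0: "\<And>x. x \<in> supp \<phi> \<Longrightarrow> norm x \<le> R0" by (auto simp: bounded_iff)
  define R where "R = max R0 1"
  have z: "\<phi> x = 0" if "norm x > R" for x
    using R0[of x] that closure_subset[of "{x. \<phi> x \<noteq> 0}"] by (force simp: supp_def R_def)
  have "dtest \<phi> x = 0" if "norm x > R" for x
  proof -
    have "(\<phi> has_derivative (\<lambda>_. 0)) (at x)"
      using that z by (intro has_derivative_eq_0[of "{x. norm x > R}"]) (auto intro!: open_Collect_less continuous_intros)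
    then have "frechet_derivative \<phi> (at x) = (\<lambda>_. 0)"
      using has_derivative_unique[OF test_function_props(1)[OF assms]] by blast
    then show ?thesis by (simp add: dtest_def partial_def complex_eq_iff)
  qed
  then show ?thesis using that[of R] z by (auto simp: R_def)
qed

lemma C1c_test_function:
  assumes "test_function \<phi>"
  shows "C1c (\<lambda>z. \<phi> (ofC z)) (\<lambda>z h. frechet_derivative \<phi> (at (ofC z)) (ofC h))"
    "dbar (\<lambda>z h. frechet_derivative \<phi> (at (ofC z)) (ofC h)) z = dtest \<phi> (ofC z)"
proof -
  note T = test_function_props[OF assms]
  obtain R where R: "\<And>x. norm x > R \<Longrightarrow> \<phi> x = 0"
    using test_function_bounded_support[OF assms] by metis
  have "((\<lambda>z. \<phi> (ofC z)) has_derivative (\<lambda>h. frechet_derivative \<phi> (at (ofC z)) (ofC h))) (at z)" for z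
    by (rule has_derivative_compose[OF bounded_linear_imp_has_derivative[OF bounded_linear_ofC] T(1)])
  moreover have "continuous_on UNIV (\<lambda>z. frechet_derivative \<phi> (at (ofC z)) (ofC h))" for h
    unfolding T(4) by (intro continuous_intros continuous_on_compose2[OF T(2)]) auto
  moreover have "\<phi> (ofC z) = 0" if "cmod z > R" for z using R[of "ofC z"] that by simp
  ultimately show "C1c (\<lambda>z. \<phi> (ofC z)) (\<lambda>z h. frechet_derivative \<phi> (at (ofC z)) (ofC h))"
    unfolding C1c_def by blast
  show "dbar (\<lambda>z h. frechet_derivative \<phi> (at (ofC z)) (ofC h)) z = dtest \<phi> (ofC z)"
    by (simp add: dbar_def dtest_def T(4) ofC_def complex_eq_iff)
qed

text \<open>A general bilinear product covers the three uses: a component of \<open>j\<close> times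
  a partial derivative, \<open>scaleR\<close> in convolutions, and complex multiplication by
  \<open>dtest \<phi>\<close>.\<close>

lemma integrable_mult_compact_support:
  fixes f :: "real^2 \<Rightarrow> 'a::euclidean_space" and u :: "real^2 \<Rightarrow> 'b::euclidean_space"
    and mult :: "'a \<Rightarrow> 'b \<Rightarrow> 'c::euclidean_space"
  assumes bl: "bounded_bilinear mult" and f: "\<And>K. compact K \<Longrightarrow> set_integrable lebesgue K f"
    and u: "continuous_on UNIV u" "\<And>x. norm x > R \<Longrightarrow> u x = 0"
  shows "integrable lebesgue (\<lambda>x. mult (f x) (u x))"
proof -
  interpret bounded_bilinear mult by (rule bl)
  obtain K where K: "\<And>a b. norm (mult a b) \<le> norm a * norm b * K" using bounded by blast
  obtain M where M: "\<And>x. norm x \<le> R \<Longrightarrow> norm (u x) \<le> M"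
    by (rule continuous_norm_bound_cball[OF u(1), where R=R], rule that)
  define v where "v x = indicator (cball 0 R) x *\<^sub>R f x" for x
  have iv: "integrable lebesgue v"
    using f[of "cball 0 R"] unfolding v_def set_integrable_def by simp
  have eq: "mult (f x) (u x) = mult (v x) (u x)" for x
    using u(2)[of x] by (auto simp: v_def indicator_def zero_right)
  have um: "u \<in> borel_measurable lebesgue"
    by (intro measurable_completion) (simp add: borel_measurable_continuous_onI u)
  have vm: "v \<in> borel_measurable lebesgue" using iv by auto
  have m: "(\<lambda>x. mult (v x) (u x)) \<in> borel_measurable lebesgue"
    by (rule borel_measurable_continuous_Pair[OF vm um]) (intro continuous_on continuous_intros)
  show ?thesis
    unfolding eq
  proof (rule Bochner_Integration.integrable_bound[OF _ m])
    show "integrable lebesgue (\<lambda>x. (\<bar>K\<bar> * \<bar>M\<bar>) * norm (v x))" using iv by simp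
    show "AE x in lebesgue. norm (mult (v x) (u x)) \<le> norm ((\<bar>K\<bar> * \<bar>M\<bar>) * norm (v x))"
    proof (rule AE_I2)
      fix x
      show "norm (mult (v x) (u x)) \<le> norm ((\<bar>K\<bar> * \<bar>M\<bar>) * norm (v x))"
      proof (cases "norm x \<le> R")
        case True
        have "norm (mult (v x) (u x)) \<le> norm (v x) * norm (u x) * K" by (rule K)
        also have "\<dots> \<le> norm (v x) * norm (u x) * \<bar>K\<bar>" by (intro mult_left_mono) auto
        also have "\<dots> \<le> norm (v x) * \<bar>M\<bar> * \<bar>K\<bar>"
          using M[OF True] by (intro mult_right_mono mult_left_mono) auto
        finally show ?thesis by (simp add: abs_mult mult_ac)
      qed (simp add: u(2) zero_right)
    qed
  qed
qed

lemma integrable_test_function: "test_function \<phi> \<Longrightarrow> integrable lborel \<phi>"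
proof -
  assume T: "test_function \<phi>"
  obtain R where R: "\<And>x. norm x > R \<Longrightarrow> \<phi> x = 0"
    using test_function_bounded_support[OF T] by metis
  have "integrable lborel (\<lambda>x. indicator (cball 0 R) x *\<^sub>R \<phi> x)"
    by (intro borel_integrable_compact continuous_on_subset[OF test_function_props(3)[OF T]]) auto
  moreover have "indicator (cball 0 R) z *\<^sub>R \<phi> z = \<phi> z" for z
    using R[of z] by (auto simp: indicator_def)
  ultimately show ?thesis by (simp only:)
qed

text \<open>The real and imaginary parts of \<open>dtest \<phi> x * cfield j x\<close> are the
  integrands of \<open>curl_dist\<close> and \<open>div_dist\<close>, so the two equations become
  one. Local integrability ensures that the complex integral splits into its two parts.\<close>

lemma curl_div_system_iff:
  "curl_div_system m \<Lambda> j \<longleftrightarrow> locally_integrable j \<and> (\<forall>\<phi>. test_function \<phi> \<longrightarrow>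
     (\<integral>x. dtest \<phi> x * cfield j x \<partial>lebesgue) = - of_real (2 * pi * (\<Sum>\<^sub>\<infinity>p\<in>\<Lambda>. \<phi> p) - m * (\<integral>x. \<phi> x \<partial>lebesgue)))"
proof (cases "locally_integrable j")
  case True
  have li: "set_integrable lebesgue K j" if "compact K" for K
    using True that by (auto simp: locally_integrable_def)
  have "(\<integral>x. dtest \<phi> x * cfield j x \<partial>lebesgue) = - Complex (curl_dist j \<phi>) (div_dist j \<phi>)" if T: "test_function \<phi>" for \<phi>
  proof -
    obtain R where R: "\<And>x. norm x > R \<Longrightarrow> dtest \<phi> x = 0"
      using test_function_bounded_support[OF T] by metis
    have p0: "partial 1 \<phi> x = 0" "partial 2 \<phi> x = 0" if "norm x > R" for x
      using R[OF that] by (auto simp: dtest_def complex_eq_iff)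
    have bl: "bounded_bilinear (\<lambda>(a::real^2) b. a $ i * (b::real))" for i
      by (rule bounded_bilinear.comp1[OF bounded_bilinear_mult bounded_linear_vec_nth])
    have p0': "norm x > R \<Longrightarrow> partial k \<phi> x = 0" for x k
      using p0[of x] exhaust_2[of k] by auto
    have i: "integrable lebesgue (\<lambda>x. j x $ i * partial k \<phi> x)" for i k
      by (rule integrable_mult_compact_support[OF bl li test_function_props(2)[OF T] p0'])
    have ci: "integrable lebesgue (\<lambda>x. dtest \<phi> x * cfield j x)"
    proof -
      have "(\<lambda>x. dtest \<phi> x * cfield j x) = (\<lambda>x. of_real (j x $ 2 * partial 1 \<phi> x - j x $ 1 * partial 2 \<phi> x)
          + \<i> * of_real (j x $ 1 * partial 1 \<phi> x + j x $ 2 * partial 2 \<phi> x))"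
        by (auto simp: dtest_def cfield_def complex_eq_iff fun_eq_iff)
      then show ?thesis
        using i by (simp only:) (intro Bochner_Integration.integrable_add integrable_mult_right
            integrable_of_real Bochner_Integration.integrable_diff i)
    qed
    have "Re (\<integral>x. dtest \<phi> x * cfield j x \<partial>lebesgue) = - curl_dist j \<phi>"
      using ci by (subst integral_Re[symmetric]) (auto simp: curl_dist_def dtest_def cfield_def mult.commute)
    moreover have "Im (\<integral>x. dtest \<phi> x * cfield j x \<partial>lebesgue) = - div_dist j \<phi>"
      using ci by (subst integral_Im[symmetric]) (auto simp: div_dist_def dtest_def cfield_def mult.commute add.commute)
    ultimately show ?thesis by (simp add: complex_eq_iff)
  qed
  then show ?thesis
    using True unfolding curl_div_system_def by (auto simp: complex_eq_iff)
qed (simp add: curl_div_system_def)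

section \<open>Test functions and periodic fields\<close>

lemma C_diff_Suc_imp: "C_diff (Suc k) f \<Longrightarrow> C_diff k f"
proof (induction k arbitrary: f)
  case 0
  then show ?case
    by (auto intro!: continuous_at_imp_continuous_on differentiable_imp_continuous_within)
qed auto

lemma partial_mult:
  assumes "f differentiable (at x)" "g differentiable (at x)"
  shows "partial i (\<lambda>x. f x * g x) x = f x * partial i g x + partial i f x * g x"
proof -
  have "((\<lambda>x. f x * g x) has_derivative (\<lambda>h. f x * frechet_derivative g (at x) h + frechet_derivative f (at x) h * g x)) (at x)"
    using assms by (intro has_derivative_mult) (auto simp: frechet_derivative_works)
  then show ?thesis by (simp add: partial_def frechet_derivative_at[symmetric])
qed

lemma partial_add:
  assumes "f differentiable (at x)" "g differentiable (at x)"
  shows "partial i (\<lambda>x. f x + g x) x = partial i f x + partial i g x"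
proof -
  have "((\<lambda>x. f x + g x) has_derivative (\<lambda>h. frechet_derivative f (at x) h + frechet_derivative g (at x) h)) (at x)"
    using assms by (intro has_derivative_add) (auto simp: frechet_derivative_works)
  then show ?thesis by (simp add: partial_def frechet_derivative_at[symmetric])
qed

lemma C_diff_add: "C_diff k f \<Longrightarrow> C_diff k g \<Longrightarrow> C_diff k (\<lambda>x. f x + g x)"
proof (induction k arbitrary: f g)
  case (Suc k)
  have "partial i (\<lambda>x. f x + g x) = (\<lambda>x. partial i f x + partial i g x)" for i
    using Suc.prems by (auto simp: fun_eq_iff partial_add)
  then show ?case using Suc by auto
qed (auto intro: continuous_intros)

lemma C_diff_mult: "C_diff k f \<Longrightarrow> C_diff k g \<Longrightarrow> C_diff k (\<lambda>x. f x * g x)"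
proof (induction k arbitrary: f g)
  case (Suc k)
  have "partial i (\<lambda>x. f x * g x) = (\<lambda>x. f x * partial i g x + partial i f x * g x)" for i
    using Suc.prems by (auto simp: fun_eq_iff partial_mult)
  moreover have "C_diff k f" "C_diff k g"
    using Suc.prems C_diff_Suc_imp by blast+
  ultimately show ?case using Suc by (auto intro!: C_diff_add)
qed (auto intro: continuous_intros)

text \<open>\<open>C_diff\<close> recurses through partial derivatives, so the induction needs a
  family closed under them: a partial derivative of the n-th member is the next member or
  zero.\<close>

lemma C_diff_coordinate:
  assumes G: "\<And>n t. (G n has_real_derivative G (Suc n) t) (at t)"
  shows "C_diff k (\<lambda>x. G n (x $ i))"
proof (induction k arbitrary: n)
  case 0
  have "continuous_on UNIV (G n)"
    using G by (meson continuous_at_imp_continuous_on DERIV_isCont)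
  then show ?case by (auto intro!: continuous_on_compose2[of UNIV "G n"] continuous_intros)
next
  case (Suc k)
  have d: "((\<lambda>x. G n (x $ i)) has_derivative (\<lambda>h. h $ i * G (Suc n) (x $ i))) (at x)" for x :: "real^2"
    using has_derivative_compose[OF bounded_linear_imp_has_derivative[OF bounded_linear_vec_nth[of i]]
        G[of n "x $ i", unfolded has_field_derivative_def]]
    by (simp add: mult.commute)
  have "partial j (\<lambda>x. G n (x $ i)) = (if j = i then (\<lambda>x. G (Suc n) (x $ i)) else (\<lambda>x. 0))" for j
    using frechet_derivative_at[OF d, symmetric] by (auto simp: partial_def axis_def)
  moreover have "C_diff k (\<lambda>x. 0)" for k
  proof (induction k)
    case (Suc k)
    have "partial i (\<lambda>x. 0) = (\<lambda>x. 0)" for i by (simp add: partial_def fun_eq_iff)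
    then show ?case using Suc by simp
  qed simp
  moreover have "(\<lambda>x. G n (x $ i)) differentiable (at x)" for x
    using d by (rule differentiableI)
  ultimately show ?case using Suc by auto
qed

section \<open>Smooth bump functions on boxes\<close>

fun ebp :: "nat \<Rightarrow> real poly" where
  "ebp 0 = 1"
| "ebp (Suc n) = monom 1 2 * (ebp n - pderiv (ebp n))"

text \<open>The n-th derivative of exp(-1/t), extended by 0 to t <= 0. Differentiating P(1/t)
  exp(-1/t) gives (P - P')(1/t) exp(-1/t) / t^2, which explains the recursion of
  \<open>ebp\<close>.\<close>

definition ebn :: "nat \<Rightarrow> real \<Rightarrow> real" where
  "ebn n t = (if t > 0 then poly (ebp n) (1 / t) * exp (- 1 / t) else 0)"

lemma poly_times_exp_tendsto_0: "((\<lambda>x::real. poly p x * exp (- x)) \<longlongrightarrow> 0) at_top"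
proof -
  have "((\<lambda>x::real. \<Sum>i\<le>degree p. coeff p i * (x ^ i / exp x)) \<longlongrightarrow> (\<Sum>i\<le>degree p. coeff p i * 0)) at_top"
    by (intro tendsto_intros tendsto_power_div_exp_0)
  moreover have "(\<Sum>i\<le>degree p. coeff p i * (x ^ i / exp x)) = poly p x * exp (- x)" for x :: real
    by (simp add: poly_altdef exp_minus divide_inverse sum_distrib_right mult.assoc)
  ultimately show ?thesis by simp
qed

lemma ebn_deriv: "(ebn n has_real_derivative ebn (Suc n) t) (at t)"
proof -
  consider "t > 0" | "t < 0" | "t = 0" by linarith
  then show ?thesis
  proof cases
    case 1
    have "((\<lambda>t. poly (ebp n) (1 / t) * exp (- 1 / t)) has_real_derivative ebn (Suc n) t) (at t)"
    proof -
      have i: "((\<lambda>t. 1 / t) has_real_derivative - (1 / t\<^sup>2)) (at t)"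
        using 1 by (auto intro!: derivative_eq_intros simp: power2_eq_square)
      have p: "((\<lambda>t. poly (ebp n) (1 / t)) has_real_derivative poly (pderiv (ebp n)) (1 / t) * - (1 / t\<^sup>2)) (at t)"
        by (rule DERIV_chain2[OF poly_DERIV i])
      have e: "((\<lambda>t. exp (- 1 / t)) has_real_derivative exp (- 1 / t) * (1 / t\<^sup>2)) (at t)"
        using 1 by (auto intro!: derivative_eq_intros simp: power2_eq_square)
      show ?thesis
        using DERIV_mult[OF p e] 1
        by (simp add: ebn_def poly_monom algebra_simps power2_eq_square)
    qed
    then show ?thesis
      by (rule has_field_derivative_transform_within_open[of _ _ _ "{0<..}"]) (use 1 in \<open>auto simp: ebn_def\<close>)
  next
    case 2
    have "((\<lambda>t. 0) has_real_derivative ebn (Suc n) t) (at t)"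
      using 2 by (simp add: ebn_def)
    then show ?thesis
      by (rule has_field_derivative_transform_within_open[of _ _ _ "{..<0}"]) (use 2 in \<open>auto simp: ebn_def\<close>)
  next
    case 3
    have "((\<lambda>h. (ebn n h - ebn n 0) / (h - 0)) \<longlongrightarrow> 0) (at 0)"
    proof (rule filterlim_split_at)
      have "((\<lambda>h. 0) \<longlongrightarrow> (0::real)) (at_left 0)" by simp
      then show "((\<lambda>h. (ebn n h - ebn n 0) / (h - 0)) \<longlongrightarrow> 0) (at_left 0)"
        by (rule Lim_transform_eventually) (auto simp: eventually_at_filter ebn_def)
      have "((\<lambda>h. poly ([:0, 1:] * ebp n) (inverse h) * exp (- inverse h)) \<longlongrightarrow> (0::real)) (at_right 0)"
        by (rule filterlim_compose[OF poly_times_exp_tendsto_0 filterlim_inverse_at_top_right])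
      then show "((\<lambda>h. (ebn n h - ebn n 0) / (h - 0)) \<longlongrightarrow> 0) (at_right 0)"
        by (rule Lim_transform_eventually) (auto simp: eventually_at_filter ebn_def divide_inverse)
    qed
    then show ?thesis using 3 by (simp add: has_field_derivative_iff ebn_def)
  qed
qed

lemma ebn_affine_deriv:
  "((\<lambda>t. r ^ n * ebn n (r * t + c)) has_real_derivative r ^ Suc n * ebn (Suc n) (r * t + c)) (at t)"
proof -
  have "((\<lambda>t. r * t + c) has_real_derivative r) (at t)" by (auto intro!: derivative_eq_intros)
  from DERIV_cmult[OF DERIV_chain2[OF ebn_deriv this], of "r ^ n"] show ?thesis
    by (simp add: mult_ac)
qed

text \<open>The parameter \<open>r\<close> is a steepness. As it grows, the functions increase to
  the indicator of the box while their zero set stays the same, so that convolutions tend to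
  integrals over boxes.\<close>

definition bump :: "real \<Rightarrow> real^2 \<Rightarrow> real^2 \<Rightarrow> real^2 \<Rightarrow> real" where
  "bump r a b x = ebn 0 (r * (x $ 1 - a $ 1)) * ebn 0 (r * (b $ 1 - x $ 1)) *
     (ebn 0 (r * (x $ 2 - a $ 2)) * ebn 0 (r * (b $ 2 - x $ 2)))"

lemma ebn_0_bounds: "0 \<le> ebn 0 t" "ebn 0 t \<le> 1"
  by (auto simp: ebn_def)

lemma ebn_0_eq_0_iff: "ebn 0 t = 0 \<longleftrightarrow> t \<le> 0"
  by (auto simp: ebn_def)

lemma bump_bounds: "0 \<le> bump r a b x" "bump r a b x \<le> 1"
  unfolding bump_def by (auto intro!: mult_nonneg_nonneg mult_le_one ebn_0_bounds)

lemma bump_eq_0_iff: "r > 0 \<Longrightarrow> bump r a b x = 0 \<longleftrightarrow> x \<notin> box a b"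
  by (auto simp: bump_def ebn_0_eq_0_iff mem_box_cart forall_2 mult_le_0_iff not_less)

lemma bump_reflect: "bump r a b (x - y) = bump r (x - b) (x - a) y"
  by (simp add: bump_def algebra_simps)

lemma test_function_bump:
  assumes r: "r > 0"
  shows "test_function (bump r a b)"
proof -
  have "C_diff k (bump r a b)" for k
  proof -
    have 1: "C_diff k (\<lambda>x. ebn 0 (r * (x $ i - a $ i)))" for i
      using C_diff_coordinate[of "\<lambda>n t. r ^ n * ebn n (r * t + - r * a $ i)" k 0 i, OF ebn_affine_deriv]
      by (simp add: algebra_simps)
    have 2: "C_diff k (\<lambda>x. ebn 0 (r * (b $ i - x $ i)))" for i
      using C_diff_coordinate[of "\<lambda>n t. (- r) ^ n * ebn n (- r * t + r * b $ i)" k 0 i, OF ebn_affine_deriv]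
      by (simp add: algebra_simps)
    show ?thesis
      unfolding bump_def[abs_def] by (intro C_diff_mult 1 2)
  qed
  moreover have "supp (bump r a b) \<subseteq> cbox a b"
    unfolding supp_def by (intro closure_minimal) (auto simp: bump_eq_0_iff[OF r] intro: box_subset_cbox[THEN subsetD])
  then have "compact (supp (bump r a b))"
    unfolding supp_def compact_eq_bounded_closed by (auto intro: bounded_subset[OF bounded_cbox])
  ultimately show ?thesis by (simp add: test_function_def)
qed

lemma bump_tendsto_indicator: "(\<lambda>n. bump (real (Suc n)) a b x) \<longlonglongrightarrow> indicator (box a b) x"
proof (cases "x \<in> box a b")
  case True
  have e: "(\<lambda>n. ebn 0 (real (Suc n) * t)) \<longlonglongrightarrow> 1" if "t > 0" for t
  proof -
    have "(\<lambda>n. exp (- (1 / t) * inverse (real (Suc n)))) \<longlonglongrightarrow> exp (- (1 / t) * 0)"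
      by (intro tendsto_intros LIMSEQ_inverse_real_of_nat)
    moreover have "exp (- (1 / t) * inverse (real (Suc n))) = ebn 0 (real (Suc n) * t)" for n
      using that by (simp add: ebn_def field_simps add_pos_nonneg)
    ultimately show ?thesis by simp
  qed
  have "(\<lambda>n. bump (real (Suc n)) a b x) \<longlonglongrightarrow> 1 * 1 * (1 * 1)"
    unfolding bump_def using True
    by (intro tendsto_mult e) (auto simp: mem_box_cart forall_2)
  then show ?thesis using True by simp
next
  case False
  then have "bump (real (Suc n)) a b x = 0" for n
    using bump_eq_0_iff[of "real (Suc n)" a b x] by simp
  then show ?thesis using False by simp
qed

lemma integral_bump_pos:
  assumes "r > 0" "box a b \<noteq> {}"
  shows "integral\<^sup>L lborel (bump r a b) > 0"
proof -
  have i: "integrable lborel (bump r a b)"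
    by (intro integrable_test_function test_function_bump assms)
  have "integral\<^sup>L lborel (bump r a b) \<noteq> 0"
  proof
    assume "integral\<^sup>L lborel (bump r a b) = 0"
    then have "AE x in lborel. bump r a b x = 0"
      using integral_nonneg_eq_0_iff_AE[OF i] bump_bounds by auto
    then have "AE x in lborel. x \<notin> box a b"
      using bump_eq_0_iff[OF assms(1)] by auto
    then have "emeasure lborel (box a b) = 0"
      by (subst (asm) AE_iff_measurable[of "box a b"]) auto
    then have "box a b \<in> null_sets lborel" by auto
    then have "negligible (box a b)"
      by (simp add: negligible_iff_null_sets null_sets_completion_iff)
    then show False using assms(2) open_not_negligible[of "box a b"] by auto
  qed
  moreover have "integral\<^sup>L lborel (bump r a b) \<ge> 0"
    using bump_bounds by (intro integral_nonneg_AE) auto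
  ultimately show ?thesis by simp
qed

section \<open>Mollification and a Liouville theorem for periodic fields\<close>

lemma distr_lebesgue_plus: "distr lebesgue lebesgue ((+) c) = (lebesgue :: 'a::euclidean_space measure)"
  and measurable_lebesgue_plus: "(+) c \<in> lebesgue \<rightarrow>\<^sub>M (lebesgue :: 'a::euclidean_space measure)"
proof -
  have eq: "(\<lambda>x. c + (\<Sum>j\<in>Basis. (1 * (x \<bullet> j)) *\<^sub>R j)) = (+) c"
    by (simp add: fun_eq_iff euclidean_representation)
  show "(+) c \<in> lebesgue \<rightarrow>\<^sub>M lebesgue"
    using lebesgue_affine_measurable[where c="\<lambda>_. 1" and t=c] unfolding eq by simp
  have "lebesgue = density (distr lebesgue lebesgue ((+) c)) (\<lambda>_. (\<Prod>j\<in>(Basis :: 'a set). \<bar>1::real\<bar>))"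
    using lebesgue_affine_euclidean[where c="\<lambda>_. 1" and t=c] unfolding eq by simp
  then show "distr lebesgue lebesgue ((+) c) = lebesgue"
    by (simp add: density_1)
qed

lemma integral_lebesgue_translate:
  fixes g :: "'a::euclidean_space \<Rightarrow> 'b::{banach, second_countable_topology}"
  assumes "g \<in> borel_measurable lebesgue"
  shows "(\<integral>x. g (c + x) \<partial>lebesgue) = (\<integral>x. g x \<partial>lebesgue)"
  using integral_distr[OF measurable_lebesgue_plus assms, of c] by (simp add: distr_lebesgue_plus)

text \<open>Uniform continuity of the partial derivatives bounds the linearisation error of
  \<open>\<psi>\<close> by a small multiple of the step, uniformly in the base point, and for short
  steps this error vanishes off a fixed ball. Local integrability of \<open>h\<close> then suffices
  for differentiating under the integral.\<close>

lemma convolution_has_derivative: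
  fixes h :: "real^2 \<Rightarrow> complex"
  assumes h: "\<And>K. compact K \<Longrightarrow> set_integrable lebesgue K h" and T: "test_function \<psi>"
    and Tx: "\<And>x. test_function (\<lambda>y. \<psi> (x - y))"
  defines "D \<equiv> \<lambda>x \<eta>. \<integral>y. frechet_derivative \<psi> (at (x - y)) \<eta> *\<^sub>R h y \<partial>lebesgue"
  shows "((\<lambda>x. \<integral>y. \<psi> (x - y) *\<^sub>R h y \<partial>lebesgue) has_derivative D x) (at x)"
proof -
  note P = test_function_props[OF T]
  obtain R where R: "R > 0" "\<And>x. norm x > R \<Longrightarrow> \<psi> x = 0" "\<And>x. norm x > R \<Longrightarrow> dtest \<psi> x = 0"
    using test_function_bounded_support[OF T] by metis
  have p0: "partial i \<psi> x = 0" if "norm x > R" for i x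
    using R(3)[OF that] exhaust_2[of i] by (auto simp: dtest_def complex_eq_iff)
  note bl = bounded_bilinear.flip[OF bounded_bilinear_scaleR]
  have far: "norm (x - y) > R" if "norm y > R + norm x" for x y :: "real^2"
    using that norm_triangle_ineq2[of y x] by (simp add: norm_minus_commute)
  have i0: "integrable lebesgue (\<lambda>y. \<psi> (x - y) *\<^sub>R h y)" for x
    by (rule integrable_mult_compact_support[OF bl h, of _ "R + norm x"])
       (auto intro!: continuous_on_compose2[OF P(3)] continuous_intros R far)
  have i1: "integrable lebesgue (\<lambda>y. partial i \<psi> (x - y) *\<^sub>R h y)" for i x
    by (rule integrable_mult_compact_support[OF bl h, of _ "R + norm x"])
       (auto intro!: continuous_on_compose2[OF P(2)] continuous_intros p0 far)
  have Deq: "frechet_derivative \<psi> (at (x - y)) \<eta> *\<^sub>R h y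
     = \<eta> $ 1 *\<^sub>R (partial 1 \<psi> (x - y) *\<^sub>R h y) + \<eta> $ 2 *\<^sub>R (partial 2 \<psi> (x - y) *\<^sub>R h y)" for x y \<eta>
    by (simp add: P(4) scaleR_add_left)
  have i2: "integrable lebesgue (\<lambda>y. frechet_derivative \<psi> (at (x - y)) \<eta> *\<^sub>R h y)" for x \<eta>
    unfolding Deq using i1 by (intro Bochner_Integration.integrable_add integrable_scaleR_right)
  have DD: "D x \<eta> = \<eta> $ 1 *\<^sub>R (\<integral>y. partial 1 \<psi> (x - y) *\<^sub>R h y \<partial>lebesgue) + \<eta> $ 2 *\<^sub>R (\<integral>y. partial 2 \<psi> (x - y) *\<^sub>R h y \<partial>lebesgue)" for x \<eta>
  proof -
    have "D x \<eta> = (\<integral>y. \<eta> $ 1 *\<^sub>R (partial 1 \<psi> (x - y) *\<^sub>R h y) \<partial>lebesgue) + (\<integral>y. \<eta> $ 2 *\<^sub>R (partial 2 \<psi> (x - y) *\<^sub>R h y) \<partial>lebesgue)"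
      unfolding D_def Deq by (intro Bochner_Integration.integral_add integrable_scaleR_right i1)
    then show ?thesis by (simp only: integral_scaleR_right i1)
  qed
  have blD: "bounded_linear (D x)"
    unfolding DD[abs_def]
    by (intro bounded_linear_add bounded_linear_scaleR_const bounded_linear_vec_nth)
  \<comment> \<open>The mass of \<open>h\<close> on the ball that carries the linearisation error:
    for steps shorter than 1 the error is zero once the distance from \<open>x\<close> exceeds R +
    1.\<close>
  define C where "C = (\<integral>y. indicator (cball x (R + 1)) y *\<^sub>R norm (h y) \<partial>lebesgue)"
  have iC: "integrable lebesgue (\<lambda>y. indicator (cball x (R + 1)) y *\<^sub>R norm (h y))"
    using h[of "cball x (R + 1)"] integrable_norm[of lebesgue "\<lambda>y. indicator (cball x (R + 1)) y *\<^sub>R h y"]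
    by (simp add: set_integrable_def)
  have C0: "C \<ge> 0" unfolding C_def by (intro integral_nonneg_AE) auto
  have "\<exists>d>0. \<forall>x'. norm (x' - x) < d \<longrightarrow>
      norm ((\<integral>y. \<psi> (x' - y) *\<^sub>R h y \<partial>lebesgue) - (\<integral>y. \<psi> (x - y) *\<^sub>R h y \<partial>lebesgue) - D x (x' - x)) \<le> e * norm (x' - x)"
    if e: "e > 0" for e
  proof -
    define \<epsilon> where "\<epsilon> = e / (2 * (C + 1))"
    have \<epsilon>: "\<epsilon> > 0" using e C0 by (simp add: \<epsilon>_def)
    have "\<exists>d>0. \<forall>u\<in>cball 0 (R + 2). \<forall>v\<in>cball 0 (R + 2). dist v u < d \<longrightarrow> dist (partial i \<psi> v) (partial i \<psi> u) < \<epsilon>" for i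
    proof -
      have "uniformly_continuous_on (cball 0 (R + 2)) (partial i \<psi>)"
        by (intro compact_uniformly_continuous continuous_on_subset[OF P(2)]) auto
      then show ?thesis using \<epsilon> unfolding uniformly_continuous_on_def by blast
    qed
    then obtain d where d: "\<And>i. d i > 0" "\<And>i u v. u \<in> cball 0 (R + 2) \<Longrightarrow> v \<in> cball 0 (R + 2) \<Longrightarrow> dist v u < d i \<Longrightarrow> dist (partial i \<psi> v) (partial i \<psi> u) < \<epsilon>"
      by metis
    define \<delta> where "\<delta> = min 1 (min (d 1) (d 2))"
    have \<delta>: "\<delta> > 0" using d(1) by (simp add: \<delta>_def)
    have close: "\<bar>partial i \<psi> v - partial i \<psi> u\<bar> \<le> \<epsilon>" if "norm (v - u) < \<delta>" for i u v
    proof (cases "norm u \<le> R + 1")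
      case True
      then have "norm v \<le> R + 2"
        using that norm_triangle_ineq2[of v u] by (simp add: \<delta>_def)
      moreover have "norm (v - u) < d i" using that exhaust_2[of i] by (auto simp: \<delta>_def)
      ultimately show ?thesis using d(2)[of u v i] True by (auto simp: dist_norm)
    next
      case False
      then have "norm v > R"
        using that norm_triangle_ineq2[of u v] by (simp add: \<delta>_def norm_minus_commute)
      then show ?thesis using p0[of u i] p0[of v i] False \<epsilon> by simp
    qed
    have lin: "\<bar>\<psi> (z + \<eta>) - \<psi> z - frechet_derivative \<psi> (at z) \<eta>\<bar> \<le> 2 * \<epsilon> * norm \<eta>" if "norm \<eta> < \<delta>" for z \<eta>
    proof -
      have "norm (\<psi> (z + \<eta>) - \<psi> z - frechet_derivative \<psi> (at z) (z + \<eta> - z)) \<le> norm (z + \<eta> - z) * (2 * \<epsilon>)"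
      proof (rule differentiable_bound_linearization[where S="ball z \<delta>" and f'="\<lambda>x. frechet_derivative \<psi> (at x)"])
        show "z + t *\<^sub>R (z + \<eta> - z) \<in> ball z \<delta>" if "t \<in> {0..1}" for t
        proof -
          have "norm (t *\<^sub>R \<eta>) \<le> 1 * norm \<eta>" using that unfolding norm_scaleR by (intro mult_right_mono) auto
          then show ?thesis using \<open>norm \<eta> < \<delta>\<close> by (simp add: dist_norm)
        qed
        show "(\<psi> has_derivative frechet_derivative \<psi> (at u)) (at u within ball z \<delta>)" for u
          using P(1) by (rule has_derivative_at_withinI)
        show "onorm (frechet_derivative \<psi> (at u) - frechet_derivative \<psi> (at z)) \<le> 2 * \<epsilon>" if "u \<in> ball z \<delta>" for u
        proof (rule onorm_bound)
          fix \<xi> :: "real^2"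
          have c: "\<bar>partial i \<psi> u - partial i \<psi> z\<bar> \<le> \<epsilon>" for i
            using that by (intro close) (simp add: dist_norm norm_minus_commute)
          have "(frechet_derivative \<psi> (at u) - frechet_derivative \<psi> (at z)) \<xi>
             = \<xi> $ 1 * (partial 1 \<psi> u - partial 1 \<psi> z) + \<xi> $ 2 * (partial 2 \<psi> u - partial 2 \<psi> z)"
            by (simp add: P(4) algebra_simps)
          also have "\<bar>\<dots>\<bar> \<le> \<bar>\<xi> $ 1\<bar> * \<bar>partial 1 \<psi> u - partial 1 \<psi> z\<bar> + \<bar>\<xi> $ 2\<bar> * \<bar>partial 2 \<psi> u - partial 2 \<psi> z\<bar>"
            by (metis abs_mult abs_triangle_ineq)
          also have "\<dots> \<le> norm \<xi> * \<epsilon> + norm \<xi> * \<epsilon>"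
            by (intro add_mono mult_mono c component_le_norm_cart) auto
          finally show "norm ((frechet_derivative \<psi> (at u) - frechet_derivative \<psi> (at z)) \<xi>) \<le> 2 * \<epsilon> * norm \<xi>"
            by simp
        qed (use \<epsilon> in auto)
      qed (use \<delta> in auto)
      then show ?thesis by (simp add: mult.commute)
    qed
    have "norm ((\<integral>y. \<psi> (x' - y) *\<^sub>R h y \<partial>lebesgue) - (\<integral>y. \<psi> (x - y) *\<^sub>R h y \<partial>lebesgue) - D x (x' - x)) \<le> e * norm (x' - x)"
      if x': "norm (x' - x) < \<delta>" for x'
    proof -
      define \<eta> where "\<eta> = x' - x"
      define r where "r y = \<psi> (x - y + \<eta>) - \<psi> (x - y) - frechet_derivative \<psi> (at (x - y)) \<eta>" for y
      have re: "r y *\<^sub>R h y = \<psi> (x' - y) *\<^sub>R h y - \<psi> (x - y) *\<^sub>R h y - frechet_derivative \<psi> (at (x - y)) \<eta> *\<^sub>R h y" for y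
        by (simp add: r_def \<eta>_def algebra_simps)
      have "(\<integral>y. \<psi> (x' - y) *\<^sub>R h y \<partial>lebesgue) - (\<integral>y. \<psi> (x - y) *\<^sub>R h y \<partial>lebesgue) - D x \<eta> = (\<integral>y. r y *\<^sub>R h y \<partial>lebesgue)"
        unfolding re D_def using i0 i2
        by (subst Bochner_Integration.integral_diff; (subst Bochner_Integration.integral_diff)?) auto
      also have "norm \<dots> \<le> (\<integral>y. 2 * \<epsilon> * norm \<eta> * (indicator (cball x (R + 1)) y *\<^sub>R norm (h y)) \<partial>lebesgue)"
      proof (rule order_trans[OF integral_norm_bound integral_mono])
        show "integrable lebesgue (\<lambda>y. norm (r y *\<^sub>R h y))"
          unfolding re by (intro integrable_norm Bochner_Integration.integrable_diff i0 i2)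
        show "integrable lebesgue (\<lambda>y. 2 * \<epsilon> * norm \<eta> * (indicator (cball x (R + 1)) y *\<^sub>R norm (h y)))"
          using iC by (intro integrable_mult_right)
        fix y
        show "norm (r y *\<^sub>R h y) \<le> 2 * \<epsilon> * norm \<eta> * (indicator (cball x (R + 1)) y *\<^sub>R norm (h y))"
        proof (cases "y \<in> cball x (R + 1)")
          case True
          have "\<bar>r y\<bar> \<le> 2 * \<epsilon> * norm \<eta>" unfolding r_def by (rule lin) (use x' in \<open>simp add: \<eta>_def\<close>)
          then show ?thesis using True by (simp add: mult_right_mono)
        next
          case False
          then have f: "norm (x - y) > R + 1" by (simp add: dist_norm)
          have "norm (x - y) \<le> norm (x - y + \<eta>) + norm \<eta>"
            by (metis add_diff_cancel norm_triangle_ineq4)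
          then have "norm (x - y + \<eta>) > R" using f x' by (simp add: \<eta>_def \<delta>_def)
          then have "r y = 0" using f R(2) p0[of "x - y"] by (simp add: r_def P(4))
          then show ?thesis using \<epsilon> by simp
        qed
      qed
      also have "\<dots> = 2 * \<epsilon> * norm \<eta> * C" by (simp add: C_def)
      also have "\<dots> = (e * norm \<eta>) * (C / (C + 1))" using C0 by (simp add: \<epsilon>_def field_simps)
      also have "\<dots> \<le> (e * norm \<eta>) * 1" using C0 e by (intro mult_left_mono) auto
      finally show ?thesis by (simp add: \<eta>_def)
    qed
    then show ?thesis using \<delta> by blast
  qed
  then show ?thesis
    unfolding has_derivative_at_alt by (intro conjI blD allI impI)
qed

text \<open>\<open>F\<close> grows at most linearly, so by Liouville it is affine, with slope
  \<open>a\<close>. Then \<open>a * w - \<mu> * cnj w\<close> remains bounded when \<open>w\<close>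
  is scaled, hence it vanishes; w = 1 gives a = mu and w = i gives a = - mu.\<close>

lemma antiholomorphic_bounded:
  assumes F: "F holomorphic_on UNIV" and b: "\<And>z. cmod (F z - \<mu> * cnj z) \<le> B"
  shows "\<mu> = 0" "F z = F 0"
proof -
  have gr: "cmod (F z) \<le> (B + cmod \<mu>) * cmod z ^ 1" if "1 \<le> cmod z" for z
  proof -
    have "B \<ge> 0" using b[of 0] norm_ge_zero order_trans by blast
    have "cmod (F z) \<le> cmod (F z - \<mu> * cnj z) + cmod (\<mu> * cnj z)"
      by (metis diff_add_cancel norm_triangle_ineq)
    also have "\<dots> \<le> B * cmod z + cmod \<mu> * cmod z"
      using b[of z] that \<open>B \<ge> 0\<close> mult_left_mono[of 1 "cmod z" B] by (auto simp: norm_mult)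
    finally show ?thesis by (simp add: algebra_simps)
  qed
  define a where "a = deriv F 0"
  have lin: "F z = F 0 + a * z" for z
    using Liouville_polynomial[OF F gr, where \<xi>=z] by (simp add: a_def)
  have r: "x = 0" if "\<And>t. t > 0 \<Longrightarrow> t * cmod x \<le> B'" for x B'
  proof (rule ccontr)
    assume "x \<noteq> 0"
    then have "(\<bar>B'\<bar> + 1) / cmod x > 0" by simp
    from that[OF this] \<open>x \<noteq> 0\<close> show False by simp
  qed
  have bnd: "t * cmod (a * w - \<mu> * cnj w) \<le> B + cmod (F 0)" if "t > 0" for t w
  proof -
    have "t * cmod (a * w - \<mu> * cnj w) = cmod (of_real t * (a * w - \<mu> * cnj w))"
      using that by (simp add: norm_mult)
    also have "of_real t * (a * w - \<mu> * cnj w) = (F (of_real t * w) - \<mu> * cnj (of_real t * w)) - F 0"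
      by (subst lin) (simp add: algebra_simps)
    also have "cmod \<dots> \<le> B + cmod (F 0)"
      by (rule order_trans[OF norm_triangle_ineq4 add_right_mono[OF b]])
    finally show ?thesis .
  qed
  have "a * 1 - \<mu> * cnj 1 = 0" by (rule r, rule bnd)
  moreover have "a * \<i> - \<mu> * cnj \<i> = 0" by (rule r, rule bnd)
  ultimately have "a = \<mu>" "(a + \<mu>) * \<i> = 0" by (auto simp: algebra_simps)
  then have "\<mu> = 0 \<and> a = 0" by simp
  then show "\<mu> = 0" "F z = F 0" using lin[of z] by auto
qed

lemma holomorphic_from_dbar:
  fixes F :: "complex \<Rightarrow> complex"
  assumes "\<And>z. (F has_derivative D z) (at z)" "\<And>z. D z 1 + \<i> * D z \<i> = 0"
  shows "F holomorphic_on UNIV"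
proof -
  have "(F has_field_derivative D z 1) (at z)" for z
  proof -
    have l: "linear (D z)" using assms(1) by (rule has_derivative_linear)
    have "D z h = D z 1 * h" for h
    proof -
      have "h = Re h *\<^sub>R 1 + Im h *\<^sub>R \<i>" by (simp add: complex_eq_iff)
      then have "D z h = D z (Re h *\<^sub>R 1 + Im h *\<^sub>R \<i>)" by simp
      also have "\<dots> = Re h *\<^sub>R D z 1 + Im h *\<^sub>R D z \<i>"
        using l by (simp add: linear_add linear_cmul)
      also have "D z \<i> = \<i> * D z 1"
      proof -
        have "\<i> * (D z 1 + \<i> * D z \<i>) = 0" using assms(2) by simp
        then show ?thesis by (simp add: algebra_simps flip: mult.assoc)
      qed
      also have "Re h *\<^sub>R D z 1 + Im h *\<^sub>R (\<i> * D z 1) = D z 1 * (Re h *\<^sub>R 1 + Im h *\<^sub>R \<i>)"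
        by (simp add: scaleR_conv_of_real algebra_simps)
      also have "Re h *\<^sub>R 1 + Im h *\<^sub>R \<i> = h" by (simp add: complex_eq_iff)
      finally show ?thesis .
    qed
    then have "D z = (*) (D z 1)" by (rule ext)
    then show ?thesis using assms(1)[of z] by (simp add: has_field_derivative_def)
  qed
  then show ?thesis by (auto simp: holomorphic_on_def field_differentiable_def)
qed

text \<open>Convolution with a bump yields a differentiable periodic function whose d-bar derivative
  is constant. A multiple of the conjugate coordinate makes it entire, periodicity bounds it, and
  \<open>antiholomorphic_bounded\<close> shows that the constant is 0 and that the convolution does
  not depend on the point. As the bumps tend to indicators, integrals of \<open>h\<close> over
  translates of a box agree, and Lebesgue's differentiation theorem concludes.\<close>

lemma periodic_dbar_const:
  fixes h :: "real^2 \<Rightarrow> complex"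
  assumes h: "\<And>K. compact K \<Longrightarrow> set_integrable lebesgue K h"
    and per: "\<And>p x. p \<in> \<Lambda> \<Longrightarrow> h (x + p) = h x"
    and cov: "\<And>x. \<exists>p\<in>\<Lambda>. norm (x - p) \<le> d"
    and eq: "\<And>\<phi>. test_function \<phi> \<Longrightarrow> (\<integral>x. dtest \<phi> x * h x \<partial>lebesgue) = \<kappa> * of_real (\<integral>x. \<phi> x \<partial>lebesgue)"
  shows "\<kappa> = 0" "\<exists>c. AE x in lebesgue. h x = c"
proof -
  have hm: "h \<in> borel_measurable lebesgue"
  proof -
    have "(\<lambda>x. indicator (cball 0 (real n)) x *\<^sub>R h x) \<in> borel_measurable lebesgue" for n
      using h[of "cball 0 (real n)"] by (auto simp: set_integrable_def)
    moreover have "(\<lambda>n. indicator (cball 0 (real n)) x *\<^sub>R h x) \<longlonglongrightarrow> h x" for x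
    proof -
      obtain N where N: "norm x \<le> real N" using real_arch_simple by blast
      have "\<forall>\<^sub>F n in sequentially. indicator (cball 0 (real n)) x *\<^sub>R h x = h x"
        using eventually_ge_at_top[of N]
      proof eventually_elim
        case (elim n)
        then have "norm x \<le> real n" using N by linarith
        then show ?case by simp
      qed
      then show ?thesis by (rule tendsto_eventually)
    qed
    ultimately show ?thesis
      by (rule borel_measurable_LIMSEQ_metric[of "\<lambda>n x. indicator (cball 0 (real n)) x *\<^sub>R h x"])
  qed
  define K where "K r a b x = (\<integral>y. bump r a b (x - y) *\<^sub>R h y \<partial>lebesgue)" for r a b x
  have main: "\<kappa> * of_real (integral\<^sup>L lebesgue (bump r a b)) = 0 \<and> (\<forall>x. K r a b x = K r a b 0)" if r: "r > 0" for r a b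
  proof -
    define \<psi> where "\<psi> = bump r a b"
    have T: "test_function \<psi>" and Tx: "test_function (\<lambda>y. \<psi> (x - y))" for x
      unfolding \<psi>_def bump_reflect using test_function_bump[OF r] by (auto simp: eta_contract_eq)
    note P = test_function_props[OF T]
    define I where "I = complex_of_real (integral\<^sup>L lebesgue \<psi>)"
    define D where "D x \<eta> = (\<integral>y. frechet_derivative \<psi> (at (x - y)) \<eta> *\<^sub>R h y \<partial>lebesgue)" for x \<eta>
    have Kd: "(K r a b has_derivative D x) (at x)" for x
      using convolution_has_derivative[OF h T Tx] unfolding K_def \<psi>_def D_def by simp
    have I': "(\<integral>y. \<psi> (x - y) \<partial>lebesgue) = integral\<^sup>L lebesgue \<psi>" for x
    proof -
      have m: "\<psi> \<in> borel_measurable borel" by (intro borel_measurable_continuous_onI P)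
      have "(\<integral>y. \<psi> (x - y) \<partial>lebesgue) = (\<integral>y. \<psi> (x - y) \<partial>lborel)"
        by (rule integral_completion) (use m in measurable)
      also have "\<dots> = (\<integral>y. \<psi> y \<partial>lborel)"
      proof -
        have "lborel = distr lborel borel (\<lambda>y. x + (-1) *\<^sub>R y)"
          using lborel_affine[of "-1" x] by (simp add: density_1)
        then have "(\<integral>y. \<psi> y \<partial>lborel) = (\<integral>y. \<psi> y \<partial>distr lborel borel (\<lambda>y. x + (-1) *\<^sub>R y))" by simp
        also have "\<dots> = (\<integral>y. \<psi> (x - y) \<partial>lborel)"
          using m by (subst integral_distr) auto
        finally show ?thesis by simp
      qed
      also have "\<dots> = integral\<^sup>L lebesgue \<psi>"
        by (rule integral_completion[symmetric]) (use m in measurable)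
      finally show ?thesis .
    qed
    obtain R where R: "\<And>x. norm x > R \<Longrightarrow> \<psi> x = 0" "\<And>x. norm x > R \<Longrightarrow> dtest \<psi> x = 0"
      using test_function_bounded_support[OF T] by metis
    have p0: "partial i \<psi> x = 0" if "norm x > R" for i x
      using R(2)[OF that] exhaust_2[of i] by (auto simp: dtest_def complex_eq_iff)
    have i1: "integrable lebesgue (\<lambda>y. partial i \<psi> (x - y) *\<^sub>R h y)" for i x
    proof (rule integrable_mult_compact_support[OF bounded_bilinear.flip[OF bounded_bilinear_scaleR] h, of _ "R + norm x"])
      show "continuous_on UNIV (\<lambda>y. partial i \<psi> (x - y))"
        by (auto intro!: continuous_on_compose2[OF P(2)] continuous_intros)
      show "partial i \<psi> (x - y) = 0" if "norm y > R + norm x" for y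
        using that norm_triangle_ineq2[of y x] by (intro p0) (simp add: norm_minus_commute)
    qed
    have dtx: "dtest (\<lambda>y. \<psi> (x - y)) y = - dtest \<psi> (x - y)" for x y
    proof -
      have "((\<lambda>y. x - y) has_derivative (\<lambda>h. - h)) (at y)" by (auto intro!: derivative_eq_intros)
      then have "((\<lambda>y. \<psi> (x - y)) has_derivative (\<lambda>h. frechet_derivative \<psi> (at (x - y)) (- h))) (at y)"
        by (rule has_derivative_compose[OF _ P(1)])
      then have "frechet_derivative (\<lambda>y. \<psi> (x - y)) (at y) = (\<lambda>h. frechet_derivative \<psi> (at (x - y)) (- h))"
        by (rule frechet_derivative_at[symmetric])
      then have "partial i (\<lambda>y. \<psi> (x - y)) y = - partial i \<psi> (x - y)" for i
        using linear_neg[OF has_derivative_linear[OF P(1)]] by (simp only: partial_def)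
      then show ?thesis
        by (simp add: dtest_def complex_eq_iff)
    qed
    have D12: "D x (axis 1 1) + \<i> * D x (axis 2 1) = - \<kappa> * I" for x
    proof -
      have "D x (axis 1 1) + \<i> * D x (axis 2 1) = (\<integral>y. partial 1 \<psi> (x - y) *\<^sub>R h y \<partial>lebesgue) + \<i> * (\<integral>y. partial 2 \<psi> (x - y) *\<^sub>R h y \<partial>lebesgue)"
        by (simp add: D_def partial_def)
      also have "\<dots> = (\<integral>y. partial 1 \<psi> (x - y) *\<^sub>R h y + \<i> * (partial 2 \<psi> (x - y) *\<^sub>R h y) \<partial>lebesgue)"
        by (simp only: Bochner_Integration.integral_add[OF i1 integrable_mult_right[OF i1]] integral_mult_right_zero)
      also have "\<dots> = (\<integral>y. - (dtest (\<lambda>y. \<psi> (x - y)) y * h y) \<partial>lebesgue)"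
        by (intro Bochner_Integration.integral_cong refl) (simp add: dtx dtest_def Complex_eq scaleR_conv_of_real algebra_simps)
      also have "\<dots> = - \<kappa> * I"
        using eq[OF Tx[of x]] I'[of x] by (simp add: I_def)
      finally show ?thesis .
    qed
    define Kc where "Kc z = K r a b (ofC z)" for z
    have Kcd: "(Kc has_derivative (\<lambda>w. D (ofC z) (ofC w))) (at z)" for z
      unfolding Kc_def
      by (rule has_derivative_compose[OF bounded_linear_imp_has_derivative[OF bounded_linear_ofC] Kd])
    \<comment> \<open>The d-bar derivative of \<open>Kc\<close> is \<open>- \<kappa> * I\<close> and
      that of \<open>cnj\<close> is 2, so the sum satisfies the Cauchy-Riemann equations.\<close>
    define F where "F z = Kc z + (\<kappa> * I / 2) * cnj z" for z
    have Fd: "(F has_derivative (\<lambda>w. D (ofC z) (ofC w) + (\<kappa> * I / 2) * cnj w)) (at z)" for z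
      unfolding F_def by (intro has_derivative_add Kcd) (auto intro!: derivative_eq_intros)
    have "ofC 1 = axis 1 1" "ofC \<i> = axis 2 1"
      by (auto simp: ofC_def vec_eq_iff forall_2 axis_def)
    then have "F holomorphic_on UNIV"
      using D12 by (intro holomorphic_from_dbar[OF Fd]) (simp add: algebra_simps)
    have Kper: "K r a b (x + p) = K r a b x" if "p \<in> \<Lambda>" for x p
    proof -
      have m: "(\<lambda>y. \<psi> (x + p - y) *\<^sub>R h y) \<in> borel_measurable lebesgue"
      proof (intro borel_measurable_scaleR hm)
        have "(\<lambda>y. \<psi> (x + p - y)) \<in> borel_measurable borel"
          by (intro borel_measurable_continuous_onI continuous_on_compose2[OF P(3)] continuous_intros) auto
        then show "(\<lambda>y. \<psi> (x + p - y)) \<in> borel_measurable lebesgue"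
          by (intro measurable_completion) auto
      qed
      have "K r a b (x + p) = (\<integral>y. \<psi> (x + p - (p + y)) *\<^sub>R h (p + y) \<partial>lebesgue)"
        unfolding K_def \<psi>_def[symmetric] by (rule integral_lebesgue_translate[OF m, symmetric])
      also have "\<dots> = K r a b x"
        unfolding K_def \<psi>_def[symmetric] using per[OF that] by (simp add: add.commute[of p])
      finally show ?thesis .
    qed
    have Kcont: "continuous_on UNIV (K r a b)"
      by (meson Kd continuous_at_imp_continuous_on has_derivative_continuous)
    obtain B where B: "\<And>x. norm x \<le> d \<Longrightarrow> norm (K r a b x) \<le> B"
      by (rule continuous_norm_bound_cball[OF Kcont, where R=d], rule that)
    have KB: "norm (K r a b x) \<le> B" for x
    proof -
      obtain p where p: "p \<in> \<Lambda>" "norm (x - p) \<le> d" using cov by blast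
      have "K r a b x = K r a b (x - p)" using Kper[OF p(1), of "x - p"] by simp
      then show ?thesis using B[OF p(2)] by simp
    qed
    have Fb: "cmod (F z - (\<kappa> * I / 2) * cnj z) \<le> B" for z
      using KB[of "ofC z"] by (simp add: F_def Kc_def)
    have "\<kappa> * I / 2 = 0" and Fc: "F z = F 0" for z
      by (rule antiholomorphic_bounded[OF \<open>F holomorphic_on UNIV\<close> Fb])+
    then have kI: "\<kappa> * I = 0" by simp
    have "K r a b x = K r a b 0" for x
      using Fc[of "toC x"] by (simp add: F_def Kc_def kI)
    then show ?thesis using kI by (simp add: I_def \<psi>_def)
  qed
  show "\<kappa> = 0"
  proof -
    have "(\<chi> i. 1 / 2) \<in> box 0 (1 :: real^2)" by (simp add: mem_box_cart)
    then have ne: "box 0 (1 :: real^2) \<noteq> {}" by blast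
    have "integral\<^sup>L lebesgue (bump 1 0 1) = integral\<^sup>L lborel (bump 1 0 1)"
      by (rule integral_completion)
         (use borel_measurable_integrable[OF integrable_test_function[OF test_function_bump[of 1 0 1]]] in auto)
    then have "integral\<^sup>L lebesgue (bump 1 0 1) \<noteq> 0"
      using integral_bump_pos[OF zero_less_one ne] by simp
    then show ?thesis using main[of 1 0 1] by simp
  qed
  \<comment> \<open>The limit of \<open>K r a b x\<close> for growing \<open>r\<close>: an integral
    over a box that moves with \<open>x\<close>. It inherits from \<open>K\<close> that it does not
    depend on \<open>x\<close>.\<close>
  define J where "J a b x = (\<integral>y. indicator (box (x - b) (x - a)) y *\<^sub>R h y \<partial>lebesgue)" for a b x
  have Jc: "J a b x = J a b 0" for a b x
  proof -
    have lim: "(\<lambda>n. K (real (Suc n)) a b x) \<longlonglongrightarrow> J a b x" for x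
      unfolding K_def J_def bump_reflect
    proof (rule integral_dominated_convergence)
      define w where "w y = indicator (cbox (x - b) (x - a)) y *\<^sub>R norm (h y)" for y
      show "integrable lebesgue w"
        using h[of "cbox (x - b) (x - a)"] integrable_norm[of lebesgue "\<lambda>y. indicator (cbox (x - b) (x - a)) y *\<^sub>R h y"]
        by (simp add: set_integrable_def w_def[abs_def])
      show "AE y in lebesgue. (\<lambda>n. bump (real (Suc n)) (x - b) (x - a) y *\<^sub>R h y) \<longlonglongrightarrow> indicator (box (x - b) (x - a)) y *\<^sub>R h y"
        by (intro AE_I2 tendsto_scaleR bump_tendsto_indicator tendsto_const)
      show "AE y in lebesgue. norm (bump (real (Suc n)) (x - b) (x - a) y *\<^sub>R h y) \<le> w y" for n
      proof (rule AE_I2)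
        fix y
        show "norm (bump (real (Suc n)) (x - b) (x - a) y *\<^sub>R h y) \<le> w y"
        proof (cases "y \<in> box (x - b) (x - a)")
          case True
          then have "y \<in> cbox (x - b) (x - a)" using box_subset_cbox by blast
          then show ?thesis using bump_bounds[of "real (Suc n)" "x - b" "x - a" y]
            by (simp add: w_def mult_left_le_one_le)
        next
          case False
          then have "bump (real (Suc n)) (x - b) (x - a) y = 0" using bump_eq_0_iff[of "real (Suc n)"] by simp
          then show ?thesis by (simp add: w_def)
        qed
      qed
      show "(\<lambda>y. indicator (box (x - b) (x - a)) y *\<^sub>R h y) \<in> borel_measurable lebesgue"
        by (intro borel_measurable_scaleR borel_measurable_indicator hm) auto
      show "(\<lambda>y. bump (real (Suc n)) (x - b) (x - a) y *\<^sub>R h y) \<in> borel_measurable lebesgue" for n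
      proof (intro borel_measurable_scaleR hm)
        have "bump (real (Suc n)) (x - b) (x - a) \<in> borel_measurable lborel"
          by (rule borel_measurable_integrable[OF integrable_test_function[OF test_function_bump]]) simp
        then show "bump (real (Suc n)) (x - b) (x - a) \<in> borel_measurable lebesgue"
          by (rule measurable_completion)
      qed
    qed
    have "(\<lambda>n. K (real (Suc n)) a b x) = (\<lambda>n. K (real (Suc n)) a b 0)"
      using main[of "real (Suc _)" a b] by (intro ext) simp
    then show ?thesis using lim[of x] lim[of 0] by (auto intro: LIMSEQ_unique)
  qed
  have hk: "h integrable_on cbox a b" for a b
    using h[of "cbox a b"] set_lebesgue_integral_eq_integral(1)[of "cbox a b" h] by auto
  have int: "integral (cbox x (x + t *\<^sub>R One)) h = J (- (t *\<^sub>R One)) 0 x" for x t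
  proof -
    have si: "set_integrable lebesgue (box x (x + t *\<^sub>R One)) h"
      by (rule set_integrable_subset[OF h[of "cbox x (x + t *\<^sub>R One)"]]) (auto simp: box_subset_cbox)
    have "J (- (t *\<^sub>R One)) 0 x = (LINT y:box x (x + t *\<^sub>R One)|lebesgue. h y)"
      by (simp add: J_def set_lebesgue_integral_def)
    also have "\<dots> = integral (box x (x + t *\<^sub>R One)) h"
      by (rule set_lebesgue_integral_eq_integral(2)[OF si])
    also have "\<dots> = integral (cbox x (x + t *\<^sub>R One)) h"
      by (simp add: integral_open_interval)
    finally show ?thesis by simp
  qed
  \<comment> \<open>Off a negligible set the value of \<open>h\<close> is the limit of its means
    over small squares with corner \<open>x\<close>; by the independence just shown, these means are
    the same for all \<open>x\<close>.\<close>
  obtain N where N: "negligible N" "\<And>x e. \<lbrakk>x \<notin> N; 0 < e\<rbrakk> \<Longrightarrow>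
     \<exists>d>0. \<forall>t. 0 < t \<and> t < d \<longrightarrow> norm(integral (cbox x (x + t *\<^sub>R One)) h /\<^sub>R t ^ DIM(real^2) - h x) < e"
    by (rule integrable_ccontinuous_explicit[OF hk], rule that)
  have same: "h x = h y" if xy: "x \<notin> N" "y \<notin> N" for x y
  proof (rule ccontr)
    assume "h x \<noteq> h y"
    define e where "e = norm (h x - h y) / 2"
    have e: "e > 0" using \<open>h x \<noteq> h y\<close> by (simp add: e_def)
    obtain d1 where d1: "d1 > 0" "\<And>t. 0 < t \<Longrightarrow> t < d1 \<Longrightarrow> norm(integral (cbox x (x + t *\<^sub>R One)) h /\<^sub>R t ^ DIM(real^2) - h x) < e"
      using N(2)[OF xy(1) e] by blast
    obtain d2 where d2: "d2 > 0" "\<And>t. 0 < t \<Longrightarrow> t < d2 \<Longrightarrow> norm(integral (cbox y (y + t *\<^sub>R One)) h /\<^sub>R t ^ DIM(real^2) - h y) < e"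
      using N(2)[OF xy(2) e] by blast
    define t where "t = min d1 d2 / 2"
    have t: "0 < t" "t < d1" "t < d2" using d1(1) d2(1) by (auto simp: t_def)
    define v where "v = integral (cbox x (x + t *\<^sub>R One)) h /\<^sub>R t ^ DIM(real^2)"
    have "v = integral (cbox y (y + t *\<^sub>R One)) h /\<^sub>R t ^ DIM(real^2)"
      unfolding v_def int using Jc[of _ _ x] Jc[of _ _ y] by simp
    then have "norm (v - h x) < e" "norm (v - h y) < e"
      using d1(2)[OF t(1,2)] d2(2)[OF t(1,3)] by (auto simp: v_def)
    then have "norm (h x - h y) < e + e"
      using norm_triangle_ineq4[of "v - h y" "v - h x"] by simp
    then show False by (simp add: e_def)
  qed
  have "N \<noteq> UNIV" using N(1) open_not_negligible[of "UNIV :: (real^2) set"] by auto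
  then obtain x0 where x0: "x0 \<notin> N" by blast
  have "AE x in lebesgue. x \<notin> N"
    using N(1) unfolding negligible_iff_null_sets by (rule AE_not_in)
  then have "AE x in lebesgue. h x = h x0"
    by eventually_elim (rule same[OF _ x0])
  then show "\<exists>c. AE x in lebesgue. h x = c" by blast
qed

section \<open>Renormalized energy of a periodic field\<close>

lemma ball_sets_borel [measurable]: "ball (a :: 'a::metric_space) r \<in> sets borel" "cball a r \<in> sets borel"
  by auto

locale tiling =
  fixes L :: "complex set" and D :: "complex set" and d r0 :: real
  assumes D_sets [measurable]: "D \<in> sets borel" and D_ball: "D \<subseteq> ball 0 d"
    and r0: "r0 > 0" "ball 0 r0 \<subseteq> D"
    and tile: "\<And>z. \<exists>!p. p \<in> L \<and> z - p \<in> D"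
begin

definition "A = measure lborel D"

lemma d_pos: "d > 0"
proof -
  have "0 \<in> D" using r0 by auto
  then show ?thesis using D_ball by auto
qed

lemma D_finite: "emeasure lborel D < \<infinity>"
  by (rule emeasure_bounded_finite) (meson D_ball bounded_ball bounded_subset)

lemma emeasure_D: "emeasure lborel D = ennreal A"
  using D_finite by (simp add: A_def emeasure_eq_ennreal_measure)

lemma A_pos: "A > 0"
proof -
  have "pi * r0\<^sup>2 = measure lborel (ball (0::complex) r0)"
    using r0 by (simp add: content_ball unit_ball_vol_2)
  also have "\<dots> \<le> A"
    unfolding A_def using r0 D_finite by (intro measure_mono_fmeasurable) (auto simp: fmeasurable_def)
  finally show ?thesis using r0 by (meson less_le_trans mult_pos_pos pi_gt_zero zero_less_power)
qed

definition "T p = (+) (- p) -` D"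

lemma T_sets [measurable]: "T p \<in> sets borel"
  unfolding T_def using measurable_sets[of "(+) (- p)" borel borel D]
  by (simp del: add_uminus_conv_diff uminus_add_conv_diff)

lemma T_emeasure: "emeasure lborel (T p) = ennreal A"
proof -
  have "emeasure lborel D = emeasure (distr lborel borel ((+) (- p))) D"
    by (simp add: lborel_distr_plus)
  also have "\<dots> = emeasure lborel (T p)"
    by (subst emeasure_distr) (simp_all add: T_def del: uminus_add_conv_diff)
  finally show ?thesis using emeasure_D by simp
qed

lemma disjoint_T: "disjoint_family_on T L"
  unfolding disjoint_family_on_def T_def using tile by (auto simp: algebra_simps) (metis diff_conv_add_uminus)

lemma emeasure_T_Union:
  assumes "finite F" "F \<subseteq> L"
  shows "emeasure lborel (\<Union>p\<in>F. T p) = ennreal (real (card F) * A)"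
proof -
  have "emeasure lborel (\<Union>p\<in>F. T p) = (\<Sum>p\<in>F. emeasure lborel (T p))"
    using assms disjoint_T by (intro sum_emeasure[symmetric]) (auto intro: disjoint_family_on_mono)
  then show ?thesis
    using A_pos by (simp add: T_emeasure ennreal_mult ennreal_of_nat_eq_real_of_nat)
qed

lemma emeasure_ball_complex: "R \<ge> 0 \<Longrightarrow> emeasure lborel (ball (0::complex) R) = ennreal (pi * R\<^sup>2)"
  by (simp add: emeasure_ball unit_ball_vol_2)

text \<open>The tiles at the points of \<open>F\<close> are disjoint and lie in a ball larger by
  \<open>d\<close>, so areas bound their number. The bound is made for finite subsets because
  finiteness of the whole intersection is deduced from it.\<close>

lemma card_upper_aux:
  assumes "finite F" "F \<subseteq> L \<inter> ball 0 R"
  shows "real (card F) * A \<le> pi * (max R 0 + d)\<^sup>2"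
proof -
  have "(\<Union>p\<in>F. T p) \<subseteq> ball 0 (max R 0 + d)"
  proof
    fix z assume "z \<in> (\<Union>p\<in>F. T p)"
    then obtain p where p: "p \<in> F" "- p + z \<in> D" by (auto simp: T_def)
    then have "cmod p < R" "cmod (- p + z) < d" using assms D_ball by auto
    moreover have "cmod z \<le> cmod p + cmod (- p + z)"
      by (metis add_minus_cancel norm_triangle_ineq)
    ultimately show "z \<in> ball 0 (max R 0 + d)" by simp
  qed
  then have "emeasure lborel (\<Union>p\<in>F. T p) \<le> emeasure lborel (ball (0::complex) (max R 0 + d))"
    by (intro emeasure_mono) auto
  then show ?thesis
    using emeasure_T_Union[of F] assms d_pos by (simp add: emeasure_ball_complex ennreal_le_iff)
qed

lemma finite_L: "finite (L \<inter> ball 0 R)"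
proof -
  have "\<forall>F. F \<subseteq> L \<inter> ball 0 R \<longrightarrow> finite F \<longrightarrow> card F \<le> nat \<lceil>pi * (max R 0 + d)\<^sup>2 / A\<rceil>"
  proof (intro allI impI)
    fix F assume F: "F \<subseteq> L \<inter> ball 0 R" "finite F"
    have "real (card F) \<le> pi * (max R 0 + d)\<^sup>2 / A"
      using card_upper_aux[OF F(2,1)] A_pos by (simp add: field_simps)
    then show "card F \<le> nat \<lceil>pi * (max R 0 + d)\<^sup>2 / A\<rceil>" by linarith
  qed
  then show ?thesis
    by (metis finite_if_finite_subsets_card_bdd)
qed

definition "n R = real (card (L \<inter> ball 0 R))"

lemma n_upper: "R \<ge> 0 \<Longrightarrow> n R * A \<le> pi * (R + d)\<^sup>2"
  using card_upper_aux[OF finite_L order_refl, of R] by (simp add: n_def max_def)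

text \<open>Conversely, the tiles with centre in the ball cover the ball that is smaller by
  \<open>d\<close>.\<close>

lemma n_lower:
  assumes "R \<ge> d"
  shows "pi * (R - d)\<^sup>2 \<le> n R * A"
proof -
  have "ball 0 (R - d) \<subseteq> (\<Union>p\<in>L \<inter> ball 0 R. T p)"
  proof
    fix z :: complex assume z: "z \<in> ball 0 (R - d)"
    obtain p where p: "p \<in> L" "z - p \<in> D" using tile by blast
    then have "cmod (z - p) < d" using D_ball by auto
    moreover have "cmod p \<le> cmod z + cmod (z - p)"
      by (metis diff_diff_eq2 add_diff_cancel_left' norm_triangle_ineq4)
    ultimately have "cmod p < R" using z by simp
    then show "z \<in> (\<Union>p\<in>L \<inter> ball 0 R. T p)" using p by (auto simp: T_def)
  qed
  then have "emeasure lborel (ball (0::complex) (R - d)) \<le> emeasure lborel (\<Union>p\<in>L \<inter> ball 0 R. T p)"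
    using finite_L by (intro emeasure_mono) auto
  then show ?thesis
    using emeasure_T_Union[of "L \<inter> ball 0 R"] finite_L assms A_pos
    by (simp add: emeasure_ball_complex ennreal_le_iff n_def)
qed

text \<open>The shift \<open>c\<close> is there for boundary layers: balls whose radii differ by a
  constant have the same asymptotic count, so the cells between them disappear from
  averages.\<close>

lemma n_limit: "((\<lambda>R. n (R + c) / (pi * R\<^sup>2)) \<longlongrightarrow> 1 / A) at_top"
proof (rule tendsto_sandwich)
  show "\<forall>\<^sub>F R in at_top. (R + c - d)\<^sup>2 / (A * R\<^sup>2) \<le> n (R + c) / (pi * R\<^sup>2)"
    using eventually_gt_at_top[of "max 1 (d - c)"]
  proof eventually_elim
    case (elim R)
    have "pi * (R + c - d)\<^sup>2 \<le> n (R + c) * A" using elim n_lower[of "R + c"] by simp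
    then show ?case using elim A_pos by (simp add: field_simps)
  qed
  show "\<forall>\<^sub>F R in at_top. n (R + c) / (pi * R\<^sup>2) \<le> (R + c + d)\<^sup>2 / (A * R\<^sup>2)"
    using eventually_gt_at_top[of "max 1 (- c)"]
  proof eventually_elim
    case (elim R)
    have "n (R + c) * A \<le> pi * (R + c + d)\<^sup>2" using elim n_upper[of "R + c"] by simp
    then show ?case using elim A_pos by (simp add: field_simps)
  qed
  have *: "((\<lambda>R::real. (R + k)\<^sup>2 / (A * R\<^sup>2)) \<longlongrightarrow> 1 / A) at_top" for k
  proof -
    have "((\<lambda>R::real. (1 + k / R)\<^sup>2 / A) \<longlongrightarrow> (1 + 0)\<^sup>2 / A) at_top"
      by (intro tendsto_intros tendsto_divide_0[OF tendsto_const]) (use A_pos filterlim_ident in \<open>auto intro: filterlim_at_top_imp_at_infinity\<close>)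
    moreover have "\<forall>\<^sub>F R in at_top. (1 + k / R)\<^sup>2 / A = (R + k)\<^sup>2 / (A * R\<^sup>2)"
      using eventually_gt_at_top[of 0] by eventually_elim (use A_pos in \<open>simp add: field_simps power2_eq_square\<close>)
    ultimately show ?thesis by (auto intro: Lim_transform_eventually)
  qed
  show "((\<lambda>R::real. (R + c - d)\<^sup>2 / (A * R\<^sup>2)) \<longlongrightarrow> 1 / A) at_top"
    using *[of "c - d"] by (simp add: algebra_simps)
  show "((\<lambda>R::real. (R + c + d)\<^sup>2 / (A * R\<^sup>2)) \<longlongrightarrow> 1 / A) at_top"
    using *[of "c + d"] by (simp add: algebra_simps)
qed

end

section \<open>Finite part of the energy of a cell, and energies with a cutoff\<close>

locale tiling_energy = tiling +
  fixes N :: "complex \<Rightarrow> real" and C0 r1 :: real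
  assumes N_meas [measurable]: "N \<in> borel_measurable borel" and N_nonneg: "N z \<ge> 0"
    and N_per: "p \<in> L \<Longrightarrow> N (z + p) = N z"
    and N_sing: "\<And>z. z \<in> D \<Longrightarrow> z \<noteq> 0 \<Longrightarrow> \<bar>N z - 1 / (cmod z)\<^sup>2\<bar> \<le> C0 / cmod z"
    and r1: "0 < r1" "r1 < r0"
begin

text \<open>The finite part of half the integral of \<open>N\<close> over a cell. \<open>N\<close>
  differs from 1/|z|^2 by at most \<open>C0\<close> / |z|, which is integrable in the plane, so
  removing 1/|z|^2 on a disc leaves a convergent integral; the logarithm makes the value independent
  of the radius of that disc, as \<open>E_limit\<close> shows.\<close>

definition "E = (\<integral>z. indicator D z * (N z - indicator (cball 0 r1) z / (cmod z)\<^sup>2) \<partial>lborel) / 2 + pi * ln r1"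

lemma integrable_D_inverse: "integrable lborel (\<lambda>z. indicator D z * (1 / cmod z))"
proof (rule Bochner_Integration.integrable_bound[OF integrable_inverse_cmod[of d, unfolded set_integrable_def]])
  show "AE z in lborel. norm (indicator D z * (1 / cmod z)) \<le> norm (indicator (cball 0 d) z *\<^sub>R (1 / cmod z))"
    using D_ball by (intro AE_I2) (auto simp: indicator_def)
qed measurable

lemma integrable_D: "integrable lborel (\<lambda>z. indicator D z * (c::real))"
  using D_finite by (intro integrable_mult_left integrable_real_indicator) auto

lemma N_le: "z \<in> D \<Longrightarrow> z \<noteq> 0 \<Longrightarrow> N z \<le> 1 / (cmod z)\<^sup>2 + C0 / cmod z"
  using N_sing[of z] by linarith

text \<open>The Lipschitz bound of a cutoff supplies one factor |z| against the singularity 1/|z|^2;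
  this first moment therefore controls the error of treating the cutoff as constant on a
  cell.\<close>

definition "M1 = (\<integral>z. indicator D z * (cmod z * N z) \<partial>lborel)"

lemma integrable_cmod_N: "integrable lborel (\<lambda>z. indicator D z * (cmod z * N z))"
proof (rule Bochner_Integration.integrable_bound)
  show "integrable lborel (\<lambda>z. indicator D z * (1 / cmod z) + indicator D z * \<bar>C0\<bar>)"
    by (intro Bochner_Integration.integrable_add integrable_D_inverse integrable_D)
  show "AE z in lborel. norm (indicator D z * (cmod z * N z)) \<le> norm (indicator D z * (1 / cmod z) + indicator D z * \<bar>C0\<bar>)"
  proof (rule AE_I2)
    fix z
    show "norm (indicator D z * (cmod z * N z)) \<le> norm (indicator D z * (1 / cmod z) + indicator D z * \<bar>C0\<bar>)"
    proof (cases "z \<in> D \<and> z \<noteq> 0")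
      case True
      have "cmod z * N z \<le> cmod z * (1 / (cmod z)\<^sup>2 + C0 / cmod z)"
        using True N_le by (intro mult_left_mono) auto
      also have "\<dots> = 1 / cmod z + C0" using True by (simp add: field_simps power2_eq_square)
      finally show ?thesis using True N_nonneg[of z] by (simp add: abs_mult)
    qed auto
  qed
qed measurable

lemma tendsto_at_right_dominated:
  fixes f :: "complex \<Rightarrow> real"
  assumes [measurable]: "f \<in> borel_measurable borel" and w: "integrable lborel w" "\<And>z. z \<noteq> 0 \<Longrightarrow> \<bar>f z\<bar> \<le> w z"
  shows "((\<lambda>\<eta>. \<integral>z. indicator (- ball 0 \<eta>) z * f z \<partial>lborel) \<longlongrightarrow> (\<integral>z. f z \<partial>lborel)) (at_right 0)"
  unfolding tendsto_at_iff_sequentially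
proof (intro allI impI)
  fix X :: "nat \<Rightarrow> real" assume X: "\<forall>i. X i \<in> {0<..} - {0}" "X \<longlonglongrightarrow> 0"
  have ae: "AE z in lborel. z \<noteq> (0::complex)" by (rule AE_lborel_singleton)
  show "((\<lambda>\<eta>. \<integral>z. indicator (- ball 0 \<eta>) z * f z \<partial>lborel) \<circ> X) \<longlonglongrightarrow> (\<integral>z. f z \<partial>lborel)"
    unfolding o_def
  proof (rule integral_dominated_convergence[where w=w])
    show "AE z in lborel. (\<lambda>i. indicator (- ball 0 (X i)) z * f z) \<longlonglongrightarrow> f z"
      using ae
    proof eventually_elim
      case (elim z)
      have "\<forall>\<^sub>F i in sequentially. X i < cmod z"
        using X(2) elim by (intro order_tendstoD(2)[of X 0]) auto
      then have "\<forall>\<^sub>F i in sequentially. indicator (- ball 0 (X i)) z * f z = f z"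
        by eventually_elim auto
      then show ?case by (rule tendsto_eventually)
    qed
    show "AE z in lborel. norm (indicator (- ball 0 (X i)) z * f z) \<le> w z" for i
      using ae
    proof eventually_elim
      case (elim z)
      then show ?case using w(2)[of z] by (auto simp: indicator_def)
    qed
  qed (use w in auto)
qed

lemma integrable_N_eta:
  fixes g :: "complex \<Rightarrow> real"
  assumes "\<eta> > 0" and [measurable]: "g \<in> borel_measurable borel" and g: "\<And>z. \<bar>g z\<bar> \<le> B"
  shows "integrable lborel (\<lambda>z. indicator (- ball 0 \<eta>) z * (indicator D z * (g z * N z)))"
proof (rule Bochner_Integration.integrable_bound)
  have B: "B \<ge> 0" using g[of 0] by linarith
  show "integrable lborel (\<lambda>z. indicator D z * (B * (1 / \<eta>\<^sup>2 + \<bar>C0\<bar> / \<eta>)))"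
    by (rule integrable_D)
  show "AE z in lborel. norm (indicator (- ball 0 \<eta>) z * (indicator D z * (g z * N z))) \<le> norm (indicator D z * (B * (1 / \<eta>\<^sup>2 + \<bar>C0\<bar> / \<eta>)))"
  proof (rule AE_I2)
    fix z
    show "norm (indicator (- ball 0 \<eta>) z * (indicator D z * (g z * N z))) \<le> norm (indicator D z * (B * (1 / \<eta>\<^sup>2 + \<bar>C0\<bar> / \<eta>)))"
    proof (cases "z \<in> D \<and> \<eta> \<le> cmod z")
      case True
      then have z: "z \<noteq> 0" using assms(1) by auto
      have "N z \<le> 1 / (cmod z)\<^sup>2 + \<bar>C0\<bar> / cmod z"
        using N_le[of z] True z divide_right_mono[OF abs_ge_self[of C0] norm_ge_zero[of z]] by linarith
      also have "\<dots> \<le> 1 / \<eta>\<^sup>2 + \<bar>C0\<bar> / \<eta>"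
        using True assms(1) by (intro add_mono frac_le power_mono) auto
      finally have "\<bar>g z\<bar> * N z \<le> B * (1 / \<eta>\<^sup>2 + \<bar>C0\<bar> / \<eta>)"
        using g N_nonneg B by (intro mult_mono) auto
      moreover have "0 \<le> 1 / \<eta>\<^sup>2 + \<bar>C0\<bar> / \<eta>" using assms(1) by simp
      ultimately show ?thesis using True N_nonneg[of z] B by (simp add: abs_mult abs_of_nonneg)
    qed (auto simp: indicator_def)
  qed
qed measurable

text \<open>The annulus between the radii \<eta> and \<open>r1\<close> carries
  \<open>2 * pi * ln r1 - 2 * pi * ln \<eta>\<close> of the singular part, which trades
  \<open>pi * ln r1\<close> for \<open>pi * ln \<eta>\<close>. The regularised integrand converges
  by domination.\<close>

lemma E_limit: "((\<lambda>\<eta>. (\<integral>z. indicator (- ball 0 \<eta>) z * (indicator D z * N z) \<partial>lborel) / 2 + pi * ln \<eta>) \<longlongrightarrow> E) (at_right 0)"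
proof -
  define f where "f z = indicator D z * (N z - indicator (cball 0 r1) z / (cmod z)\<^sup>2)" for z
  have [measurable]: "f \<in> borel_measurable borel" unfolding f_def by measurable
  have "((\<lambda>\<eta>. \<integral>z. indicator (- ball 0 \<eta>) z * f z \<partial>lborel) \<longlongrightarrow> (\<integral>z. f z \<partial>lborel)) (at_right 0)"
  proof (rule tendsto_at_right_dominated)
    show "integrable lborel (\<lambda>z. \<bar>C0\<bar> * (indicator D z * (1 / cmod z)) + indicator D z * (1 / r1\<^sup>2))"
      by (intro Bochner_Integration.integrable_add integrable_mult_right integrable_D_inverse integrable_D)
    fix z :: complex assume z: "z \<noteq> 0"
    show "\<bar>f z\<bar> \<le> \<bar>C0\<bar> * (indicator D z * (1 / cmod z)) + indicator D z * (1 / r1\<^sup>2)"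
    proof (cases "z \<in> D")
      case True
      have s: "\<bar>N z - 1 / (cmod z)\<^sup>2\<bar> \<le> \<bar>C0\<bar> * (1 / cmod z)"
        using N_sing[OF True z] divide_right_mono[OF abs_ge_self[of C0] norm_ge_zero[of z]] by simp
      show ?thesis
      proof (cases "cmod z \<le> r1")
        case False
        have "1 / (cmod z)\<^sup>2 \<le> 1 / r1\<^sup>2" using False r1 by (intro frac_le power_mono) auto
        then have "\<bar>N z\<bar> \<le> \<bar>C0\<bar> * (1 / cmod z) + 1 / r1\<^sup>2"
          using s N_nonneg[of z] by linarith
        then show ?thesis using True False by (simp add: f_def)
      next
        case inb: True
        have "0 \<le> 1 / r1\<^sup>2" by simp
        then have "\<bar>N z - 1 / (cmod z)\<^sup>2\<bar> \<le> \<bar>C0\<bar> * (1 / cmod z) + 1 / r1\<^sup>2" using s by linarith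
        then show ?thesis using True inb by (simp add: f_def)
      qed
    qed (simp add: f_def)
  qed measurable
  then have "((\<lambda>\<eta>. (\<integral>z. indicator (- ball 0 \<eta>) z * f z \<partial>lborel) / 2 + pi * ln r1) \<longlongrightarrow> (\<integral>z. f z \<partial>lborel) / 2 + pi * ln r1) (at_right 0)"
    by (intro tendsto_intros) auto
  moreover have "(\<integral>z. f z \<partial>lborel) / 2 + pi * ln r1 = E" by (simp add: E_def f_def)
  moreover have "\<forall>\<^sub>F \<eta> in at_right 0. (\<integral>z. indicator (- ball 0 \<eta>) z * f z \<partial>lborel) / 2 + pi * ln r1
     = (\<integral>z. indicator (- ball 0 \<eta>) z * (indicator D z * N z) \<partial>lborel) / 2 + pi * ln \<eta>"
  proof -
    have "\<forall>\<^sub>F \<eta> in at_right 0. \<eta> \<in> {0<..<r1}" using r1 by (intro eventually_at_right_real) auto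
    then show ?thesis
    proof eventually_elim
      case (elim \<eta>)
      define a where "a z = 1 / (cmod z)\<^sup>2 * indicator (cball 0 r1 - ball 0 \<eta>) z" for z
      have am: "a \<in> borel_measurable lborel" "AE z in lborel. 0 \<le> a z"
      proof -
        show "a \<in> borel_measurable lborel" unfolding a_def by measurable
        show "AE z in lborel. 0 \<le> a z" by (simp add: a_def)
      qed
      have "(\<integral>\<^sup>+z. ennreal (a z) \<partial>lborel) = ennreal (2 * pi * ln r1 - 2 * pi * ln \<eta>)"
      proof -
        have "ennreal (a z) = ennreal (1 / (cmod z)\<^sup>2) * indicator {z. \<eta> \<le> cmod z \<and> cmod z \<le> r1} z" for z
          by (auto simp: a_def indicator_def not_le)
        then show ?thesis using nn_integral_annulus[of \<eta> r1] elim by simp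
      qed
      moreover have "0 \<le> 2 * pi * ln r1 - 2 * pi * ln \<eta>" using elim by simp
      ultimately have ia: "integrable lborel a" "integral\<^sup>L lborel a = 2 * pi * ln r1 - 2 * pi * ln \<eta>"
        using nn_integral_eq_integrable[of a lborel "2 * pi * ln r1 - 2 * pi * ln \<eta>"] am
        by auto
      have iN: "integrable lborel (\<lambda>z. indicator (- ball 0 \<eta>) z * (indicator D z * N z))"
        using integrable_N_eta[of \<eta> "\<lambda>_. 1" 1] elim by simp
      have "indicator (- ball 0 \<eta>) z * f z = indicator (- ball 0 \<eta>) z * (indicator D z * N z) - a z" for z
      proof (cases "cmod z \<le> r1")
        case True
        then have "z \<in> D" using r0 r1 by auto
        then show ?thesis using True by (auto simp: f_def a_def indicator_def)
      qed (auto simp: f_def a_def indicator_def)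
      then have "(\<integral>z. indicator (- ball 0 \<eta>) z * f z \<partial>lborel) = (\<integral>z. indicator (- ball 0 \<eta>) z * (indicator D z * N z) \<partial>lborel) - (2 * pi * ln r1 - 2 * pi * ln \<eta>)"
        using iN ia by simp
      then show ?case by (simp add: field_simps)
    qed
  qed
  ultimately show ?thesis by (auto intro: Lim_transform_eventually)
qed

context
  fixes ct :: "complex \<Rightarrow> real" and C R :: real
  assumes chi_nonneg: "\<And>z. ct z \<ge> 0" and lip: "\<And>z w. \<bar>ct z - ct w\<bar> \<le> C * cmod (z - w)"
    and C_nonneg: "C \<ge> 0" and chi_supp: "\<And>z. cmod z \<ge> R \<Longrightarrow> ct z = 0" and R_pos: "R > 0"
begin

lemma chi_bound: "\<bar>ct z\<bar> \<le> C * (2 * R)"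
proof (cases "cmod z \<ge> R")
  case False
  have "ct (of_real R) = 0" using R_pos by (intro chi_supp) simp
  then have "\<bar>ct z\<bar> \<le> C * cmod (z - of_real R)" using lip[of z "of_real R"] by simp
  also have "\<dots> \<le> C * (2 * R)"
    using False R_pos norm_triangle_ineq4[of z "of_real R"] C_nonneg by (intro mult_left_mono) auto
  finally show ?thesis .
qed (use chi_supp C_nonneg R_pos in auto)

lemma chi_meas [measurable]: "ct \<in> borel_measurable borel"
proof (intro borel_measurable_continuous_onI)
  show "continuous_on UNIV ct"
    using lip C_nonneg
    by (intro lipschitz_on_continuous_on[of C]) (auto simp: lipschitz_on_def dist_norm)
qed

text \<open>The contribution, in the cell of \<open>p\<close>, of the deviation of the cutoff from
  its value at \<open>p\<close>. That deviation lowers the order of the singularity by one, so the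
  integral converges without cutting out a disc.\<close>

definition "\<Delta> p = (\<integral>w. indicator D w * ((ct (p + w) - ct p) * N w) \<partial>lborel)"

lemma Delta_dom: "\<bar>indicator D w * ((ct (p + w) - ct p) * N w)\<bar> \<le> C * (indicator D w * (cmod w * N w))"
  using mult_right_mono[OF lip[of "p + w" p] N_nonneg[of w]] N_nonneg[of w]
  by (auto simp: abs_mult indicator_def)

lemma Delta_integrable: "integrable lborel (\<lambda>w. indicator D w * ((ct (p + w) - ct p) * N w))"
  by (rule Bochner_Integration.integrable_bound[OF integrable_mult_right[OF integrable_cmod_N, of C]])
     (measurable, use order_trans[OF Delta_dom abs_ge_self] in auto)

lemma Delta_bound: "\<bar>\<Delta> p\<bar> \<le> C * M1"
proof -
  have "\<bar>\<Delta> p\<bar> \<le> (\<integral>w. \<bar>indicator D w * ((ct (p + w) - ct p) * N w)\<bar> \<partial>lborel)"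
    unfolding \<Delta>_def using integral_norm_bound[of lborel "\<lambda>w. indicator D w * ((ct (p + w) - ct p) * N w)"] by simp
  also have "\<dots> \<le> (\<integral>w. C * (indicator D w * (cmod w * N w)) \<partial>lborel)"
    by (intro integral_mono integrable_mult_right integrable_cmod_N integrable_abs Delta_integrable Delta_dom)
  finally show ?thesis by (simp add: M1_def)
qed

definition "F = L \<inter> ball 0 (R + d)"

lemma finite_F: "finite F" unfolding F_def by (rule finite_L)

text \<open>Every point of the support of \<open>ct\<close> lies in exactly one tile, and its centre
  is in \<open>F\<close>. Since \<eta> is below \<open>r0\<close>, the disc around a lattice point
  stays in the tile of that point, so after translation each cell has lost the same disc around
  0.\<close>

lemma nn_split:
  assumes "0 < \<eta>" "\<eta> < r0"
  shows "(\<integral>\<^sup>+z\<in>UNIV - (\<Union>p\<in>L. ball p \<eta>). ennreal (ct z * N z) \<partial>lborel)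
    = ennreal (\<Sum>p\<in>F. \<integral>w. indicator (- ball 0 \<eta>) w * (indicator D w * (ct (p + w) * N w)) \<partial>lborel)"
proof -
  have pt: "ennreal (ct z * N z) * indicator (UNIV - (\<Union>p\<in>L. ball p \<eta>)) z
     = (\<Sum>p\<in>F. ennreal (indicator (- ball 0 \<eta>) (- p + z) * (indicator D (- p + z) * (ct (p + (- p + z)) * N (- p + z)))))" for z
  proof (cases "ct z = 0")
    case False
    then have z: "cmod z < R" using chi_supp[of z] by force
    obtain p where p: "p \<in> L" "z - p \<in> D" "\<And>p'. p' \<in> L \<Longrightarrow> z - p' \<in> D \<Longrightarrow> p' = p" using tile by blast
    have "cmod p \<le> cmod z + cmod (z - p)"
      by (metis diff_diff_eq2 add_diff_cancel_left' norm_triangle_ineq4)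
    moreover have "cmod (z - p) < d" using p(2) D_ball by auto
    ultimately have pF: "p \<in> F" using p(1) z by (simp add: F_def)
    have Nz: "N (- p + z) = N z" using N_per[OF p(1), of "- p + z"] by simp
    have "(\<Sum>p\<in>F. ennreal (indicator (- ball 0 \<eta>) (- p + z) * (indicator D (- p + z) * (ct (p + (- p + z)) * N (- p + z)))))
      = ennreal (indicator (- ball 0 \<eta>) (- p + z) * (indicator D (- p + z) * (ct (p + (- p + z)) * N (- p + z))))"
    proof (rule trans[OF sum.mono_neutral_right[of F "{p}"]])
      show "\<forall>i\<in>F - {p}. ennreal (indicator (- ball 0 \<eta>) (- i + z) * (indicator D (- i + z) * (ct (i + (- i + z)) * N (- i + z)))) = 0"
      proof
        fix i assume "i \<in> F - {p}"
        then have "z - i \<notin> D" using p(3)[of i] by (auto simp: F_def)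
        then have "- i + z \<notin> D" by (simp add: algebra_simps)
        then show "ennreal (indicator (- ball 0 \<eta>) (- i + z) * (indicator D (- i + z) * (ct (i + (- i + z)) * N (- i + z)))) = 0"
          by simp
      qed
    qed (use pF finite_F in auto)
    also have "indicator D (- p + z) = (1::real)" using p(2) by (simp add: algebra_simps)
    also have "(indicator (- ball 0 \<eta>) (- p + z) :: real) = indicator (UNIV - (\<Union>p\<in>L. ball p \<eta>)) z"
    proof -
      have "z \<in> (\<Union>p\<in>L. ball p \<eta>) \<longleftrightarrow> cmod (- p + z) < \<eta>"
      proof
        assume "z \<in> (\<Union>p\<in>L. ball p \<eta>)"
        then obtain p' where p': "p' \<in> L" "cmod (z - p') < \<eta>" by (auto simp: dist_norm norm_minus_commute)
        then have "z - p' \<in> ball 0 r0" using assms by simp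
        then have "p' = p" using p(3)[OF p'(1)] r0 by blast
        then show "cmod (- p + z) < \<eta>" using p' by (simp add: algebra_simps)
      next
        assume "cmod (- p + z) < \<eta>"
        then show "z \<in> (\<Union>p\<in>L. ball p \<eta>)"
          using p(1) by (intro UN_I[of p]) (auto simp: dist_norm norm_minus_commute algebra_simps)
      qed
      then show ?thesis by (auto simp: indicator_def)
    qed
    finally show ?thesis unfolding Nz by (auto simp: indicator_def)
  qed simp
  have i: "integrable lborel (\<lambda>w. indicator (- ball 0 \<eta>) w * (indicator D w * (ct (p + w) * N w)))" for p
    using assms by (intro integrable_N_eta[where B="C * (2 * R)"] chi_bound) measurable
  have pos: "0 \<le> indicator (- ball 0 \<eta>) w * (indicator D w * (ct (p + w) * N w))" for p w
    using chi_nonneg N_nonneg by simp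
  have "(\<integral>\<^sup>+z\<in>UNIV - (\<Union>p\<in>L. ball p \<eta>). ennreal (ct z * N z) \<partial>lborel)
    = (\<Sum>p\<in>F. \<integral>\<^sup>+z. ennreal (indicator (- ball 0 \<eta>) (- p + z) * (indicator D (- p + z) * (ct (p + (- p + z)) * N (- p + z)))) \<partial>lborel)"
    unfolding pt by (rule nn_integral_sum) measurable
  also have "\<dots> = (\<Sum>p\<in>F. \<integral>\<^sup>+w. ennreal (indicator (- ball 0 \<eta>) w * (indicator D w * (ct (p + w) * N w))) \<partial>lborel)"
  proof (rule sum.cong[OF refl])
    fix p
    have m: "(\<lambda>w. ennreal (indicator (- ball 0 \<eta>) w * (indicator D w * (ct (p + w) * N w)))) \<in> borel_measurable borel"
      by measurable
    show "(\<integral>\<^sup>+z. ennreal (indicator (- ball 0 \<eta>) (- p + z) * (indicator D (- p + z) * (ct (p + (- p + z)) * N (- p + z)))) \<partial>lborel)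
       = (\<integral>\<^sup>+w. ennreal (indicator (- ball 0 \<eta>) w * (indicator D w * (ct (p + w) * N w))) \<partial>lborel)"
      by (rule nn_integral_translate[OF m])
  qed
  also have "\<dots> = (\<Sum>p\<in>F. ennreal (\<integral>w. indicator (- ball 0 \<eta>) w * (indicator D w * (ct (p + w) * N w)) \<partial>lborel))"
    using i pos by (intro sum.cong refl nn_integral_eq_integral) auto
  also have "\<dots> = ennreal (\<Sum>p\<in>F. \<integral>w. indicator (- ball 0 \<eta>) w * (indicator D w * (ct (p + w) * N w)) \<partial>lborel)"
    using pos by (intro sum_ennreal integral_nonneg_AE) auto
  finally show ?thesis .
qed

text \<open>On each cell the cutoff is split into its value at the centre and the deviation from it.
  The first part is \<open>ct p\<close> times the expression of \<open>E_limit\<close>, logarithm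
  included; the second converges to \<Delta> by domination.\<close>

lemma cut_energy:
  "((\<lambda>\<eta>. enn2ereal (\<integral>\<^sup>+z\<in>UNIV - (\<Union>p\<in>L. ball p \<eta>). ennreal (ct z * N z) \<partial>lborel) / 2
     + ereal (pi * ln \<eta> * (\<Sum>\<^sub>\<infinity>p\<in>L. ct p))) \<longlongrightarrow> ereal (\<Sum>p\<in>F. ct p * E + \<Delta> p / 2)) (at_right 0)"
proof -
  define J where "J p \<eta> = (\<integral>w. indicator (- ball 0 \<eta>) w * (indicator D w * (ct (p + w) * N w)) \<partial>lborel)" for p \<eta>
  define J1 where "J1 p \<eta> = (\<integral>w. indicator (- ball 0 \<eta>) w * (indicator D w * ((ct (p + w) - ct p) * N w)) \<partial>lborel)" for p \<eta>
  define M where "M \<eta> = (\<integral>w. indicator (- ball 0 \<eta>) w * (indicator D w * N w) \<partial>lborel)" for \<eta>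
  have infs: "(\<Sum>\<^sub>\<infinity>p\<in>L. ct p) = (\<Sum>p\<in>F. ct p)"
  proof -
    have "(\<Sum>\<^sub>\<infinity>p\<in>L. ct p) = (\<Sum>\<^sub>\<infinity>p\<in>F. ct p)"
      using d_pos chi_supp by (intro infsum_cong_neutral) (auto simp: F_def not_less)
    then show ?thesis using finite_F by simp
  qed
  have "((\<lambda>\<eta>. \<Sum>p\<in>F. ct p * (M \<eta> / 2 + pi * ln \<eta>) + J1 p \<eta> / 2) \<longlongrightarrow> (\<Sum>p\<in>F. ct p * E + \<Delta> p / 2)) (at_right 0)"
  proof (intro tendsto_sum tendsto_add tendsto_mult tendsto_const tendsto_divide)
    show "((\<lambda>\<eta>. M \<eta> / 2 + pi * ln \<eta>) \<longlongrightarrow> E) (at_right 0)" unfolding M_def by (rule E_limit)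
    show "(J1 p \<longlongrightarrow> \<Delta> p) (at_right 0)" for p
      unfolding J1_def \<Delta>_def
      by (rule tendsto_at_right_dominated[OF _ integrable_mult_right[OF integrable_cmod_N, of C] Delta_dom]) measurable
  qed auto
  then have "((\<lambda>\<eta>. ereal (\<Sum>p\<in>F. ct p * (M \<eta> / 2 + pi * ln \<eta>) + J1 p \<eta> / 2)) \<longlongrightarrow> ereal (\<Sum>p\<in>F. ct p * E + \<Delta> p / 2)) (at_right 0)"
    by (rule tendsto_ereal)
  moreover have "\<forall>\<^sub>F \<eta> in at_right 0. ereal (\<Sum>p\<in>F. ct p * (M \<eta> / 2 + pi * ln \<eta>) + J1 p \<eta> / 2)
    = enn2ereal (\<integral>\<^sup>+z\<in>UNIV - (\<Union>p\<in>L. ball p \<eta>). ennreal (ct z * N z) \<partial>lborel) / 2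
     + ereal (pi * ln \<eta> * (\<Sum>\<^sub>\<infinity>p\<in>L. ct p))"
  proof -
    have "\<forall>\<^sub>F \<eta> in at_right 0. \<eta> \<in> {0<..<r0}" using r0 by (intro eventually_at_right_real) auto
    then show ?thesis
    proof eventually_elim
      case (elim \<eta>)
      have i1: "integrable lborel (\<lambda>w. indicator (- ball 0 \<eta>) w * (indicator D w * (ct (p + w) * N w)))" for p
        using elim by (intro integrable_N_eta[where B="C * (2 * R)"] chi_bound) (auto, measurable)
      have i2: "integrable lborel (\<lambda>w. ct p * (indicator (- ball 0 \<eta>) w * (indicator D w * N w)))" for p
        using integrable_N_eta[of \<eta> "\<lambda>_. 1" 1] elim by (intro integrable_mult_right) simp
      have J1: "J1 p \<eta> = J p \<eta> - ct p * M \<eta>" for p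
      proof -
        have "J1 p \<eta> = (\<integral>w. indicator (- ball 0 \<eta>) w * (indicator D w * (ct (p + w) * N w)) - ct p * (indicator (- ball 0 \<eta>) w * (indicator D w * N w)) \<partial>lborel)"
          unfolding J1_def by (intro Bochner_Integration.integral_cong refl) (simp add: algebra_simps)
        also have "\<dots> = J p \<eta> - ct p * M \<eta>"
          unfolding Bochner_Integration.integral_diff[OF i1 i2] J_def M_def by simp
        finally show ?thesis .
      qed
      have "(\<Sum>p\<in>F. J p \<eta>) \<ge> 0"
        unfolding J_def using chi_nonneg N_nonneg by (intro sum_nonneg integral_nonneg_AE) auto
      then have "enn2ereal (\<integral>\<^sup>+z\<in>UNIV - (\<Union>p\<in>L. ball p \<eta>). ennreal (ct z * N z) \<partial>lborel) = ereal (\<Sum>p\<in>F. J p \<eta>)"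
        using nn_split[of \<eta>] elim unfolding J_def[symmetric] by simp
      moreover have "(\<Sum>p\<in>F. ct p * (M \<eta> / 2 + pi * ln \<eta>) + J1 p \<eta> / 2) = (\<Sum>p\<in>F. J p \<eta>) / 2 + pi * ln \<eta> * (\<Sum>p\<in>F. ct p)"
        unfolding J1 by (simp add: sum_divide_distrib sum_distrib_left flip: sum.distrib) (intro sum.cong refl, simp add: field_simps)
      ultimately show ?case
        by (simp add: infs)
    qed
  qed
  ultimately show ?thesis by (rule Lim_transform_eventually)
qed

text \<open>Cells deep inside the ball see a constant cutoff and contribute exactly
  \<open>E\<close>. The others lie in a boundary layer of fixed width and contribute a bounded
  amount each, so the error is governed by the number of cells in the layer.\<close>

lemma cut_energy_bound:
  assumes one: "\<And>z. cmod z \<le> R - 1 \<Longrightarrow> ct z = 1"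
  shows "\<bar>(\<Sum>p\<in>F. ct p * E + \<Delta> p / 2) - E * n (R - 1 - d)\<bar> \<le> ((2 + C) * \<bar>E\<bar> + C * M1) * (n (R + d) - n (R - 1 - d))"
proof -
  define G where "G = L \<inter> ball 0 (R - 1 - d)"
  have GF: "G \<subseteq> F" unfolding G_def F_def using d_pos by auto
  have fG: "finite G" using GF finite_F finite_subset by blast
  have t1: "ct p * E + \<Delta> p / 2 = E" if "p \<in> G" for p
  proof -
    have p: "cmod p < R - 1 - d" using that by (simp add: G_def)
    have "ct (p + w) = 1" if "w \<in> D" for w
    proof (rule one)
      have "cmod w < d" using that D_ball by auto
      then show "cmod (p + w) \<le> R - 1" using p norm_triangle_ineq[of p w] by linarith
    qed
    moreover have c1: "ct p = 1" using p d_pos by (intro one) auto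
    ultimately have "(\<lambda>w. indicator D w * ((ct (p + w) - ct p) * N w)) = (\<lambda>w. 0)"
      by (auto simp: fun_eq_iff indicator_def)
    then have "\<Delta> p = 0" by (simp add: \<Delta>_def)
    then show ?thesis using c1 by simp
  qed
  have M1: "M1 \<ge> 0" unfolding M1_def using N_nonneg by (intro integral_nonneg_AE) auto
  \<comment> \<open>Unlike \<open>chi_bound\<close>, this bound does not grow with \<open>R\<close>:
    where the cutoff is not already known to be 0 or 1, the radial projection to the circle of
    radius \<open>R\<close> moves a point by at most 1.\<close>
  have chi2: "\<bar>ct p\<bar> \<le> 2 + C" for p
  proof -
    consider "cmod p \<ge> R" | "cmod p \<le> R - 1" | "R - 1 < cmod p" "cmod p < R" by linarith
    then show ?thesis
    proof cases
      case 3
      show ?thesis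
      proof (cases "p = 0")
        case True
        have "ct (of_real R) = 0" using R_pos by (intro chi_supp) simp
        then have "\<bar>ct p\<bar> \<le> C * R" using lip[of p "of_real R"] True R_pos by simp
        also have "\<dots> \<le> C * 1" using 3 True C_nonneg by (intro mult_left_mono) auto
        finally show ?thesis by simp
      next
        case False
        define q where "q = of_real (R / cmod p) * p"
        have "cmod q = R" using False R_pos by (simp add: q_def norm_mult norm_divide)
        then have "ct q = 0" by (intro chi_supp) simp
        then have "\<bar>ct p\<bar> \<le> C * cmod (p - q)" using lip[of p q] by simp
        also have "p - q = of_real (1 - R / cmod p) * p" by (simp add: q_def algebra_simps)
        also have "cmod (of_real (1 - R / cmod p) * p) = \<bar>1 - R / cmod p\<bar> * cmod p" by (simp only: norm_mult norm_of_real)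
        also have "\<bar>1 - R / cmod p\<bar> * cmod p = \<bar>(1 - R / cmod p) * cmod p\<bar>" by (simp add: abs_mult)
        also have "(1 - R / cmod p) * cmod p = cmod p - R" using False by (simp add: field_simps)
        also have "C * \<bar>cmod p - R\<bar> \<le> C * 1" using 3 C_nonneg by (intro mult_left_mono) auto
        finally show ?thesis by simp
      qed
    qed (use chi_supp[of p] one[of p] C_nonneg in auto)
  qed
  have t2: "\<bar>ct p * E + \<Delta> p / 2\<bar> \<le> (2 + C) * \<bar>E\<bar> + C * M1" for p
  proof -
    have "\<bar>ct p * E\<bar> \<le> (2 + C) * \<bar>E\<bar>" unfolding abs_mult by (intro mult_right_mono chi2) auto
    moreover have "\<bar>\<Delta> p / 2\<bar> \<le> C * M1"
      using Delta_bound[of p] mult_nonneg_nonneg[OF C_nonneg M1] by simp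
    ultimately show ?thesis by linarith
  qed
  have "(\<Sum>p\<in>F. ct p * E + \<Delta> p / 2) = (\<Sum>p\<in>F - G. ct p * E + \<Delta> p / 2) + (\<Sum>p\<in>G. ct p * E + \<Delta> p / 2)"
    using sum.subset_diff[OF GF finite_F] .
  also have "(\<Sum>p\<in>G. ct p * E + \<Delta> p / 2) = E * n (R - 1 - d)"
    using t1 by (simp add: n_def G_def)
  finally have "\<bar>(\<Sum>p\<in>F. ct p * E + \<Delta> p / 2) - E * n (R - 1 - d)\<bar> = \<bar>\<Sum>p\<in>F - G. ct p * E + \<Delta> p / 2\<bar>"
    by simp
  also have "\<dots> \<le> (\<Sum>p\<in>F - G. (2 + C) * \<bar>E\<bar> + C * M1)"
    by (rule order_trans[OF sum_abs sum_mono[OF t2]])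
  also have "\<dots> = ((2 + C) * \<bar>E\<bar> + C * M1) * (real (card F) - real (card G))"
    using card_Diff_subset[OF fG GF] card_mono[OF finite_F GF] by (simp add: of_nat_diff algebra_simps)
  finally show ?thesis by (simp add: n_def F_def G_def)
qed

end

end

section \<open>Cutoff functions\<close>

lemma has_real_derivative_max_sq: "((\<lambda>t::real. (max 0 t)\<^sup>2) has_real_derivative 2 * max 0 t) (at t)"
proof -
  consider "t > 0" | "t < 0" | "t = 0" by linarith
  then show ?thesis
  proof cases
    case 1
    have "((\<lambda>t::real. t\<^sup>2) has_real_derivative 2 * max 0 t) (at t)"
      using 1 by (auto intro!: derivative_eq_intros)
    then show ?thesis
      by (rule has_field_derivative_transform_within_open[of _ _ _ "{0<..}"]) (use 1 in auto)
  next
    case 2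
    have "((\<lambda>t::real. 0) has_real_derivative 2 * max 0 t) (at t)" using 2 by simp
    then show ?thesis
      by (rule has_field_derivative_transform_within_open[of _ _ _ "{..<0}"]) (use 2 in auto)
  next
    case 3
    have "((\<lambda>h::real. ((max 0 h)\<^sup>2 - (max 0 0)\<^sup>2) / (h - 0)) \<longlongrightarrow> 0) (at 0)"
    proof (rule Lim_null_comparison)
      show "\<forall>\<^sub>F h::real in at 0. norm (((max 0 h)\<^sup>2 - (max 0 0)\<^sup>2) / (h - 0)) \<le> \<bar>h\<bar>"
        by (intro always_eventually allI) (auto simp: max_def power2_eq_square)
      show "((\<lambda>h::real. \<bar>h\<bar>) \<longlongrightarrow> 0) (at 0)" by (auto intro!: tendsto_eq_intros)
    qed
    then show ?thesis using 3 by (simp add: has_field_derivative_iff)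
  qed
qed

text \<open>The description in \<open>W_field\<close> quantifies over all families; if there were
  none, every \<open>w\<close> would satisfy it and no value would be singled out.\<close>

lemma cutoff_family_exists: "\<exists>X. cutoff_family X"
proof -
  \<comment> \<open>A differentiable transition from 0 to 1 on [0, 1] with slope at most 4, composed
    of squared positive parts.\<close>
  define \<kappa> where "\<kappa> s = (max 0 (1 - (max 0 (1 - s))\<^sup>2))\<^sup>2" for s :: real
  define \<kappa>' where "\<kappa>' s = 2 * max 0 (1 - (max 0 (1 - s))\<^sup>2) * (2 * max 0 (1 - s))" for s :: real
  have kd: "(\<kappa> has_real_derivative \<kappa>' s) (at s)" for s
  proof -
    have i: "((\<lambda>s. 1 - (max 0 (1 - s))\<^sup>2) has_real_derivative 2 * max 0 (1 - s)) (at s)"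
    proof -
      have "((\<lambda>s. (max 0 (1 - s))\<^sup>2) has_real_derivative 2 * max 0 (1 - s) * (- 1)) (at s)"
        by (rule DERIV_chain2[where f="\<lambda>t. (max 0 t)\<^sup>2" and g="\<lambda>s. 1 - s", OF has_real_derivative_max_sq])
           (auto intro!: derivative_eq_intros)
      from DERIV_diff[OF DERIV_const[of 1] this] show ?thesis by simp
    qed
    show ?thesis
      unfolding \<kappa>_def[abs_def] \<kappa>'_def
      by (rule DERIV_chain2[where f="\<lambda>t. (max 0 t)\<^sup>2" and g="\<lambda>s. 1 - (max 0 (1 - s))\<^sup>2", OF has_real_derivative_max_sq i])
  qed
  have k0: "\<kappa> s = 0" if "s \<le> 0" for s
  proof -
    have "1\<^sup>2 \<le> (1 - s)\<^sup>2" using that by (intro power_mono) auto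
    then have "max 0 (1 - (1 - s)\<^sup>2) = 0" by simp
    moreover have "max 0 (1 - s) = 1 - s" using that by simp
    ultimately show ?thesis by (simp only: \<kappa>_def) simp
  qed
  have k1: "\<kappa> s = 1" if "s \<ge> 1" for s using that by (simp add: \<kappa>_def max_def)
  have kb: "\<bar>\<kappa>' s\<bar> \<le> 4" for s
  proof (cases "s \<ge> 0")
    case True
    have "max 0 (1 - (max 0 (1 - s))\<^sup>2) \<le> 1" "max 0 (1 - s) \<le> 1" using True by auto
    then have "2 * max 0 (1 - (max 0 (1 - s))\<^sup>2) * (2 * max 0 (1 - s)) \<le> 2 * 1 * (2 * 1)"
      by (intro mult_mono) auto
    then show ?thesis by (simp add: \<kappa>'_def abs_mult)
  next
    case False
    have "1\<^sup>2 \<le> (1 - s)\<^sup>2" using False by (intro power_mono) auto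
    then have "max 0 (1 - (1 - s)\<^sup>2) = 0" by simp
    moreover have "max 0 (1 - s) = 1 - s" using False by simp
    ultimately show ?thesis by (simp add: \<kappa>'_def)
  qed
  \<comment> \<open>The transition takes place while \<open>R - norm x\<close> runs from 1/4 to 3/4.
    So the support stays inside the open ball, and the value 1 is reached before distance 1 from the
    complement. The factor 2 raises the slope to 8. For R < 1 no point is at distance 1 from the
    complement, which allows the zero function.\<close>
  define X :: "real \<Rightarrow> real^2 \<Rightarrow> real" where "X R x = (if R < 1 then 0 else \<kappa> (2 * (R - norm x) - 1 / 2))" for R x
  have d: "\<exists>c v. (X R has_derivative (\<lambda>h. c * (v \<bullet> h))) (at x) \<and> \<bar>c\<bar> \<le> 8 \<and> norm v \<le> 1" for R x
  proof -
    consider "R < 1" | "R \<ge> 1" "x = 0" | "R \<ge> 1" "x \<noteq> 0" by linarith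
    then show ?thesis
    proof cases
      case 1
      then have "X R = (\<lambda>_. 0)" by (simp add: X_def fun_eq_iff)
      then show ?thesis by (intro exI[of _ 0]) auto
    next
      case 2
      have "((\<lambda>_. 1) has_derivative (\<lambda>h. 0)) (at x)" by simp
      then have "(X R has_derivative (\<lambda>h. 0)) (at x)"
      proof (rule has_derivative_transform_within_open)
        show "open (ball (0 :: real^2) (1 / 4))" "x \<in> ball 0 (1 / 4)" using 2 by auto
        show "1 = X R y" if "y \<in> ball 0 (1 / 4)" for y
          using that 2 by (simp add: X_def k1)
      qed
      then show ?thesis by (intro exI[of _ 0] exI[of _ 0]) auto
    next
      case 3
      have n: "((\<lambda>x. 2 * (R - norm x) - 1 / 2) has_derivative (\<lambda>h. - 2 * (sgn x \<bullet> h))) (at x)"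
        by (auto intro!: derivative_eq_intros has_derivative_norm[OF 3(2)] simp: inner_commute)
      have "((\<lambda>x. \<kappa> (2 * (R - norm x) - 1 / 2)) has_derivative (\<lambda>h. \<kappa>' (2 * (R - norm x) - 1 / 2) * (- 2 * (sgn x \<bullet> h)))) (at x)"
        by (rule has_derivative_compose[OF n kd[unfolded has_field_derivative_def]])
      moreover have "(\<lambda>x. \<kappa> (2 * (R - norm x) - 1 / 2)) = X R" using 3 by (auto simp: X_def)
      moreover have "(\<lambda>h. \<kappa>' (2 * (R - norm x) - 1 / 2) * (- 2 * (sgn x \<bullet> h))) = (\<lambda>h. (- 2 * \<kappa>' (2 * (R - norm x) - 1 / 2)) * (sgn x \<bullet> h))"
        by auto
      ultimately show ?thesis
        using kb[of "2 * (R - norm x) - 1 / 2"]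
        by (intro exI[of _ "- 2 * \<kappa>' (2 * (R - norm x) - 1 / 2)"] exI[of _ "sgn x"]) (auto simp: norm_sgn abs_mult)
    qed
  qed
  have "cutoff_family X"
    unfolding cutoff_family_def
  proof (intro exI[of _ 8] allI impI conjI ballI)
    fix R :: real and x :: "real^2" assume R: "R > 0"
    show "X R x \<ge> 0" by (simp add: X_def \<kappa>_def)
    obtain c v where cv: "(X R has_derivative (\<lambda>h. c * (v \<bullet> h))) (at x)" "\<bar>c\<bar> \<le> 8" "norm v \<le> 1"
      using d by blast
    from cv(1) show "X R differentiable (at x)" by (rule differentiableI)
    have "frechet_derivative (X R) (at x) = (\<lambda>h. c * (v \<bullet> h))"
      using frechet_derivative_at[OF cv(1)] by simp
    then have "grad (X R) x = c *\<^sub>R v"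
      by (simp add: grad_def partial_def vec_eq_iff inner_axis)
    then have "norm (grad (X R) x) \<le> 8 * 1"
      using cv(2,3) by (simp only: norm_scaleR) (intro mult_mono; simp)
    then show "norm (grad (X R) x) \<le> 8" by simp
  next
    fix R :: real assume R: "R > 0"
    show "supp (X R) \<subseteq> ball 0 R"
    proof -
      have "{x. X R x \<noteq> 0} \<subseteq> cball 0 (R - 1 / 4)"
      proof
        fix x assume "x \<in> {x. X R x \<noteq> 0}"
        then have "\<not> 2 * (R - norm x) - 1 / 2 \<le> 0" using k0 by (auto simp: X_def split: if_splits)
        then show "x \<in> cball 0 (R - 1 / 4)" by simp
      qed
      then have "supp (X R) \<subseteq> cball 0 (R - 1 / 4)"
        unfolding supp_def by (intro closure_minimal) auto
      then show ?thesis by force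
    qed
  next
    fix R :: real and x :: "real^2" assume R: "R > 0" and x: "x \<in> ball 0 R" "infdist x (- ball 0 R) \<ge> 1"
    have "norm x \<le> R - 1"
    proof (cases "x = 0")
      case True
      have "(R *\<^sub>R axis 1 1 :: real^2) \<in> - ball 0 R" using R by simp
      from infdist_le[OF this, of x] have "infdist x (- ball 0 R) \<le> R"
        using R True by (simp add: dist_norm)
      then show ?thesis using x True by simp
    next
      case False
      have "(R / norm x) *\<^sub>R x \<in> - ball 0 R" using R False by simp
      from infdist_le[OF this, of x] have "infdist x (- ball 0 R) \<le> norm (x - (R / norm x) *\<^sub>R x)"
        by (simp add: dist_norm)
      also have "x - (R / norm x) *\<^sub>R x = (1 - R / norm x) *\<^sub>R x" by (simp add: algebra_simps)
      also have "norm ((1 - R / norm x) *\<^sub>R x) = \<bar>(1 - R / norm x) * norm x\<bar>" by (simp add: abs_mult)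
      also have "(1 - R / norm x) * norm x = norm x - R" using False by (simp add: field_simps)
      finally show ?thesis using x by auto
    qed
    moreover from this have "R \<ge> 1" using norm_ge_zero[of x] by linarith
    ultimately show "X R x = 1" by (auto simp: X_def intro!: k1)
  qed
  then show ?thesis by blast
qed

lemma cutoff_family_props:
  assumes "cutoff_family X"
  obtains C where "C \<ge> 0" "\<And>R x. R > 0 \<Longrightarrow> X R x \<ge> 0"
    "\<And>R x y. R > 0 \<Longrightarrow> \<bar>X R x - X R y\<bar> \<le> C * norm (x - y)"
    "\<And>R x. R > 0 \<Longrightarrow> norm x \<ge> R \<Longrightarrow> X R x = 0"
    "\<And>R x. R > 0 \<Longrightarrow> norm x \<le> R - 1 \<Longrightarrow> X R x = 1"
proof -
  obtain C where C: "\<And>R x. R > 0 \<Longrightarrow> X R x \<ge> 0" "\<And>R x. R > 0 \<Longrightarrow> X R differentiable (at x)"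
    "\<And>R x. R > 0 \<Longrightarrow> norm (grad (X R) x) \<le> C" "\<And>R. R > 0 \<Longrightarrow> supp (X R) \<subseteq> ball 0 R"
    "\<And>R x. R > 0 \<Longrightarrow> x \<in> ball 0 R \<Longrightarrow> infdist x (- ball 0 R) \<ge> 1 \<Longrightarrow> X R x = 1"
    using assms unfolding cutoff_family_def by blast
  have C0: "C \<ge> 0" using C(3)[of 1 0] norm_ge_zero order_trans zero_less_one by blast
  have lip: "\<bar>X R x - X R y\<bar> \<le> C * norm (x - y)" if R: "R > 0" for R x y
  proof -
    have "norm (X R x - X R y) \<le> C * norm (x - y)"
    proof (rule differentiable_bound[where S=UNIV and f'="\<lambda>x. frechet_derivative (X R) (at x)"])
      show D: "(X R has_derivative frechet_derivative (X R) (at x)) (at x within UNIV)" for x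
        using C(2)[OF R, of x] frechet_derivative_works by auto
      show "onorm (frechet_derivative (X R) (at x)) \<le> C" for x
      proof (rule onorm_bound[OF C0])
        fix h :: "real^2"
        have "h = h $ 1 *\<^sub>R axis 1 1 + h $ 2 *\<^sub>R axis 2 1"
          by (simp add: vec_eq_iff forall_2 axis_def)
        then have "frechet_derivative (X R) (at x) h = frechet_derivative (X R) (at x) (h $ 1 *\<^sub>R axis 1 1 + h $ 2 *\<^sub>R axis 2 1)"
          by simp
        also have "\<dots> = h $ 1 *\<^sub>R frechet_derivative (X R) (at x) (axis 1 1) + h $ 2 *\<^sub>R frechet_derivative (X R) (at x) (axis 2 1)"
          using has_derivative_linear[OF D[of x]] by (simp add: linear_add linear_cmul)
        also have "\<dots> = grad (X R) x \<bullet> h"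
          by (simp add: grad_def partial_def inner_vec_def sum_2 mult.commute)
        finally have "norm (frechet_derivative (X R) (at x) h) \<le> norm (grad (X R) x) * norm h"
          by (simp add: Cauchy_Schwarz_ineq2)
        also have "\<dots> \<le> C * norm h" by (intro mult_right_mono C(3) R) auto
        finally show "norm (frechet_derivative (X R) (at x) h) \<le> C * norm h" .
      qed
    qed auto
    then show ?thesis by simp
  qed
  have z: "X R x = 0" if "R > 0" "norm x \<ge> R" for R x
  proof (rule ccontr)
    assume "X R x \<noteq> 0"
    then have "x \<in> supp (X R)"
      unfolding supp_def by (intro subsetD[OF closure_subset]) simp
    then have "x \<in> ball 0 R" by (rule subsetD[OF C(4)[OF that(1)]])
    then show False using that(2) by simp
  qed
  have o: "X R x = 1" if "R > 0" "norm x \<le> R - 1" for R x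
  proof (rule C(5)[OF that(1)])
    show "x \<in> ball 0 R" using that by simp
    have "(R *\<^sub>R axis 1 1 :: real^2) \<in> - ball 0 R" using that by simp
    then have "- ball 0 R \<noteq> ({} :: (real^2) set)" by blast
    moreover have "1 \<le> (INF y\<in>- ball 0 R. dist x y)"
    proof (rule cINF_greatest)
      show "- ball 0 R \<noteq> ({} :: (real^2) set)" by fact
      fix y assume "y \<in> - ball (0::real^2) R"
      then have "norm y \<ge> R" by simp
      then show "1 \<le> dist x y" using that norm_triangle_ineq2[of y x] by (simp add: dist_norm norm_minus_commute)
    qed
    ultimately show "infdist x (- ball 0 R) \<ge> 1" by (simp only: infdist_def if_False)
  qed
  show ?thesis by (rule that[OF C0 C(1) lip z o])
qed

section \<open>Energy per unit area of a periodic field\<close>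

context tiling_energy
begin

lemma W_cut_eq:
  assumes j: "AE x in lebesgue. (norm (j x))\<^sup>2 = N (toC x)"
    and X: "\<And>x. X x \<ge> 0" "\<And>x y. \<bar>X x - X y\<bar> \<le> C * norm (x - y)" "C \<ge> 0" "\<And>x. norm x \<ge> R \<Longrightarrow> X x = 0" "R > 0"
  shows "W_cut (ofC ` L) j X = ereal (\<Sum>p\<in>F R. X (ofC p) * E + \<Delta> (\<lambda>z. X (ofC z)) p / 2)"
proof -
  define ct where "ct z = X (ofC z)" for z
  have c: "\<And>z. ct z \<ge> 0" "\<And>z w. \<bar>ct z - ct w\<bar> \<le> C * cmod (z - w)" "\<And>z. cmod z \<ge> R \<Longrightarrow> ct z = 0"
    unfolding ct_def using X(1) X(2)[of "ofC _" "ofC _"] X(4) by (auto simp flip: ofC_diff)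
  have m[measurable]: "ct \<in> borel_measurable borel" by (rule chi_meas[OF c(1,2) X(3) c(3) X(5)])
  have eq: "(\<integral>\<^sup>+x\<in>UNIV - (\<Union>p\<in>ofC ` L. ball p \<eta>). ennreal (X x * (norm (j x))\<^sup>2) \<partial>lebesgue)
     = (\<integral>\<^sup>+z\<in>UNIV - (\<Union>p\<in>L. ball p \<eta>). ennreal (ct z * N z) \<partial>lborel)" for \<eta>
  proof -
    define U where "U = UNIV - (\<Union>p\<in>L. ball p \<eta>)"
    have "open (\<Union>p\<in>L. ball p \<eta>)" by blast
    then have "closed (- (\<Union>p\<in>L. ball p \<eta>))" by (rule closed_Compl)
    then have [measurable]: "U \<in> sets borel" unfolding U_def Compl_eq_Diff_UNIV[symmetric] by (rule borel_closed)
    define g where "g z = ennreal (ct z * N z) * indicator U z" for z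
    have gm[measurable]: "g \<in> borel_measurable borel" unfolding g_def by measurable
    have ind: "indicator (UNIV - (\<Union>p\<in>ofC ` L. ball p \<eta>)) x = (indicator U (toC x) :: ennreal)" for x
    proof -
      have "x \<in> (\<Union>p\<in>ofC ` L. ball p \<eta>) \<longleftrightarrow> toC x \<in> (\<Union>p\<in>L. ball p \<eta>)"
        using dist_toC[of "ofC _" x] by auto
      then show ?thesis by (auto simp: indicator_def U_def)
    qed
    have "(\<integral>\<^sup>+x\<in>UNIV - (\<Union>p\<in>ofC ` L. ball p \<eta>). ennreal (X x * (norm (j x))\<^sup>2) \<partial>lebesgue) = (\<integral>\<^sup>+x. g (toC x) \<partial>lebesgue)"
    proof (rule nn_integral_cong_AE)
      show "AE x in lebesgue. ennreal (X x * (norm (j x))\<^sup>2) * indicator (UNIV - (\<Union>p\<in>ofC ` L. ball p \<eta>)) x = g (toC x)"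
        using j by eventually_elim (simp only: g_def ct_def ofC_toC ind)
    qed
    also have "\<dots> = (\<integral>\<^sup>+x. g (toC x) \<partial>lborel)" by (intro nn_integral_completion) measurable
    also have "\<dots> = (\<integral>\<^sup>+z. g z \<partial>lborel)" by (rule nn_integral_toC[OF gm])
    finally show ?thesis by (simp add: g_def U_def)
  qed
  have inf: "(\<Sum>\<^sub>\<infinity>p\<in>ofC ` L. X p) = (\<Sum>\<^sub>\<infinity>p\<in>L. ct p)"
  proof -
    have "inj_on ofC L" by (metis inj_onI toC_ofC)
    then show ?thesis by (simp add: infsum_reindex o_def ct_def)
  qed
  have "W_cut (ofC ` L) j X = ereal (\<Sum>p\<in>F R. ct p * E + \<Delta> ct p / 2)"
    unfolding W_cut_def eq inf
    by (rule tendsto_Lim[OF _ cut_energy[OF c(1,2) X(3) c(3) X(5)]]) simp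
  then show ?thesis by (simp add: ct_def[abs_def])
qed

text \<open>After division by the area of the ball the boundary error vanishes by
  \<open>n_limit\<close>, so there is a genuine limit \<open>E / A\<close>, the same for every
  cutoff family.\<close>

lemma W_field_eq:
  assumes j: "AE x in lebesgue. (norm (j x))\<^sup>2 = N (toC x)"
  shows "W_field (ofC ` L) j = ereal (E / A)"
proof -
  have main: "Limsup at_top (\<lambda>R. W_cut (ofC ` L) j (X R) / ereal (measure lebesgue (ball (0 :: real^2) R))) = ereal (E / A)"
    if X: "cutoff_family X" for X
  proof -
    obtain C where C: "C \<ge> 0" "\<And>R x. R > 0 \<Longrightarrow> X R x \<ge> 0"
      "\<And>R x y. R > 0 \<Longrightarrow> \<bar>X R x - X R y\<bar> \<le> C * norm (x - y)"
      "\<And>R x. R > 0 \<Longrightarrow> norm x \<ge> R \<Longrightarrow> X R x = 0"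
      "\<And>R x. R > 0 \<Longrightarrow> norm x \<le> R - 1 \<Longrightarrow> X R x = 1"
      by (rule cutoff_family_props[OF X], rule that)
    define S where "S R = (\<Sum>p\<in>F R. X R (ofC p) * E + \<Delta> (\<lambda>z. X R (ofC z)) p / 2)" for R
    define K where "K = (2 + C) * \<bar>E\<bar> + C * M1"
    have Sb: "\<bar>S R - E * n (R - 1 - d)\<bar> \<le> K * (n (R + d) - n (R - 1 - d))" if R: "R > 0" for R
      unfolding S_def K_def
      by (rule cut_energy_bound[of "\<lambda>z. X R (ofC z)" C R])
         (use C(2)[OF R] C(3)[OF R, of "ofC _" "ofC _"] C(1) C(4)[OF R] C(5)[OF R] R in \<open>auto simp flip: ofC_diff\<close>)
    have W: "W_cut (ofC ` L) j (X R) / ereal (measure lebesgue (ball (0 :: real^2) R)) = ereal (S R / (pi * R\<^sup>2))" if R: "R > 0" for R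
    proof -
      have "measure lebesgue (ball (0 :: real^2) R) = pi * R\<^sup>2"
        using R by (simp add: content_ball unit_ball_vol_2)
      moreover have "W_cut (ofC ` L) j (X R) = ereal (S R)"
        unfolding S_def by (rule W_cut_eq[OF j C(2)[OF R] C(3)[OF R] C(1) C(4)[OF R] R])
      ultimately show ?thesis using R by simp
    qed
    have "((\<lambda>R. S R / (pi * R\<^sup>2)) \<longlongrightarrow> E / A) at_top"
    proof -
      have n1: "((\<lambda>R. n (R - 1 - d) / (pi * R\<^sup>2)) \<longlongrightarrow> 1 / A) at_top"
        using n_limit[of "- 1 - d"] by (simp add: algebra_simps)
      have a: "((\<lambda>R. E * (n (R - 1 - d) / (pi * R\<^sup>2))) \<longlongrightarrow> E * (1 / A)) at_top"
        by (intro tendsto_intros n1)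
      have b: "((\<lambda>R. K * (n (R + d) / (pi * R\<^sup>2) - n (R - 1 - d) / (pi * R\<^sup>2))) \<longlongrightarrow> K * (1 / A - 1 / A)) at_top"
        by (intro tendsto_intros n1 n_limit)
      have "((\<lambda>R. S R / (pi * R\<^sup>2) - E * (n (R - 1 - d) / (pi * R\<^sup>2))) \<longlongrightarrow> 0) at_top"
      proof (rule Lim_null_comparison)
        show "\<forall>\<^sub>F R in at_top. norm (S R / (pi * R\<^sup>2) - E * (n (R - 1 - d) / (pi * R\<^sup>2)))
            \<le> K * (n (R + d) / (pi * R\<^sup>2) - n (R - 1 - d) / (pi * R\<^sup>2))"
          using eventually_gt_at_top[of 0]
        proof eventually_elim
          case (elim R)
          have "S R / (pi * R\<^sup>2) - E * (n (R - 1 - d) / (pi * R\<^sup>2)) = (S R - E * n (R - 1 - d)) / (pi * R\<^sup>2)"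
            by (simp add: diff_divide_distrib)
          also have "norm \<dots> = \<bar>S R - E * n (R - 1 - d)\<bar> / (pi * R\<^sup>2)"
            using elim by simp
          also have "\<dots> \<le> (K * (n (R + d) - n (R - 1 - d))) / (pi * R\<^sup>2)"
            using elim Sb[OF elim] by (intro divide_right_mono) auto
          finally show ?case by (simp add: diff_divide_distrib right_diff_distrib)
        qed
        show "((\<lambda>R. K * (n (R + d) / (pi * R\<^sup>2) - n (R - 1 - d) / (pi * R\<^sup>2))) \<longlongrightarrow> 0) at_top"
          using b by simp
      qed
      from tendsto_add[OF this a] show ?thesis by simp
    qed
    then have "((\<lambda>R. ereal (S R / (pi * R\<^sup>2))) \<longlongrightarrow> ereal (E / A)) at_top" by (rule tendsto_ereal)
    then have "((\<lambda>R. W_cut (ofC ` L) j (X R) / ereal (measure lebesgue (ball (0 :: real^2) R))) \<longlongrightarrow> ereal (E / A)) at_top"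
    proof (rule Lim_transform_eventually)
      show "\<forall>\<^sub>F R in at_top. ereal (S R / (pi * R\<^sup>2)) = W_cut (ofC ` L) j (X R) / ereal (measure lebesgue (ball (0 :: real^2) R))"
        using eventually_gt_at_top[of 0] by eventually_elim (simp only: W)
    qed
    then show ?thesis by (intro lim_imp_Limsup) auto
  qed
  obtain X0 where X0: "cutoff_family X0" using cutoff_family_exists by blast
  show ?thesis
    unfolding W_field_def
  proof (rule the_equality)
    show "\<forall>X. cutoff_family X \<longrightarrow> ereal (E / A) = Limsup at_top (\<lambda>R. W_cut (ofC ` L) j (X R) / ereal (measure lebesgue (ball (0 :: real^2) R)))"
      using main by simp
    fix w assume "\<forall>X. cutoff_family X \<longrightarrow> w = Limsup at_top (\<lambda>R. W_cut (ofC ` L) j (X R) / ereal (measure lebesgue (ball (0 :: real^2) R)))"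
    from spec[OF this, of X0] show "w = ereal (E / A)" using X0 main[OF X0] by simp
  qed
qed

end

section \<open>The modular function\<close>

text \<open>\<open>pk s (cos \<theta>)\<close> is the real part of \<open>q / (1 - q)\<close> for \<open>q = s exp(\<i>\<theta>)\<close>.\<close>

definition pk :: "real \<Rightarrow> real \<Rightarrow> real" where
  "pk s c = (s * c - s\<^sup>2) / (1 - 2 * s * c + s\<^sup>2)"

text \<open>For q = r exp(i theta), expanding the logarithms shows that this is minus the sum over n
  of ln |1 - q^n|, the contribution of the infinite product in Dedekind's eta function.\<close>

definition Ssum :: "real \<Rightarrow> real \<Rightarrow> real" where
  "Ssum r \<theta> = (\<Sum>k. pk (r ^ Suc k) (cos (real (Suc k) * \<theta>)) / real (Suc k))"

definition Phi :: "real \<Rightarrow> real \<Rightarrow> real" where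
  "Phi a b = - ln b / 2 + pi * b / 6 + 2 * Ssum (exp (- 2 * pi * b)) (2 * pi * a)"

text \<open>The denominator of \<open>pk\<close> is |1 - q|^2 for a number q of modulus
  \<open>s\<close>, hence lies between the squares of 1 - s and 1 + s.\<close>

lemma pk_den:
  fixes s c :: real
  assumes "0 \<le> s" "s < 1" "\<bar>c\<bar> \<le> 1"
  shows "(1 - s)\<^sup>2 \<le> 1 - 2 * s * c + s\<^sup>2" "1 - 2 * s * c + s\<^sup>2 \<le> (1 + s)\<^sup>2" "0 < (1 - s)\<^sup>2"
    "0 < 1 - 2 * s * c + s\<^sup>2"
proof -
  have "s * c \<le> s * 1" "s * (-1) \<le> s * c" using assms by (intro mult_left_mono; simp)+
  then show 1: "(1 - s)\<^sup>2 \<le> 1 - 2 * s * c + s\<^sup>2" and "1 - 2 * s * c + s\<^sup>2 \<le> (1 + s)\<^sup>2"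
    by (simp_all add: power2_eq_square algebra_simps)
  show 2: "0 < (1 - s)\<^sup>2" using assms by simp
  from 1 2 show "0 < 1 - 2 * s * c + s\<^sup>2" by linarith
qed

section \<open>Comparison of the series with its value at the angle pi\<close>

lemma pk_diff:
  assumes "0 \<le> s" "s < 1" "\<bar>c\<bar> \<le> 1" "\<bar>c'\<bar> \<le> 1"
  shows "pk s c - pk s c' = s * (1 - s\<^sup>2) * (c - c') / ((1 - 2 * s * c + s\<^sup>2) * (1 - 2 * s * c' + s\<^sup>2))"
proof -
  have "1 - 2 * s * c + s\<^sup>2 \<noteq> 0" "1 - 2 * s * c' + s\<^sup>2 \<noteq> 0" using pk_den assms by fastforce+
  then show ?thesis
    unfolding pk_def by (simp add: diff_frac_eq) (simp add: algebra_simps power2_eq_square)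
qed

lemma pk_diff_lower:
  assumes "0 \<le> s" "s \<le> 1 / 10" "\<bar>c\<bar> \<le> 1" "\<bar>c'\<bar> \<le> 1" "c' \<le> c"
  shows "pk s c - pk s c' \<ge> (6 / 10) * s * (c - c')"
proof -
  have s1: "s < 1" using assms by simp
  define X Y where "X = 1 - 2 * s * c + s\<^sup>2" and "Y = 1 - 2 * s * c' + s\<^sup>2"
  have D: "(1 - s)\<^sup>2 \<le> X" "X \<le> (1 + s)\<^sup>2" "0 < (1 - s)\<^sup>2" "0 < X"
    unfolding X_def by (rule pk_den[OF assms(1) s1 assms(3)])+
  have D': "(1 - s)\<^sup>2 \<le> Y" "Y \<le> (1 + s)\<^sup>2" "0 < (1 - s)\<^sup>2" "0 < Y"
    unfolding Y_def by (rule pk_den[OF assms(1) s1 assms(4)])+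
  have s2: "s\<^sup>2 \<le> 1 / 100" using power_mono[OF assms(2,1), of 2] by (simp add: power2_eq_square)
  have "X * Y \<le> (1 + s)\<^sup>2 * (1 + s)\<^sup>2"
    using less_imp_le[OF D(4)] less_imp_le[OF D'(4)] by (intro mult_mono D D') auto
  also have "\<dots> \<le> (11 / 10)\<^sup>2 * (11 / 10)\<^sup>2" using assms by (intro mult_mono power_mono) auto
  finally have den: "X * Y \<le> 14641 / 10000"
    by (simp add: power2_eq_square)
  have sc: "0 \<le> s * (c - c')" using assms by simp
  have "s * (c - c') * (99 / 100) \<le> s * (c - c') * (1 - s\<^sup>2)"
    using s2 by (intro mult_left_mono sc) simp
  then have num: "s * (c - c') * (99 / 100) \<le> s * (1 - s\<^sup>2) * (c - c')"
    by (simp only: mult_ac)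
  have "(6 / 10) * s * (c - c') \<le> s * (c - c') * (99 / 100) / (14641 / 10000)"
  proof -
    define X where "X = s * (c - c')"
    have "(6 / 10) * X \<le> X * (99 / 100) / (14641 / 10000)" using sc unfolding X_def[symmetric] by simp
    then show ?thesis by (simp only: X_def mult.assoc)
  qed
  also have "\<dots> \<le> s * (1 - s\<^sup>2) * (c - c') / (X * Y)"
  proof (rule frac_le[OF _ num mult_pos_pos[OF D(4) D'(4)] den])
    show "0 \<le> s * (1 - s\<^sup>2) * (c - c')" using assms s2 by (intro mult_nonneg_nonneg) auto
  qed
  finally show ?thesis using pk_diff[OF assms(1) s1 assms(3,4)] by (simp add: X_def Y_def)
qed

lemma pk_diff_upper:
  assumes "0 \<le> s" "s \<le> 1 / 100" "\<bar>c\<bar> \<le> 1" "\<bar>c'\<bar> \<le> 1"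
  shows "\<bar>pk s c - pk s c'\<bar> \<le> (11 / 10) * s * \<bar>c - c'\<bar>"
proof -
  have s1: "s < 1" using assms by simp
  define X Y where "X = 1 - 2 * s * c + s\<^sup>2" and "Y = 1 - 2 * s * c' + s\<^sup>2"
  have D: "(1 - s)\<^sup>2 \<le> X" "X \<le> (1 + s)\<^sup>2" "0 < (1 - s)\<^sup>2" "0 < X"
    unfolding X_def by (rule pk_den[OF assms(1) s1 assms(3)])+
  have D': "(1 - s)\<^sup>2 \<le> Y" "Y \<le> (1 + s)\<^sup>2" "0 < (1 - s)\<^sup>2" "0 < Y"
    unfolding Y_def by (rule pk_den[OF assms(1) s1 assms(4)])+
  have "(99 / 100)\<^sup>2 * (99 / 100)\<^sup>2 \<le> (1 - s)\<^sup>2 * (1 - s)\<^sup>2" using assms by (intro mult_mono power_mono) auto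
  also have "\<dots> \<le> X * Y"
    using less_imp_le[OF D(4)] by (intro mult_mono D D') auto
  finally have den: "10 / 11 \<le> X * Y"
    by (simp add: power2_eq_square)
  have s2: "s\<^sup>2 \<le> 1" using power_mono[of s 1 2] assms by simp
  note DD = mult_pos_pos[OF D(4) D'(4)]
  have "\<bar>pk s c - pk s c'\<bar> = s * (1 - s\<^sup>2) * \<bar>c - c'\<bar> / (X * Y)"
    unfolding pk_diff[OF assms(1) s1 assms(3,4), folded X_def Y_def] abs_divide abs_of_pos[OF DD] using assms(1) s2
    by (simp add: abs_mult)
  also have "\<dots> \<le> s * 1 * \<bar>c - c'\<bar> / (10 / 11)"
    using den assms s2 by (intro frac_le mult_mono) auto
  finally show ?thesis by simp
qed

lemma abs_sin_mult_le: "\<bar>sin (real n * x)\<bar> \<le> real n * \<bar>sin x\<bar>"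
proof (induction n)
  case (Suc n)
  have "sin (real (Suc n) * x) = sin (real n * x) * cos x + cos (real n * x) * sin x"
    by (simp add: distrib_right sin_add add.commute)
  then have "\<bar>sin (real (Suc n) * x)\<bar> \<le> \<bar>sin (real n * x)\<bar> * \<bar>cos x\<bar> + \<bar>cos (real n * x)\<bar> * \<bar>sin x\<bar>"
    by (metis abs_mult abs_triangle_ineq)
  also have "\<dots> \<le> \<bar>sin (real n * x)\<bar> * 1 + 1 * \<bar>sin x\<bar>"
    by (intro add_mono mult_mono) auto
  finally show ?case using Suc by (simp add: algebra_simps)
qed simp

text \<open>With x = (theta - pi) / 2 the left side is 2 sin(n x)^2 and 1 + cos theta is 2 sin(x)^2.
  This makes every frequency comparable to the first one, at the price of n^2.\<close>

lemma cos_mult_pi_diff: "\<bar>cos (real n * \<theta>) - cos (real n * pi)\<bar> \<le> (real n)\<^sup>2 * (1 + cos \<theta>)"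
proof -
  define x where "x = (\<theta> - pi) / 2"
  have th: "\<theta> = 2 * x + pi" by (simp add: x_def field_simps)
  have "cos (real n * \<theta>) = cos (2 * (real n * x) + real n * pi)" by (simp add: th algebra_simps)
  also have "\<dots> = cos (2 * (real n * x)) * cos (real n * pi)" by (simp add: cos_add)
  finally have c: "cos (real n * \<theta>) = cos (2 * (real n * x)) * cos (real n * pi)" .
  have "cos (real n * \<theta>) - cos (real n * pi) = - (cos (real n * pi) * (2 * (sin (real n * x))\<^sup>2))"
    unfolding c cos_double_sin by (simp add: algebra_simps)
  then have "\<bar>cos (real n * \<theta>) - cos (real n * pi)\<bar> = 2 * (sin (real n * x))\<^sup>2"
    by (simp add: abs_mult cos_npi2)
  also have "\<dots> \<le> 2 * (real n * \<bar>sin x\<bar>)\<^sup>2"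
    using power_mono[OF abs_sin_mult_le[of n x], of 2] by simp
  also have "\<dots> = (real n)\<^sup>2 * (2 * (sin x)\<^sup>2)" by (simp add: power_mult_distrib)
  also have "2 * (sin x)\<^sup>2 = 1 + cos \<theta>"
    by (simp add: th cos_add cos_double_sin)
  finally show ?thesis .
qed

lemma pk_bound:
  assumes "0 \<le> s" "s \<le> 1 / 10" "\<bar>c\<bar> \<le> 1"
  shows "\<bar>pk s c\<bar> \<le> 2 * s"
proof -
  have s1: "s < 1" using assms by simp
  note D = pk_den[OF assms(1) s1 assms(3)]
  have "(9 / 10)\<^sup>2 \<le> (1 - s)\<^sup>2" using assms by (intro power_mono) auto
  then have den: "8 / 10 \<le> 1 - 2 * s * c + s\<^sup>2" using D by (simp add: power2_eq_square)
  have "s * c - s\<^sup>2 = s * (c - s)" by (simp add: power2_eq_square algebra_simps)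
  then have "\<bar>s * c - s\<^sup>2\<bar> = s * \<bar>c - s\<bar>"
    using assms(1) by (simp add: abs_mult)
  also have "\<dots> \<le> s * (11 / 10)"
  proof (intro mult_left_mono assms)
    show "\<bar>c - s\<bar> \<le> 11 / 10" using assms by linarith
  qed
  finally have "\<bar>s * c - s\<^sup>2\<bar> \<le> s * (11 / 10)" .
  then have "\<bar>pk s c\<bar> \<le> s * (11 / 10) / (8 / 10)"
    unfolding pk_def abs_divide using den assms by (intro frac_le) auto
  then show ?thesis using assms by simp
qed

lemma power_Suc_le_10:
  assumes "0 \<le> r" "r \<le> (1::real) / 10"
  shows "0 \<le> r ^ Suc k" "r ^ Suc k \<le> 1 / 10" "r ^ Suc k \<le> r"
proof -
  show "0 \<le> r ^ Suc k" using assms by simp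
  have "r ^ Suc k \<le> r ^ 1" using assms by (intro power_decreasing) auto
  then show "r ^ Suc k \<le> r" by simp
  with assms show "r ^ Suc k \<le> 1 / 10" by linarith
qed

lemma summable_Ssum:
  assumes "0 \<le> r" "r \<le> 1 / 10"
  shows "summable (\<lambda>k. pk (r ^ Suc k) (cos (real (Suc k) * \<theta>)) / real (Suc k))"
proof (rule summable_comparison_test')
  show "summable (\<lambda>k. 2 * r ^ Suc k)"
    using assms by (intro summable_mult) (simp_all add: summable_geometric)
  fix k :: nat
  have "\<bar>pk (r ^ Suc k) (cos (real (Suc k) * \<theta>))\<bar> / real (Suc k) \<le> (2 * r ^ Suc k) / 1"
    using power_Suc_le_10[OF assms] by (intro frac_le pk_bound) auto
  then show "norm (pk (r ^ Suc k) (cos (real (Suc k) * \<theta>)) / real (Suc k)) \<le> 2 * r ^ Suc k"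
    by simp
qed

text \<open>All terms are measured in u = 1 + cos theta. The first one gains at least 0.6 r u. A
  term of frequency n can lose at most 1.1 n r^n u, and all of them from n = 2 on lose at most 0.275
  r u, so more than r u / 4 is left when u is positive.\<close>

lemma Ssum_diff_lower:
  assumes "0 < r" "r \<le> 1 / 10"
  shows "Ssum r \<theta> - Ssum r pi \<ge> (1 + cos \<theta>) * (r / 4)"
proof -
  have r0: "0 \<le> r" using assms by simp
  define f where "f k = (pk (r ^ Suc k) (cos (real (Suc k) * \<theta>)) - pk (r ^ Suc k) (cos (real (Suc k) * pi))) / real (Suc k)" for k
  have sf: "f sums (Ssum r \<theta> - Ssum r pi)"
    unfolding f_def diff_divide_distrib Ssum_def
    by (intro sums_diff summable_sums summable_Ssum r0 assms)
  define u where "u = 1 + cos \<theta>"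
  have u: "u \<ge> 0" using cos_ge_minus_one[of \<theta>] unfolding u_def by linarith
  have f0: "f 0 \<ge> (6 / 10) * r * u"
    using pk_diff_lower[OF r0 assms(2), of "cos \<theta>" "-1"] cos_ge_minus_one[of \<theta>] by (simp add: f_def u_def add.commute)
  have fS: "f (Suc k) \<ge> - (11 / 10 * u * (4 * r\<^sup>2 / 2) * (2 * r) ^ k)" for k
  proof -
    define K where "K = real (Suc (Suc k))"
    define s where "s = r ^ Suc (Suc k)"
    have K: "K \<ge> 1" by (simp add: K_def)
    have "s \<le> r ^ 2" unfolding s_def using assms by (intro power_decreasing) auto
    also have "\<dots> \<le> (1 / 10)\<^sup>2" using assms by (intro power_mono) auto
    finally have s: "0 \<le> s" "s \<le> 1 / 100" using assms by (auto simp: s_def power2_eq_square)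
    have "\<bar>pk s (cos (K * \<theta>)) - pk s (cos (K * pi))\<bar> \<le> 11 / 10 * s * \<bar>cos (K * \<theta>) - cos (K * pi)\<bar>"
      by (intro pk_diff_upper s) auto
    also have "\<dots> \<le> 11 / 10 * s * (K\<^sup>2 * u)"
      unfolding K_def u_def using s by (intro mult_left_mono cos_mult_pi_diff) auto
    finally have "\<bar>pk s (cos (K * \<theta>)) - pk s (cos (K * pi))\<bar> / K \<le> 11 / 10 * s * (K\<^sup>2 * u) / K"
      using K by (intro divide_right_mono) auto
    then have "\<bar>f (Suc k)\<bar> \<le> 11 / 10 * s * (K\<^sup>2 * u) / K"
      using K unfolding f_def K_def[symmetric] s_def[symmetric] abs_divide by simp
    also have "\<dots> = 11 / 10 * u * (K * s)" using K by (simp add: power2_eq_square)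
    also have "\<dots> \<le> 11 / 10 * u * ((4 * r\<^sup>2 / 2) * (2 * r) ^ k)"
    proof (intro mult_left_mono)
      \<comment> \<open>Bounding the frequency by a power of two absorbs it into the ratio of a
        geometric series, which becomes \<open>2 * r\<close> and is at most 1/5.\<close>
      have "Suc (Suc k) \<le> 2 * 2 ^ k" by (induction k) auto
      then have "real (Suc (Suc k)) \<le> real (2 * 2 ^ k)" by (rule of_nat_mono)
      then have "K \<le> 2 * 2 ^ k" by (simp add: K_def)
      then have "K * s \<le> 2 * 2 ^ k * s" using s by (intro mult_right_mono)
      also have "\<dots> = (4 * r\<^sup>2 / 2) * (2 * r) ^ k" by (simp add: s_def power_mult_distrib power2_eq_square)
      finally show "K * s \<le> (4 * r\<^sup>2 / 2) * (2 * r) ^ k" .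
    qed (use u in auto)
    finally show ?thesis by (simp add: mult_ac)
  qed
  have g: "(\<lambda>k. - (11 / 10 * u * (4 * r\<^sup>2 / 2) * (2 * r) ^ k)) sums - (11 / 10 * u * (4 * r\<^sup>2 / 2) * (1 / (1 - 2 * r)))"
    using assms by (intro sums_minus sums_mult geometric_sums) auto
  have "(\<lambda>k. f (Suc k)) sums (Ssum r \<theta> - Ssum r pi - f 0)"
    using sf by (simp add: sums_Suc_iff)
  from sums_le[OF fS g this]
  have 1: "Ssum r \<theta> - Ssum r pi \<ge> f 0 - 11 / 10 * u * (4 * r\<^sup>2 / 2) * (1 / (1 - 2 * r))" by linarith
  have "11 / 10 * u * (4 * r\<^sup>2 / 2) * (1 / (1 - 2 * r)) \<le> 11 / 10 * u * (2 * (r * (1 / 10))) * (1 / (8 / 10))"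
    using assms u by (intro mult_mono frac_le) (auto simp: power2_eq_square)
  also have "\<dots> = 275 / 1000 * (u * r)" by simp
  finally have "Ssum r \<theta> - Ssum r pi \<ge> 6 / 10 * (u * r) - 275 / 1000 * (u * r)"
    using 1 f0 by (simp add: mult_ac)
  moreover have "u * r \<ge> 0" using u r0 by simp
  ultimately have "Ssum r \<theta> - Ssum r pi \<ge> (u * r) / 4" by linarith
  then show ?thesis by (simp add: u_def[symmetric])
qed

text \<open>All estimates of the series are made for r <= 1/10. Since e >= 5/2, already e^3 exceeds
  10, and pi > 3 makes b >= 1/2 sufficient; this is the origin of the threshold 1/2.\<close>

lemma exp_minus_le_10:
  assumes "b \<ge> 1 / 2"
  shows "exp (- 2 * pi * b) \<le> 1 / 10"
proof -
  have "exp (1::real) \<ge> 5 / 2" using exp_lower_Taylor_quadratic[of 1] by simp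
  then have "(5 / 2) ^ 3 \<le> exp (1::real) ^ 3" by (intro power_mono) auto
  also have "\<dots> = exp 3" by (simp flip: exp_of_nat_mult)
  also have "\<dots> \<le> exp (2 * pi * b)"
    using pi_gt3 assms mult_mono[of 3 pi 1 "2 * b"] by (simp add: mult_ac)
  finally have "10 \<le> exp (2 * pi * b)" by (simp add: power3_eq_cube)
  then show ?thesis by (simp add: exp_minus field_simps)
qed

lemma Phi_ge_half:
  assumes "b \<ge> 1 / 2"
  shows "Phi a b \<ge> Phi (1 / 2) b" "cos (2 * pi * a) \<noteq> -1 \<Longrightarrow> Phi a b > Phi (1 / 2) b"
proof -
  define r where "r = exp (- 2 * pi * b)"
  have r: "0 < r" "r \<le> 1 / 10" unfolding r_def using exp_minus_le_10[OF assms] by auto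
  define D where "D = Ssum r (2 * pi * a) - Ssum r pi"
  have P: "Phi a b = Phi (1 / 2) b + 2 * D"
    by (simp add: Phi_def r_def D_def)
  define w where "w = (1 + cos (2 * pi * a)) * (r / 4)"
  have L: "w \<le> D" unfolding w_def D_def by (rule Ssum_diff_lower[OF r])
  have c: "1 + cos (2 * pi * a) \<ge> 0" using cos_ge_minus_one[of "2 * pi * a"] by linarith
  then have "w \<ge> 0" using r unfolding w_def by simp
  then show "Phi a b \<ge> Phi (1 / 2) b" using L unfolding P by simp
  assume "cos (2 * pi * a) \<noteq> -1"
  then have "w > 0" using r c unfolding w_def by (intro mult_pos_pos) auto
  then show "Phi a b > Phi (1 / 2) b" using L unfolding P by simp
qed

section \<open>The modular function on the line a = 1/2\<close>

lemma pk_one_diff: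
  assumes s: "0 \<le> s" "s \<le> 1 / 10" "0 \<le> t" "t \<le> 1 / 10" and c: "c = 1 \<or> c = -1"
  shows "\<bar>pk s c - pk t c\<bar> \<le> 13 / 10 * \<bar>s - t\<bar>"
proof -
  have d: "1 - s * c \<ge> 9 / 10" "1 - t * c \<ge> 9 / 10" using s c by auto
  \<comment> \<open>For c = 1 or c = -1 the number q is real, and the denominator is a perfect
    square.\<close>
  have pk1: "pk x c = x * c / (1 - x * c)" if "1 - x * c \<ge> 9 / 10" for x
  proof -
    have c2: "c * c = 1" using c by auto
    then have "1 - 2 * x * c + x\<^sup>2 = (1 - x * c) * (1 - x * c)" "x * c - x\<^sup>2 = x * c * (1 - x * c)"
      by (auto simp: power2_eq_square algebra_simps)
    then show ?thesis using that by (simp add: pk_def)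
  qed
  have "pk s c - pk t c = (s - t) * c / ((1 - s * c) * (1 - t * c))"
    unfolding pk1[OF d(1)] pk1[OF d(2)] using d by (simp add: diff_frac_eq) (simp add: algebra_simps)
  also have "\<bar>\<dots>\<bar> = \<bar>s - t\<bar> / ((1 - s * c) * (1 - t * c))"
    using d c by (auto simp: abs_mult)
  also have "\<dots> \<le> \<bar>s - t\<bar> / ((9 / 10) * (9 / 10))"
    using d by (intro divide_left_mono mult_mono) (auto intro!: mult_pos_pos)
  also have "\<dots> \<le> 13 / 10 * \<bar>s - t\<bar>" by simp
  finally show ?thesis .
qed

lemma cos_npi_cases: "cos (real n * pi) = 1 \<or> cos (real n * pi) = -1"
  by (cases "even n") (auto simp: cos_npi)

lemma power_diff_bound:
  assumes "0 \<le> r" "r \<le> t" "t \<le> (1::real) / 10"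
  shows "t ^ Suc k - r ^ Suc k \<le> real (Suc k) * (1 / 10) ^ k * (t - r)"
proof (induction k)
  case (Suc k)
  have "t ^ Suc (Suc k) - r ^ Suc (Suc k) = t * (t ^ Suc k - r ^ Suc k) + (t - r) * r ^ Suc k"
    by (simp add: algebra_simps)
  also have "\<dots> \<le> (1 / 10) * (real (Suc k) * (1 / 10) ^ k * (t - r)) + (t - r) * (1 / 10) ^ Suc k"
    using assms Suc power_mono[OF assms(2,1), of "Suc k"]
    by (intro add_mono mult_mono mult_left_mono power_mono) auto
  also have "\<dots> = real (Suc (Suc k)) * (1 / 10) ^ Suc k * (t - r)"
    by (simp add: field_simps)
  finally show ?case .
qed simp

text \<open>The first term, -x / (1 + x), decreases at a rate of at least 0.8, while the others
  together change at a rate below 0.15; so the sum decreases. The upper bound yields the continuity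
  of \<open>Phi\<close> on the line.\<close>

lemma Ssum_pi_diff:
  assumes "0 \<le> r" "r \<le> t" "t \<le> 1 / 10"
  shows "Ssum r pi \<ge> Ssum t pi" "Ssum r pi - Ssum t pi \<le> 2 * (t - r)"
proof -
  define f where "f k = (pk (r ^ Suc k) (cos (real (Suc k) * pi)) - pk (t ^ Suc k) (cos (real (Suc k) * pi))) / real (Suc k)" for k
  have sf: "f sums (Ssum r pi - Ssum t pi)"
    unfolding f_def diff_divide_distrib Ssum_def using assms
    by (intro sums_diff summable_sums summable_Ssum) auto
  have fk: "\<bar>f k\<bar> \<le> 13 / 10 * (t - r) * (1 / 10) ^ k" for k
  proof -
    have "\<bar>pk (r ^ Suc k) (cos (real (Suc k) * pi)) - pk (t ^ Suc k) (cos (real (Suc k) * pi))\<bar> \<le> 13 / 10 * \<bar>r ^ Suc k - t ^ Suc k\<bar>"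
      using assms by (intro pk_one_diff power_Suc_le_10 cos_npi_cases) auto
    also have "\<bar>r ^ Suc k - t ^ Suc k\<bar> = t ^ Suc k - r ^ Suc k"
      using power_mono[OF assms(2,1), of "Suc k"] by simp
    also have "13 / 10 * (t ^ Suc k - r ^ Suc k) \<le> 13 / 10 * (real (Suc k) * (1 / 10) ^ k * (t - r))"
      using power_diff_bound[OF assms] by (intro mult_left_mono) auto
    finally have "\<bar>f k\<bar> \<le> 13 / 10 * (real (Suc k) * (1 / 10) ^ k * (t - r)) / real (Suc k)"
      unfolding f_def abs_divide abs_of_nat by (rule divide_right_mono) simp_all
    also have "\<dots> = 13 / 10 * (t - r) * (1 / 10) ^ k" by (simp del: of_nat_Suc)
    finally show ?thesis .
  qed
  have g: "(\<lambda>k. 13 / 10 * (t - r) * (1 / 10) ^ k) sums (13 / 10 * (t - r) * (1 / (1 - 1 / 10)))"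
    by (intro sums_mult geometric_sums) auto
  have "Ssum r pi - Ssum t pi \<le> 13 / 10 * (t - r) * (1 / (1 - 1 / 10))"
    by (rule sums_le[OF _ sf g]) (rule order_trans[OF abs_ge_self fk])
  then show "Ssum r pi - Ssum t pi \<le> 2 * (t - r)" using assms by simp
  have f0: "f 0 \<ge> 8 / 10 * (t - r)"
  proof -
    have "pk x (-1) = - x / (1 + x)" if "0 \<le> x" for x
    proof -
      have "1 - 2 * x * (-1) + x\<^sup>2 = (1 + x) * (1 + x)" "x * (-1) - x\<^sup>2 = - x * (1 + x)"
        by (auto simp: power2_eq_square algebra_simps)
      then show ?thesis using that by (simp add: pk_def)
    qed
    then have "f 0 = t / (1 + t) - r / (1 + r)" using assms by (simp add: f_def)
    also have "\<dots> = (t - r) / ((1 + t) * (1 + r))"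
      using assms by (simp add: diff_frac_eq) (simp add: algebra_simps)
    also have "\<dots> \<ge> (t - r) / ((11 / 10) * (11 / 10))"
      using assms by (intro divide_left_mono mult_mono) auto
    finally show ?thesis using assms by simp
  qed
  have fS: "f (Suc k) \<ge> - (13 / 100 * (t - r) * (1 / 10) ^ k)" for k
    using fk[of "Suc k"] by (simp add: abs_le_iff)
  have g': "(\<lambda>k. - (13 / 100 * (t - r) * (1 / 10) ^ k)) sums - (13 / 100 * (t - r) * (1 / (1 - 1 / 10)))"
    by (intro sums_minus sums_mult geometric_sums) auto
  have "(\<lambda>k. f (Suc k)) sums (Ssum r pi - Ssum t pi - f 0)"
    using sf by (simp add: sums_Suc_iff)
  from sums_le[OF fS g' this]
  have 1: "- (13 / 100 * (t - r) * (10 / 9)) \<le> Ssum r pi - Ssum t pi - f 0" by simp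
  obtain v where v: "t - r = v" by blast
  have "v \<ge> 0" using assms(2) v by simp
  then show "Ssum r pi \<ge> Ssum t pi" using f0 1 unfolding v by simp
qed

text \<open>Beyond b = 1 the linear term gains pi/6 per unit, more than the 1/2 that the logarithm
  can take away, and the series does not decrease because its argument exp(- 2 pi b) becomes
  smaller.\<close>

lemma Phi_half_gt_1:
  assumes "b > 1"
  shows "Phi (1 / 2) b > Phi (1 / 2) 1"
proof -
  have "Ssum (exp (- 2 * pi * b)) pi \<ge> Ssum (exp (- 2 * pi * 1)) pi"
    using assms exp_minus_le_10[of 1] by (intro Ssum_pi_diff) auto
  moreover have "ln b \<le> b - 1" using assms ln_le_minus_one[of b] by simp
  moreover have "3 * (b - 1) < pi * (b - 1)" using assms pi_gt3 by (intro mult_strict_right_mono) auto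
  ultimately show ?thesis by (simp add: Phi_def algebra_simps)
qed

lemma continuous_on_Phi_half: "continuous_on {1 / 2..} (Phi (1 / 2))"
proof -
  have lip: "\<bar>Ssum x pi - Ssum y pi\<bar> \<le> 2 * \<bar>x - y\<bar>" if "x \<in> {0..1/10}" "y \<in> {0..1/10}" for x y
    using that Ssum_pi_diff[of x y] Ssum_pi_diff[of y x] by (cases "x \<le> y") auto
  have "continuous_on {0..1 / 10} (\<lambda>r. Ssum r pi)"
    by (intro lipschitz_on_continuous_on[of 2]) (auto simp: lipschitz_on_def dist_real_def intro!: lip)
  then have "continuous_on {1 / 2..} (\<lambda>b. Ssum (exp (- 2 * pi * b)) pi)"
    by (rule continuous_on_compose2) (auto intro!: continuous_intros exp_minus_le_10[simplified])
  then show ?thesis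
    unfolding Phi_def by (intro continuous_intros) auto
qed

lemma cos_ne_minus_one:
  assumes "0 < \<bar>x\<bar>" "\<bar>x\<bar> < 2 * pi" "\<bar>x\<bar> \<noteq> pi"
  shows "cos x \<noteq> -1"
proof
  assume c: "cos x = -1"
  then have "cos \<bar>x\<bar> = -1" by (simp add: cos_abs_real)
  then obtain k :: int where "\<bar>x\<bar> = (2 * of_int k + 1) * pi"
    using cos_eq_minus1[of "\<bar>x\<bar>"] by blast
  then have "0 < (2 * of_int k + 1) * pi" "(2 * of_int k + 1) * pi < 2 * pi" using assms by auto
  then have "0 < 2 * real_of_int k + 1" "2 * real_of_int k + 1 < 2" by (auto simp: zero_less_mult_iff)
  then have "k = 0" by linarith
  then show False using \<open>\<bar>x\<bar> = _\<close> assms by simp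
qed

text \<open>Inversion is an assumption here because it comes from the energy of a lattice, computed
  later; \<open>Phi_triangular_min\<close> discharges it by \<open>Phi_inversion\<close>.\<close>

context
  assumes inversion: "\<And>a b. b > 1 / 2 \<Longrightarrow> b / (a\<^sup>2 + b\<^sup>2) > 1 / 2 \<Longrightarrow>
      Phi a b = Phi (- a / (a\<^sup>2 + b\<^sup>2)) (b / (a\<^sup>2 + b\<^sup>2))"
begin

text \<open>With s = 1/4 + b^2, inversion sends 1/2 + i b to (-1/2 + i b) / s. The bounds on b keep
  1/s between 0 and 2, where cos(pi / s) = -1 only for s = 1; so the return to the line a = 1/2
  lowers \<open>Phi\<close> strictly.\<close>

lemma Phi_half_step:
  assumes "4 / 5 \<le> b" "b \<le> 1" "b\<^sup>2 \<noteq> 3 / 4"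
  shows "Phi (1 / 2) b > Phi (1 / 2) (b / (1 / 4 + b\<^sup>2))"
proof -
  define s where "s = 1 / 4 + b\<^sup>2"
  have s: "8 / 10 \<le> s" "s \<le> 5 / 4" "s \<noteq> 1"
    using power_mono[OF assms(1), of 2] power_mono[OF assms(2), of 2] assms by (auto simp: s_def power2_eq_square)
  have bs: "b / s > 1 / 2" using s assms by (simp add: field_simps)
  have "Phi (1 / 2) b = Phi (- (1 / 2) / s) (b / s)"
    using inversion[of b "1 / 2"] bs assms by (simp add: s_def power2_eq_square)
  also have "\<dots> > Phi (1 / 2) (b / s)"
  proof (intro Phi_ge_half(2) cos_ne_minus_one)
    have e: "\<bar>2 * pi * (- (1 / 2) / s)\<bar> = pi * (1 / s)" using s by (simp add: abs_mult)
    have "1 / s < 2" "1 / s \<noteq> 1" "0 < 1 / s" using s by (auto simp: field_simps)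
    then show "0 < \<bar>2 * pi * (- (1 / 2) / s)\<bar>" "\<bar>2 * pi * (- (1 / 2) / s)\<bar> < 2 * pi" "\<bar>2 * pi * (- (1 / 2) / s)\<bar> \<noteq> pi"
      unfolding e using pi_gt_zero by (auto simp del: times_divide_eq_right)
  qed (use bs in auto)
  finally show ?thesis by (simp add: s_def)
qed

lemma Phi_half_min:
  assumes "b > sqrt 3 / 2"
  shows "Phi (1 / 2) b > Phi (1 / 2) (sqrt 3 / 2)"
proof -
  define h where "h = sqrt 3 / 2"
  have h2: "h\<^sup>2 = 3 / 4" by (simp add: h_def power_divide)
  have h0: "h > 0" by (simp add: h_def)
  have "(8 / 10)\<^sup>2 < h\<^sup>2" unfolding h2 by (simp add: power2_eq_square)
  then have h8: "8 / 10 < h" by (rule power2_less_imp_less[OF _ less_imp_le[OF h0]])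
  have "h\<^sup>2 < 1\<^sup>2" unfolding h2 by simp
  then have h1: "h < 1" by (rule power2_less_imp_less) simp
  have main: "Phi (1 / 2) x > Phi (1 / 2) h" if x: "h < x" "x \<le> 1" for x
  proof -
    have "continuous_on {h..1} (Phi (1 / 2))"
      using h8 by (intro continuous_on_subset[OF continuous_on_Phi_half]) auto
    then obtain y where y: "y \<in> {h..1}" "\<And>z. z \<in> {h..1} \<Longrightarrow> Phi (1 / 2) y \<le> Phi (1 / 2) z"
      using continuous_attains_inf[of "{h..1}" "Phi (1 / 2)"] h1 by fastforce
    \<comment> \<open>Two moves take z first to z1 in [4/5, h) and then to z2 in (h, 1], inside the
      interval over which y is a minimizer.\<close>
    have step: False if z: "h < z" "z \<le> 1" "Phi (1 / 2) z \<le> Phi (1 / 2) y" for z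
    proof -
      define z1 where "z1 = z / (1 / 4 + z\<^sup>2)"
      define z2 where "z2 = z1 / (1 / 4 + z1\<^sup>2)"
      have zz: "z\<^sup>2 > 3 / 4" using power_strict_mono[OF z(1), of 2] h0 by (simp add: h2)
      have p1: "Phi (1 / 2) z > Phi (1 / 2) z1"
        unfolding z1_def using z h8 zz by (intro Phi_half_step) auto
      have pos: "1 / 4 + z\<^sup>2 > 0" using zz by simp
      \<comment> \<open>The zeros 1 and 1/4 of the product are the two solutions of z / (1/4 + z^2)
        = 4/5, the lower end of the range of \<open>Phi_half_step\<close>.\<close>
      have "0 \<le> (1 - z) * (8 / 10 * z - 2 / 10)" using z h8 by (intro mult_nonneg_nonneg) auto
      also have "(1 - z) * (8 / 10 * z - 2 / 10) = z - 4 / 5 * (1 / 4 + z\<^sup>2)"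
        by (simp add: field_simps power2_eq_square)
      finally have "4 / 5 * (1 / 4 + z\<^sup>2) \<le> z" by (simp only: diff_ge_0_iff_ge)
      then have z1a: "4 / 5 \<le> z1"
        unfolding z1_def using pos by (simp only: pos_le_divide_eq)
      \<comment> \<open>The factors vanish at the two solutions h and 1 / (4 h) of z / (1/4 + z^2) =
        h; positivity says that z lands on the other side of the fixed point.\<close>
      have "0 < (z - h) * (h * z - 1 / 4)"
      proof (rule mult_pos_pos)
        have "h * h \<le> h * z" using z h0 by (intro mult_left_mono) auto
        then show "0 < h * z - 1 / 4" using h2 by (simp add: power2_eq_square)
      qed (use z in auto)
      also have "(z - h) * (h * z - 1 / 4) = h * (1 / 4 + z\<^sup>2) - z * (h\<^sup>2 + 1 / 4)"
        by (simp add: field_simps power2_eq_square)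
      also have "z * (h\<^sup>2 + 1 / 4) = z" by (simp add: h2)
      finally have "z < h * (1 / 4 + z\<^sup>2)" by (simp only: diff_gt_0_iff_gt)
      then have z1b: "z1 < h" unfolding z1_def using pos by (simp only: pos_divide_less_eq)
      have z1z: "z1\<^sup>2 < 3 / 4" using power_strict_mono[OF z1b, of 2] z1a by (simp add: h2)
      have p2: "Phi (1 / 2) z1 > Phi (1 / 2) z2"
        unfolding z2_def using z1a z1b h1 z1z by (intro Phi_half_step) auto
      have pos1: "1 / 4 + z1\<^sup>2 > 0" by (simp add: add_pos_nonneg)
      have "0 < (h - z1) * (h * z1 - 1 / 4)"
      proof (rule mult_pos_pos)
        have "(8 / 10) * (8 / 10) \<le> h * z1" using z1a h8 by (intro mult_mono) auto
        then show "0 < h * z1 - 1 / 4" by simp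
      qed (use z1b in auto)
      also have "(h - z1) * (h * z1 - 1 / 4) = z1 * (h\<^sup>2 + 1 / 4) - h * (1 / 4 + z1\<^sup>2)"
        by (simp add: field_simps power2_eq_square)
      also have "z1 * (h\<^sup>2 + 1 / 4) = z1" by (simp add: h2)
      finally have "h * (1 / 4 + z1\<^sup>2) < z1" by (simp only: diff_gt_0_iff_gt)
      then have z2a: "h < z2" unfolding z2_def using pos1 by (simp only: pos_less_divide_eq)
      \<comment> \<open>The map b -> b / (1/4 + b^2) nowhere exceeds 1, its value at 1/2.\<close>
      have "0 \<le> (z1 - 1 / 2)\<^sup>2" by simp
      also have "(z1 - 1 / 2)\<^sup>2 = (1 / 4 + z1\<^sup>2) - z1" by (simp add: power2_eq_square field_simps)
      finally have "z1 \<le> 1 * (1 / 4 + z1\<^sup>2)" by simp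
      then have z2b: "z2 \<le> 1" unfolding z2_def using pos1 by (simp only: pos_divide_le_eq)
      have "Phi (1 / 2) y \<le> Phi (1 / 2) z2" using z2a z2b by (intro y) auto
      then show False using p1 p2 z(3) by linarith
    qed
    have "y = h" using y(1) step[of y] by force
    then show ?thesis using y(2)[of x] step[of x] x by fastforce
  qed
  show ?thesis
  proof (cases "b \<le> 1")
    case True
    then show ?thesis using main[of b] assms by (simp add: h_def)
  next
    case False
    then show ?thesis using main[of 1] Phi_half_gt_1[of b] h1 by (simp add: h_def)
  qed
qed

lemma Phi_min:
  assumes "\<bar>a\<bar> \<le> 1 / 2" "a\<^sup>2 + b\<^sup>2 \<ge> 1" "b > 0"
  shows "Phi a b \<ge> Phi (1 / 2) (sqrt 3 / 2)"
    "Phi a b = Phi (1 / 2) (sqrt 3 / 2) \<Longrightarrow> \<bar>a\<bar> = 1 / 2 \<and> b = sqrt 3 / 2"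
proof -
  have "a\<^sup>2 \<le> 1 / 4" using power_mono[OF assms(1), of 2] by (simp add: power2_eq_square)
  then have "3 / 4 \<le> b\<^sup>2" using assms(2) by linarith
  then have "(sqrt 3 / 2)\<^sup>2 \<le> b\<^sup>2" by (simp add: power_divide)
  then have b: "sqrt 3 / 2 \<le> b" by (rule power2_le_imp_le[OF _ less_imp_le[OF assms(3)]])
  have "(1::real) \<le> sqrt 3" by simp
  then have b2: "1 / 2 \<le> b" using b by linarith
  have 1: "Phi (1 / 2) b \<ge> Phi (1 / 2) (sqrt 3 / 2)"
    using less_imp_le[OF Phi_half_min[of b]] b unfolding le_less[of "sqrt 3 / 2" b] by blast
  then show "Phi a b \<ge> Phi (1 / 2) (sqrt 3 / 2)"
    using Phi_ge_half(1)[OF b2, of a] by linarith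
  assume eq: "Phi a b = Phi (1 / 2) (sqrt 3 / 2)"
  have "b = sqrt 3 / 2"
  proof (rule ccontr)
    assume "b \<noteq> sqrt 3 / 2"
    then have "sqrt 3 / 2 < b" using b by linarith
    from Phi_half_min[OF this] show False using Phi_ge_half(1)[OF b2, of a] eq by linarith
  qed
  moreover have "\<bar>a\<bar> = 1 / 2"
  proof (rule ccontr)
    assume n: "\<bar>a\<bar> \<noteq> 1 / 2"
    have "cos (2 * pi * a) \<noteq> -1"
    proof (cases "a = 0")
      case False
      show ?thesis
      proof (rule cos_ne_minus_one)
        have e: "\<bar>2 * pi * a\<bar> = pi * (2 * \<bar>a\<bar>)" by (simp add: abs_mult)
        show "0 < \<bar>2 * pi * a\<bar>" "\<bar>2 * pi * a\<bar> < 2 * pi" "\<bar>2 * pi * a\<bar> \<noteq> pi"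
          unfolding e using False n assms(1) by auto
      qed
    qed simp
    then show False using Phi_ge_half(2)[OF b2, of a] 1 eq by linarith
  qed
  ultimately show "\<bar>a\<bar> = 1 / 2 \<and> b = sqrt 3 / 2" by simp
qed

end

section \<open>The energy of a cell\<close>

lemma has_bochner_integral_e2:
  "has_bochner_integral lborel (\<lambda>x::real. indicator {-1/2..1/2} x *\<^sub>R e2 (of_int k * of_real x)) (if k = 0 then 1 else 0)"
proof (cases "k = 0")
  case True
  have "has_bochner_integral lborel (\<lambda>x::real. indicator {-1/2..1/2} x *\<^sub>R (1::complex)) (of_real (1/2) - of_real (-1/2))"
    by (rule has_bochner_integral_FTC_Icc) (auto intro!: derivative_eq_intros simp: has_vector_derivative_def scaleR_conv_of_real)
  then show ?thesis using True by simp
next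
  case False
  define G where "G z = e2 (of_int k * z) / (2 * of_real pi * \<i> * of_int k)" for z
  have "((\<lambda>x. G (of_real x)) has_vector_derivative e2 (of_int k * of_real x)) (at x within S)" for x S
  proof (rule has_vector_derivative_real_field)
    show "(G has_field_derivative e2 (of_int k * of_real x)) (at (of_real x))"
      unfolding G_def e2_def using False by (auto intro!: derivative_eq_intros)
  qed
  then have "has_bochner_integral lborel (\<lambda>x::real. indicator {-1/2..1/2} x *\<^sub>R e2 (of_int k * of_real x)) (G (of_real (1/2)) - G (of_real (-1/2)))"
    by (intro has_bochner_integral_FTC_Icc) (auto intro!: continuous_intros)
  moreover have "e2 (of_int k * of_real (1/2)) = e2 (of_int k * of_real (-1/2))"
    using e2_diff_of_int(2)[of "of_int k * of_real (-1/2)" k] by (simp add: field_simps)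
  then have "G (of_real (1/2)) - G (of_real (-1/2)) = 0" by (simp only: G_def) simp
  ultimately show ?thesis using False by (simp only: if_False)
qed

lemma cnj_e2_real: "cnj (e2 (of_int l * of_real x)) = e2 (of_int (- l) * of_real x)"
  by (simp add: e2_def exp_cnj)

lemma trig_poly_norm:
  assumes "finite S"
  shows "has_bochner_integral lborel (\<lambda>x::real. indicator {-1/2..1/2} x * (cmod (\<Sum>k\<in>S. c k * e2 (of_int k * of_real x)))\<^sup>2)
     (\<Sum>k\<in>S. (cmod (c k))\<^sup>2)"
proof -
  have eq: "complex_of_real (indicator {-1/2..1/2} x * (cmod (\<Sum>k\<in>S. c k * e2 (of_int k * of_real x)))\<^sup>2)
     = (\<Sum>k\<in>S. \<Sum>l\<in>S. c k * cnj (c l) * (indicator {-1/2..1/2} x *\<^sub>R e2 (of_int (k - l) * of_real x)))" for x :: real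
  proof -
    have "complex_of_real ((cmod (\<Sum>k\<in>S. c k * e2 (of_int k * of_real x)))\<^sup>2)
       = (\<Sum>k\<in>S. c k * e2 (of_int k * of_real x)) * cnj (\<Sum>l\<in>S. c l * e2 (of_int l * of_real x))"
      by (rule complex_norm_square)
    also have "\<dots> = (\<Sum>k\<in>S. \<Sum>l\<in>S. (c k * e2 (of_int k * of_real x)) * cnj (c l * e2 (of_int l * of_real x)))"
      by (simp only: cnj_sum sum_product)
    also have "\<dots> = (\<Sum>k\<in>S. \<Sum>l\<in>S. c k * cnj (c l) * e2 (of_int (k - l) * of_real x))"
    proof (intro sum.cong refl)
      fix k l
      have "e2 (of_int k * of_real x) * e2 (of_int (- l) * of_real x) = e2 (of_int (k - l) * of_real x)"
        unfolding e2_add[symmetric] by (simp add: algebra_simps)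
      then show "(c k * e2 (of_int k * of_real x)) * cnj (c l * e2 (of_int l * of_real x)) = c k * cnj (c l) * e2 (of_int (k - l) * of_real x)"
        by (simp only: complex_cnj_mult cnj_e2_real) (simp add: mult_ac)
    qed
    finally show ?thesis
      by (simp only: of_real_mult) (simp add: indicator_def)
  qed
  have "has_bochner_integral lborel (\<lambda>x. \<Sum>k\<in>S. \<Sum>l\<in>S. c k * cnj (c l) * (indicator {-1/2..1/2} x *\<^sub>R e2 (of_int (k - l) * of_real x)))
     (\<Sum>k\<in>S. \<Sum>l\<in>S. c k * cnj (c l) * (if k - l = 0 then 1 else 0))"
    by (intro has_bochner_integral_sum has_bochner_integral_mult_right has_bochner_integral_e2)
  also have "(\<Sum>k\<in>S. \<Sum>l\<in>S. c k * cnj (c l) * (if k - l = 0 then 1 else 0)) = (\<Sum>k\<in>S. c k * cnj (c k))"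
    using assms by (intro sum.cong refl) (simp add: if_distrib cong: if_cong)
  also have "\<dots> = complex_of_real (\<Sum>k\<in>S. (cmod (c k))\<^sup>2)" by (simp only: of_real_sum complex_norm_square)
  finally have "has_bochner_integral lborel (\<lambda>x. complex_of_real (indicator {-1/2..1/2} x * (cmod (\<Sum>k\<in>S. c k * e2 (of_int k * of_real x)))\<^sup>2))
     (complex_of_real (\<Sum>k\<in>S. (cmod (c k))\<^sup>2))"
    by (simp only: eq)
  from has_bochner_integral_bounded_linear[OF bounded_linear_Re this] show ?thesis by simp
qed

lemma sum_symmetric_interval:
  fixes f :: "int \<Rightarrow> 'a::comm_monoid_add"
  shows "(\<Sum>k\<in>{- int N..int N}. f k) = f 0 + (\<Sum>n<N. f (int (Suc n)) + f (- int (Suc n)))"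
proof (induction N)
  case (Suc N)
  have "{- int (Suc N)..int (Suc N)} = insert (int (Suc N)) (insert (- int (Suc N)) {- int N..int N})" by auto
  then have "(\<Sum>k\<in>{- int (Suc N)..int (Suc N)}. f k) = f (int (Suc N)) + (f (- int (Suc N)) + (\<Sum>k\<in>{- int N..int N}. f k))"
    by (simp del: of_nat_Suc)
  then show ?case unfolding Suc by (simp add: algebra_simps del: of_nat_Suc)
qed simp

lemma e2_power: "e2 z ^ n = e2 (of_nat n * z)"
  by (simp add: e2_def exp_of_nat_mult[symmetric] mult_ac)

text \<open>Absolute summability bounds all partial sums by one constant, so the identity for
  trigonometric polynomials passes to the limit by dominated convergence.\<close>

lemma parseval:
  fixes \<alpha> \<beta> :: "nat \<Rightarrow> complex" and c0 :: complex
  assumes a: "summable (\<lambda>n. cmod (\<alpha> n))" and b: "summable (\<lambda>n. cmod (\<beta> n))"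
  defines "f \<equiv> \<lambda>x. c0 + (\<Sum>n. \<alpha> n * e2 (of_real x) ^ Suc n + \<beta> n * inverse (e2 (of_real x)) ^ Suc n)"
  shows "integrable lborel (\<lambda>x::real. indicator {-1/2..1/2} x * (cmod (f x))\<^sup>2)"
    "(\<lambda>n. (cmod (\<alpha> n))\<^sup>2 + (cmod (\<beta> n))\<^sup>2) sums
       ((\<integral>x. indicator {-1/2..1/2} x * (cmod (f x))\<^sup>2 \<partial>lborel) - (cmod c0)\<^sup>2)"
proof -
  define t where "t n x = \<alpha> n * e2 (of_real x) ^ Suc n + \<beta> n * inverse (e2 (of_real x)) ^ Suc n" for n and x :: real
  define F where "F N x = c0 + (\<Sum>n<N. t n x)" for N x
  have u: "cmod (e2 (of_real x)) = 1" for x :: real by (simp add: norm_e2)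
  have tn: "cmod (t n x) \<le> cmod (\<alpha> n) + cmod (\<beta> n)" for n x
    unfolding t_def by (rule order_trans[OF norm_triangle_ineq]) (simp add: norm_mult norm_power norm_inverse u)
  have sab: "summable (\<lambda>n. cmod (\<alpha> n) + cmod (\<beta> n))" by (intro summable_add a b)
  have st: "summable (\<lambda>n. t n x)" for x
    by (rule summable_comparison_test'[OF sab]) (use tn in auto)
  define M where "M = cmod c0 + (\<Sum>n. cmod (\<alpha> n) + cmod (\<beta> n))"
  have FM: "cmod (F N x) \<le> M" for N x
  proof -
    have "cmod (F N x) \<le> cmod c0 + (\<Sum>n<N. cmod (\<alpha> n) + cmod (\<beta> n))"
      unfolding F_def by (rule order_trans[OF norm_triangle_ineq add_left_mono[OF sum_norm_le]]) (rule tn)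
    also have "\<dots> \<le> M" unfolding M_def by (intro add_left_mono sum_le_suminf sab) auto
    finally show ?thesis .
  qed
  have Flim: "(\<lambda>N. F N x) \<longlonglongrightarrow> f x" for x
    unfolding F_def f_def t_def[symmetric] by (intro tendsto_add tendsto_const summable_LIMSEQ st)
  \<comment> \<open>The two coefficient sequences, indexed by the positive and the negative
    frequencies with a shift by one, are joined into one family over the integers.\<close>
  define c where "c k = (if k = 0 then c0 else if k > 0 then \<alpha> (nat (k - 1)) else \<beta> (nat (- k - 1)))" for k :: int
  have c: "c 0 = c0" "c (int (Suc n)) = \<alpha> n" "c (- int (Suc n)) = \<beta> n" for n
    by (auto simp: c_def)
  have FS: "F N x = (\<Sum>k\<in>{- int N..int N}. c k * e2 (of_int k * of_real x))" for N x
  proof -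
    have p: "e2 (of_real x) ^ Suc n = e2 (of_int (int (Suc n)) * of_real x)" for n
      by (simp only: e2_power of_int_of_nat_eq)
    have m: "inverse (e2 (of_real x)) ^ Suc n = e2 (of_int (- int (Suc n)) * of_real x)" for n
      by (simp only: e2_minus[symmetric] e2_power of_int_minus of_int_of_nat_eq mult_minus_left mult_minus_right)
    show ?thesis
      unfolding F_def t_def sum_symmetric_interval c p m by (simp only: of_int_0 mult_zero_left e2_0 mult_1_right)
  qed
  have sq: "(\<Sum>k\<in>{- int N..int N}. (cmod (c k))\<^sup>2) = (cmod c0)\<^sup>2 + (\<Sum>n<N. (cmod (\<alpha> n))\<^sup>2 + (cmod (\<beta> n))\<^sup>2)" for N
    unfolding sum_symmetric_interval c ..
  have HB: "has_bochner_integral lborel (\<lambda>x::real. indicator {-1/2..1/2} x * (cmod (F N x))\<^sup>2) ((cmod c0)\<^sup>2 + (\<Sum>n<N. (cmod (\<alpha> n))\<^sup>2 + (cmod (\<beta> n))\<^sup>2))" for N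
    using trig_poly_norm[of "{- int N..int N}" c] unfolding FS[symmetric] sq by simp
  have mF: "(\<lambda>x::real. indicator {-1/2..1/2} x * (cmod (F N x))\<^sup>2) \<in> borel_measurable lborel" for N
    using HB[of N] by (auto simp: has_bochner_integral_iff)
  have lim: "(\<lambda>N. indicator {-1/2..1/2} x * (cmod (F N x))\<^sup>2) \<longlonglongrightarrow> indicator {-1/2..1/2} x * (cmod (f x))\<^sup>2" for x :: real
    by (intro tendsto_intros Flim)
  have mf: "(\<lambda>x::real. indicator {-1/2..1/2} x * (cmod (f x))\<^sup>2) \<in> borel_measurable lborel"
    by (rule borel_measurable_LIMSEQ_real[OF lim mF])
  have iw: "integrable lborel (\<lambda>x::real. indicator {-1/2..1/2} x * M\<^sup>2)"
    by (intro integrable_mult_left integrable_real_indicator) auto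
  have dom: "norm (indicator {-1/2..1/2} x * (cmod (F N x))\<^sup>2) \<le> indicator {-1/2..1/2} x * M\<^sup>2" for N and x :: real
    using power_mono[OF FM[of N x] norm_ge_zero, of 2] by (auto simp: indicator_def)
  show "integrable lborel (\<lambda>x::real. indicator {-1/2..1/2} x * (cmod (f x))\<^sup>2)"
    by (rule integrable_dominated_convergence[OF mf mF iw AE_I2[OF lim] AE_I2[OF dom]])
  have "(\<lambda>N. \<integral>x. indicator {-1/2..1/2} x * (cmod (F N x))\<^sup>2 \<partial>lborel) \<longlonglongrightarrow> (\<integral>x. indicator {-1/2..1/2} x * (cmod (f x))\<^sup>2 \<partial>lborel)"
    by (rule integral_dominated_convergence[OF mf mF iw AE_I2[OF lim] AE_I2[OF dom]])
  moreover have "(\<integral>x. indicator {-1/2..1/2} x * (cmod (F N x))\<^sup>2 \<partial>lborel) = (cmod c0)\<^sup>2 + (\<Sum>n<N. (cmod (\<alpha> n))\<^sup>2 + (cmod (\<beta> n))\<^sup>2)" for N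
    using HB[of N] by (simp add: has_bochner_integral_iff)
  ultimately have "(\<lambda>N. (cmod c0)\<^sup>2 + (\<Sum>n<N. (cmod (\<alpha> n))\<^sup>2 + (cmod (\<beta> n))\<^sup>2)) \<longlonglongrightarrow> (\<integral>x. indicator {-1/2..1/2} x * (cmod (f x))\<^sup>2 \<partial>lborel)"
    by simp
  from tendsto_diff[OF this tendsto_const[of "(cmod c0)\<^sup>2"]]
  show "(\<lambda>n. (cmod (\<alpha> n))\<^sup>2 + (cmod (\<beta> n))\<^sup>2) sums ((\<integral>x. indicator {-1/2..1/2} x * (cmod (f x))\<^sup>2 \<partial>lborel) - (cmod c0)\<^sup>2)"
    by (simp add: sums_def)
qed

lemma integrable_Complex:
  fixes g :: "complex \<Rightarrow> real"
  assumes g: "integrable lborel g"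
  shows "integrable lborel (\<lambda>y. \<integral>x. g (Complex x y) \<partial>lborel)"
    "integral\<^sup>L lborel g = (\<integral>y. \<integral>x. g (Complex x y) \<partial>lborel \<partial>lborel)"
proof -
  have gm: "g \<in> borel_measurable borel" using g by auto
  have i: "integrable (lborel \<Otimes>\<^sub>M lborel) (\<lambda>(x, y). g (Complex x y))"
    using g gm integrable_distr_eq[OF measurable_Complex gm] lborel_Complex by (simp add: case_prod_unfold)
  show "integrable lborel (\<lambda>y. \<integral>x. g (Complex x y) \<partial>lborel)"
    by (rule lborel_pair.integrable_snd[OF i])
  have "integral\<^sup>L lborel g = (\<integral>p. g (case p of (x, y) \<Rightarrow> Complex x y) \<partial>(lborel \<Otimes>\<^sub>M lborel))"
    using integral_distr[OF measurable_Complex gm] lborel_Complex by simp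
  also have "\<dots> = (\<integral>y. \<integral>x. g (Complex x y) \<partial>lborel \<partial>lborel)"
    using lborel_pair.integral_snd[OF i] by (simp add: case_prod_unfold)
  finally show "integral\<^sup>L lborel g = (\<integral>y. \<integral>x. g (Complex x y) \<partial>lborel \<partial>lborel)" .
qed

lemma integral_even_real:
  fixes k :: "real \<Rightarrow> real"
  assumes k: "integrable lborel k" and even: "\<And>y. k (- y) = k y"
  shows "integral\<^sup>L lborel k = 2 * (\<integral>y. indicator {0<..} y * k y \<partial>lborel)"
proof -
  have [measurable]: "k \<in> borel_measurable borel" using k by auto
  have i1: "integrable lborel (\<lambda>y. indicator {0<..} y * k y)" and i2: "integrable lborel (\<lambda>y. indicator {..<0} y * k y)"
    using integrable_mult_indicator[OF _ k, of "{0<..}"] integrable_mult_indicator[OF _ k, of "{..<0}"] by simp_all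
  have "integral\<^sup>L lborel k = (\<integral>y. indicator {0<..} y * k y + indicator {..<0} y * k y \<partial>lborel)"
    by (rule integral_cong_AE, simp, measurable)
       (use AE_lborel_singleton[of "0::real"] in \<open>eventually_elim, auto simp: indicator_def\<close>)
  also have "\<dots> = (\<integral>y. indicator {0<..} y * k y \<partial>lborel) + (\<integral>y. indicator {..<0} y * k y \<partial>lborel)"
    by (rule Bochner_Integration.integral_add[OF i1 i2])
  also have "(\<integral>y. indicator {..<0} y * k y \<partial>lborel) = (\<integral>y. indicator {..<0} (- y) * k (- y) \<partial>lborel)"
    using lborel_integral_real_affine[of "-1" "\<lambda>y. indicator {..<0} y * k y" 0] by simp
  also have "\<dots> = (\<integral>y. indicator {0<..} y * k y \<partial>lborel)"
    by (intro Bochner_Integration.integral_cong refl) (auto simp: indicator_def even)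
  finally show ?thesis by simp
qed

lemma measurable_Re_Im [measurable]: "Re \<in> borel_measurable borel" "Im \<in> borel_measurable borel"
  by (intro borel_measurable_continuous_onI continuous_intros)+

text \<open>The difference of the squares of |1/z + g| and |1/z| factors into their difference, at
  most \<open>B\<close>, and their sum; so only one power of 1/|z| survives, which is integrable in
  the plane.\<close>

lemma singular_square_bound:
  assumes "cmod g \<le> B" "z \<noteq> 0" "cmod z \<le> d"
  shows "\<bar>(cmod (1 / z + g))\<^sup>2 - 1 / (cmod z)\<^sup>2\<bar> \<le> (2 * B + B\<^sup>2 * d) / cmod z"
proof -
  define a where "a = cmod (1 / z)"
  define s where "s = cmod (1 / z + g)"
  have a: "a = 1 / cmod z" "a > 0" using assms(2) by (simp_all add: a_def norm_divide)
  have B: "B \<ge> 0" using assms(1) norm_ge_zero order_trans by blast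
  have d: "\<bar>s - a\<bar> \<le> B" unfolding s_def a_def
    using norm_triangle_ineq3[of "1 / z + g" "1 / z"] assms(1) by simp
  have "\<bar>s\<^sup>2 - a\<^sup>2\<bar> = \<bar>s - a\<bar> * (s + a)"
    using a(2) norm_ge_zero[of "1 / z + g"] unfolding s_def[symmetric]
    by (simp add: power2_eq_square square_diff_square_factored abs_mult mult.commute)
  also have "\<dots> \<le> B * (2 * a + B)" using d a(2) B by (intro mult_mono) (auto simp: s_def)
  also have "\<dots> = (2 * B + B\<^sup>2 * cmod z) / cmod z" using assms(2) by (simp add: a field_simps power2_eq_square)
  also have "\<dots> \<le> (2 * B + B\<^sup>2 * d) / cmod z" using assms(3) by (intro divide_right_mono add_left_mono mult_left_mono) auto
  finally show ?thesis by (simp add: s_def a power_divide)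
qed

lemma integrable_regularised:
  fixes u :: "complex \<Rightarrow> real"
  assumes [measurable]: "u \<in> borel_measurable borel" "S \<in> sets borel" and S: "S \<subseteq> cball 0 d" and \<rho>: "\<rho> > 0"
    and b: "\<And>z. z \<in> S \<Longrightarrow> z \<noteq> 0 \<Longrightarrow> \<bar>u z - 1 / (cmod z)\<^sup>2\<bar> \<le> C / cmod z"
  shows "integrable lborel (\<lambda>z. indicator S z * (u z - indicator (cball 0 \<rho>) z / (cmod z)\<^sup>2))"
proof (rule Bochner_Integration.integrable_bound)
  show "integrable lborel (\<lambda>z. \<bar>C\<bar> * (indicator (cball 0 d) z *\<^sub>R (1 / cmod z)) + indicator (cball (0::complex) d) z * (1 / \<rho>\<^sup>2))"
    using integrable_inverse_cmod[of d] unfolding set_integrable_def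
    by (intro Bochner_Integration.integrable_add integrable_mult_right integrable_mult_left integrable_real_indicator)
       (auto intro: emeasure_bounded_finite[unfolded infinity_ennreal_def])
  show "AE z in lborel. norm (indicator S z * (u z - indicator (cball 0 \<rho>) z / (cmod z)\<^sup>2))
     \<le> norm (\<bar>C\<bar> * (indicator (cball 0 d) z *\<^sub>R (1 / cmod z)) + indicator (cball (0::complex) d) z * (1 / \<rho>\<^sup>2))"
    using AE_lborel_singleton[of "0::complex"]
  proof eventually_elim
    case (elim z)
    show ?case
    proof (cases "z \<in> S")
      case True
      then have zd: "z \<in> cball 0 d" using S by blast
      have s: "\<bar>u z - 1 / (cmod z)\<^sup>2\<bar> \<le> \<bar>C\<bar> * (1 / cmod z)"
        using b[OF True elim] divide_right_mono[OF abs_ge_self[of C] norm_ge_zero[of z]] by simp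
      have "\<bar>u z - indicator (cball 0 \<rho>) z / (cmod z)\<^sup>2\<bar> \<le> \<bar>C\<bar> * (1 / cmod z) + 1 / \<rho>\<^sup>2"
      proof (cases "cmod z \<le> \<rho>")
        case False
        have "1 / (cmod z)\<^sup>2 \<le> 1 / \<rho>\<^sup>2" using False \<rho> by (intro frac_le power_mono) auto
        moreover have "0 \<le> 1 / (cmod z)\<^sup>2" by simp
        ultimately have "\<bar>u z\<bar> \<le> \<bar>C\<bar> * (1 / cmod z) + 1 / \<rho>\<^sup>2" using s by linarith
        then show ?thesis using False by simp
      next
        case inb: True
        have "0 \<le> 1 / \<rho>\<^sup>2" by simp
        then have "\<bar>u z - 1 / (cmod z)\<^sup>2\<bar> \<le> \<bar>C\<bar> * (1 / cmod z) + 1 / \<rho>\<^sup>2" using s by linarith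
        then show ?thesis using inb by simp
      qed
      then show ?thesis using True zd by (simp add: order_trans[OF _ abs_ge_self])
    qed simp
  qed
qed measurable

section \<open>The reference function on a rectangle\<close>

definition crect :: "real \<Rightarrow> complex set" where
  "crect b = {z. \<bar>Re z\<bar> \<le> 1 / 2 \<and> \<bar>Im z\<bar> \<le> b / 2}"

lemma crect_sets [measurable]: "crect b \<in> sets borel"
  unfolding crect_def by measurable

lemma crect_cball: "crect b \<subseteq> cball 0 (1 / 2 + \<bar>b\<bar> / 2)"
proof
  fix z assume "z \<in> crect b"
  then show "z \<in> cball 0 (1 / 2 + \<bar>b\<bar> / 2)"
    using cmod_le[of z] abs_ge_self[of b] by (simp add: crect_def)
qed

lemma compact_crect: "compact (crect b)"
proof -
  have "closed (crect b)"
    unfolding crect_def by (intro closed_Collect_conj closed_Collect_le continuous_intros)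
  moreover have "bounded (crect b)" using crect_cball bounded_cball bounded_subset by blast
  ultimately show ?thesis by (simp add: compact_eq_bounded_closed)
qed

text \<open>An explicit function with the same singularity at 0 as \<open>|fld \<tau>|\<^sup>2\<close>: it cancels the divergence of the
  energy while its integrals over horizontal lines stay computable. It does not depend on \<open>\<tau>\<close>.\<close>

definition refP :: "complex \<Rightarrow> real" where
  "refP z = (cmod (2 * of_real pi * e2 (Complex (Re z) \<bar>Im z\<bar>) / (1 - e2 (Complex (Re z) \<bar>Im z\<bar>))))\<^sup>2"

lemma refP_meas [measurable]: "refP \<in> borel_measurable borel"
proof -
  have [measurable]: "(\<lambda>z. Complex (Re z) \<bar>Im z\<bar>) \<in> borel_measurable borel"
    unfolding Complex_eq by measurable
  show ?thesis unfolding refP_def[abs_def] by measurable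
qed

lemma refP_minus: "refP (- z) = refP z"
proof -
  have "e2 (Complex (- x) y) = cnj (e2 (Complex x y))" for x y
    by (simp add: e2_def complex_eq_iff Re_exp Im_exp)
  then have "2 * of_real pi * e2 (Complex (Re (- z)) \<bar>Im (- z)\<bar>) / (1 - e2 (Complex (Re (- z)) \<bar>Im (- z)\<bar>))
     = cnj (2 * of_real pi * e2 (Complex (Re z) \<bar>Im z\<bar>) / (1 - e2 (Complex (Re z) \<bar>Im z\<bar>)))"
    by simp
  then show ?thesis unfolding refP_def by (simp only: complex_mod_cnj)
qed

text \<open>The function inside the modulus is i (\<open>cotp\<close> + pi i) at the point reflected
  into the upper half-plane. So it has a simple pole with residue of modulus 1, and the reflection
  does not change |z|. The rectangle lies in the unit disc, where \<open>cotp_pole\<close>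
  applies.\<close>

lemma refP_sing: "\<exists>C. \<forall>z\<in>crect (1 / 2). z \<noteq> 0 \<longrightarrow> \<bar>refP z - 1 / (cmod z)\<^sup>2\<bar> \<le> C / cmod z"
proof -
  obtain h where h: "h holomorphic_on ball 0 1" "\<And>z. z \<in> ball 0 1 \<Longrightarrow> cotp z = 1 / z + h z"
    by (rule cotp_pole, rule that)
  have "continuous_on (cball 0 (3 / 4)) h"
    by (intro holomorphic_on_imp_continuous_on holomorphic_on_subset[OF h(1)]) auto
  then have "compact (h ` cball 0 (3 / 4))" by (intro compact_continuous_image) auto
  then have "bounded (h ` cball 0 (3 / 4))" by (rule compact_imp_bounded)
  then obtain B0 where "\<forall>w\<in>h ` cball 0 (3 / 4). cmod w \<le> B0" unfolding bounded_iff by blast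
  then have B0: "cmod (h z) \<le> B0" if "z \<in> cball 0 (3 / 4)" for z using that by blast
  define B where "B = B0 + pi"
  have "\<bar>refP z - 1 / (cmod z)\<^sup>2\<bar> \<le> (2 * B + B\<^sup>2 * 1) / cmod z" if z: "z \<in> crect (1 / 2)" "z \<noteq> 0" for z
  proof -
    define v where "v = Complex (Re z) \<bar>Im z\<bar>"
    have nv: "cmod v = cmod z" by (simp add: v_def cmod_def)
    have zb: "cmod z \<le> 3 / 4" using z(1) crect_cball[of "1 / 2"] by auto
    have v: "v \<in> ball 0 1" "v \<in> cball 0 (3 / 4)" "v \<noteq> 0" using nv zb z(2) by auto
    have ne: "e2 v \<noteq> 1"
    proof
      assume "e2 v = 1"
      then obtain n where "v = of_int n" by (auto simp: e2_eq_1_iff elim: Ints_cases)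
      with v show False by auto
    qed
    have "2 * of_real pi * e2 v / (1 - e2 v) = \<i> * (cotp v + of_real pi * \<i>)"
      using ne unfolding cotp_def by (simp add: divide_simps) (simp add: algebra_simps)
    then have "refP z = (cmod (1 / v + (h v + of_real pi * \<i>)))\<^sup>2"
      unfolding refP_def v_def[symmetric] using h(2)[OF v(1)] by (simp add: norm_mult add.assoc)
    moreover have "cmod (h v + of_real pi * \<i>) \<le> B"
      unfolding B_def using B0[OF v(2)] by (intro order_trans[OF norm_triangle_ineq add_mono]) (auto simp: norm_mult)
    ultimately show ?thesis
      using singular_square_bound[of "h v + of_real pi * \<i>" B v 1] v nv zb by simp
  qed
  then show ?thesis by blast
qed

text \<open>The finite part of the reference integral. It enters the energy of every lattice as the
  same constant, so its value never has to be computed.\<close>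

definition "Vref = (\<integral>z. indicator (crect (1 / 2)) z * (refP z - indicator (cball 0 (1 / 8)) z / (cmod z)\<^sup>2) \<partial>lborel)"

lemma summable_power_Suc: "0 \<le> r \<Longrightarrow> r < (1::real) \<Longrightarrow> summable (\<lambda>n. r ^ Suc n)"
  by (simp add: summable_geometric)

lemma refP_parseval:
  assumes "y > 0"
  shows "integrable lborel (\<lambda>x. indicator {-1/2..1/2} x * refP (Complex x y))"
    "(\<lambda>n. 4 * pi\<^sup>2 * exp (- 4 * pi * real (Suc n) * y)) sums (\<integral>x. indicator {-1/2..1/2} x * refP (Complex x y) \<partial>lborel)"
proof -
  define v where "v = e2 (\<i> * of_real y)"
  have nv: "cmod v = exp (- 2 * pi * y)" by (simp add: v_def norm_e2)
  have v1: "cmod v < 1" using assms by (simp add: nv)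
  define \<alpha> where "\<alpha> n = 2 * of_real pi * v ^ Suc n" for n
  have sa: "summable (\<lambda>n. cmod (\<alpha> n))"
    unfolding \<alpha>_def norm_mult norm_power using v1 by (intro summable_mult summable_power_Suc) auto
  have eq: "refP (Complex x y) = (cmod (0 + (\<Sum>n. \<alpha> n * e2 (of_real x) ^ Suc n + 0 * inverse (e2 (of_real x)) ^ Suc n)))\<^sup>2" for x
  proof -
    define E where "E = e2 (Complex x y)"
    have E: "E = e2 (of_real x) * v" unfolding E_def v_def e2_add[symmetric] by (simp add: Complex_eq)
    have E1: "cmod E < 1" using v1 by (simp add: E norm_mult norm_e2)
    have "(\<lambda>n. E ^ Suc n) sums (E / (1 - E))"
      using sums_mult[OF geometric_sums[OF E1], of E] by (simp add: field_simps)
    then have "(\<lambda>n. 2 * of_real pi * E ^ Suc n) sums (2 * of_real pi * (E / (1 - E)))" by (rule sums_mult)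
    moreover have "2 * of_real pi * E ^ Suc n = \<alpha> n * e2 (of_real x) ^ Suc n + 0 * inverse (e2 (of_real x)) ^ Suc n" for n
      by (simp add: \<alpha>_def E power_mult_distrib mult_ac)
    ultimately have "(\<Sum>n. \<alpha> n * e2 (of_real x) ^ Suc n + 0 * inverse (e2 (of_real x)) ^ Suc n) = 2 * of_real pi * (E / (1 - E))"
      by (simp only: sums_iff)
    then show ?thesis using assms by (simp add: refP_def E_def)
  qed
  note PV = parseval[OF sa, of "\<lambda>_. 0" 0, folded eq]
  show "integrable lborel (\<lambda>x. indicator {-1/2..1/2} x * refP (Complex x y))"
    by (rule PV(1)) simp
  have "(cmod (\<alpha> n))\<^sup>2 + (cmod (0::complex))\<^sup>2 = 4 * pi\<^sup>2 * exp (- 4 * pi * real (Suc n) * y)" for n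
  proof -
    have "cmod (\<alpha> n) = 2 * pi * exp (- 2 * pi * y) ^ Suc n" by (simp add: \<alpha>_def norm_mult norm_power nv)
    also have "exp (- 2 * pi * y) ^ Suc n = exp (real (Suc n) * (- 2 * pi * y))" by (rule exp_of_nat_mult[symmetric])
    finally have "(cmod (\<alpha> n))\<^sup>2 = 4 * pi\<^sup>2 * (exp (real (Suc n) * (- 2 * pi * y)))\<^sup>2" by (simp only: power_mult_distrib) simp
    also have "(exp (real (Suc n) * (- 2 * pi * y)))\<^sup>2 = exp (- 4 * pi * real (Suc n) * y)"
      unfolding exp_double[symmetric] by (simp add: mult_ac)
    finally show ?thesis by simp
  qed
  then show "(\<lambda>n. 4 * pi\<^sup>2 * exp (- 4 * pi * real (Suc n) * y)) sums (\<integral>x. indicator {-1/2..1/2} x * refP (Complex x y) \<partial>lborel)"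
    using PV(2) by simp
qed

lemma fld_parseval:
  assumes tau: "Im \<tau> > 0" and y: "0 < y" "y < Im \<tau>"
  shows "integrable lborel (\<lambda>x. indicator {-1/2..1/2} x * (cmod (fld \<tau> (Complex x y)))\<^sup>2)"
    "(\<lambda>n. 4 * pi\<^sup>2 * (exp (- 4 * pi * real (Suc n) * y) / (cmod (1 - e2 \<tau> ^ Suc n))\<^sup>2
        + (exp (- 2 * pi * Im \<tau>) ^ Suc n)\<^sup>2 * exp (4 * pi * real (Suc n) * y) / (cmod (1 - e2 \<tau> ^ Suc n))\<^sup>2)) sums
      ((\<integral>x. indicator {-1/2..1/2} x * (cmod (fld \<tau> (Complex x y)))\<^sup>2 \<partial>lborel) - pi\<^sup>2 * (1 - 2 * y / Im \<tau>)\<^sup>2)"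
proof -
  define u v where "u = e2 (\<i> * of_real y)" and "v = e2 (\<tau> - \<i> * of_real y)"
  have nu: "cmod u = exp (- 2 * pi * y)" and nv: "cmod v = exp (- 2 * pi * (Im \<tau> - y))"
    by (simp_all add: u_def v_def norm_e2)
  have u1: "cmod u < 1" and v1: "cmod v < 1" using y by (simp_all add: nu nv)
  define c0 where "c0 = - of_real pi * \<i> * of_real (1 - 2 * y / Im \<tau>)"
  define \<alpha> where "\<alpha> n = - 2 * of_real pi * \<i> * (u ^ Suc n / (1 - e2 \<tau> ^ Suc n))" for n
  define \<beta> where "\<beta> n = 2 * of_real pi * \<i> * (v ^ Suc n / (1 - e2 \<tau> ^ Suc n))" for n
  have geo: "summable (\<lambda>n. cmod (x ^ Suc n / (1 - e2 \<tau> ^ Suc n)))" if "cmod x < 1" for x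
  proof (rule summable_comparison_test')
    show "summable (\<lambda>n. cmod x ^ Suc n / (1 - cmod (e2 \<tau>)))"
      using that by (intro summable_divide summable_power_Suc) auto
  qed (use norm_geom_over_q[OF tau order_refl, of x] in auto)
  have sa: "summable (\<lambda>n. cmod (\<alpha> n))" and sb: "summable (\<lambda>n. cmod (\<beta> n))"
    unfolding \<alpha>_def \<beta>_def norm_mult[of "_ * \<i>"] by (intro summable_mult geo u1 v1)+
  have eq: "fld \<tau> (Complex x y) = c0 + (\<Sum>n. \<alpha> n * e2 (of_real x) ^ Suc n + \<beta> n * inverse (e2 (of_real x)) ^ Suc n)" for x
  proof -
    define z where "z = Complex x y"
    have z: "0 < Im z" "Im z < Im \<tau>" "Im z = y" using y by (auto simp: z_def)
    have ez: "e2 z = e2 (of_real x) * u" unfolding u_def e2_add[symmetric] by (simp add: z_def Complex_eq)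
    have "\<tau> - z = (\<tau> - \<i> * of_real y) + (- of_real x)" by (simp add: z_def Complex_eq)
    then have etz: "e2 (\<tau> - z) = v * inverse (e2 (of_real x))" by (simp only: v_def e2_add e2_minus)
    have "(\<lambda>n. - 2 * of_real pi * \<i> * ((e2 z ^ Suc n - e2 (\<tau> - z) ^ Suc n) / (1 - e2 \<tau> ^ Suc n))) sums
       (- 2 * of_real pi * \<i> * ((fld \<tau> z + of_real pi * \<i> * of_real (1 - 2 * Im z / Im \<tau>)) / (- 2 * of_real pi * \<i>)))"
      by (intro sums_mult fldh_Fourier tau z)
    moreover have "- 2 * of_real pi * \<i> * ((fld \<tau> z + of_real pi * \<i> * of_real (1 - 2 * Im z / Im \<tau>)) / (- 2 * of_real pi * \<i>)) = fld \<tau> z - c0"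
      by (simp add: c0_def z(3))
    moreover have "- 2 * of_real pi * \<i> * ((e2 z ^ Suc n - e2 (\<tau> - z) ^ Suc n) / (1 - e2 \<tau> ^ Suc n))
       = \<alpha> n * e2 (of_real x) ^ Suc n + \<beta> n * inverse (e2 (of_real x)) ^ Suc n" for n
      unfolding ez etz power_mult_distrib \<alpha>_def \<beta>_def diff_divide_distrib right_diff_distrib
      by (simp add: mult_ac del: power_Suc)
    ultimately have "(\<Sum>n. \<alpha> n * e2 (of_real x) ^ Suc n + \<beta> n * inverse (e2 (of_real x)) ^ Suc n) = fld \<tau> z - c0"
      by (simp only: sums_iff)
    then show ?thesis by (simp add: z_def)
  qed
  note PV = parseval[OF sa sb, of c0, folded eq]
  show "integrable lborel (\<lambda>x. indicator {-1/2..1/2} x * (cmod (fld \<tau> (Complex x y)))\<^sup>2)" by (rule PV(1))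
  have c0: "(cmod c0)\<^sup>2 = pi\<^sup>2 * (1 - 2 * y / Im \<tau>)\<^sup>2"
    by (simp only: c0_def norm_mult norm_of_real norm_minus_cancel) (simp add: power_mult_distrib)
  have sq: "(cmod (\<alpha> n))\<^sup>2 + (cmod (\<beta> n))\<^sup>2 = 4 * pi\<^sup>2 * (exp (- 4 * pi * real (Suc n) * y) / (cmod (1 - e2 \<tau> ^ Suc n))\<^sup>2
        + (exp (- 2 * pi * Im \<tau>) ^ Suc n)\<^sup>2 * exp (4 * pi * real (Suc n) * y) / (cmod (1 - e2 \<tau> ^ Suc n))\<^sup>2)" for n
  proof -
    have "cmod (\<alpha> n) = 2 * pi * (exp (- 2 * pi * y) ^ Suc n / cmod (1 - e2 \<tau> ^ Suc n))"
      by (simp only: \<alpha>_def norm_mult norm_divide norm_power nu) simp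
    also have "exp (- 2 * pi * y) ^ Suc n = exp (real (Suc n) * (- 2 * pi * y))" by (rule exp_of_nat_mult[symmetric])
    finally have "(cmod (\<alpha> n))\<^sup>2 = 4 * pi\<^sup>2 * ((exp (real (Suc n) * (- 2 * pi * y)))\<^sup>2 / (cmod (1 - e2 \<tau> ^ Suc n))\<^sup>2)"
      by (simp only: power_mult_distrib power_divide) simp
    moreover have "(exp (real (Suc n) * (- 2 * pi * y)))\<^sup>2 = exp (- 4 * pi * real (Suc n) * y)"
      unfolding exp_double[symmetric] by (simp add: mult_ac)
    moreover have "cmod (\<beta> n) = 2 * pi * (exp (- 2 * pi * (Im \<tau> - y)) ^ Suc n / cmod (1 - e2 \<tau> ^ Suc n))"
      by (simp only: \<beta>_def norm_mult norm_divide norm_power nv) simp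
    then have "(cmod (\<beta> n))\<^sup>2 = 4 * pi\<^sup>2 * ((exp (- 2 * pi * (Im \<tau> - y)) ^ Suc n)\<^sup>2 / (cmod (1 - e2 \<tau> ^ Suc n))\<^sup>2)"
      by (simp only: power_mult_distrib power_divide) simp
    moreover have "(exp (- 2 * pi * (Im \<tau> - y)) ^ Suc n)\<^sup>2 = (exp (- 2 * pi * Im \<tau>) ^ Suc n)\<^sup>2 * exp (4 * pi * real (Suc n) * y)"
      unfolding exp_of_nat_mult[symmetric] exp_double[symmetric] exp_add[symmetric]
      by (rule arg_cong[of _ _ exp]) (simp add: algebra_simps)
    ultimately show ?thesis by (simp add: distrib_left)
  qed
  show "(\<lambda>n. 4 * pi\<^sup>2 * (exp (- 4 * pi * real (Suc n) * y) / (cmod (1 - e2 \<tau> ^ Suc n))\<^sup>2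
        + (exp (- 2 * pi * Im \<tau>) ^ Suc n)\<^sup>2 * exp (4 * pi * real (Suc n) * y) / (cmod (1 - e2 \<tau> ^ Suc n))\<^sup>2)) sums
      ((\<integral>x. indicator {-1/2..1/2} x * (cmod (fld \<tau> (Complex x y)))\<^sup>2 \<partial>lborel) - pi\<^sup>2 * (1 - 2 * y / Im \<tau>)\<^sup>2)"
    using PV(2) unfolding sq c0 .
qed

text \<open>What the upper edge y = 1/4 of the reference rectangle leaves behind, since exp(- 4 pi n
  y) equals exp(- pi n) there; again a constant common to all lattices.\<close>

definition "Cref = (\<Sum>n. exp (- pi * real (Suc n)) / real (Suc n))"

lemma exp_integral:
  fixes a c :: real
  assumes "a \<noteq> 0" "c \<ge> 0"
  shows "has_bochner_integral lborel (\<lambda>y. indicator {0..c} y * exp (a * y)) ((exp (a * c) - 1) / a)"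
proof -
  have "has_bochner_integral lborel (\<lambda>y. indicator {0..c} y *\<^sub>R exp (a * y)) (exp (a * c) / a - exp (a * 0) / a)"
    using assms
    by (intro has_bochner_integral_FTC_Icc[where F="\<lambda>y. exp (a * y) / a"])
       (auto intro!: derivative_eq_intros continuous_intros simp: has_real_derivative_iff_has_vector_derivative[symmetric])
  then show ?thesis by (simp add: diff_divide_distrib)
qed

section \<open>Integration of the Fourier modes over the height of a cell\<close>

context
  fixes \<tau> :: complex
  assumes b: "Im \<tau> > 1 / 2"
begin

definition "qr = exp (- 2 * pi * Im \<tau>)"
definition "qD n = (cmod (1 - e2 \<tau> ^ Suc n))\<^sup>2"
text \<open>The share of the frequencies n + 1 and - (n + 1) on the line at height y, divided by 4
  pi^2, after subtraction of the reference mode. Without the subtraction its integral would be of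
  order 1/n and the sum over n would diverge: the logarithmic singularity in Fourier form.\<close>

definition "TT n y = exp (- 4 * pi * real (Suc n) * y) * (1 / qD n - indicator {..1/4} y) + (qr ^ Suc n)\<^sup>2 * exp (4 * pi * real (Suc n) * y) / qD n"

lemma qr: "0 < qr" "qr \<le> 1 / 10" "qr \<le> exp (- pi)"
proof -
  show "0 < qr" "qr \<le> 1 / 10" using exp_minus_le_10[of "Im \<tau>"] b by (auto simp: qr_def)
  have "pi * 1 \<le> pi * (2 * Im \<tau>)" using b by (intro mult_left_mono) auto
  then show "qr \<le> exp (- pi)" by (simp add: qr_def mult_ac)
qed

lemma q_polar: "e2 \<tau> ^ Suc n = of_real (qr ^ Suc n) * cis (real (Suc n) * (2 * pi * Re \<tau>))"
proof -
  have "e2 \<tau> = of_real qr * cis (2 * pi * Re \<tau>)"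
    by (simp add: e2_def qr_def exp_eq_polar)
  then have "e2 \<tau> ^ Suc n = of_real qr ^ Suc n * cis (2 * pi * Re \<tau>) ^ Suc n" by (simp only: power_mult_distrib)
  also have "cis (2 * pi * Re \<tau>) ^ Suc n = cis (real (Suc n) * (2 * pi * Re \<tau>))" by (rule Complex.DeMoivre)
  finally show ?thesis by (simp only: of_real_power)
qed

lemma qD_eq: "qD n = 1 - 2 * qr ^ Suc n * cos (real (Suc n) * (2 * pi * Re \<tau>)) + (qr ^ Suc n)\<^sup>2"
proof -
  define s c where "s = qr ^ Suc n" and "c = real (Suc n) * (2 * pi * Re \<tau>)"
  have "qD n = (1 - s * cos c)\<^sup>2 + (s * sin c)\<^sup>2"
    unfolding qD_def q_polar s_def[symmetric] c_def[symmetric] cmod_power2 by simp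
  also have "\<dots> = 1 - 2 * s * cos c + s\<^sup>2 * ((sin c)\<^sup>2 + (cos c)\<^sup>2)"
    by algebra
  finally show ?thesis by (simp add: s_def c_def)
qed

lemma qD_bounds: "8 / 10 \<le> qD n" "\<bar>1 - qD n\<bar> \<le> 3 * qr ^ Suc n"
proof -
  define s c where "s = qr ^ Suc n" and "c = cos (real (Suc n) * (2 * pi * Re \<tau>))"
  have s: "0 \<le> s" "s \<le> 1 / 10" unfolding s_def using power_Suc_le_10[of qr n] qr by auto
  have sc: "\<bar>s * c\<bar> \<le> s" using s mult_left_mono[of "\<bar>c\<bar>" 1 s] by (simp add: abs_mult c_def)
  have ss: "0 \<le> s\<^sup>2" "s\<^sup>2 \<le> s" using s mult_left_mono[of s 1 s] by (auto simp: power2_eq_square)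
  have q: "qD n = 1 - 2 * (s * c) + s\<^sup>2" unfolding qD_eq s_def c_def by (simp only: mult.assoc)
  show "8 / 10 \<le> qD n" using sc ss s unfolding q abs_le_iff by linarith
  show "\<bar>1 - qD n\<bar> \<le> 3 * qr ^ Suc n" using sc ss s unfolding q s_def[symmetric] abs_le_iff by linarith
qed

text \<open>Below y = 1/4 the factor 1/qD - 1 is of order |q|^(n+1), with |q| <= exp(- pi); above
  1/4 the exponential itself is that small. In the second summand y <= Im tau / 2 bounds the
  exponential by the inverse of |q|^(n+1), so one of the two powers of |q|^(n+1) is left. The bound
  permits integrating the series termwise.\<close>

lemma TT_bound:
  assumes y: "0 \<le> y" "y \<le> Im \<tau> / 2"
  shows "\<bar>TT n y\<bar> \<le> 10 * exp (- pi) ^ Suc n"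
proof -
  define s where "s = qr ^ Suc n"
  define x where "x = exp (- pi) ^ Suc n"
  have s0: "s \<noteq> 0" unfolding s_def using qr by simp
  have sx: "0 \<le> s" "s \<le> x" unfolding s_def x_def using qr by (auto intro!: power_mono simp del: power_Suc)
  have D: "8 / 10 \<le> qD n" "\<bar>1 - qD n\<bar> \<le> 3 * s" using qD_bounds unfolding s_def by auto
  have t1: "\<bar>exp (- 4 * pi * real (Suc n) * y) * (1 / qD n - indicator {..1/4} y)\<bar> \<le> 5 * x"
  proof (cases "y \<le> 1 / 4")
    case True
    have "1 / qD n - 1 = (1 - qD n) / qD n" using D by (simp add: field_simps)
    then have "\<bar>1 / qD n - 1\<bar> = \<bar>1 - qD n\<bar> / qD n" using D by (simp add: abs_divide)
    also have "\<dots> \<le> 3 * s / (8 / 10)" using D sx by (intro frac_le) auto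
    finally have "\<bar>1 / qD n - 1\<bar> \<le> 5 * x" using sx by simp
    moreover have "exp (- 4 * pi * real (Suc n) * y) \<le> 1" using y by (simp add: mult_nonneg_nonneg)
    ultimately have "exp (- 4 * pi * real (Suc n) * y) * \<bar>1 / qD n - 1\<bar> \<le> 1 * (5 * x)"
      by (intro mult_mono) auto
    then show ?thesis using True by (simp add: abs_mult)
  next
    case False
    have "exp (- 4 * pi * real (Suc n) * y) \<le> exp (real (Suc n) * - pi)"
    proof -
      have "(pi * real (Suc n)) * 1 \<le> (pi * real (Suc n)) * (4 * y)" using False by (intro mult_left_mono) auto
      then show ?thesis by (simp add: mult_ac del: of_nat_Suc)
    qed
    also have "\<dots> = x" unfolding x_def by (rule exp_of_nat_mult)
    finally have "exp (- 4 * pi * real (Suc n) * y) * (1 / qD n) \<le> x * (1 / (8 / 10))"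
      using D sx by (intro mult_mono frac_le) auto
    moreover have "0 \<le> exp (- 4 * pi * real (Suc n) * y) * (1 / qD n)" using D by simp
    moreover have "indicator {..1/4} y = (0::real)" using False by simp
    moreover have "x * (1 / (8 / 10)) \<le> 5 * x" using sx by simp
    ultimately show ?thesis by (simp only: diff_0_right abs_of_nonneg)
  qed
  have t2: "\<bar>s\<^sup>2 * exp (4 * pi * real (Suc n) * y) / qD n\<bar> \<le> 5 * x"
  proof -
    have "exp (4 * pi * real (Suc n) * y) \<le> exp (real (Suc n) * (2 * pi * Im \<tau>))"
    proof -
      have "(4 * pi * real (Suc n)) * y \<le> (4 * pi * real (Suc n)) * (Im \<tau> / 2)" using y by (intro mult_left_mono) auto
      also have "\<dots> = real (Suc n) * (2 * pi * Im \<tau>)" by simp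
      finally show ?thesis by (simp only: exp_le_cancel_iff)
    qed
    also have "\<dots> = inverse s"
      unfolding s_def qr_def exp_of_nat_mult[symmetric] exp_minus[symmetric] by simp
    finally have "s\<^sup>2 * exp (4 * pi * real (Suc n) * y) \<le> s\<^sup>2 * inverse s" by (intro mult_left_mono) auto
    also have "\<dots> = s" using s0 by (simp add: power2_eq_square)
    finally have "s\<^sup>2 * exp (4 * pi * real (Suc n) * y) / qD n \<le> x / (8 / 10)"
      using D sx by (intro frac_le) auto
    moreover have "0 \<le> s\<^sup>2 * exp (4 * pi * real (Suc n) * y) / qD n" using D by simp
    moreover have "x / (8 / 10) \<le> 5 * x" using sx by simp
    ultimately show ?thesis by (simp only: abs_of_nonneg)
  qed
  show ?thesis
    using abs_triangle_ineq[of "exp (- 4 * pi * real (Suc n) * y) * (1 / qD n - indicator {..1/4} y)" "s\<^sup>2 * exp (4 * pi * real (Suc n) * y) / qD n"] t1 t2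
    unfolding TT_def s_def[symmetric] x_def[symmetric] by linarith
qed

text \<open>Apart from the constant due to the cut at 1/4, the exponentials integrate to (1 - s^2) /
  D - 1. By the Poisson kernel identity (1 - |q|^2) / |1 - q|^2 = 1 + 2 Re (q / (1 - q)) this is
  \<open>2 * pk s c\<close>.\<close>

lemma TT_integral:
  "has_bochner_integral lborel (\<lambda>y. indicator {0..Im \<tau> / 2} y * TT n y)
     ((2 * pk (qr ^ Suc n) (cos (real (Suc n) * (2 * pi * Re \<tau>))) + exp (- pi * real (Suc n))) / (4 * pi * real (Suc n)))"
proof -
  define K where "K = real (Suc n)"
  define s where "s = qr ^ Suc n"
  define c where "c = cos (K * (2 * pi * Re \<tau>))"
  define D where "D = qD n"
  have K: "K > 0" by (simp add: K_def)
  have s0: "s > 0" using qr by (simp add: s_def)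
  have D0: "D > 0" using qD_bounds[of n] by (simp add: D_def)
  define a where "a = 4 * pi * K"
  have a0: "a > 0" using K by (simp add: a_def)
  have e1: "exp (- a * (Im \<tau> / 2)) = s"
    unfolding s_def qr_def exp_of_nat_mult[symmetric] a_def K_def by (rule arg_cong[of _ _ exp]) (simp add: algebra_simps)
  have e2: "exp (a * (Im \<tau> / 2)) = inverse s"
    unfolding e1[symmetric] exp_minus[symmetric] by simp
  have e3: "exp (- a * (1 / 4)) = exp (- pi * K)" by (simp add: a_def)
  have "has_bochner_integral lborel (\<lambda>y. (indicator {0..Im \<tau> / 2} y * exp (- a * y)) * (1 / D) - indicator {0..1/4} y * exp (- a * y)
       + (s\<^sup>2 / D) * (indicator {0..Im \<tau> / 2} y * exp (a * y)))
      (((exp (- a * (Im \<tau> / 2)) - 1) / (- a)) * (1 / D) - (exp (- a * (1 / 4)) - 1) / (- a) + (s\<^sup>2 / D) * ((exp (a * (Im \<tau> / 2)) - 1) / a))"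
    using a0 b
    by (intro has_bochner_integral_add has_bochner_integral_diff has_bochner_integral_mult_left has_bochner_integral_mult_right exp_integral) auto
  also have "(\<lambda>y. (indicator {0..Im \<tau> / 2} y * exp (- a * y)) * (1 / D) - indicator {0..1/4} y * exp (- a * y)
       + (s\<^sup>2 / D) * (indicator {0..Im \<tau> / 2} y * exp (a * y))) = (\<lambda>y. indicator {0..Im \<tau> / 2} y * TT n y)"
  proof
    fix y
    have ea: "- a * y = - 4 * pi * real (Suc n) * y" "a * y = 4 * pi * real (Suc n) * y" by (auto simp: a_def K_def)
    show "(indicator {0..Im \<tau> / 2} y * exp (- a * y)) * (1 / D) - indicator {0..1/4} y * exp (- a * y)
       + (s\<^sup>2 / D) * (indicator {0..Im \<tau> / 2} y * exp (a * y)) = indicator {0..Im \<tau> / 2} y * TT n y"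
      using b unfolding TT_def s_def[symmetric] D_def[symmetric] ea
      by (auto simp: indicator_def algebra_simps)
  qed
  also have "((exp (- a * (Im \<tau> / 2)) - 1) / (- a)) * (1 / D) - (exp (- a * (1 / 4)) - 1) / (- a) + (s\<^sup>2 / D) * ((exp (a * (Im \<tau> / 2)) - 1) / a)
      = (2 * pk s c + exp (- pi * K)) / a"
  proof -
    have "D = 1 - 2 * s * c + s\<^sup>2" unfolding D_def qD_eq s_def c_def K_def ..
    then have pk: "2 * pk s c = (1 - s\<^sup>2) / D - 1"
      unfolding pk_def using D0 by (simp add: divide_simps)
    have "((s - 1) / (- a)) * (1 / D) - (exp (- pi * K) - 1) / (- a) + (s\<^sup>2 / D) * ((inverse s - 1) / a)
       = ((1 - s) / D + (exp (- pi * K) - 1) + s\<^sup>2 * (inverse s - 1) / D) / a"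
      using a0 D0 by (simp add: field_simps)
    also have "s\<^sup>2 * (inverse s - 1) = s - s\<^sup>2" using s0 by (simp add: field_simps power2_eq_square)
    also have "(1 - s) / D + (exp (- pi * K) - 1) + (s - s\<^sup>2) / D = 2 * pk s c + exp (- pi * K)"
      unfolding pk by (simp add: diff_divide_distrib)
    finally show ?thesis unfolding e1 e2 e3 .
  qed
  finally show ?thesis by (simp only: s_def c_def K_def a_def)
qed

text \<open>The integral is taken line by line. \<open>H\<close> is even, so the lines with 0 < y <
  Im tau / 2 suffice, and there both Fourier expansions are valid. The zero mode produces
  \<open>pi\<^sup>2 * Im \<tau> / 3\<close>; the remaining modes are summed by
  \<open>TT_integral\<close>.\<close>

lemma Hint:
  defines "H \<equiv> \<lambda>z. indicator (crect (Im \<tau>)) z * (cmod (fld \<tau> z))\<^sup>2 - indicator (crect (1 / 2)) z * refP z"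
  assumes iH: "integrable lborel H"
  shows "integral\<^sup>L lborel H = pi\<^sup>2 * Im \<tau> / 3 + 2 * pi * (2 * Ssum qr (2 * pi * Re \<tau>) + Cref)"
proof -
  have tau: "Im \<tau> > 0" using b by simp
  define k where "k y = (\<integral>x. H (Complex x y) \<partial>lborel)" for y
  have Hminus: "H (- z) = H z" for z
    by (simp add: H_def crect_def indicator_def refP_minus fld_minus[OF tau])
  have ik: "integrable lborel k" and HI: "integral\<^sup>L lborel H = integral\<^sup>L lborel k"
    unfolding k_def using integrable_Complex[OF iH] by auto
  have even: "k (- y) = k y" for y
  proof -
    have "k (- y) = (\<integral>x. H (Complex (- x) (- y)) \<partial>lborel)"
      unfolding k_def using lborel_integral_real_affine[of "-1" "\<lambda>x. H (Complex x (- y))" 0] by simp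
    also have "(\<lambda>x. H (Complex (- x) (- y))) = (\<lambda>x. H (Complex x y))"
    proof
      fix x
      have "Complex (- x) (- y) = - Complex x y" by (simp add: complex_eq_iff)
      then show "H (Complex (- x) (- y)) = H (Complex x y)" by (simp only: Hminus)
    qed
    finally show ?thesis by (simp add: k_def)
  qed
  define f0 where "f0 y = indicator {0..Im \<tau> / 2} y * (pi\<^sup>2 * (1 - 2 * y / Im \<tau>)\<^sup>2)" for y
  define f where "f n y = indicator {0..Im \<tau> / 2} y * TT n y" for n y
  have kval: "indicator {0<..} y * k y = f0 y + 4 * pi\<^sup>2 * (\<Sum>n. f n y)" if ne: "y \<noteq> 0" "y \<noteq> Im \<tau> / 2" for y
  proof (cases "0 < y \<and> y < Im \<tau> / 2")
    case True
    then have y: "0 < y" "y < Im \<tau>" "y \<le> Im \<tau> / 2" using tau by auto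
    define P1 where "P1 = (\<integral>x. indicator {-1/2..1/2} x * (cmod (fld \<tau> (Complex x y)))\<^sup>2 \<partial>lborel)"
    define P2 where "P2 = (\<integral>x. indicator {-1/2..1/2} x * refP (Complex x y) \<partial>lborel)"
    have "H (Complex x y) = indicator {-1/2..1/2} x * (cmod (fld \<tau> (Complex x y)))\<^sup>2 - indicator {..1/4} y * (indicator {-1/2..1/2} x * refP (Complex x y))" for x
      using y by (auto simp: H_def crect_def indicator_def)
    then have "k y = P1 - indicator {..1/4} y * P2"
      unfolding k_def P1_def P2_def
      using fld_parseval(1)[OF tau y(1,2)] refP_parseval(1)[OF y(1)]
      by (simp only: Bochner_Integration.integral_diff integrable_mult_right integral_mult_right_zero)
    moreover have "(\<lambda>n. 4 * pi\<^sup>2 * TT n y) sums (P1 - pi\<^sup>2 * (1 - 2 * y / Im \<tau>)\<^sup>2 - indicator {..1/4} y * P2)"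
    proof -
      have alg: "c * (E / D + F / D) - I * (c * E) = c * (E * (1 / D - I) + F / D)" for c D E F I :: real
        by (simp add: algebra_simps)
      have "(\<lambda>n. 4 * pi\<^sup>2 * (exp (- 4 * pi * real (Suc n) * y) / qD n + (qr ^ Suc n)\<^sup>2 * exp (4 * pi * real (Suc n) * y) / qD n)
          - indicator {..1/4} y * (4 * pi\<^sup>2 * exp (- 4 * pi * real (Suc n) * y))) sums (P1 - pi\<^sup>2 * (1 - 2 * y / Im \<tau>)\<^sup>2 - indicator {..1/4} y * P2)"
        unfolding P1_def P2_def qD_def qr_def
        by (intro sums_diff sums_mult fld_parseval(2)[OF tau y(1,2)] refP_parseval(2)[OF y(1)])
      moreover have "4 * pi\<^sup>2 * (exp (- 4 * pi * real (Suc n) * y) / qD n + (qr ^ Suc n)\<^sup>2 * exp (4 * pi * real (Suc n) * y) / qD n)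
          - indicator {..1/4} y * (4 * pi\<^sup>2 * exp (- 4 * pi * real (Suc n) * y)) = 4 * pi\<^sup>2 * TT n y" for n
        unfolding TT_def by (rule alg)
      ultimately show ?thesis by (simp only:)
    qed
    then have "(\<lambda>n. (4 * pi\<^sup>2 * TT n y) / (4 * pi\<^sup>2)) sums ((P1 - pi\<^sup>2 * (1 - 2 * y / Im \<tau>)\<^sup>2 - indicator {..1/4} y * P2) / (4 * pi\<^sup>2))"
      by (rule sums_divide)
    then have "(\<Sum>n. TT n y) = (P1 - pi\<^sup>2 * (1 - 2 * y / Im \<tau>)\<^sup>2 - indicator {..1/4} y * P2) / (4 * pi\<^sup>2)"
      by (simp add: sums_iff)
    then have "4 * pi\<^sup>2 * (\<Sum>n. TT n y) = P1 - pi\<^sup>2 * (1 - 2 * y / Im \<tau>)\<^sup>2 - indicator {..1/4} y * P2" by simp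
    moreover have "f n y = TT n y" for n using y by (simp add: f_def)
    moreover have "f0 y = pi\<^sup>2 * (1 - 2 * y / Im \<tau>)\<^sup>2" using y by (simp add: f0_def)
    moreover have "indicator {0<..} y * k y = k y" using y by simp
    ultimately show ?thesis by simp
  next
    case False
    have "indicator {0<..} y * k y = 0"
    proof (cases "y \<le> 0")
      case False
      then have "y > Im \<tau> / 2" "y > 1 / 4" using \<open>\<not> (0 < y \<and> y < Im \<tau> / 2)\<close> ne b by auto
      then have "H (Complex x y) = 0" for x by (simp add: H_def crect_def)
      then show ?thesis by (simp add: k_def)
    qed simp
    moreover have "f0 y = 0" "f n y = 0" for n using False ne by (auto simp: f0_def f_def indicator_def)
    ultimately show ?thesis by simp
  qed
  have fi: "integrable lborel (f n)" and fint: "integral\<^sup>L lborel (f n) = (2 * pk (qr ^ Suc n) (cos (real (Suc n) * (2 * pi * Re \<tau>))) + exp (- pi * real (Suc n))) / (4 * pi * real (Suc n))" for n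
    using TT_integral[of n] unfolding f_def by (auto simp: has_bochner_integral_iff)
  have e1: "0 \<le> exp (- pi)" "exp (- pi) < 1" by auto
  have sB: "summable (\<lambda>n. 10 * exp (- pi) ^ Suc n)" using e1 by (intro summable_mult summable_power_Suc)
  have fb: "norm (f n y) \<le> indicator {0..Im \<tau> / 2} y * (10 * exp (- pi) ^ Suc n)" for n y
    using TT_bound[of y n] by (auto simp: f_def indicator_def simp del: power_Suc)
  have sn: "summable (\<lambda>n. norm (f n y))" for y
  proof (rule summable_comparison_test'[OF sB])
    fix n
    have "indicator {0..Im \<tau> / 2} y * (10 * exp (- pi) ^ Suc n) \<le> 10 * exp (- pi) ^ Suc n"
      by (auto simp: indicator_def)
    with fb[of n y] have "norm (f n y) \<le> 10 * exp (- pi) ^ Suc n" by (rule order_trans)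
    then show "norm (norm (f n y)) \<le> 10 * exp (- pi) ^ Suc n" by (simp del: power_Suc)
  qed
  have si: "summable (\<lambda>n. \<integral>y. norm (f n y) \<partial>lborel)"
  proof (rule summable_comparison_test')
    show "summable (\<lambda>n. Im \<tau> / 2 * (10 * exp (- pi) ^ Suc n))" by (intro summable_mult sB)
    fix n
    have ii: "integrable lborel (\<lambda>y. indicator {0..Im \<tau> / 2} y * (10 * exp (- pi) ^ Suc n))"
      by (intro integrable_mult_left integrable_real_indicator) (auto simp: emeasure_lborel_Icc_eq)
    have "(\<integral>y. norm (f n y) \<partial>lborel) \<le> (\<integral>y. indicator {0..Im \<tau> / 2} y * (10 * exp (- pi) ^ Suc n) \<partial>lborel)"
      by (intro integral_mono integrable_norm fi ii fb)
    also have "\<dots> = Im \<tau> / 2 * (10 * exp (- pi) ^ Suc n)" using tau by simp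
    finally show "norm (\<integral>y. norm (f n y) \<partial>lborel) \<le> Im \<tau> / 2 * (10 * exp (- pi) ^ Suc n)"
      by simp
  qed
  have isum: "integrable lborel (\<lambda>y. \<Sum>n. f n y)"
    and vsum: "(\<lambda>n. integral\<^sup>L lborel (f n)) sums (\<integral>y. (\<Sum>n. f n y) \<partial>lborel)"
    using integrable_suminf[of lborel f] sums_integral[of lborel f] fi sn si by auto
  have f0i: "has_bochner_integral lborel f0 (pi\<^sup>2 * Im \<tau> / 6)"
  proof -
    have "has_bochner_integral lborel (\<lambda>y. indicator {0..Im \<tau> / 2} y *\<^sub>R (pi\<^sup>2 * (1 - 2 * y / Im \<tau>)\<^sup>2))
       (- (pi\<^sup>2 * Im \<tau> / 6) * (1 - 2 * (Im \<tau> / 2) / Im \<tau>) ^ 3 - - (pi\<^sup>2 * Im \<tau> / 6) * (1 - 2 * 0 / Im \<tau>) ^ 3)"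
      using tau
      by (intro has_bochner_integral_FTC_Icc[where F="\<lambda>y. - (pi\<^sup>2 * Im \<tau> / 6) * (1 - 2 * y / Im \<tau>) ^ 3"])
         (auto intro!: derivative_eq_intros continuous_intros simp: has_real_derivative_iff_has_vector_derivative[symmetric])
    then show ?thesis using tau by (simp add: f0_def[abs_def])
  qed
  have r10: "0 \<le> qr" "qr \<le> 1 / 10" using qr by auto
  have sS: "(\<lambda>n. pk (qr ^ Suc n) (cos (real (Suc n) * (2 * pi * Re \<tau>))) / real (Suc n)) sums Ssum qr (2 * pi * Re \<tau>)"
    unfolding Ssum_def by (intro summable_sums summable_Ssum r10)
  have sC: "(\<lambda>n. exp (- pi * real (Suc n)) / real (Suc n)) sums Cref"
    unfolding Cref_def
  proof (intro summable_sums summable_comparison_test'[OF summable_power_Suc[OF e1]])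
    fix n
    have "exp (- pi * real (Suc n)) = exp (- pi) ^ Suc n"
      unfolding exp_of_nat_mult[symmetric] by (rule arg_cong[of _ _ exp]) (rule mult.commute)
    then have "exp (- pi * real (Suc n)) / real (Suc n) \<le> exp (- pi) ^ Suc n / 1"
      by (simp only:) (intro frac_le; simp)
    then show "norm (exp (- pi * real (Suc n)) / real (Suc n)) \<le> exp (- pi) ^ Suc n"
      by (simp del: power_Suc)
  qed
  have "(\<lambda>n. integral\<^sup>L lborel (f n)) sums ((2 * Ssum qr (2 * pi * Re \<tau>) + Cref) / (4 * pi))"
  proof -
    have "(\<lambda>n. (2 * (pk (qr ^ Suc n) (cos (real (Suc n) * (2 * pi * Re \<tau>))) / real (Suc n)) + exp (- pi * real (Suc n)) / real (Suc n)) / (4 * pi)) sums ((2 * Ssum qr (2 * pi * Re \<tau>) + Cref) / (4 * pi))"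
      by (intro sums_divide sums_add sums_mult sS sC)
    moreover have "(2 * (pk (qr ^ Suc n) (cos (real (Suc n) * (2 * pi * Re \<tau>))) / real (Suc n)) + exp (- pi * real (Suc n)) / real (Suc n)) / (4 * pi) = integral\<^sup>L lborel (f n)" for n
      unfolding fint by (simp add: add_divide_distrib mult_ac del: of_nat_Suc)
    ultimately show ?thesis by (simp only:)
  qed
  then have vs: "(\<integral>y. (\<Sum>n. f n y) \<partial>lborel) = (2 * Ssum qr (2 * pi * Re \<tau>) + Cref) / (4 * pi)"
    using vsum sums_unique2 by blast
  have "integral\<^sup>L lborel k = 2 * (\<integral>y. indicator {0<..} y * k y \<partial>lborel)"
    by (rule integral_even_real[OF ik even])
  also have "(\<integral>y. indicator {0<..} y * k y \<partial>lborel) = (\<integral>y. f0 y + 4 * pi\<^sup>2 * (\<Sum>n. f n y) \<partial>lborel)"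
  proof (rule integral_cong_AE)
    show "(\<lambda>y. indicator {0<..} y * k y) \<in> borel_measurable lborel" using ik by auto
    show "(\<lambda>y. f0 y + 4 * pi\<^sup>2 * (\<Sum>n. f n y)) \<in> borel_measurable lborel"
      using f0i isum by (auto simp: has_bochner_integral_iff)
    show "AE y in lborel. indicator {0<..} y * k y = f0 y + 4 * pi\<^sup>2 * (\<Sum>n. f n y)"
      using AE_lborel_singleton[of "0::real"] AE_lborel_singleton[of "Im \<tau> / 2"]
      by eventually_elim (rule kval)
  qed
  also have "\<dots> = pi\<^sup>2 * Im \<tau> / 6 + 4 * pi\<^sup>2 * ((2 * Ssum qr (2 * pi * Re \<tau>) + Cref) / (4 * pi))"
    using f0i isum vs by (subst Bochner_Integration.integral_add) (auto simp: has_bochner_integral_iff)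
  also have "4 * pi\<^sup>2 * ((2 * Ssum qr (2 * pi * Re \<tau>) + Cref) / (4 * pi)) = pi * (2 * Ssum qr (2 * pi * Re \<tau>) + Cref)"
    by (simp add: power2_eq_square)
  finally show ?thesis unfolding HI by simp
qed

end

text \<open>The part of the energy of a cell that all lattices share; \<open>ln 8\<close> comes from
  the regularising disc, of radius \<open>cmod w1 / 8\<close>.\<close>

definition "Econst = Vref / 2 + pi * Cref - pi * ln 8"

section \<open>The energy of a lattice on a rectangular cell\<close>

context lat
begin

text \<open>A rectangle replaces the period parallelogram: its translates by multiples of tau are
  rows shifted sideways, which still tile the plane, and each of its horizontal lines spans one full
  period, as Parseval's identity requires.\<close>

definition "rect = {z. - 1 / 2 \<le> Re z \<and> Re z < 1 / 2 \<and> - Im tau / 2 \<le> Im z \<and> Im z < Im tau / 2}"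
definition "Dm = {z. z / w1 \<in> rect}"

lemma rect_sets [measurable]: "rect \<in> sets borel"
  unfolding rect_def by measurable

lemma Dm_sets [measurable]: "Dm \<in> sets borel"
proof -
  have "(\<lambda>z. z / w1) -` rect \<inter> space borel \<in> sets borel"
    by (rule measurable_sets[OF _ rect_sets]) measurable
  then show ?thesis by (simp add: Dm_def vimage_def)
qed

lemma L_coordinates:
  assumes "p \<in> L"
  obtains m n where "p = of_int m * w1 + of_int n * w2" "Re (p / w1) = of_int m + of_int n * Re tau" "Im (p / w1) = of_int n * Im tau"
proof -
  obtain m n where p: "p = of_int m * w1 + of_int n * w2" using L_D[OF assms] by blast
  then have "p = (of_int m + of_int n * tau) * w1" by (simp add: distrib_right mult.assoc tau_w1)
  then have "p / w1 = of_int m + of_int n * tau" by simp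
  then show ?thesis by (intro that[OF p]) auto
qed

lemma L_small_eq_0:
  assumes "p \<in> L" "\<bar>Im (p / w1)\<bar> < Im tau" "\<bar>Re (p / w1)\<bar> < 1"
  shows "p = 0"
proof -
  obtain m n where p: "p = of_int m * w1 + of_int n * w2"
    and c: "Re (p / w1) = of_int m + of_int n * Re tau" "Im (p / w1) = of_int n * Im tau"
    by (rule L_coordinates[OF assms(1)])
  have "n = 0"
  proof (rule ccontr)
    assume "n \<noteq> 0"
    then have "1 * Im tau \<le> \<bar>of_int n\<bar> * Im tau" using Im_tau by (intro mult_right_mono) linarith+
    then show False using assms(2) Im_tau unfolding c by (simp add: abs_mult)
  qed
  moreover from this have "m = 0" using assms(3) unfolding c by simp
  ultimately show ?thesis using p by simp
qed

lemma Dm_tile: "\<exists>!p. p \<in> L \<and> z - p \<in> Dm"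
proof (rule ex_ex1I)
  define y where "y = z / w1"
  define b where "b = Im tau"
  have b: "b > 0" using Im_tau by (simp add: b_def)
  define n where "n = \<lfloor>Im y / b + 1 / 2\<rfloor>"
  define m where "m = \<lfloor>Re (y - of_int n * tau) + 1 / 2\<rfloor>"
  define p where "p = of_int m * w1 + of_int n * w2"
  have "p = (of_int m + of_int n * tau) * w1" by (simp add: p_def distrib_right mult.assoc tau_w1)
  then have eq: "(z - p) / w1 = y - of_int n * tau - of_int m" by (simp add: y_def diff_divide_distrib)
  have "of_int n \<le> Im y / b + 1 / 2" "Im y / b + 1 / 2 < of_int n + 1" unfolding n_def by linarith+
  then have n: "of_int n * b \<le> Im y + b / 2" "Im y < of_int n * b + b / 2" using b by (auto simp: field_simps)
  have m: "of_int m \<le> Re (y - of_int n * tau) + 1 / 2" "Re (y - of_int n * tau) + 1 / 2 < of_int m + 1" unfolding m_def by linarith+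
  have "p \<in> L" unfolding p_def by (rule L_I)
  moreover have "z - p \<in> Dm"
    unfolding Dm_def rect_def mem_Collect_eq eq using n m by (auto simp: b_def)
  ultimately show "\<exists>p. p \<in> L \<and> z - p \<in> Dm" by blast
next
  fix p q assume p: "p \<in> L \<and> z - p \<in> Dm" and q: "q \<in> L \<and> z - q \<in> Dm"
  define x where "x = (z - p) / w1"
  define y where "y = (z - q) / w1"
  have "y - x = (p - q) / w1" by (simp add: x_def y_def diff_divide_distrib)
  moreover have "x \<in> rect" "y \<in> rect" using p q by (auto simp: x_def y_def Dm_def)
  then have "\<bar>Re (y - x)\<bar> < 1" "\<bar>Im (y - x)\<bar> < Im tau" by (auto simp: rect_def)
  ultimately have "p - q = 0" using L_diff p q by (intro L_small_eq_0) auto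
  then show "p = q" by simp
qed

lemma Dm_ball: "Dm \<subseteq> ball 0 (cmod w1 * (1 + Im tau))"
proof
  fix z assume "z \<in> Dm"
  then have "\<bar>Re (z / w1)\<bar> \<le> 1 / 2" "\<bar>Im (z / w1)\<bar> \<le> Im tau / 2" by (auto simp: Dm_def rect_def)
  then have "cmod (z / w1) < 1 + Im tau" using cmod_le[of "z / w1"] Im_tau by linarith
  then show "z \<in> ball 0 (cmod w1 * (1 + Im tau))" by (simp add: norm_divide field_simps)
qed

lemma ball_Dm: "ball 0 (cmod w1 * min (1 / 2) (Im tau / 2)) \<subseteq> Dm"
proof
  fix z :: complex assume "z \<in> ball 0 (cmod w1 * min (1 / 2) (Im tau / 2))"
  then have "cmod (z / w1) < min (1 / 2) (Im tau / 2)"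
    by (simp add: norm_divide pos_divide_less_eq mult.commute del: min_less_iff_conj)
  then have "\<bar>Re (z / w1)\<bar> < 1 / 2" "\<bar>Im (z / w1)\<bar> < Im tau / 2"
    using abs_Re_le_cmod[of "z / w1"] abs_Im_le_cmod[of "z / w1"] by auto
  then show "z \<in> Dm" unfolding Dm_def rect_def mem_Collect_eq by linarith
qed

sublocale tl: tiling L Dm "cmod w1 * (1 + Im tau)" "cmod w1 * min (1 / 2) (Im tau / 2)"
proof
  show "Dm \<in> sets borel" by (rule Dm_sets)
  show "Dm \<subseteq> ball 0 (cmod w1 * (1 + Im tau))" by (rule Dm_ball)
  show "0 < cmod w1 * min (1 / 2) (Im tau / 2)" using Im_tau by simp
  show "ball 0 (cmod w1 * min (1 / 2) (Im tau / 2)) \<subseteq> Dm" by (rule ball_Dm)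
  show "\<exists>!p. p \<in> L \<and> z - p \<in> Dm" for z by (rule Dm_tile)
qed

definition "cbl = Complex (- 1 / 2) (- Im tau / 2)"
definition "cbu = Complex (1 / 2) (Im tau / 2)"

lemma box_rect: "box cbl cbu \<subseteq> rect" and rect_cbox: "rect \<subseteq> cbox cbl cbu" and crect_cbox: "crect (Im tau) = cbox cbl cbu"
  by (auto simp: box_complex_iff cbl_def cbu_def rect_def crect_def in_cbox_complex_iff)

lemma emeasure_cbox: "emeasure lborel (cbox cbl cbu) = emeasure lborel (box cbl cbu)"
  by (simp add: emeasure_lborel_cbox_eq emeasure_lborel_box_eq)

lemma emeasure_box: "emeasure lborel (box cbl cbu) = ennreal (Im tau)"
  using emeasure_box_complex[of cbl cbu] Im_tau by (simp add: cbl_def cbu_def)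

lemma AE_rect_crect: "AE z in lborel. z \<in> rect \<longleftrightarrow> z \<in> crect (Im tau)"
proof -
  have "emeasure lborel (cbox cbl cbu - box cbl cbu) = 0"
    using emeasure_box by (subst emeasure_Diff) (auto simp: emeasure_cbox box_subset_cbox)
  then have "AE z in lborel. z \<notin> cbox cbl cbu - box cbl cbu"
    by (intro AE_not_in) auto
  then show ?thesis
    by eventually_elim (use box_rect rect_cbox crect_cbox in auto)
qed

lemma tl_A: "tl.A = area"
proof -
  have "emeasure lborel rect = ennreal (Im tau)"
  proof (rule antisym)
    show "emeasure lborel rect \<le> ennreal (Im tau)"
      unfolding emeasure_box[symmetric] emeasure_cbox[symmetric] by (intro emeasure_mono rect_cbox) auto
    show "ennreal (Im tau) \<le> emeasure lborel rect"
      unfolding emeasure_box[symmetric] by (intro emeasure_mono box_rect) auto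
  qed
  moreover have "(indicator Dm (w1 * z) :: ennreal) = indicator rect z" for z by (simp add: Dm_def indicator_def)
  ultimately have "emeasure lborel Dm = ennreal area"
    using nn_integral_mult_complex[of w1 "indicator Dm"] Im_tau
    by (simp add: area_def ennreal_mult)
  then show ?thesis using area_pos by (simp add: tl.emeasure_D tl.A_pos less_imp_le)
qed

text \<open>The closed cell contains no lattice point except 0, so once 1/z is removed the field is
  continuous on a compact set and hence bounded there.\<close>

lemma jC_singularity:
  "\<exists>C. \<forall>z. z / w1 \<in> crect (Im tau) \<longrightarrow> z \<noteq> 0 \<longrightarrow> \<bar>(cmod (jC z))\<^sup>2 - 1 / (cmod z)\<^sup>2\<bar> \<le> C / cmod z"
proof -
  define R where "R = cmod w1 * (1 + Im tau)"
  define K where "K = (\<lambda>z. w1 * z) ` crect (Im tau)"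
  have K: "z \<in> K \<longleftrightarrow> z / w1 \<in> crect (Im tau)" for z
    unfolding K_def image_iff by (metis nonzero_mult_div_cancel_left times_divide_eq_right w1_nz)
  have cK: "compact K" unfolding K_def by (intro compact_continuous_image compact_crect continuous_intros)
  have KR: "K \<subseteq> ball 0 R"
  proof
    fix z assume "z \<in> K"
    then have "cmod (z / w1) < 1 + Im tau" using K crect_cball[of "Im tau"] Im_tau by fastforce
    then show "z \<in> ball 0 R" by (simp add: R_def norm_divide field_simps)
  qed
  obtain G where G: "G holomorphic_on ball 0 R" "\<And>z. jC z = G z + (\<Sum>p\<in>L \<inter> cball 0 R. 1 / (z - p)) + lin z"
    by (rule jC_decomp[of R], rule that)
  define F where "F = L \<inter> cball 0 R - {0}"
  have F: "p \<in> F \<Longrightarrow> z \<in> K \<Longrightarrow> z \<noteq> p" for p z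
    using L_small_eq_0[of z] Im_tau by (auto simp: F_def K crect_def)
  define g where "g z = G z + (\<Sum>p\<in>F. 1 / (z - p)) + lin z" for z
  have "R \<ge> 0" using Im_tau by (simp add: R_def)
  then have jg: "jC z = 1 / z + g z" for z
    unfolding G(2) g_def F_def using finite_L_cball[of R] by (subst sum.remove[of _ 0]) auto
  have "continuous_on K g"
    unfolding g_def
    by (intro continuous_intros holomorphic_on_imp_continuous_on holomorphic_on_subset[OF G(1)] KR) (use F in auto)
  then have "bounded (g ` K)" by (intro compact_imp_bounded compact_continuous_image cK)
  then obtain B where "\<forall>w\<in>g ` K. cmod w \<le> B" unfolding bounded_iff by blast
  then have B: "cmod (g z) \<le> B" if "z \<in> K" for z using that by blast
  have "\<bar>(cmod (jC z))\<^sup>2 - 1 / (cmod z)\<^sup>2\<bar> \<le> (2 * B + B\<^sup>2 * R) / cmod z" if "z / w1 \<in> crect (Im tau)" "z \<noteq> 0" for z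
  proof -
    have z: "z \<in> K" using that K by blast
    then have "cmod z \<le> R" using KR by auto
    with B[OF z] that(2) show ?thesis unfolding jg by (intro singular_square_bound) auto
  qed
  then show ?thesis by blast
qed

lemma fld_jC: "cmod (fld tau z) = cmod w1 * cmod (jC (w1 * z))"
  by (simp add: jC_def norm_divide)

context
  assumes b: "Im tau > 1 / 2"
begin

text \<open>The disc of radius 1/8 lies in both rectangles, the height of the larger one being Im
  tau > 1/2. So the regularising terms cancel in the difference of \<open>U\<close> and
  \<open>V\<close>, which is the integrand of \<open>Hint\<close>.\<close>

lemma energy_integral:
  "(\<integral>z. indicator (crect (Im tau)) z * ((cmod (fld tau z))\<^sup>2 - indicator (cball 0 (1 / 8)) z / (cmod z)\<^sup>2) \<partial>lborel)
    = Vref + pi\<^sup>2 * Im tau / 3 + 2 * pi * (2 * Ssum (exp (- 2 * pi * Im tau)) (2 * pi * Re tau) + Cref)"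
proof -
  define U where "U z = indicator (crect (Im tau)) z * ((cmod (fld tau z))\<^sup>2 - indicator (cball 0 (1 / 8)) z / (cmod z)\<^sup>2)" for z
  define V where "V z = indicator (crect (1 / 2)) z * (refP z - indicator (cball 0 (1 / 8)) z / (cmod z)\<^sup>2)" for z
  obtain C where C: "\<And>z. z / w1 \<in> crect (Im tau) \<Longrightarrow> z \<noteq> 0 \<Longrightarrow> \<bar>(cmod (jC z))\<^sup>2 - 1 / (cmod z)\<^sup>2\<bar> \<le> C / cmod z"
    using jC_singularity by blast
  have iU: "integrable lborel U"
    unfolding U_def
  proof (rule integrable_regularised[OF _ crect_sets crect_cball])
    show "(\<lambda>z. (cmod (fld tau z))\<^sup>2) \<in> borel_measurable borel" by measurable
    show "(1 / 8 :: real) > 0" by simp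
    fix z assume z: "z \<in> crect (Im tau)" "z \<noteq> 0"
    have "\<bar>(cmod (fld tau z))\<^sup>2 - 1 / (cmod z)\<^sup>2\<bar> = (cmod w1)\<^sup>2 * \<bar>(cmod (jC (w1 * z)))\<^sup>2 - 1 / (cmod (w1 * z))\<^sup>2\<bar>"
    proof -
      have "(cmod (fld tau z))\<^sup>2 - 1 / (cmod z)\<^sup>2 = (cmod w1)\<^sup>2 * ((cmod (jC (w1 * z)))\<^sup>2 - 1 / (cmod (w1 * z))\<^sup>2)"
        by (simp add: fld_jC norm_mult power_mult_distrib right_diff_distrib)
      then show ?thesis by (simp add: abs_mult)
    qed
    also have "\<dots> \<le> (cmod w1)\<^sup>2 * (C / cmod (w1 * z))"
      using C[of "w1 * z"] z by (intro mult_left_mono) auto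
    also have "\<dots> = (cmod w1 * C) / cmod z" by (simp add: norm_mult power2_eq_square)
    finally show "\<bar>(cmod (fld tau z))\<^sup>2 - 1 / (cmod z)\<^sup>2\<bar> \<le> (cmod w1 * C) / cmod z" .
  qed
  obtain C' where C': "\<And>z. z \<in> crect (1 / 2) \<Longrightarrow> z \<noteq> 0 \<Longrightarrow> \<bar>refP z - 1 / (cmod z)\<^sup>2\<bar> \<le> C' / cmod z"
    using refP_sing by blast
  have iV: "integrable lborel V"
    unfolding V_def by (rule integrable_regularised[OF refP_meas crect_sets crect_cball _ C']) auto
  have UV: "(\<lambda>z. U z - V z) = (\<lambda>z. indicator (crect (Im tau)) z * (cmod (fld tau z))\<^sup>2 - indicator (crect (1 / 2)) z * refP z)"
  proof
    fix z
    have "z \<in> crect (Im tau)" "z \<in> crect (1 / 2)" if "cmod z \<le> 1 / 8"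
      using that b abs_Re_le_cmod[of z] abs_Im_le_cmod[of z] by (auto simp: crect_def)
    then show "U z - V z = indicator (crect (Im tau)) z * (cmod (fld tau z))\<^sup>2 - indicator (crect (1 / 2)) z * refP z"
      by (cases "cmod z \<le> 1 / 8") (auto simp: U_def V_def indicator_def)
  qed
  have "(\<integral>z. U z - V z \<partial>lborel) = pi\<^sup>2 * Im tau / 3 + 2 * pi * (2 * Ssum (exp (- 2 * pi * Im tau)) (2 * pi * Re tau) + Cref)"
    unfolding UV qr_def[OF b, symmetric]
    by (rule Hint[OF b]) (use Bochner_Integration.integrable_diff[OF iU iV] in \<open>simp add: UV\<close>)
  moreover have "(\<integral>z. U z - V z \<partial>lborel) = integral\<^sup>L lborel U - Vref"
    unfolding Vref_def V_def[symmetric] by (rule Bochner_Integration.integral_diff[OF iU iV])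
  ultimately show ?thesis unfolding U_def[symmetric] by simp
qed

text \<open>Scaling by \<open>w1\<close> reduces the cell to that of the lattice with basis 1 and
  tau and leaves \<open>pi * ln (cmod w1)\<close>. Expressed through ln area = 2 ln |w1| + ln Im
  tau, this gives the term \<open>pi / 2 * ln area\<close> and the summand - (ln b) / 2 of
  \<open>Phi\<close>.\<close>

lemma W_field_formula:
  assumes j: "AE x in lebesgue. norm (j x) = cmod (jC (toC x))"
  shows "W_field (ofC ` L) j = ereal ((Econst + pi / 2 * ln area + pi * Phi (Re tau) (Im tau)) / area)"
proof -
  obtain C0 where C0: "\<And>z. z / w1 \<in> crect (Im tau) \<Longrightarrow> z \<noteq> 0 \<Longrightarrow> \<bar>(cmod (jC z))\<^sup>2 - 1 / (cmod z)\<^sup>2\<bar> \<le> C0 / cmod z"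
    using jC_singularity by blast
  interpret te: tiling_energy L Dm "cmod w1 * (1 + Im tau)" "cmod w1 * min (1 / 2) (Im tau / 2)" "\<lambda>z. (cmod (jC z))\<^sup>2" C0 "cmod w1 / 8"
  proof
    show "(\<lambda>z. (cmod (jC z))\<^sup>2) \<in> borel_measurable borel" by measurable
    show "\<bar>(cmod (jC z))\<^sup>2 - 1 / (cmod z)\<^sup>2\<bar> \<le> C0 / cmod z" if "z \<in> Dm" "z \<noteq> 0" for z
      using that by (intro C0) (auto simp: Dm_def rect_def crect_def)
    have "cmod w1 * (1 / 8) < cmod w1 * min (1 / 2) (Im tau / 2)" using b by (intro mult_strict_left_mono) auto
    then show "cmod w1 / 8 < cmod w1 * min (1 / 2) (Im tau / 2)" by simp
  qed (auto simp: jC_periodic)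
  have "(\<integral>z. indicator Dm z * ((cmod (jC z))\<^sup>2 - indicator (cball 0 (cmod w1 / 8)) z / (cmod z)\<^sup>2) \<partial>lborel)
     = (cmod w1)\<^sup>2 *\<^sub>R (\<integral>z. indicator Dm (w1 * z) * ((cmod (jC (w1 * z)))\<^sup>2 - indicator (cball 0 (cmod w1 / 8)) (w1 * z) / (cmod (w1 * z))\<^sup>2) \<partial>lborel)"
    by (rule integral_mult_complex) (simp, measurable)
  also have "\<dots> = (\<integral>z. (cmod w1)\<^sup>2 * (indicator Dm (w1 * z) * ((cmod (jC (w1 * z)))\<^sup>2 - indicator (cball 0 (cmod w1 / 8)) (w1 * z) / (cmod (w1 * z))\<^sup>2)) \<partial>lborel)"
    by simp
  also have "\<dots> = (\<integral>z. indicator rect z * ((cmod (fld tau z))\<^sup>2 - indicator (cball 0 (1 / 8)) z / (cmod z)\<^sup>2) \<partial>lborel)"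
  proof (intro Bochner_Integration.integral_cong refl)
    fix z
    have "indicator Dm (w1 * z) = (indicator rect z :: real)" by (simp add: Dm_def indicator_def)
    moreover have "indicator (cball 0 (cmod w1 / 8)) (w1 * z) = (indicator (cball 0 (1 / 8)) z :: real)"
      by (simp add: indicator_def norm_mult)
    ultimately show "(cmod w1)\<^sup>2 * (indicator Dm (w1 * z) * ((cmod (jC (w1 * z)))\<^sup>2 - indicator (cball 0 (cmod w1 / 8)) (w1 * z) / (cmod (w1 * z))\<^sup>2))
       = indicator rect z * ((cmod (fld tau z))\<^sup>2 - indicator (cball 0 (1 / 8)) z / (cmod z)\<^sup>2)"
      by (simp only: fld_jC norm_mult power_mult_distrib) (simp add: field_simps)
  qed
  also have "\<dots> = (\<integral>z. indicator (crect (Im tau)) z * ((cmod (fld tau z))\<^sup>2 - indicator (cball 0 (1 / 8)) z / (cmod z)\<^sup>2) \<partial>lborel)"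
  proof (rule integral_cong_AE)
    show "AE z in lborel. indicator rect z * ((cmod (fld tau z))\<^sup>2 - indicator (cball 0 (1 / 8)) z / (cmod z)\<^sup>2)
       = indicator (crect (Im tau)) z * ((cmod (fld tau z))\<^sup>2 - indicator (cball 0 (1 / 8)) z / (cmod z)\<^sup>2)"
      using AE_rect_crect by eventually_elim (simp add: indicator_def)
  qed measurable
  finally have I: "te.E = (Vref + pi\<^sup>2 * Im tau / 3 + 2 * pi * (2 * Ssum (exp (- 2 * pi * Im tau)) (2 * pi * Re tau) + Cref)) / 2 + pi * ln (cmod w1 / 8)"
    unfolding te.E_def energy_integral by simp
  have "ln area = 2 * ln (cmod w1) + ln (Im tau)"
    unfolding area_def using Im_tau by (simp add: ln_mult ln_realpow)
  then have "te.E = Econst + pi / 2 * ln area + pi * Phi (Re tau) (Im tau)"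
    unfolding I Econst_def Phi_def by (simp add: ln_div field_simps power2_eq_square)
  moreover have "AE x in lebesgue. (norm (j x))\<^sup>2 = (cmod (jC (toC x)))\<^sup>2"
    using j by eventually_elim simp
  ultimately show ?thesis using te.W_field_eq tl_A by simp
qed

end

end

section \<open>Uniqueness of the lattice field\<close>

lemma toC_combination: "toC (a *\<^sub>R u + b *\<^sub>R v) = of_real a * toC u + of_real b * toC v"
  by (simp only: toC_add toC_scaleR) (simp add: scaleR_conv_of_real)

lemma lattice_of_latt: "lattice_of u v = ofC ` latt (toC u) (toC v)"
proof -
  have "of_int a *\<^sub>R u + of_int b *\<^sub>R v = ofC (of_int a * toC u + of_int b * toC v)" for a b
  proof -
    have "toC (of_int a *\<^sub>R u + of_int b *\<^sub>R v) = of_int a * toC u + of_int b * toC v"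
      by (simp only: toC_combination of_real_of_int_eq)
    then show ?thesis by (metis ofC_toC)
  qed
  then show ?thesis unfolding lattice_of_def latt_def by force
qed

lemma plane_basis_iff: "plane_basis u v \<longleftrightarrow> Im (toC v / toC u) \<noteq> 0"
proof
  assume B: "plane_basis u v"
  show "Im (toC v / toC u) \<noteq> 0"
  proof
    assume im: "Im (toC v / toC u) = 0"
    have ind: "independent {u, v}" and ne: "u \<noteq> v" using B by (auto simp: plane_basis_def)
    have "u \<noteq> 0" using ind dependent_zero by blast
    then have u0: "toC u \<noteq> 0" by (metis norm_eq_zero norm_toC)
    define r where "r = Re (toC v / toC u)"
    have "toC v / toC u = of_real r" using im by (simp add: r_def complex_eq_iff)
    then have "toC v = of_real r * toC u" using u0 by (simp add: field_simps)
    then have "toC v = toC (r *\<^sub>R u)" by (simp only: toC_scaleR) (simp add: scaleR_conv_of_real)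
    then have "v = r *\<^sub>R u" using inj_toC by (simp add: inj_eq)
    then have "v \<in> span {u}" by (simp add: span_mul span_base)
    moreover have "insert v {u} - {v} = {u}" using ne by auto
    ultimately have "dependent {u, v}" unfolding dependent_def by (metis insert_commute insertI1)
    then show False using ind by simp
  qed
next
  assume im: "Im (toC v / toC u) \<noteq> 0"
  define t where "t = toC v / toC u"
  have u0: "toC u \<noteq> 0" using im by auto
  then have vt: "toC v = t * toC u" by (simp add: t_def)
  have t: "Im t \<noteq> 0" using im by (simp add: t_def)
  have ne: "u \<noteq> v" using im u0 by auto
  have "x \<in> span {u, v}" for x
  proof -
    define z where "z = toC x / toC u"
    define b where "b = Im z / Im t"
    define a where "a = Re z - b * Re t"
    have "z = of_real a + of_real b * t" using t by (simp add: complex_eq_iff a_def b_def)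
    moreover have "toC x = z * toC u" using u0 by (simp add: z_def)
    ultimately have "toC x = toC (a *\<^sub>R u + b *\<^sub>R v)"
      by (simp only: toC_combination) (simp add: vt algebra_simps)
    then have "x = a *\<^sub>R u + b *\<^sub>R v" using inj_toC by (simp add: inj_eq)
    then show ?thesis by (simp add: span_add span_mul span_base)
  qed
  then have "span {u, v} = UNIV" by auto
  moreover have "independent {u, v}"
  proof (rule card_le_dim_spanning)
    show "UNIV \<subseteq> span {u, v}" using calculation by simp
    show "card {u, v} \<le> dim (UNIV :: (real^2) set)" using ne by simp
  qed auto
  ultimately show "plane_basis u v" using ne by (simp add: plane_basis_def)
qed

text \<open>The first two are the generators tau -> - 1 / tau and tau -> tau + k of the modular
  group, acting on bases; both preserve the orientation.\<close>

lemma latt_swap: "latt w1 w2 = latt w2 (- w1)"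
  and latt_shift: "latt w1 (w2 + of_int k * w1) = latt w1 w2"
  and latt_commute: "latt w1 w2 = latt w2 w1"
proof -
  have "of_int m * w1 + of_int n * w2 = of_int n * w2 + of_int (- m) * (- w1)" for m n by simp
  moreover have "of_int m * w2 + of_int n * (- w1) = of_int (- n) * w1 + of_int m * w2" for m n by simp
  ultimately show "latt w1 w2 = latt w2 (- w1)" unfolding latt_def by (intro set_eqI iffI) (use add.commute in \<open>blast+\<close>)
  have "of_int m * w1 + of_int n * (w2 + of_int k * w1) = of_int (m + n * k) * w1 + of_int n * w2" for m n
    by (simp add: algebra_simps)
  moreover have "of_int m * w1 + of_int n * w2 = of_int (m - n * k) * w1 + of_int n * (w2 + of_int k * w1)" for m n
    by (simp add: algebra_simps)
  ultimately show "latt w1 (w2 + of_int k * w1) = latt w1 w2" unfolding latt_def by (intro set_eqI iffI) blast+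
  show "latt w1 w2 = latt w2 w1" unfolding latt_def by (intro set_eqI iffI) (use add.commute in \<open>blast+\<close>)
qed

lemma is_lattice_iff: "is_lattice \<Lambda> \<longleftrightarrow> (\<exists>w1 w2. Im (w2 / w1) > 0 \<and> \<Lambda> = ofC ` latt w1 w2)"
proof
  assume "is_lattice \<Lambda>"
  then obtain u v where uv: "plane_basis u v" "\<Lambda> = lattice_of u v" unfolding is_lattice_def by blast
  \<comment> \<open>The two ratios are inverse to each other, so their imaginary parts have opposite
    signs, and exchanging the basis vectors corrects the orientation.\<close>
  have "Im (toC v / toC u) > 0 \<or> Im (toC u / toC v) > 0"
  proof (rule ccontr)
    assume "\<not> ?thesis"
    then have neg: "Im (toC v / toC u) < 0" "Im (toC u / toC v) \<le> 0" using uv(1) by (auto simp: plane_basis_iff)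
    define r where "r = toC v / toC u"
    have "toC u / toC v = inverse r" by (simp add: r_def inverse_eq_divide)
    then have "Im (toC u / toC v) = - Im r / ((Re r)\<^sup>2 + (Im r)\<^sup>2)" by simp
    also have "\<dots> > 0" using neg(1) unfolding r_def[symmetric] by (intro divide_pos_pos) (auto intro: add_nonneg_pos)
    finally show False using neg(2) by simp
  qed
  moreover have "\<Lambda> = ofC ` latt (toC u) (toC v)" using uv(2) by (simp only: lattice_of_latt)
  moreover from this have "\<Lambda> = ofC ` latt (toC v) (toC u)" by (simp only: latt_commute)
  ultimately show "\<exists>w1 w2. Im (w2 / w1) > 0 \<and> \<Lambda> = ofC ` latt w1 w2" by blast
next
  assume "\<exists>w1 w2. Im (w2 / w1) > 0 \<and> \<Lambda> = ofC ` latt w1 w2"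
  then obtain w1 w2 where w: "Im (w2 / w1) > 0" "\<Lambda> = ofC ` latt w1 w2" by blast
  then have "plane_basis (ofC w1) (ofC w2)" "\<Lambda> = lattice_of (ofC w1) (ofC w2)"
    by (simp_all add: plane_basis_iff lattice_of_latt)
  then show "is_lattice \<Lambda>" unfolding is_lattice_def by blast
qed

section \<open>Period cells under reflection and translation\<close>

lemma measurable_lebesgue_minus: "(-) c \<in> lebesgue \<rightarrow>\<^sub>M (lebesgue :: 'a::euclidean_space measure)"
  and distr_lebesgue_minus: "distr lebesgue lebesgue ((-) c) = (lebesgue :: 'a::euclidean_space measure)"
proof -
  have eq: "(\<lambda>x. c + (\<Sum>j\<in>Basis. (- 1 * (x \<bullet> j)) *\<^sub>R j)) = (-) c"
    by (simp add: fun_eq_iff sum_negf euclidean_representation)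
  show m: "(-) c \<in> lebesgue \<rightarrow>\<^sub>M lebesgue"
    using lebesgue_affine_measurable[where c="\<lambda>_. - 1" and t=c] unfolding eq by simp
  have "lebesgue = density (distr lebesgue lebesgue ((-) c)) (\<lambda>_. (\<Prod>j\<in>(Basis :: 'a set). \<bar>- 1::real\<bar>))"
    using lebesgue_affine_euclidean[where c="\<lambda>_. - 1" and t=c] unfolding eq by simp
  then show "distr lebesgue lebesgue ((-) c) = (lebesgue :: 'a measure)"
    by (simp add: density_1)
qed

lemma integral_lebesgue_reflect:
  fixes g :: "'a::euclidean_space \<Rightarrow> 'b::{banach, second_countable_topology}"
  assumes "g \<in> borel_measurable lebesgue"
  shows "(\<integral>x. g (c - x) \<partial>lebesgue) = (\<integral>x. g x \<partial>lebesgue)"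
  using integral_distr[OF measurable_lebesgue_minus assms, of c] by (simp add: distr_lebesgue_minus)

definition cellmap :: "real^2 \<Rightarrow> real^2 \<Rightarrow> real^2 \<Rightarrow> real^2" where
  "cellmap u v y = y $ 1 *\<^sub>R u + y $ 2 *\<^sub>R v"

lemma cellmap_vector [simp]: "cellmap u v (vector [s, t]) = s *\<^sub>R u + t *\<^sub>R v"
  by (simp add: cellmap_def)

lemma linear_cellmap: "linear (cellmap u v)"
  by (rule linearI) (simp_all add: cellmap_def algebra_simps)

lemma period_cell_eq: "period_cell u v = cellmap u v ` {y. 0 \<le> y $ 1 \<and> y $ 1 < 1 \<and> 0 \<le> y $ 2 \<and> y $ 2 < 1}"
proof (intro set_eqI iffI)
  fix x assume "x \<in> period_cell u v"
  then obtain s t where "x = s *\<^sub>R u + t *\<^sub>R v" "0 \<le> s \<and> s < 1 \<and> 0 \<le> t \<and> t < 1"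
    unfolding period_cell_def by blast
  then show "x \<in> cellmap u v ` {y. 0 \<le> y $ 1 \<and> y $ 1 < 1 \<and> 0 \<le> y $ 2 \<and> y $ 2 < 1}"
    by (intro image_eqI[of _ _ "vector [s, t]"]) auto
next
  fix x assume "x \<in> cellmap u v ` {y. 0 \<le> y $ 1 \<and> y $ 1 < 1 \<and> 0 \<le> y $ 2 \<and> y $ 2 < 1}"
  then show "x \<in> period_cell u v"
    unfolding period_cell_def cellmap_def[abs_def] by blast
qed

lemma period_cell_bounded: "bounded (period_cell u v)"
proof -
  have "bounded {y :: real^2. 0 \<le> y $ 1 \<and> y $ 1 < 1 \<and> 0 \<le> y $ 2 \<and> y $ 2 < 1}"
    by (rule bounded_subset[OF bounded_cbox[of 0 1]]) (auto simp: mem_box_cart forall_2)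
  then show ?thesis
    unfolding period_cell_eq by (intro bounded_linear_image) (use linear_cellmap linear_conv_bounded_linear in blast)+
qed

lemma period_cell_lmeasurable: "period_cell u v \<in> lmeasurable"
proof (rule measurable_convex[OF _ period_cell_bounded])
  have "convex {y :: real^2. 0 \<le> y $ 1 \<and> y $ 1 < 1 \<and> 0 \<le> y $ 2 \<and> y $ 2 < 1}"
    unfolding convex_def by (auto simp: intro!: add_nonneg_nonneg convex_bound_lt)
  then show "convex (period_cell u v)"
    unfolding period_cell_eq by (intro convex_linear_image linear_cellmap)
qed

text \<open>The reflection exchanges the included and the excluded sides of the half-open cell, so
  the equivalence can fail only on the image of the boundary of the unit square. Combined with an
  odd field it yields mean zero.\<close>

lemma period_cell_reflect:
  "AE x in lebesgue. x \<in> period_cell u v \<longleftrightarrow> u + v - x \<in> period_cell u v"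
proof -
  define N where "N = cellmap u v ` (cbox 0 1 - box 0 1)"
  have "negligible N"
    unfolding N_def
    by (intro negligible_differentiable_image_negligible negligible_frontier_interval
        linear_imp_differentiable_on linear_cellmap) simp
  then have "AE x in lebesgue. x \<notin> N" by (simp add: negligible_iff_null_sets AE_not_in)
  moreover have "x \<in> period_cell u v \<longleftrightarrow> u + v - x \<in> period_cell u v" if "x \<notin> N" for x
  proof -
    have ref: "u + v - cellmap u v y = cellmap u v (1 - y)" for y
      by (simp add: cellmap_def algebra_simps)
    have inner: "0 < y $ 1 \<and> y $ 1 < 1 \<and> 0 < y $ 2 \<and> y $ 2 < 1"
      if "x = cellmap u v y" "0 \<le> y $ 1 \<and> y $ 1 \<le> 1 \<and> 0 \<le> y $ 2 \<and> y $ 2 \<le> 1" for y :: "real^2"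
    proof -
      have "y \<in> cbox 0 1" using that(2) by (simp add: mem_box_cart forall_2)
      then have "y \<in> box 0 1" using that(1) \<open>x \<notin> N\<close> unfolding N_def by blast
      then show ?thesis by (simp add: mem_box_cart forall_2)
    qed
    show ?thesis
    proof
      assume "x \<in> period_cell u v"
      then obtain y :: "real^2" where y: "x = cellmap u v y" "0 \<le> y $ 1 \<and> y $ 1 < 1 \<and> 0 \<le> y $ 2 \<and> y $ 2 < 1"
        unfolding period_cell_eq by blast
      then have "0 < y $ 1 \<and> y $ 1 < 1 \<and> 0 < y $ 2 \<and> y $ 2 < 1" by (intro inner) auto
      then show "u + v - x \<in> period_cell u v"
        unfolding period_cell_eq y(1) ref by (intro imageI) simp
    next
      assume "u + v - x \<in> period_cell u v"
      then obtain y :: "real^2" where y: "u + v - x = cellmap u v y" "0 \<le> y $ 1 \<and> y $ 1 < 1 \<and> 0 \<le> y $ 2 \<and> y $ 2 < 1"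
        unfolding period_cell_eq by blast
      have "x = u + v - cellmap u v y" using y(1) by (simp add: algebra_simps)
      then have x: "x = cellmap u v (1 - y)" by (simp only: ref)
      then have "0 < (1 - y) $ 1 \<and> (1 - y) $ 1 < 1 \<and> 0 < (1 - y) $ 2 \<and> (1 - y) $ 2 < 1" using y(2) by (intro inner) auto
      then show "x \<in> period_cell u v"
        unfolding period_cell_eq x by (intro imageI) simp
    qed
  qed
  ultimately show ?thesis by (rule eventually_mono)
qed

lemma period_cell_cover:
  assumes "plane_basis u v"
  obtains p where "p \<in> lattice_of u v" "x - p \<in> period_cell u v"
proof -
  define t where "t = toC v / toC u"
  have t: "Im t \<noteq> 0" and u0: "toC u \<noteq> 0" using assms by (auto simp: plane_basis_iff t_def)
  have vt: "toC v = t * toC u" using u0 by (simp add: t_def)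
  define z where "z = toC x / toC u"
  define b where "b = Im z / Im t"
  define a where "a = Re z - b * Re t"
  have "z = of_real a + of_real b * t" using t by (simp add: complex_eq_iff a_def b_def)
  moreover have "toC x = z * toC u" using u0 by (simp add: z_def)
  ultimately have "toC x = toC (a *\<^sub>R u + b *\<^sub>R v)"
    by (simp only: toC_combination) (simp add: vt algebra_simps)
  then have x: "x = a *\<^sub>R u + b *\<^sub>R v" using inj_toC by (simp add: inj_eq)
  define p where "p = of_int \<lfloor>a\<rfloor> *\<^sub>R u + of_int \<lfloor>b\<rfloor> *\<^sub>R v"
  have "p \<in> lattice_of u v" unfolding lattice_of_def p_def by blast
  moreover have "x - p = frac a *\<^sub>R u + frac b *\<^sub>R v"
    by (simp add: x p_def frac_def algebra_simps)
  then have "x - p \<in> period_cell u v"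
    unfolding period_cell_def mem_Collect_eq by (intro exI[of _ "frac a"] exI[of _ "frac b"]) (simp add: frac_lt_1)
  ultimately show ?thesis by (rule that)
qed

lemma countable_lattice_of: "countable (lattice_of u v)"
proof -
  have "lattice_of u v = range (\<lambda>(a :: int, b :: int). of_int a *\<^sub>R u + of_int b *\<^sub>R v)"
    unfolding lattice_of_def by auto
  then show ?thesis by simp
qed

text \<open>Countably many translates of the cell cover the plane, so the cell cannot be
  negligible.\<close>

lemma measure_period_cell_pos:
  assumes "plane_basis u v"
  shows "measure lebesgue (period_cell u v) > 0"
proof (rule ccontr)
  assume "\<not> ?thesis"
  then have "measure lebesgue (period_cell u v) = 0" using measure_nonneg[of lebesgue "period_cell u v"] by linarith
  then have n: "negligible (period_cell u v)"
    using negligible_iff_measure[of "period_cell u v"] period_cell_lmeasurable by blast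
  have "negligible (\<Union>p\<in>lattice_of u v. (+) p ` period_cell u v)"
    using n by (intro negligible_countable_Union countable_image countable_lattice_of) (auto intro: negligible_translation)
  moreover have "(\<Union>p\<in>lattice_of u v. (+) p ` period_cell u v) = UNIV"
  proof (intro equalityI subsetI UNIV_I)
    fix x
    obtain p where "p \<in> lattice_of u v" "x - p \<in> period_cell u v" by (rule period_cell_cover[OF assms])
    then show "x \<in> (\<Union>p\<in>lattice_of u v. (+) p ` period_cell u v)"
      by (intro UN_I[of p]) (auto intro!: image_eqI[of _ _ "x - p"])
  qed
  ultimately show False by simp
qed

section \<open>The lattice field as a planar vector field\<close>

context lat
begin

text \<open>The inverse of the encoding \<open>cfield\<close>, in which the first component is the
  imaginary part.\<close>

definition jR :: "real^2 \<Rightarrow> real^2" where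
  "jR x = vector [Im (jC (toC x)), Re (jC (toC x))]"

lemma cfield_jR: "cfield jR x = jC (toC x)"
  by (simp add: cfield_def jR_def complex_eq_iff)

lemma norm_jR: "norm (jR x) = cmod (jC (toC x))"
  unfolding cfield_jR[symmetric] norm_cfield ..

lemma jR_periodic: "p \<in> ofC ` L \<Longrightarrow> jR (x + p) = jR x"
  by (auto simp: jR_def toC_add jC_periodic)

lemma jR_minus: "jR (- x) = - jR x"
  by (simp add: jR_def toC_uminus jC_minus vec_eq_iff forall_2)

lemma set_integrable_jR:
  assumes "K \<in> sets lebesgue" "bounded K"
  shows "set_integrable lebesgue K jR"
proof -
  obtain R where "K \<subseteq> ball 0 R" using bounded_subset_ballD[OF assms(2), of 0] by auto
  then have R: "K \<subseteq> cball 0 R" by (rule order_trans[OF _ ball_subset_cball])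
  have m: "(\<lambda>z. indicator (cball 0 R) z *\<^sub>R jC z) \<in> borel_measurable borel" by measurable
  have "integrable lborel (\<lambda>x. indicator (cball 0 R) (toC x) *\<^sub>R jC (toC x))"
    using set_integrable_jC[of R] integrable_toC_iff[OF m] unfolding set_integrable_def by simp
  \<comment> \<open>Multiplying the conjugate by i swaps real and imaginary part, which is how
    \<open>jC\<close> becomes \<open>jR\<close>.\<close>
  then have "integrable lborel (\<lambda>x. ofC (\<i> * cnj (indicator (cball 0 R) (toC x) *\<^sub>R jC (toC x))))"
    by (intro integrable_bounded_linear[OF bounded_linear_ofC] integrable_mult_right integrable_cnj)
  also have "(\<lambda>x. ofC (\<i> * cnj (indicator (cball 0 R) (toC x) *\<^sub>R jC (toC x)))) = (\<lambda>x. indicator (cball 0 R) x *\<^sub>R jR x)"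
    by (auto simp: fun_eq_iff indicator_def jR_def ofC_def vec_eq_iff forall_2)
  finally have "integrable lebesgue (\<lambda>x. indicator (cball 0 R) x *\<^sub>R jR x)"
    by (subst integrable_completion) auto
  then have "set_integrable lebesgue (cball 0 R) jR" by (simp add: set_integrable_def)
  then show ?thesis by (rule set_integrable_subset) (use assms R in auto)
qed

lemma curl_div_jR: "curl_div_system (2 * pi / area) (ofC ` L) jR"
  unfolding curl_div_system_iff cfield_jR
proof (intro conjI allI impI)
  show "locally_integrable jR"
    unfolding locally_integrable_def
    by (intro allI impI set_integrable_jR fmeasurableD lmeasurable_compact compact_imp_bounded)
  fix \<phi> assume T: "test_function \<phi>"
  obtain R where R: "\<And>x. norm x > R \<Longrightarrow> \<phi> x = 0" using test_function_bounded_support[OF T] by metis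
  define F where "F = {p \<in> L. \<phi> (ofC p) \<noteq> 0}"
  have "F \<subseteq> L \<inter> cball 0 R" using R by (auto simp: F_def) (metis norm_ofC not_le)
  then have fF: "finite F" using finite_L_cball finite_subset by blast
  have dm: "(\<lambda>z. dtest \<phi> (ofC z)) \<in> borel_measurable borel"
    by (intro borel_measurable_continuous_onI continuous_on_compose2[OF test_function_props(5)[OF T]] continuous_intros) auto
  then have gm: "(\<lambda>z. dtest \<phi> (ofC z) * jC z) \<in> borel_measurable borel" by measurable
  have pm: "\<phi> \<in> borel_measurable borel" using test_function_props(3)[OF T] borel_measurable_continuous_onI by blast
  have "(\<integral>x. dtest \<phi> x * jC (toC x) \<partial>lebesgue) = (\<integral>x. dtest \<phi> x * jC (toC x) \<partial>lborel)"
    using measurable_compose[OF borel_measurable_toC gm] by (intro integral_completion) simp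
  also have "\<dots> = (\<integral>z. dtest \<phi> (ofC z) * jC z \<partial>lborel)"
    using integral_toC[OF gm] by simp
  also have "\<dots> = - of_real (2 * pi * (\<Sum>p\<in>F. \<phi> (ofC p)) - 2 * pi / area * (\<integral>z. \<phi> (ofC z) \<partial>lborel))"
    unfolding C1c_test_function(2)[OF T, symmetric]
    by (rule dbar_jC[OF C1c_test_function(1)[OF T] fF]) (auto simp: F_def)
  also have "(\<integral>z. \<phi> (ofC z) \<partial>lborel) = (\<integral>x. \<phi> x \<partial>lborel)"
    using integral_toC[of "\<lambda>z. \<phi> (ofC z)"] measurable_compose[OF borel_measurable_ofC pm] by simp
  also have "\<dots> = (\<integral>x. \<phi> x \<partial>lebesgue)" using pm by (intro integral_completion[symmetric]) simp
  also have "(\<Sum>p\<in>F. \<phi> (ofC p)) = (\<Sum>\<^sub>\<infinity>p\<in>ofC ` L. \<phi> p)"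
  proof -
    have "(\<Sum>\<^sub>\<infinity>p\<in>ofC ` L. \<phi> p) = (\<Sum>\<^sub>\<infinity>p\<in>L. \<phi> (ofC p))"
      by (subst infsum_reindex) (auto intro!: inj_onI simp: o_def dest: arg_cong[of _ _ toC])
    also have "\<dots> = (\<Sum>\<^sub>\<infinity>p\<in>F. \<phi> (ofC p))" by (intro infsum_cong_neutral) (auto simp: F_def)
    finally show ?thesis using fF by simp
  qed
  finally show "(\<integral>x. dtest \<phi> x * jC (toC x) \<partial>lebesgue) = - of_real (2 * pi * (\<Sum>\<^sub>\<infinity>p\<in>ofC ` L. \<phi> p) - 2 * pi / area * (\<integral>x. \<phi> x \<partial>lebesgue))" .
qed

lemma is_lattice_field_jR: "is_lattice_field (ofC ` L) jR"
  unfolding is_lattice_field_def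
proof (intro conjI ballI allI impI)
  show "\<exists>m. curl_div_system m (ofC ` L) jR" using curl_div_jR by blast
  show "jR (x + p) = jR x" if "p \<in> ofC ` L" for p x using that by (rule jR_periodic)
  fix u v assume uv: "plane_basis u v \<and> ofC ` L = lattice_of u v"
  define g where "g x = indicator (period_cell u v) x *\<^sub>R jR x" for x
  have "set_integrable lebesgue (period_cell u v) jR"
    using period_cell_lmeasurable[of u v] by (intro set_integrable_jR period_cell_bounded) auto
  then have gm: "g \<in> borel_measurable lebesgue" unfolding g_def set_integrable_def by auto
  have uvL: "u + v \<in> ofC ` L"
  proof -
    have "u + v = of_int 1 *\<^sub>R u + of_int 1 *\<^sub>R v" by simp
    then show ?thesis using uv unfolding lattice_of_def by blast
  qed
  \<comment> \<open>As \<open>u + v\<close> is a period of the odd field, the reflection of the cell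
    changes the sign of the integrand and the integral equals its own negative. The argument applies
    to every basis of the lattice.\<close>
  have refl: "jR (u + v - x) = - jR x" for x
    using jR_periodic[OF uvL, of "- x"] by (simp add: jR_minus)
  have "(\<integral>x. g x \<partial>lebesgue) = (\<integral>x. g (u + v - x) \<partial>lebesgue)"
    by (rule integral_lebesgue_reflect[OF gm, symmetric])
  also have "\<dots> = (\<integral>x. - g x \<partial>lebesgue)"
  proof (rule integral_cong_AE)
    show "AE x in lebesgue. g (u + v - x) = - g x"
      using period_cell_reflect[of u v] by eventually_elim (simp add: g_def refl indicator_def)
    show "(\<lambda>x. - g x) \<in> borel_measurable lebesgue" using gm by simp
    show "(\<lambda>x. g (u + v - x)) \<in> borel_measurable lebesgue"
      using measurable_compose[OF measurable_lebesgue_minus gm] by simp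
  qed
  also have "\<dots> = - (\<integral>x. g x \<partial>lebesgue)" by simp
  finally have "2 *\<^sub>R (\<integral>x. g x \<partial>lebesgue) = 0" by (simp add: scaleR_2)
  then show "(\<integral>x\<in>period_cell u v. jR x \<partial>lebesgue) = 0"
    unfolding set_lebesgue_integral_def g_def by simp
qed

text \<open>In the difference from \<open>jR\<close> the point masses cancel, so it is a periodic
  field with constant curl and zero divergence. \<open>periodic_dbar_const\<close> makes the
  constant curl 0, which determines \<open>m\<close>, and the field constant almost everywhere; the
  mean over a cell of positive measure removes that constant.\<close>

lemma lattice_field_unique:
  assumes j: "is_lattice_field (ofC ` L) j"
  shows "curl_div_system m (ofC ` L) j \<Longrightarrow> m = 2 * pi / area" "AE x in lebesgue. j x = jR x"
proof -
  obtain m0 where m0: "curl_div_system m0 (ofC ` L) j" using j unfolding is_lattice_field_def by blast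
  define h where "h x = cfield j x - cfield jR x" for x
  have li: "locally_integrable j" "locally_integrable jR"
    using m0 curl_div_jR by (auto simp: curl_div_system_def)
  have cfi: "set_integrable lebesgue K (cfield f)" if "locally_integrable f" "compact K" for f K
  proof -
    have "integrable lebesgue (\<lambda>x. indicator K x *\<^sub>R f x)" using that by (auto simp: locally_integrable_def set_integrable_def)
    then have "integrable lebesgue (\<lambda>x. \<i> * cnj (toC (indicator K x *\<^sub>R f x)))"
      by (intro integrable_mult_right integrable_cnj integrable_bounded_linear[OF bounded_linear_toC])
    also have "(\<lambda>x. \<i> * cnj (toC (indicator K x *\<^sub>R f x))) = (\<lambda>x. indicator K x *\<^sub>R cfield f x)"
      by (auto simp: fun_eq_iff toC_def cfield_def complex_eq_iff)
    finally show ?thesis by (simp add: set_integrable_def)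
  qed
  have hi: "set_integrable lebesgue K h" if "compact K" for K
    unfolding h_def by (intro set_integral_diff cfi li that)
  have per: "h (x + p) = h x" if "p \<in> ofC ` L" for p x
    using j jR_periodic[OF that, of x] that by (auto simp: h_def cfield_def is_lattice_field_def)
  have cov: "\<exists>p\<in>ofC ` L. norm (x - p) \<le> cmod w1 * (1 + Im tau)" for x
  proof -
    obtain p where p: "p \<in> L" "toC x - p \<in> Dm" using Dm_tile[of "toC x"] by blast
    then have "cmod (toC (x - ofC p)) < cmod w1 * (1 + Im tau)" using Dm_ball by (auto simp: toC_diff)
    then show ?thesis using p(1) by (intro bexI[of _ "ofC p"]) auto
  qed
  have eq: "(\<integral>x. dtest \<phi> x * h x \<partial>lebesgue) = of_real (m - 2 * pi / area) * of_real (\<integral>x. \<phi> x \<partial>lebesgue)"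
    if m: "curl_div_system m (ofC ` L) j" and T: "test_function \<phi>" for m \<phi>
  proof -
    obtain R where R: "\<And>x. norm x > R \<Longrightarrow> dtest \<phi> x = 0" using test_function_bounded_support[OF T] by metis
    have i: "integrable lebesgue (\<lambda>x. dtest \<phi> x * cfield f x)" if "locally_integrable f" for f
      using integrable_mult_compact_support[OF bounded_bilinear_mult cfi[OF that] test_function_props(5)[OF T] R]
      by (simp add: mult.commute)
    have "(\<integral>x. dtest \<phi> x * h x \<partial>lebesgue) = (\<integral>x. dtest \<phi> x * cfield j x - dtest \<phi> x * cfield jR x \<partial>lebesgue)"
      by (simp add: h_def right_diff_distrib)
    also have "\<dots> = (\<integral>x. dtest \<phi> x * cfield j x \<partial>lebesgue) - (\<integral>x. dtest \<phi> x * cfield jR x \<partial>lebesgue)"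
      by (intro Bochner_Integration.integral_diff i li)
    also have "(\<integral>x. dtest \<phi> x * cfield j x \<partial>lebesgue) = - of_real (2 * pi * (\<Sum>\<^sub>\<infinity>p\<in>ofC ` L. \<phi> p) - m * (\<integral>x. \<phi> x \<partial>lebesgue))"
      using m T by (simp only: curl_div_system_iff)
    also have "(\<integral>x. dtest \<phi> x * cfield jR x \<partial>lebesgue) = - of_real (2 * pi * (\<Sum>\<^sub>\<infinity>p\<in>ofC ` L. \<phi> p) - 2 * pi / area * (\<integral>x. \<phi> x \<partial>lebesgue))"
      using curl_div_jR T by (simp only: curl_div_system_iff)
    finally show ?thesis by (simp only: of_real_mult[symmetric] of_real_minus[symmetric] of_real_diff[symmetric]) (simp add: algebra_simps)
  qed
  show "m = 2 * pi / area" if "curl_div_system m (ofC ` L) j"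
  proof -
    have "complex_of_real (m - 2 * pi / area) = 0" by (rule periodic_dbar_const(1)[OF hi per cov eq[OF that]])
    then show ?thesis by (simp only: of_real_eq_0_iff)
  qed
  obtain c where c: "AE x in lebesgue. h x = c"
    using periodic_dbar_const(2)[OF hi per cov eq[OF m0]] by blast
  define e where "e = (vector [Im c, Re c] :: real^2)"
  have je: "AE x in lebesgue. j x = jR x + e"
    using c
  proof eventually_elim
    case (elim x)
    then show ?case by (auto simp: h_def cfield_def complex_eq_iff e_def vec_eq_iff forall_2)
  qed
  define u v where "u = ofC w1" and "v = ofC w2"
  have uv: "plane_basis u v" "ofC ` L = lattice_of u v"
    using orient by (simp_all add: plane_basis_iff lattice_of_latt L_def u_def v_def)
  define D where "D = period_cell u v"
  have D: "D \<in> lmeasurable" unfolding D_def by (rule period_cell_lmeasurable)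
  have iR: "set_integrable lebesgue D jR"
    unfolding D_def using period_cell_lmeasurable by (intro set_integrable_jR period_cell_bounded) auto
  have ie: "integrable lebesgue (\<lambda>x. indicator D x *\<^sub>R e)"
    using D by (intro integrable_scaleR_left) (auto simp: fmeasurable_def)
  have "(\<integral>x. indicator D x *\<^sub>R j x \<partial>lebesgue) = 0" "(\<integral>x. indicator D x *\<^sub>R jR x \<partial>lebesgue) = 0"
    using j is_lattice_field_jR uv unfolding is_lattice_field_def D_def set_lebesgue_integral_def by auto
  moreover have "(\<integral>x. indicator D x *\<^sub>R j x \<partial>lebesgue) = (\<integral>x. indicator D x *\<^sub>R jR x + indicator D x *\<^sub>R e \<partial>lebesgue)"
  proof (rule Bochner_Integration.integral_cong_AE)
    show "AE x in lebesgue. indicator D x *\<^sub>R j x = indicator D x *\<^sub>R jR x + indicator D x *\<^sub>R e"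
      using je by eventually_elim (simp add: scaleR_add_right)
    show "(\<lambda>x. indicator D x *\<^sub>R jR x + indicator D x *\<^sub>R e) \<in> borel_measurable lebesgue"
      using iR ie unfolding set_integrable_def by auto
    obtain R where "D \<subseteq> ball 0 R" using bounded_subset_ballD[OF period_cell_bounded[of u v], of 0] unfolding D_def by auto
    then have R: "D \<subseteq> cball 0 R" by (rule order_trans[OF _ ball_subset_cball])
    have "set_integrable lebesgue (cball 0 R) j" using li(1) by (simp add: locally_integrable_def)
    then have "set_integrable lebesgue D j" by (rule set_integrable_subset) (use D R in auto)
    then show "(\<lambda>x. indicator D x *\<^sub>R j x) \<in> borel_measurable lebesgue" unfolding set_integrable_def by auto
  qed
  moreover have "(\<integral>x. indicator D x *\<^sub>R jR x + indicator D x *\<^sub>R e \<partial>lebesgue) = (\<integral>x. indicator D x *\<^sub>R jR x \<partial>lebesgue) + (\<integral>x. indicator D x *\<^sub>R e \<partial>lebesgue)"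
    by (intro Bochner_Integration.integral_add ie iR[unfolded set_integrable_def])
  moreover have "(\<integral>x. indicator D x *\<^sub>R e \<partial>lebesgue) = measure lebesgue D *\<^sub>R e"
    using D by (subst integral_scaleR_left) (auto simp: fmeasurable_def)
  ultimately have "measure lebesgue D *\<^sub>R e = 0" by simp
  then have "e = 0" using measure_period_cell_pos[OF uv(1)] by (simp add: D_def)
  then show "AE x in lebesgue. j x = jR x" using je by simp
qed

lemma lattice_field:
  shows "is_lattice_field (ofC ` L) (lattice_field (ofC ` L))"
    "AE x in lebesgue. lattice_field (ofC ` L) x = jR x"
    "curl_div_system (2 * pi / area) (ofC ` L) (lattice_field (ofC ` L))"
proof -
  show 1: "is_lattice_field (ofC ` L) (lattice_field (ofC ` L))"
    unfolding lattice_field_def by (rule someI[of "is_lattice_field (ofC ` L)", OF is_lattice_field_jR])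
  show "AE x in lebesgue. lattice_field (ofC ` L) x = jR x" by (rule lattice_field_unique(2)[OF 1])
  obtain m where "curl_div_system m (ofC ` L) (lattice_field (ofC ` L))" using 1 unfolding is_lattice_field_def by blast
  with lattice_field_unique(1)[OF 1] show "curl_div_system (2 * pi / area) (ofC ` L) (lattice_field (ofC ` L))" by blast
qed

lemma W_lattice_formula:
  assumes "Im tau > 1 / 2"
  shows "W_lattice (ofC ` L) = ereal ((Econst + pi / 2 * ln area + pi * Phi (Re tau) (Im tau)) / area)"
  unfolding W_lattice_def
proof (rule W_field_formula[OF assms])
  show "AE x in lebesgue. norm (lattice_field (ofC ` L) x) = cmod (jC (toC x))"
    using lattice_field(2) by eventually_elim (simp add: norm_jR)
qed

lemma discrete_L: "discrete (ofC ` L)"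
proof (rule discreteI)
  fix x assume "x \<in> ofC ` L"
  have "finite (ofC ` L \<inter> ball x 1)"
  proof (rule finite_subset)
    show "ofC ` L \<inter> ball x 1 \<subseteq> ofC ` (L \<inter> ball 0 (norm x + 1))"
    proof
      fix y assume y: "y \<in> ofC ` L \<inter> ball x 1"
      then have "norm y < norm x + 1" using norm_triangle_sub[of y x] by (simp add: dist_norm norm_minus_commute)
      then show "y \<in> ofC ` (L \<inter> ball 0 (norm x + 1))" using y by auto
    qed
    show "finite (ofC ` (L \<inter> ball 0 (norm x + 1)))" using finite_L_ball by blast
  qed
  then have "\<not> x islimpt (ofC ` L)"
    using islimpt_eq_infinite_ball[of x "ofC ` L"] by (metis zero_less_one)
  then show "x isolated_in (ofC ` L)"
    using \<open>x \<in> ofC ` L\<close> unfolding isolated_in_islimpt_iff by blast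
qed

lemma bounded_density_L: "bounded_density (ofC ` L)"
  unfolding bounded_density_def
proof (intro exI allI impI conjI)
  fix R :: real assume R: "R > 1"
  define d where "d = cmod w1 * (1 + Im tau)"
  have d: "d \<ge> 0" using Im_tau by (simp add: d_def)
  have eq: "ofC ` L \<inter> ball 0 R = ofC ` (L \<inter> ball 0 R)" by auto
  show "finite (ofC ` L \<inter> ball 0 R)" unfolding eq using finite_L_ball by blast
  have "inj_on ofC (L \<inter> ball 0 R)" by (rule inj_onI) (metis toC_ofC)
  then have "card (ofC ` L \<inter> ball 0 R) = card (L \<inter> ball 0 R)" unfolding eq by (rule card_image)
  then have n: "real (card (ofC ` L \<inter> ball 0 R)) * area \<le> pi * (R + d)\<^sup>2"
    using tl.n_upper[of R] R by (simp add: tl.n_def tl_A d_def)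
  have "R + d \<le> R * (1 + d)" using R d mult_left_mono[of 1 R d] by (simp add: algebra_simps)
  then have "pi * (R + d)\<^sup>2 \<le> pi * (R * (1 + d))\<^sup>2" using R d by (intro mult_left_mono power_mono) auto
  also have "pi * (R * (1 + d))\<^sup>2 = (1 + d)\<^sup>2 * (pi * R\<^sup>2)" by (simp add: power_mult_distrib)
  finally have "real (card (ofC ` L \<inter> ball 0 R)) * area \<le> (1 + d)\<^sup>2 * (pi * R\<^sup>2)" using n by linarith
  then have "real (card (ofC ` L \<inter> ball 0 R)) / (pi * R\<^sup>2) \<le> (1 + d)\<^sup>2 / area"
    using area_pos R by (simp add: field_simps)
  then have le: "2 * pi * (real (card (ofC ` L \<inter> ball 0 R)) / (pi * R\<^sup>2)) \<le> 2 * pi * ((1 + d)\<^sup>2 / area)"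
    by (rule mult_left_mono) simp
  have m: "measure lebesgue (ball (0 :: real^2) R) = pi * R\<^sup>2"
    using R by (simp add: content_ball unit_ball_vol_2)
  show "2 * pi * real (card (ofC ` L \<inter> ball 0 R)) / measure lebesgue (ball (0 :: real^2) R) \<le> 2 * pi * ((1 + (cmod w1 * (1 + Im tau)))\<^sup>2 / area)"
    using le by (simp only: m d_def times_divide_eq_right)
qed

text \<open>Membership in \<open>A_set m\<close> only asserts the system for some point set
  \<Lambda>', a priori unrelated to the lattice. A bump whose support avoids the points of both sets
  isolates the background density, and comparing the two curl equations determines
  \<open>m\<close>.\<close>

lemma lattice_field_A_set: "lattice_field (ofC ` L) \<in> A_set m \<longleftrightarrow> area = 2 * pi / m"
proof
  assume "area = 2 * pi / m"
  then have "m = 2 * pi / area" using area_pos by (cases "m = 0") auto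
  then show "lattice_field (ofC ` L) \<in> A_set m"
    unfolding A_set_def using discrete_L bounded_density_L lattice_field(3) by blast
next
  assume "lattice_field (ofC ` L) \<in> A_set m"
  then obtain \<Lambda>' where L': "bounded_density \<Lambda>'" "curl_div_system m \<Lambda>' (lattice_field (ofC ` L))"
    unfolding A_set_def by blast
  \<comment> \<open>The radius 2 exceeds 1, as \<open>bounded_density\<close> asks; so only finitely
    many points of both sets lie in the ball and some box inside it contains none.\<close>
  define F where "F = (\<Lambda>' \<union> ofC ` L) \<inter> ball 0 2"
  have "finite (\<Lambda>' \<inter> ball 0 2)" "finite (ofC ` L \<inter> ball 0 2)"
    using L'(1) bounded_density_L unfolding bounded_density_def by auto
  then have fF: "finite F" unfolding F_def by (simp add: Int_Un_distrib2)
  have "uncountable (ball (0::real^2) 2)" by (rule uncountable_ball) simp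
  then have "infinite (ball (0::real^2) 2)" using countable_finite by blast
  then have "\<not> ball 0 2 \<subseteq> F" using fF finite_subset by blast
  then obtain x where x: "x \<in> ball 0 2 - F" by blast
  have op: "open (ball 0 2 - F)" by (intro open_Diff finite_imp_closed fF) auto
  obtain a b where ab: "cbox a b \<subseteq> ball 0 2 - F" "x \<in> box a b"
    by (rule open_contains_cbox[OF op x], rule that)
  define \<phi> where "\<phi> = bump 1 a b"
  have T: "test_function \<phi>" unfolding \<phi>_def by (rule test_function_bump) simp
  have z: "\<phi> p = 0" if "p \<in> \<Lambda>' \<union> ofC ` L" for p
  proof -
    have "p \<notin> ball 0 2 - F" using that by (simp add: F_def)
    then have "p \<notin> box a b" using ab(1) box_subset_cbox[of a b] by blast
    then show ?thesis unfolding \<phi>_def by (subst bump_eq_0_iff) auto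
  qed
  have s: "(\<Sum>\<^sub>\<infinity>p\<in>\<Lambda>'. \<phi> p) = 0" "(\<Sum>\<^sub>\<infinity>p\<in>ofC ` L. \<phi> p) = 0"
    by (rule infsum_0; rule z; simp)+
  have pos: "(\<integral>x. \<phi> x \<partial>lebesgue) > 0"
  proof -
    have "\<phi> \<in> borel_measurable lborel" using integrable_test_function[OF T] by auto
    then show ?thesis using integral_bump_pos[of 1 a b] ab(2) by (auto simp: integral_completion \<phi>_def)
  qed
  have "curl_dist (lattice_field (ofC ` L)) \<phi> = - m * (\<integral>x. \<phi> x \<partial>lebesgue)"
    using L'(2) T s(1) by (simp add: curl_div_system_def)
  moreover have "curl_dist (lattice_field (ofC ` L)) \<phi> = - (2 * pi / area) * (\<integral>x. \<phi> x \<partial>lebesgue)"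
    using lattice_field(3) T s(2) by (simp add: curl_div_system_def)
  ultimately have "- m * (\<integral>x. \<phi> x \<partial>lebesgue) = - (2 * pi / area) * (\<integral>x. \<phi> x \<partial>lebesgue)" by (rule trans[OF sym])
  then have "- m = - (2 * pi / area)" using pos by (subst (asm) mult_cancel_right) auto
  then have "m = 2 * pi / area" by simp
  then show "area = 2 * pi / m" using area_pos by simp
qed

end

section \<open>Optimal lattices\<close>

lemma W_lattice_latt:
  assumes "Im (w2 / w1) > 1 / 2"
  shows "W_lattice (ofC ` latt w1 w2) = ereal ((Econst + pi / 2 * ln ((cmod w1)\<^sup>2 * Im (w2 / w1)) + pi * Phi (Re (w2 / w1)) (Im (w2 / w1)))
    / ((cmod w1)\<^sup>2 * Im (w2 / w1)))"
proof -
  interpret lat w1 w2 by unfold_locales (use assms in simp)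
  show ?thesis using W_lattice_formula assms unfolding L_def area_def tau_def by blast
qed

lemma L_set_latt:
  assumes "Im (w2 / w1) > 0"
  shows "ofC ` latt w1 w2 \<in> L_set m \<longleftrightarrow> (cmod w1)\<^sup>2 * Im (w2 / w1) = 2 * pi / m"
proof -
  interpret lat w1 w2 by unfold_locales (rule assms)
  have "is_lattice (ofC ` latt w1 w2)" unfolding is_lattice_iff using assms by blast
  then show ?thesis using lattice_field_A_set[of m] unfolding L_set_def L_def area_def tau_def by simp
qed

text \<open>Both sides are, up to the same constants, the energy of the lattice \<open>\<int> \<oplus> \<tau>\<int>\<close> with
  \<open>\<tau> = a + \<i>b\<close>, computed in the bases \<open>(1, \<tau>)\<close> and \<open>(\<tau>, -1)\<close>.\<close>

lemma Phi_inversion: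
  assumes "b > 1 / 2" "b / (a\<^sup>2 + b\<^sup>2) > 1 / 2"
  shows "Phi a b = Phi (- a / (a\<^sup>2 + b\<^sup>2)) (b / (a\<^sup>2 + b\<^sup>2))"
proof -
  define t where "t = Complex a b"
  have R: "Re (- 1 / t) = - a / (a\<^sup>2 + b\<^sup>2)" and I: "Im (- 1 / t) = b / (a\<^sup>2 + b\<^sup>2)"
    by (simp_all add: t_def Re_divide Im_divide)
  have n: "(cmod t)\<^sup>2 = a\<^sup>2 + b\<^sup>2" by (simp add: t_def cmod_power2)
  have pos: "a\<^sup>2 + b\<^sup>2 > 0" using assms(1) by (intro add_nonneg_pos) auto
  have "latt 1 t = latt t (- 1)" by (rule latt_swap)
  then have "W_lattice (ofC ` latt 1 t) = W_lattice (ofC ` latt t (- 1))" by simp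
  moreover have "W_lattice (ofC ` latt 1 t) = ereal ((Econst + pi / 2 * ln b + pi * Phi a b) / b)"
    using W_lattice_latt[of t 1] assms(1) by (simp add: t_def)
  moreover have "W_lattice (ofC ` latt t (- 1)) = ereal ((Econst + pi / 2 * ln b + pi * Phi (- a / (a\<^sup>2 + b\<^sup>2)) (b / (a\<^sup>2 + b\<^sup>2))) / b)"
  proof -
    have "(cmod t)\<^sup>2 * Im (- 1 / t) = b" unfolding n I using pos by simp
    then show ?thesis using W_lattice_latt[of "- 1" t] assms(2) by (simp only: R I)
  qed
  ultimately show ?thesis using assms(1) by simp
qed

lemma Phi_triangular_min:
  assumes "\<bar>a\<bar> \<le> 1 / 2" "a\<^sup>2 + b\<^sup>2 \<ge> 1" "b > 0"
  shows "Phi a b \<ge> Phi (1 / 2) (sqrt 3 / 2)"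
    "Phi a b = Phi (1 / 2) (sqrt 3 / 2) \<Longrightarrow> \<bar>a\<bar> = 1 / 2 \<and> b = sqrt 3 / 2"
  by (rule Phi_min; (rule Phi_inversion assms | assumption)+)+

text \<open>A shortest vector among the first vectors of oriented bases is chosen, and the second
  vector is translated to make the real part of the ratio small. Were the ratio shorter than 1, the
  swapped basis would start with a shorter vector.\<close>

lemma reduced_basis:
  assumes "Im (w2 / w1) > 0"
  obtains v1 v2 where "Im (v2 / v1) > 0" "latt v1 v2 = latt w1 w2" "\<bar>Re (v2 / v1)\<bar> \<le> 1 / 2" "cmod (v2 / v1) \<ge> 1"
proof -
  interpret lat w1 w2 by unfold_locales (rule assms)
  \<comment> \<open>Restricting to vectors no longer than \<open>w1\<close> makes the set finite
    while it still contains \<open>w1\<close>.\<close>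
  define S where "S = {v1 \<in> L \<inter> cball 0 (cmod w1). \<exists>v2. Im (v2 / v1) > 0 \<and> latt v1 v2 = L}"
  have fS: "finite S" by (rule finite_subset[OF _ finite_L_cball[of "cmod w1"]]) (auto simp: S_def)
  have "w1 \<in> L" using L_I[of 1 0] by simp
  then have "w1 \<in> S" using assms by (auto simp: S_def L_def)
  then have "Min (cmod ` S) \<in> cmod ` S" using fS by (intro Min_in) auto
  then obtain v1 where v1: "v1 \<in> S" "Min (cmod ` S) = cmod v1" by blast
  then have min: "cmod v1 \<le> cmod v" if "v \<in> S" for v using fS that by (metis Min_le finite_imageI imageI)
  obtain v2 where v2: "Im (v2 / v1) > 0" "latt v1 v2 = L" using v1(1) by (auto simp: S_def)
  have v1_nz: "v1 \<noteq> 0" using v2(1) by auto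
  \<comment> \<open>The integer nearest to the real part of the ratio.\<close>
  define k where "k = \<lfloor>Re (v2 / v1) + 1 / 2\<rfloor>"
  define v3 where "v3 = v2 + of_int (- k) * v1"
  define t where "t = v3 / v1"
  have t: "t = v2 / v1 - of_int k" using v1_nz by (simp add: t_def v3_def diff_divide_distrib)
  have "of_int k \<le> Re (v2 / v1) + 1 / 2" "Re (v2 / v1) + 1 / 2 < of_int k + 1" unfolding k_def by linarith+
  moreover have "Re t = Re (v2 / v1) - of_int k" by (simp add: t)
  ultimately have re: "\<bar>Re t\<bar> \<le> 1 / 2" by linarith
  have im: "Im t > 0" using v2(1) by (simp add: t)
  have l3: "latt v1 v3 = L" unfolding v3_def latt_shift by (rule v2(2))
  have "cmod t \<ge> 1"
  proof (rule ccontr)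
    assume "\<not> cmod t \<ge> 1"
    then have lt: "cmod v3 < cmod v1" using v1_nz by (simp add: t_def norm_divide)
    have "v3 = of_int 0 * v1 + of_int 1 * v3" by simp
    then have "v3 \<in> L" unfolding l3[symmetric] latt_def by blast
    moreover have "cmod v3 \<le> cmod w1" using lt v1(1) by (auto simp: S_def)
    moreover have "Im (- v1 / v3) > 0"
    proof -
      have "- v1 / v3 = - inverse t" by (simp add: t_def inverse_eq_divide)
      then have "Im (- v1 / v3) = Im t / ((Re t)\<^sup>2 + (Im t)\<^sup>2)" by simp
      also have "\<dots> > 0" using im by (intro divide_pos_pos) (auto intro: add_nonneg_pos)
      finally show ?thesis .
    qed
    moreover have "latt v3 (- v1) = L" unfolding latt_swap[symmetric] by (rule l3)
    ultimately have "v3 \<in> S" unfolding S_def mem_Collect_eq Int_iff mem_cball_0 by blast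
    then show False using min lt by fastforce
  qed
  then show ?thesis using that[of v3 v1] im l3 re unfolding t_def L_def by blast
qed

section \<open>Rotations and the triangular lattice\<close>

lemma rotation_image_iff:
  "(\<exists>Q. rotation_matrix Q \<and> \<Lambda> = ((*v) Q) ` M) \<longleftrightarrow> (\<exists>c. cmod c = 1 \<and> \<Lambda> = (\<lambda>x. ofC (c * toC x)) ` M)"
proof
  assume "\<exists>Q. rotation_matrix Q \<and> \<Lambda> = ((*v) Q) ` M"
  then obtain Q :: "real^2^2" where Q: "rotation_matrix Q" "\<Lambda> = ((*v) Q) ` M" by blast
  have "transpose Q ** Q = mat 1" "det Q = 1" using Q(1) by (auto simp: rotation_matrix_def orthogonal_matrix_def)
  then have e: "Q$1$1 * Q$1$1 + Q$2$1 * Q$2$1 = 1" "Q$1$2 * Q$1$2 + Q$2$2 * Q$2$2 = 1" "Q$1$1 * Q$2$2 - Q$1$2 * Q$2$1 = 1"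
    by (simp_all add: vec_eq_iff matrix_matrix_mult_def transpose_def mat_def forall_2 sum_2 det_2)
  \<comment> \<open>The squared lengths of the columns add up to 2, and twice the determinant is
    subtracted; the sum of squares left over is 0 and forces the shape of multiplication by a
    complex number.\<close>
  then have "(Q$1$1 - Q$2$2)\<^sup>2 + (Q$1$2 + Q$2$1)\<^sup>2 = 0" by (simp add: power2_eq_square algebra_simps)
  then have q: "Q$2$2 = Q$1$1" "Q$1$2 = - Q$2$1" by (auto simp: sum_power2_eq_zero_iff)
  define c where "c = Complex (Q$1$1) (Q$2$1)"
  have "cmod c = 1" using e(1) by (simp add: c_def cmod_def power2_eq_square)
  moreover have "Q *v x = ofC (c * toC x)" for x
    by (simp add: vec_eq_iff forall_2 matrix_vector_mult_def sum_2 ofC_def toC_def c_def q)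
  then have "\<Lambda> = (\<lambda>x. ofC (c * toC x)) ` M" using Q(2) by simp
  ultimately show "\<exists>c. cmod c = 1 \<and> \<Lambda> = (\<lambda>x. ofC (c * toC x)) ` M" by blast
next
  assume "\<exists>c. cmod c = 1 \<and> \<Lambda> = (\<lambda>x. ofC (c * toC x)) ` M"
  then obtain c where c: "cmod c = 1" "\<Lambda> = (\<lambda>x. ofC (c * toC x)) ` M" by blast
  define Q :: "real^2^2" where "Q = vector [vector [Re c, - Im c], vector [Im c, Re c]]"
  have c2: "Re c * Re c + Im c * Im c = 1" using c(1) cmod_power2[of c] by (simp add: power2_eq_square)
  have "orthogonal_matrix Q"
    unfolding orthogonal_matrix
    using c2 by (simp add: Q_def vec_eq_iff matrix_matrix_mult_def transpose_def mat_def forall_2 sum_2 add.commute)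
  moreover have "det Q = 1" using c2 by (simp add: Q_def det_2)
  moreover have "Q *v x = ofC (c * toC x)" for x
    by (simp add: vec_eq_iff forall_2 matrix_vector_mult_def sum_2 ofC_def toC_def Q_def)
  then have "\<Lambda> = ((*v) Q) ` M" using c(2) by simp
  ultimately show "\<exists>Q. rotation_matrix Q \<and> \<Lambda> = ((*v) Q) ` M" unfolding rotation_matrix_def by blast
qed

text \<open>The primitive sixth root of unity exp(i pi / 3).\<close>

definition "tri = Complex (1 / 2) (sqrt 3 / 2)"

lemma image_mult_latt: "(\<lambda>z. c * z) ` latt w1 w2 = latt (c * w1) (c * w2)"
proof -
  have "c * (of_int m * w1 + of_int n * w2) = of_int m * (c * w1) + of_int n * (c * w2)" for m n
    by (simp add: algebra_simps)
  then show ?thesis unfolding latt_def by (auto simp: image_iff) metis+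
qed

lemma triangular_lattice_latt:
  fixes m :: real
  defines "s \<equiv> of_real (sqrt (4 * pi / (m * sqrt 3)))"
  shows "triangular_lattice m = ofC ` latt s (s * tri)"
proof -
  have t: "toC (vector [1, 0]) = 1" "toC (vector [1 / 2, sqrt 3 / 2]) = tri"
    by (simp_all add: toC_def tri_def complex_eq_iff)
  have "sqrt (4 * pi / (m * sqrt 3)) *\<^sub>R ofC z = ofC (s * z)" for z
    unfolding s_def by (simp only: scaleR_conv_of_real[symmetric] ofC_scaleR)
  then have "triangular_lattice m = ofC ` (\<lambda>z. s * z) ` latt 1 tri"
    unfolding triangular_lattice_def lattice_of_latt t by (simp only: image_image)
  then show ?thesis by (simp only: image_mult_latt mult_1_right)
qed

theorem theorem2:
  fixes m :: real
  assumes "m > 0"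
  shows "triangular_lattice m \<in> L_set m \<and>
    (\<forall>\<Lambda>\<in>L_set m. W_lattice (triangular_lattice m) \<le> W_lattice \<Lambda>) \<and>
    (\<forall>\<Lambda>\<in>L_set m. W_lattice \<Lambda> = W_lattice (triangular_lattice m) \<longleftrightarrow>
       (\<exists>Q. rotation_matrix Q \<and> \<Lambda> = ((*v) Q) ` triangular_lattice m))"
proof -
  define s where "s = sqrt (4 * pi / (m * sqrt 3))"
  define A where "A = 2 * pi / m"
  \<comment> \<open>Once the area of the cell is fixed to \<open>A\<close>, the energy is a strictly
    increasing affine function of \<open>Phi\<close>.\<close>
  define V where "V a b = ereal ((Econst + pi / 2 * ln A + pi * Phi a b) / A)" for a b
  \<comment> \<open>For |c| = 1 these are the rotated copies of the triangular lattice, see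
    \<open>rot_T\<close>.\<close>
  define T where "T c = ofC ` latt (c * of_real s) (c * of_real s * tri)" for c
  have s: "s > 0" and A: "A > 0" using assms by (simp_all add: s_def A_def)
  have "s\<^sup>2 = 4 * pi / (m * sqrt 3)" using assms by (simp add: s_def)
  then have sA: "s\<^sup>2 * (sqrt 3 / 2) = A" using assms by (simp add: A_def field_simps)
  have h: "1 / 2 < sqrt 3 / 2" by simp
  have tri: "Re tri = 1 / 2" "Im tri = sqrt 3 / 2" by (simp_all add: tri_def)
  have T: "T c \<in> L_set m" "W_lattice (T c) = V (1 / 2) (sqrt 3 / 2)" if c: "cmod c = 1" for c
  proof -
    have "c * of_real s \<noteq> 0" using c s by auto
    then have t: "c * of_real s * tri / (c * of_real s) = tri" by simp
    have n: "cmod (c * of_real s) = s" using c s by (simp add: norm_mult)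
    show "T c \<in> L_set m"
      unfolding T_def using L_set_latt[of "c * of_real s * tri" "c * of_real s" m] h
      by (simp only: t tri n sA A_def)
    show "W_lattice (T c) = V (1 / 2) (sqrt 3 / 2)"
      unfolding T_def V_def using W_lattice_latt[of "c * of_real s * tri" "c * of_real s"] h
      by (simp only: t tri n sA)
  qed
  have tri_T: "triangular_lattice m = T 1" by (simp add: triangular_lattice_latt T_def s_def)
  have rot_T: "(\<lambda>x. ofC (c * toC x)) ` triangular_lattice m = T c" for c
  proof -
    have "(\<lambda>x. ofC (c * toC x)) ` T 1 = ofC ` (\<lambda>z. c * z) ` latt (of_real s) (of_real s * tri)"
      by (simp add: T_def image_image)
    then show ?thesis unfolding tri_T by (simp only: image_mult_latt T_def mult.assoc)
  qed
  have main: "V (1 / 2) (sqrt 3 / 2) \<le> W_lattice \<Lambda>"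
    "W_lattice \<Lambda> = V (1 / 2) (sqrt 3 / 2) \<Longrightarrow> \<exists>c. cmod c = 1 \<and> \<Lambda> = T c"
    if L: "\<Lambda> \<in> L_set m" for \<Lambda>
  proof -
    have "is_lattice \<Lambda>" using L by (simp add: L_set_def)
    then obtain w1 w2 where w: "Im (w2 / w1) > 0" "\<Lambda> = ofC ` latt w1 w2" by (auto simp: is_lattice_iff)
    obtain v1 v2 where v: "Im (v2 / v1) > 0" "latt v1 v2 = latt w1 w2" "\<bar>Re (v2 / v1)\<bar> \<le> 1 / 2" "cmod (v2 / v1) \<ge> 1"
      by (rule reduced_basis[OF w(1)], rule that)
    have Lv: "\<Lambda> = ofC ` latt v1 v2" using w(2) v(2) by simp
    define a b where "a = Re (v2 / v1)" and "b = Im (v2 / v1)"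
    have a: "\<bar>a\<bar> \<le> 1 / 2" and b: "b > 0" using v by (simp_all add: a_def b_def)
    have ab: "a\<^sup>2 + b\<^sup>2 \<ge> 1"
      using power_mono[OF v(4), of 2] cmod_power2[of "v2 / v1"] by (simp add: a_def b_def)
    \<comment> \<open>\<open>W_lattice_latt\<close> is available only above height 1/2.\<close>
    have b2: "b > 1 / 2"
    proof (rule ccontr)
      assume "\<not> b > 1 / 2"
      then have "b\<^sup>2 \<le> (1 / 2)\<^sup>2" using b by (intro power_mono) auto
      moreover have "\<bar>a\<bar>\<^sup>2 \<le> (1 / 2)\<^sup>2" using a by (intro power_mono) auto
      ultimately show False using ab by (simp add: power2_eq_square)
    qed
    have area: "(cmod v1)\<^sup>2 * b = A"
      using L L_set_latt[OF v(1), of m] unfolding Lv by (simp add: b_def A_def)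
    have W: "W_lattice \<Lambda> = V a b"
      using W_lattice_latt[of v2 v1] b2 area unfolding Lv V_def a_def b_def by simp
    show "V (1 / 2) (sqrt 3 / 2) \<le> W_lattice \<Lambda>"
      using Phi_triangular_min(1)[OF a ab b] A unfolding W V_def by (simp add: divide_right_mono)
    assume "W_lattice \<Lambda> = V (1 / 2) (sqrt 3 / 2)"
    then have "Phi a b = Phi (1 / 2) (sqrt 3 / 2)" using A unfolding W V_def by simp
    then have eq: "\<bar>a\<bar> = 1 / 2" "b = sqrt 3 / 2" using Phi_triangular_min(2)[OF a ab b] by auto
    \<comment> \<open>The two corners of the fundamental domain, with real part -1/2 and 1/2, differ
      by a translation and belong to the same lattice; the left one is moved to
      \<open>tri\<close>.\<close>
    define v3 where "v3 = v2 + of_int (if a = 1 / 2 then 0 else 1) * v1"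
    have nz: "v1 \<noteq> 0" using v(1) by auto
    have "v3 / v1 = v2 / v1 + of_int (if a = 1 / 2 then 0 else 1)" using nz by (simp add: v3_def add_divide_distrib)
    also have "\<dots> = tri" using eq by (auto simp: complex_eq_iff tri a_def b_def)
    finally have v3: "v3 = v1 * tri" using nz by (simp add: field_simps)
    have "(cmod v1)\<^sup>2 * (sqrt 3 / 2) = s\<^sup>2 * (sqrt 3 / 2)" using area sA eq(2) by simp
    then have "(cmod v1)\<^sup>2 = s\<^sup>2" by (subst (asm) mult_cancel_right) auto
    then have n: "cmod v1 = s" using s by (simp add: power2_eq_iff_nonneg)
    define c where "c = v1 / of_real s"
    have "cmod c = 1" using n s by (simp add: c_def norm_divide)
    moreover have "v1 = c * of_real s" using s by (simp add: c_def)
    moreover have "\<Lambda> = ofC ` latt v1 v3" unfolding Lv v3_def latt_shift ..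
    ultimately show "\<exists>c. cmod c = 1 \<and> \<Lambda> = T c" unfolding T_def v3 by metis
  qed
  show ?thesis
    unfolding rotation_image_iff rot_T
    using T[of 1] T main unfolding tri_T by (metis norm_one)
qed

end
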